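(* Let $h:\Omega\to\mathbb{R}$ and $H:[0,T]\times\Omega\times\mathbb{R}\times\mathbb{R}^d\to\mathbb{R}$ satisfy the standing assumptions listed in the context, and let $L_H$ be the constant from assumption (iii) there. Define $u_0:[0,T]\times\Omega\to[-\infty,\infty]$ by $$u_0(t,x):=\inf\{u(t,x): u \text{ is a non-continuous minimax } L_H\text{-supersolution of the terminal-value problem (TVP)}\},$$ where (TVP) is $$-\partial_t u-H(t,x,u,\partial_x u)=0 \text{ on } [0,T)\times\Omega,\qquad u(T,x)=h(x),\ x\in\Omega.$$ Then $u_0$ is the unique minimax $L_H$-solution of (TVP).
   Context: Setting. Fix $T>0$ and $d\in\mathbb{N}$. $\Omega=D([0,T],\mathbb{R}^d)$ is the set of all right-continuous functions $x:[0,T]\to\mathbb{R}^d$ that have left limits, equipped with the supremum norm $\|\cdot\|_\infty$. The set $[0,T]\times\Omega$ is equipped with the pseudo-metric $\mathbf{d}_\infty((t,x),(s,\tilde x)):=|t-s|+\sup_{0\le r\le T}|x(r\wedge t)-\tilde x(r\wedge s)|$; upper semicontinuity (USC) and lower semicontinuity (LSC) of real-valued functions on $[0,T]\times\Omega$ are with respect to $\mathbf{d}_\infty$. Standing assumptions on the data. $h$ is continuous on $(\Omega,\|\cdot\|_\infty)$. $H$ is non-anticipating ($x|_{[0,t]}=\tilde x|_{[0,t]}$ implies $H(t,x,y,z)=H(t,\tilde x,y,z)$) and satisfies: (i) for a.e. $t\in(0,T)$, $(x,y,z)\mapsto H(t,x,y,z)$ is continuous; (ii) for every $(x,y,z)$,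 $t\mapsto H(t,x,y,z)$ is Borel measurable; (iii) there is a constant $L_H\ge0$ such that for a.e. $t\in(0,T)$ and every $x\in\Omega$, $y\in\mathbb{R}$, $z,\tilde z\in\mathbb{R}^d$: $|H(t,x,y,z)-H(t,x,y,\tilde z)|\le L_H(1+\sup_{s\le t}|x(s)|)|z-\tilde z|$; (iv) for every $L\ge0$ there is a constant $M_L\ge0$ such that for every $(t_0,x_0)\in[0,T)\times\Omega$, $x,\tilde x\in\mathcal{X}^L(t_0,x_0)$, $y\in\mathbb{R}$, $z\in\mathbb{R}^d$ and a.e. $t\in(t_0,T)$: $|H(t,x,y,z)-H(t,\tilde x,y,z)|\le M_L(1+|y|+|z|)\sup_{s\le t}|x(s)-\tilde x(s)|$; (v) for a.e. $t\in(0,T)$ and every $(x,z)$, $y\mapsto H(t,x,y,z)$ is non-increasing; (vi) there is a constant $C_H\ge0$ such that for a.e. $t\in(0,T)$ and all $(x,y)$: $|H(t,x,y,0)|\le C_H(1+\sup_{s\le t}|x(s)|+|y|)$. Path sets. For $L\ge0$ and $(s_0,x_0)\in[0,T)\times\Omega$, $\mathcal{X}^L(s_0,x_0)$ is the set of $x\in\Omega$ with $x=x_0$ on $[0,s_0]$, $x|_{[s_0,T]}$ absolutely continuous, and $|x'(t)|\le L(1+\sup_{s\le t}|x(s)|)$ a.e. on $(s_0,T)$. For $y_0\in\mathbb{R}$, $z\in\mathbb{R}^d$, $\mathcal{Y}^L(s_0,x_0,y_0,z)$ is the set of pairs $(x,y)\in\mathcal{X}^L(s_0,x_0)\times C([s_0,T])$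 with $y(t)=y_0+\int_{s_0}^t[x'(s)\cdot z-H(s,x,y(s),z)]\,ds$ on $[s_0,T]$. Minimax solutions of (TVP). Let $L\ge 0$ and $u:[0,T]\times\Omega\to\mathbb{R}$. - $u$ is a minimax $L$-supersolution if $u$ is LSC, $u(T,\cdot)\ge h$ on $\Omega$, and for every $(s_0,x_0,z)\in[0,T)\times\Omega\times\mathbb{R}^d$ and every $y_0\ge u(s_0,x_0)$ there is $(x,y)\in\mathcal{Y}^L(s_0,x_0,y_0,z)$ with $y(t)\ge u(t,x)$ for each $t\in[s_0,T]$. - $u$ is a minimax $L$-subsolution if $u$ is USC, $u(T,\cdot)\le h$ on $\Omega$, and for every $(s_0,x_0,z)\in[0,T)\times\Omega\times\mathbb{R}^d$ and every $y_0\le u(s_0,x_0)$ there is $(x,y)\in\mathcal{Y}^L(s_0,x_0,y_0,z)$ with $y(t)\le u(t,x)$ for each $t\in[s_0,T]$. - $u$ is a minimax $L$-solution if it is both. Non-continuous minimax supersolutions. $u:[0,T]\times\Omega\to[-\infty,\infty]$ is a non-continuous minimax $L$-supersolution of (TVP) if $u(T,\cdot)=h$ on $\Omega$ and, for every $(t_0,x_0,z)\in[0,T)\times\Omega\times\mathbb{R}^d$, real $y_0>u(t_0,x_0)$ and $T_0\in(t_0,T]$, $\inf_{(x,y)\in\mathcal{Y}^L(t_0,x_0,y_0,z)}\{u(T_0,x)-y(T_0)\}\le0$. *)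

theory Defs
  imports "HOL-Analysis.Analysis"
begin

text \<open>
  Paths on \<open>[0,T]\<close> are represented by functions on the reals that are \<open>undefined\<close> outside
  \<open>{0..T}\<close>, so that equality of functions is equality of paths.
\<close>

definition path_space :: "real \<Rightarrow> (real \<Rightarrow> real^'n) set" where
  "path_space T = {x \<in> extensional {0..T}.
      (\<forall>t\<in>{0..<T}. continuous (at_right t) x) \<and>
      (\<forall>t\<in>{0<..T}. \<exists>l. (x \<longlongrightarrow> l) (at_left t))}"

text \<open>
  The supremum norm on the path space.  The library's \<open>funspace\<close> only contains bounded
  functions; this is no restriction here, since right-continuous functions with left limits are
  bounded on \<open>{0..T}\<close>.
\<close>

definition path_metric :: "real \<Rightarrow> (real \<Rightarrow> real^'n) metric" where
  "path_metric T = submetric (funspace {0..T} euclidean_metric) (path_space T)"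

definition d_infty ::
  "real \<Rightarrow> real \<times> (real \<Rightarrow> real^'n) \<Rightarrow> real \<times> (real \<Rightarrow> real^'n) \<Rightarrow> real" where
  "d_infty T = (\<lambda>(t, x) (s, x').
      \<bar>t - s\<bar> + (SUP r\<in>{0..T}. norm (x (min r t) - x' (min r s))))"

definition lsc_on_paths :: "real \<Rightarrow> (real \<Rightarrow> (real \<Rightarrow> real^'n) \<Rightarrow> real) \<Rightarrow> bool" where
  "lsc_on_paths T u \<longleftrightarrow>
    (\<forall>t\<in>{0..T}. \<forall>x\<in>path_space T. \<forall>\<epsilon>>0. \<exists>\<delta>>0. \<forall>s\<in>{0..T}. \<forall>x'\<in>path_space T.
      d_infty T (t, x) (s, x') < \<delta> \<longrightarrow> u s x' > u t x - \<epsilon>)"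

definition usc_on_paths :: "real \<Rightarrow> (real \<Rightarrow> (real \<Rightarrow> real^'n) \<Rightarrow> real) \<Rightarrow> bool" where
  "usc_on_paths T u \<longleftrightarrow>
    (\<forall>t\<in>{0..T}. \<forall>x\<in>path_space T. \<forall>\<epsilon>>0. \<exists>\<delta>>0. \<forall>s\<in>{0..T}. \<forall>x'\<in>path_space T.
      d_infty T (t, x) (s, x') < \<delta> \<longrightarrow> u s x' < u t x + \<epsilon>)"

definition running_sup :: "(real \<Rightarrow> real^'n) \<Rightarrow> real \<Rightarrow> real" where
  "running_sup x t = (SUP s\<in>{0..t}. norm (x s))"

text \<open>
  The usual \<open>\<epsilon>\<close>-\<open>\<delta>\<close> definition of absolute continuity; a division is a finite family of closed
  intervals with pairwise disjoint interiors.
\<close>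

definition absolutely_continuous_path ::
  "real \<Rightarrow> real \<Rightarrow> (real \<Rightarrow> real^'n) \<Rightarrow> bool" where
  "absolutely_continuous_path a b f \<longleftrightarrow>
    (\<forall>\<epsilon>>0. \<exists>\<delta>>0. \<forall>D S. D division_of S \<and> S \<subseteq> {a..b} \<and> (\<Sum>K\<in>D. Sup K - Inf K) < \<delta> \<longrightarrow>
      (\<Sum>K\<in>D. norm (f (Sup K) - f (Inf K))) < \<epsilon>)"

definition X_set ::
  "real \<Rightarrow> real \<Rightarrow> real \<Rightarrow> (real \<Rightarrow> real^'n) \<Rightarrow> (real \<Rightarrow> real^'n) set" where
  "X_set T L s\<^sub>0 x\<^sub>0 = {x \<in> path_space T.
      (\<forall>t\<in>{0..s\<^sub>0}. x t = x\<^sub>0 t) \<and>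
      absolutely_continuous_path s\<^sub>0 T x \<and>
      (AE t in lebesgue. s\<^sub>0 < t \<and> t < T \<longrightarrow>
        x differentiable (at t) \<and>
        norm (vector_derivative x (at t)) \<le> L * (1 + running_sup x t))}"

text \<open>
  Integrability of the right-hand side is part of the meaning of the integral equation; it has to
  be stated because the library integral of a non-integrable function is \<open>0\<close>.
\<close>

definition Y_set ::
  "real \<Rightarrow> (real \<Rightarrow> (real \<Rightarrow> real^'n) \<Rightarrow> real \<Rightarrow> real^'n \<Rightarrow> real) \<Rightarrow> real \<Rightarrow>
   real \<Rightarrow> (real \<Rightarrow> real^'n) \<Rightarrow> real \<Rightarrow> real^'n \<Rightarrow> ((real \<Rightarrow> real^'n) \<times> (real \<Rightarrow> real)) set" where
  "Y_set T H L s\<^sub>0 x\<^sub>0 y\<^sub>0 z = {(x, y).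
      x \<in> X_set T L s\<^sub>0 x\<^sub>0 \<and>
      y \<in> extensional {s\<^sub>0..T} \<and> continuous_on {s\<^sub>0..T} y \<and>
      set_integrable lebesgue {s\<^sub>0..T} (\<lambda>s. vector_derivative x (at s) \<bullet> z - H s x (y s) z) \<and>
      (\<forall>t\<in>{s\<^sub>0..T}. y t = y\<^sub>0 +
        (LINT s:{s\<^sub>0..t}|lebesgue. vector_derivative x (at s) \<bullet> z - H s x (y s) z))}"

locale tvp_data =
  fixes T :: real
    and h :: "(real \<Rightarrow> real^'n) \<Rightarrow> real"
    and H :: "real \<Rightarrow> (real \<Rightarrow> real^'n) \<Rightarrow> real \<Rightarrow> real^'n \<Rightarrow> real"
    and L\<^sub>H :: real
  assumes T_pos: "T > 0"
    and h_continuous: "continuous_map (mtopology_of (path_metric T)) euclidean h"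
    and H_nonanticipating:
      "\<And>t x x' y z. \<lbrakk>t \<in> {0..T}; x \<in> path_space T; x' \<in> path_space T; \<And>s. s \<in> {0..t} \<Longrightarrow> x s = x' s\<rbrakk>
        \<Longrightarrow> H t x y z = H t x' y z"
    and H_continuous:
      "AE t in lebesgue. 0 < t \<and> t < T \<longrightarrow>
        continuous_map (prod_topology (mtopology_of (path_metric T)) (euclidean :: (real \<times> (real^'n)) topology))
          euclidean (\<lambda>(x, y, z). H t x y z)"
    and H_measurable:
      "\<And>x y z. x \<in> path_space T \<Longrightarrow> (\<lambda>t. H t x y z) \<in> borel_measurable (restrict_space borel {0..T})"
    and L_H_nonneg: "L\<^sub>H \<ge> 0"
    and H_Lipschitz_z:
      "AE t in lebesgue. 0 < t \<and> t < T \<longrightarrow>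
        (\<forall>x\<in>path_space T. \<forall>y z z'.
          \<bar>H t x y z - H t x y z'\<bar> \<le> L\<^sub>H * (1 + running_sup x t) * norm (z - z'))"
    and H_Lipschitz_x:
      "\<And>L. L \<ge> 0 \<Longrightarrow> \<exists>M\<ge>0. \<forall>t\<^sub>0\<in>{0..<T}. \<forall>x\<^sub>0\<in>path_space T.
        \<forall>x\<in>X_set T L t\<^sub>0 x\<^sub>0. \<forall>x'\<in>X_set T L t\<^sub>0 x\<^sub>0. \<forall>y z.
          AE t in lebesgue. t\<^sub>0 < t \<and> t < T \<longrightarrow>
            \<bar>H t x y z - H t x' y z\<bar>
              \<le> M * (1 + \<bar>y\<bar> + norm z) * (SUP s\<in>{0..t}. norm (x s - x' s))"
    and H_antimono_y:
      "AE t in lebesgue. 0 < t \<and> t < T \<longrightarrow>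
        (\<forall>x\<in>path_space T. \<forall>z. antimono (\<lambda>y. H t x y z))"
    and H_growth:
      "\<exists>C\<ge>0. AE t in lebesgue. 0 < t \<and> t < T \<longrightarrow>
        (\<forall>x\<in>path_space T. \<forall>y. \<bar>H t x y 0\<bar> \<le> C * (1 + running_sup x t + \<bar>y\<bar>))"

definition minimax_supersolution ::
  "real \<Rightarrow> ((real \<Rightarrow> real^'n) \<Rightarrow> real) \<Rightarrow>
   (real \<Rightarrow> (real \<Rightarrow> real^'n) \<Rightarrow> real \<Rightarrow> real^'n \<Rightarrow> real) \<Rightarrow> real \<Rightarrow>
   (real \<Rightarrow> (real \<Rightarrow> real^'n) \<Rightarrow> real) \<Rightarrow> bool" where
  "minimax_supersolution T h H L u \<longleftrightarrow>
    lsc_on_paths T u \<and>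
    (\<forall>x\<in>path_space T. u T x \<ge> h x) \<and>
    (\<forall>s\<^sub>0\<in>{0..<T}. \<forall>x\<^sub>0\<in>path_space T. \<forall>z. \<forall>y\<^sub>0. y\<^sub>0 \<ge> u s\<^sub>0 x\<^sub>0 \<longrightarrow>
      (\<exists>(x, y)\<in>Y_set T H L s\<^sub>0 x\<^sub>0 y\<^sub>0 z. \<forall>t\<in>{s\<^sub>0..T}. y t \<ge> u t x))"

definition minimax_subsolution ::
  "real \<Rightarrow> ((real \<Rightarrow> real^'n) \<Rightarrow> real) \<Rightarrow>
   (real \<Rightarrow> (real \<Rightarrow> real^'n) \<Rightarrow> real \<Rightarrow> real^'n \<Rightarrow> real) \<Rightarrow> real \<Rightarrow>
   (real \<Rightarrow> (real \<Rightarrow> real^'n) \<Rightarrow> real) \<Rightarrow> bool" where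
  "minimax_subsolution T h H L u \<longleftrightarrow>
    usc_on_paths T u \<and>
    (\<forall>x\<in>path_space T. u T x \<le> h x) \<and>
    (\<forall>s\<^sub>0\<in>{0..<T}. \<forall>x\<^sub>0\<in>path_space T. \<forall>z. \<forall>y\<^sub>0. y\<^sub>0 \<le> u s\<^sub>0 x\<^sub>0 \<longrightarrow>
      (\<exists>(x, y)\<in>Y_set T H L s\<^sub>0 x\<^sub>0 y\<^sub>0 z. \<forall>t\<in>{s\<^sub>0..T}. y t \<le> u t x))"

definition minimax_solution ::
  "real \<Rightarrow> ((real \<Rightarrow> real^'n) \<Rightarrow> real) \<Rightarrow>
   (real \<Rightarrow> (real \<Rightarrow> real^'n) \<Rightarrow> real \<Rightarrow> real^'n \<Rightarrow> real) \<Rightarrow> real \<Rightarrow>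
   (real \<Rightarrow> (real \<Rightarrow> real^'n) \<Rightarrow> real) \<Rightarrow> bool" where
  "minimax_solution T h H L u \<longleftrightarrow>
    minimax_supersolution T h H L u \<and> minimax_subsolution T h H L u"

definition noncontinuous_minimax_supersolution ::
  "real \<Rightarrow> ((real \<Rightarrow> real^'n) \<Rightarrow> real) \<Rightarrow>
   (real \<Rightarrow> (real \<Rightarrow> real^'n) \<Rightarrow> real \<Rightarrow> real^'n \<Rightarrow> real) \<Rightarrow> real \<Rightarrow>
   (real \<Rightarrow> (real \<Rightarrow> real^'n) \<Rightarrow> ereal) \<Rightarrow> bool" where
  "noncontinuous_minimax_supersolution T h H L u \<longleftrightarrow>
    (\<forall>x\<in>path_space T. u T x = ereal (h x)) \<and>
    (\<forall>t\<^sub>0\<in>{0..<T}. \<forall>x\<^sub>0\<in>path_space T. \<forall>z. \<forall>y\<^sub>0. ereal y\<^sub>0 > u t\<^sub>0 x\<^sub>0 \<longrightarrow>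
      (\<forall>T\<^sub>0\<in>{t\<^sub>0<..T}.
        (INF (x, y)\<in>Y_set T H L t\<^sub>0 x\<^sub>0 y\<^sub>0 z. u T\<^sub>0 x - ereal (y T\<^sub>0)) \<le> 0))"

definition perron_infimum ::
  "real \<Rightarrow> ((real \<Rightarrow> real^'n) \<Rightarrow> real) \<Rightarrow>
   (real \<Rightarrow> (real \<Rightarrow> real^'n) \<Rightarrow> real \<Rightarrow> real^'n \<Rightarrow> real) \<Rightarrow> real \<Rightarrow>
   real \<Rightarrow> (real \<Rightarrow> real^'n) \<Rightarrow> ereal" where
  "perron_infimum T h H L t x =
    Inf {u t x | u. noncontinuous_minimax_supersolution T h H L u}"

end

theory Submission
  imports Defs "HOL-Complex_Analysis.Great_Picard"
begin

text \<open>
Write \<open>u\<^sub>0\<close> for the Perron infimum.  The theorem is proved by enclosing \<open>u\<^sub>0\<close> between its two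
semicontinuous envelopes and comparing these.

\<^emph>\<open>One step from above.\<close>  If \<open>y\<^sub>0 > u\<^sub>0(t\<^sub>0,x\<^sub>0)\<close>, then for every slope \<open>z\<close> and every later time some
characteristic \<open>(x,y)\<close> starting in \<open>(x\<^sub>0,y\<^sub>0)\<close> is strictly above \<open>u\<^sub>0\<close> at that time.  Each
competitor has this property, and one competitor below \<open>y\<^sub>0\<close> suffices
(\<open>perron_infimum_one_step_super\<close>).

\<^emph>\<open>One step from below.\<close>  Fix a time \<open>\<tau>\<close> and a slope \<open>\<zeta>\<close>, and change \<open>u\<^sub>0\<close> before \<open>\<tau>\<close> into the
largest initial value from which a characteristic of slope \<open>\<zeta>\<close> can end below \<open>u\<^sub>0\<close> at time \<open>\<tau>\<close>.
The result is again a competitor, so \<open>u\<^sub>0\<close> lies below it, and this says precisely that \<open>u\<^sub>0\<close> has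
the mirrored one-step property (\<open>perron_infimum_one_step_sub\<close>).  That the modified function is a
competitor rests on \<open>characteristic_exists\<close>: for any two slopes \<open>z, \<zeta>\<close> some pair \<open>(x,y)\<close> is a
characteristic for both.  Such a pair has \<open>x' \<bullet> (z - \<zeta>) = H(z) - H(\<zeta>)\<close>, and since \<open>L\<^sub>H\<close> is the
Lipschitz constant of \<open>H\<close> in \<open>z\<close>, the shortest such velocity respects the bound of the path sets.

\<^emph>\<open>Envelopes.\<close>  Chaining the one-step property along finer and finer partitions and using compactness
of the sets of characteristics (\<open>Y_set_compact\<close>) shows that the lower semicontinuous envelope of
\<open>u\<^sub>0\<close> never is \<open>-\<infinity>\<close> (\<open>lsc_envelope_not_MInf\<close>) and is a minimax supersolution if \<open>u\<^sub>0\<close> never is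
\<open>\<infinity>\<close> (\<open>lsc_envelope_minimax_supersolution\<close>).  The reflection \<open>y \<mapsto> -y, z \<mapsto> -z, H \<mapsto> -H, h \<mapsto> -h\<close>
preserves all hypotheses (\<open>tvp_data_dual\<close>), so the upper semicontinuous envelope never is \<open>\<infinity>\<close>, and
it is a minimax subsolution.

\<^emph>\<open>Comparison.\<close>  A minimax subsolution lies below every minimax supersolution
(\<open>comparison_principle\<close>).  Hence the upper envelope lies below the lower one; as \<open>u\<^sub>0\<close> is in between,
all three coincide, and \<open>u\<^sub>0\<close> is a minimax solution.  Comparison also gives uniqueness.  Its proof
follows a characteristic of each function with a common slope, the gradient of a penalty on the
distance of the two paths.  The squared supremum distance is not smooth along paths; it is replaced
by \<open>m\<^sup>2 + |w|\<^sup>4 / m\<^sup>2\<close>, where \<open>m\<close> bounds the distance so far and \<open>w\<close> is the current difference.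

All limits are taken in descriptions of the path sets without derivatives (\<open>X_set_iff\<close>,
\<open>Y_set_iff\<close>), which are stable under uniform convergence.  Their equivalence with the definitions
is the fundamental theorem of calculus for absolutely continuous paths together with the
differentiability almost everywhere of Lipschitz paths.
\<close>

section \<open>The fundamental theorem of calculus for absolutely continuous paths\<close>

text \<open>
Absolute continuity is stated for divisions.  The cells of a tagged partial division that lie in a
set \<open>U\<close> of small measure form such a division; cells occurring with several tags are degenerate, so
they contribute nothing.
\<close>

lemma absolutely_continuous_tagged_sum_less:
  fixes f :: "real \<Rightarrow> real^'n"
  assumes \<delta>: "\<And>D S. \<lbrakk>D division_of S; S \<subseteq> {a..b}; (\<Sum>K\<in>D. Sup K - Inf K) < \<delta>\<rbrakk>
      \<Longrightarrow> (\<Sum>K\<in>D. norm (f (Sup K) - f (Inf K))) < \<epsilon>"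
    and p: "p tagged_partial_division_of {a..b}"
    and U: "U \<in> lmeasurable" "measure lebesgue U < \<delta>" "\<And>x K. (x, K) \<in> p \<Longrightarrow> K \<subseteq> U"
  shows "(\<Sum>(x,K)\<in>p. norm (f (Sup K) - f (Inf K))) < \<epsilon>"
proof -
  have pt: "p tagged_division_of (\<Union>(snd ` p))"
    by (rule tagged_partial_division_of_Union_self [OF p])
  define D where "D = snd ` p"
  have D: "D division_of (\<Union>D)"
    using division_of_tagged_division [OF pt] by (simp add: D_def)
  define d where "d = (\<lambda>K. if K = {} then 0 else norm (f (Sup K) - f (Inf K)))"
  have ne: "K \<noteq> {}" if "(x, K) \<in> p" for x K
    using p that by (auto simp: tagged_partial_division_of_def)
  have neD: "K \<noteq> {}" if "K \<in> D" for K
    using that ne by (auto simp: D_def)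
  have "(\<Sum>(x,K)\<in>p. norm (f (Sup K) - f (Inf K))) = (\<Sum>(x,K)\<in>p. d K)"
    by (rule sum.cong) (auto simp: d_def dest: ne)
  also have "\<dots> = sum d D"
    unfolding D_def
    by (rule sum.over_tagged_division_lemma [OF pt]) (auto simp: d_def box_eq_empty not_less)
  also have "\<dots> = (\<Sum>K\<in>D. norm (f (Sup K) - f (Inf K)))"
    by (rule sum.cong) (auto simp: d_def dest: neD)
  also have "\<dots> < \<epsilon>"
  proof (rule \<delta> [OF D])
    show "\<Union>D \<subseteq> {a..b}"
      using p by (fastforce simp: D_def tagged_partial_division_of_def)
    have "(\<Sum>K\<in>D. Sup K - Inf K) = (\<Sum>K\<in>D. measure lebesgue K)"
    proof (rule sum.cong)
      fix K assume "K \<in> D"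
      then obtain u v where "K = cbox u v" using D by blast
      then show "Sup K - Inf K = measure lebesgue K"
        using neD [OF \<open>K \<in> D\<close>] by auto
    qed auto
    also have "\<dots> = measure lebesgue (\<Union>D)"
      using content_division [OF D] by simp
    also have "\<dots> \<le> measure lebesgue U"
    proof (rule measure_mono_fmeasurable)
      show "\<Union>D \<subseteq> U" by (auto simp: D_def dest!: U(3))
      show "\<Union>D \<in> sets lebesgue"
        using lmeasurable_division [OF D] by blast
    qed (rule U(1))
    finally show "(\<Sum>K\<in>D. Sup K - Inf K) < \<delta>" using U(2) by simp
  qed
  finally show ?thesis .
qed

text \<open>
Choose the gauge so that a cell tagged at an exceptional point lies in an open set of small measure,
and any other cell is so short that the derivative describes the increment over it.  Absolute
continuity bounds the total increment over the cells of the first kind.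
\<close>

lemma absolutely_continuous_path_has_integral:
  fixes f :: "real \<Rightarrow> real^'n"
  assumes ac: "absolutely_continuous_path a b f" and ab: "a \<le> b" and neg: "negligible N"
    and deriv: "\<And>x. x \<in> {a<..<b} - N \<Longrightarrow> (f has_vector_derivative f' x) (at x)"
  shows "(f' has_integral (f b - f a)) {a..b}"
proof -
  define N' where "N' = N \<union> {a, b}"
  define g where "g = (\<lambda>x. if x \<in> N' then 0 else f' x)"
  have neg': "negligible N'" using neg by (simp add: N'_def)
  have "(g has_integral (f b - f a)) {a..b}"
    unfolding box_real[symmetric] has_integral
  proof (intro allI impI)
    fix e :: real assume e: "e > 0"
    obtain \<delta> where "\<delta> > 0" and
      \<delta>: "\<And>D S. \<lbrakk>D division_of S; S \<subseteq> {a..b}; (\<Sum>K\<in>D. Sup K - Inf K) < \<delta>\<rbrakk>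
        \<Longrightarrow> (\<Sum>K\<in>D. norm (f (Sup K) - f (Inf K))) < e/2"
      using ac e unfolding absolutely_continuous_path_def by (meson half_gt_zero)
    have N's: "N' \<in> sets lebesgue" using neg' by (simp add: negligible_imp_sets)
    obtain U where U: "open U" "N' \<subseteq> U" "U \<in> lmeasurable" "measure lebesgue U < \<delta>"
    proof -
      obtain U where U: "open U" "N' \<subseteq> U" "U - N' \<in> lmeasurable" "emeasure lebesgue (U - N') < ennreal \<delta>"
        using sets_lebesgue_outer_open [OF N's \<open>\<delta> > 0\<close>] by metis
      have "U = (U - N') \<union> N'" using U by auto
      then have "U \<in> lmeasurable"
        by (metis U(3) fmeasurable.Un neg' negligible_imp_measurable)
      moreover have "measure lebesgue U = measure lebesgue (U - N')"
        using measure_Diff_null_set [of U lebesgue N'] neg' \<open>U \<in> lmeasurable\<close>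
        by (simp add: negligible_iff_null_sets fmeasurableD)
      ultimately show ?thesis
        using that U emeasure_eq_measure2 [OF U(3)]
        by (metis \<open>\<delta> > 0\<close> ennreal_less_iff measure_nonneg)
    qed
    define e' where "e' = e / (2 * (b - a + 1))"
    have e': "e' > 0" using e ab by (simp add: e'_def)
    have "\<forall>x. \<exists>d>0. x \<in> {a..b} - N' \<longrightarrow>
         (\<forall>y. norm (y-x) < d \<longrightarrow> norm (f y - f x - (y-x) *\<^sub>R f' x) \<le> e' * norm (y-x))"
    proof
      fix x
      show "\<exists>d>0. x \<in> {a..b} - N' \<longrightarrow>
         (\<forall>y. norm (y-x) < d \<longrightarrow> norm (f y - f x - (y-x) *\<^sub>R f' x) \<le> e' * norm (y-x))"
      proof (cases "x \<in> {a..b} - N'")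
        case True
        then have "x \<in> {a<..<b} - N" by (auto simp: N'_def)
        from deriv [OF this] show ?thesis
          unfolding has_vector_derivative_def has_derivative_at_alt using e' by blast
      qed (use zero_less_one in blast)
    qed
    then obtain d where d: "\<And>x. 0 < d x"
       "\<And>x y. \<lbrakk>x \<in> {a..b} - N'; norm (y-x) < d x\<rbrakk>
          \<Longrightarrow> norm (f y - f x - (y-x) *\<^sub>R f' x) \<le> e' * norm (y-x)"
      by metis
    \<comment> \<open>Cells tagged in \<open>N'\<close> lie in \<open>U\<close>, whose measure is below the modulus of absolute continuity.\<close>
    define \<gamma> where "\<gamma> = (\<lambda>x. if x \<in> N' then U else ball x (d x))"
    show "\<exists>\<gamma>. gauge \<gamma> \<and> (\<forall>p. p tagged_division_of (cbox a b) \<and> \<gamma> fine p \<longrightarrow>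
           norm ((\<Sum>(x, k)\<in>p. measure lborel k *\<^sub>R g x) - (f b - f a)) < e)"
    proof (intro exI conjI allI impI; (elim conjE)?)
      show "gauge \<gamma>"
        using U d(1) by (auto simp: gauge_def \<gamma>_def)
      fix p assume p: "p tagged_division_of (cbox a b)" and fine: "\<gamma> fine p"
      have ba: "b - a = (\<Sum>(x,K)\<in>p. Sup K - Inf K)" "f b - f a = (\<Sum>(x,K)\<in>p. f(Sup K) - f(Inf K))"
        using additive_tagged_division_1[where f= "\<lambda>x. x"] additive_tagged_division_1[where f= f]
            \<open>a \<le> b\<close> p by auto
      have fin: "finite p" using p by blast
      define p1 where "p1 = {(x,K) \<in> p. x \<in> N'}"
      have p1: "p1 \<subseteq> p" by (auto simp: p1_def)
      have A: "(\<Sum>(x,K)\<in>p1. norm (f (Sup K) - f (Inf K))) < e/2"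
      proof (rule absolutely_continuous_tagged_sum_less [OF \<delta>])
        show "p1 tagged_partial_division_of {a..b}"
          using p p1 by (metis box_real(2) tagged_division_of_def tagged_partial_division_subset)
        show "K \<subseteq> U" if "(x, K) \<in> p1" for x K
          using that fineD [OF fine, of x K] by (simp add: p1_def \<gamma>_def)
      qed (use U in auto)
      have B: "norm (measure lborel K *\<^sub>R g x - (f (Sup K) - f (Inf K))) \<le>
          (if x \<in> N' then norm (f (Sup K) - f (Inf K)) else e' * (Sup K - Inf K))"
        if xK: "(x, K) \<in> p" for x K
      proof -
        obtain u v where k: "K = cbox u v" and "x \<in> K" and kab: "K \<subseteq> cbox a b"
          using p xK by (meson tagged_division_ofD(2,3,4))
        have uv: "u \<le> x" "x \<le> v" using \<open>x \<in> K\<close> by (auto simp: k)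
        show ?thesis
        proof (cases "x \<in> N'")
          case True then show ?thesis using uv k by (simp add: g_def norm_minus_commute)
        next
          case False
          have ball: "K \<subseteq> ball x (d x)"
            using fineD [OF fine xK] False by (simp add: \<gamma>_def)
          then have "u \<in> ball x (d x)" "v \<in> ball x (d x)" using uv unfolding k by (auto simp del: mem_ball)
          then have nu: "norm (u - x) < d x" "norm (v - x) < d x"
            by (auto simp: dist_norm norm_minus_commute)
          have xab: "x \<in> {a..b} - N'" using False \<open>x \<in> K\<close> kab by auto
          have "norm ((v - u) *\<^sub>R f' x - (f v - f u)) = norm (f u - f x - (u - x) *\<^sub>R f' x - (f v - f x - (v - x) *\<^sub>R f' x))"
            by (auto simp: algebra_simps)
          also have "\<dots> \<le> norm (f u - f x - (u - x) *\<^sub>R f' x) + norm (f v - f x - (v - x) *\<^sub>R f' x)"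
            by (rule norm_triangle_ineq4)
          also have "\<dots> \<le> e' * norm (u - x) + e' * norm (v - x)"
            using d(2)[OF xab nu(1)] d(2)[OF xab nu(2)] by linarith
          also have "\<dots> = e' * (v - u)" using uv by (simp add: algebra_simps)
          finally show ?thesis using False uv k by (simp add: g_def)
        qed
      qed
      have "norm ((\<Sum>(x, k)\<in>p. measure lborel k *\<^sub>R g x) - (f b - f a))
          = norm (\<Sum>(x, K)\<in>p. measure lborel K *\<^sub>R g x - (f (Sup K) - f (Inf K)))"
        unfolding ba(2) by (simp add: sum_subtractf case_prod_unfold)
      also have "\<dots> \<le> (\<Sum>(x, K)\<in>p. if x \<in> N' then norm (f (Sup K) - f (Inf K)) else e' * (Sup K - Inf K))"
        by (rule sum_norm_le) (use B in auto)
      also have "\<dots> \<le> (\<Sum>(x, K)\<in>p. (if x \<in> N' then norm (f (Sup K) - f (Inf K)) else 0) + e' * (Sup K - Inf K))"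
      proof (rule sum_mono, clarify)
        fix x K assume xK: "(x, K) \<in> p"
        then obtain u v where k: "K = cbox u v" and "x \<in> K"
          using p by (meson tagged_division_ofD(2,3,4))
        then have "Inf K \<le> Sup K" by auto
        then show "(if x \<in> N' then norm (f (Sup K) - f (Inf K)) else e' * (Sup K - Inf K))
           \<le> (if x \<in> N' then norm (f (Sup K) - f (Inf K)) else 0) + e' * (Sup K - Inf K)"
          using e' by (auto intro: mult_nonneg_nonneg)
      qed
      also have "\<dots> = (\<Sum>(x, K)\<in>p1. norm (f (Sup K) - f (Inf K))) + e' * (b - a)"
      proof -
        have "(\<Sum>(x, K)\<in>p. (if x \<in> N' then norm (f (Sup K) - f (Inf K)) else 0))
            = (\<Sum>z\<in>p. if fst z \<in> N' then norm (f (Sup (snd z)) - f (Inf (snd z))) else 0)"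
          by (simp add: case_prod_unfold)
        also have "\<dots> = (\<Sum>z\<in>{z\<in>p. fst z \<in> N'}. norm (f (Sup (snd z)) - f (Inf (snd z))))"
          using fin by (simp add: sum.inter_filter)
        also have "{z\<in>p. fst z \<in> N'} = p1" by (auto simp: p1_def)
        finally have "(\<Sum>(x, K)\<in>p. (if x \<in> N' then norm (f (Sup K) - f (Inf K)) else 0))
            = (\<Sum>(x, K)\<in>p1. norm (f (Sup K) - f (Inf K)))" by (simp add: case_prod_unfold)
        then show ?thesis unfolding ba(1)
          by (simp add: case_prod_unfold sum.distrib sum_distrib_left)
      qed
      also have "\<dots> < e/2 + e/2"
      proof -
        have "e' * (b - a) \<le> e/2" using e ab by (simp add: e'_def field_simps)
        then show ?thesis using A by linarith
      qed
      finally show "norm ((\<Sum>(x, k)\<in>p. measure lborel k *\<^sub>R g x) - (f b - f a)) < e" by simp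
    qed
  qed
  then show ?thesis
    by (rule has_integral_spike [OF neg', rotated]) (auto simp: g_def)
qed

section \<open>Differentiability of Lipschitz paths almost everywhere\<close>

text \<open>
Short intervals over which the increasing function \<open>g\<close> grows by at most \<open>p\<close> times the length form a
Vitali cover of \<open>E\<close>.  A disjoint subfamily inside \<open>U\<close> covers \<open>E\<close> up to a null set; its images are
intervals of total length at most \<open>p\<close> times the measure of \<open>U\<close>, and the remaining null set is
mapped to a null set.
\<close>

lemma small_slope_image_measure:
  fixes g :: "real \<Rightarrow> real"
  assumes mono: "mono g" and lip: "\<And>x y. \<bar>g x - g y\<bar> \<le> B * \<bar>x - y\<bar>" and p: "p \<ge> 0"
    and E: "\<And>x d. \<lbrakk>x \<in> E; d > 0\<rbrakk> \<Longrightarrow> \<exists>a b. a < b \<and> a \<le> x \<and> x \<le> b \<and> b - a < d \<and> g b - g a \<le> p * (b - a)"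
    and U: "open U" "E \<subseteq> U" "U \<in> lmeasurable"
  shows "\<exists>T. g ` E \<subseteq> T \<and> T \<in> lmeasurable \<and> measure lebesgue T \<le> p * measure lebesgue U"
proof -
  define K where "K = {(c,r). 0 < r \<and> cball c r \<subseteq> U \<and> g (c + r) - g (c - r) \<le> p * (2 * r)}"
  obtain C where C: "countable C" "C \<subseteq> K"
     "pairwise (\<lambda>i j. disjnt (cball (fst i) (snd i)) (cball (fst j) (snd j))) C"
     "negligible (E - (\<Union>i \<in> C. cball (fst i) (snd i)))"
  proof (rule Vitali_covering_theorem_cballs [of K snd E fst])
    show "0 < snd i" if "i \<in> K" for i using that by (auto simp: K_def)
    fix x d :: real assume x: "x \<in> E" and d: "0 < d"
    obtain e where e: "e > 0" "ball x e \<subseteq> U" using U x by (meson openE subsetD)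
    obtain a b where ab: "a < b" "a \<le> x" "x \<le> b" "b - a < min d e" "g b - g a \<le> p * (b - a)"
      using E [OF x, of "min d e"] d e by auto
    let ?c = "(a + b) / 2" and ?r = "(b - a) / 2"
    have cr: "?c + ?r = b" "?c - ?r = a" by (simp_all add: field_simps)
    have "cball ?c ?r = {a..b}" by (simp only: cball_eq_atLeastAtMost cr)
    moreover have "{a..b} \<subseteq> ball x e" using ab by (auto simp: dist_real_def)
    ultimately have "(?c, ?r) \<in> K" "x \<in> cball ?c ?r"
      using ab e unfolding K_def mem_Collect_eq case_prod_conv cr by (auto simp: field_simps)
    moreover have "?r < d" using ab by auto
    ultimately show "\<exists>i. i \<in> K \<and> x \<in> cball (fst i) (snd i) \<and> snd i < d"
      by (intro exI [of _ "(?c, ?r)"]) auto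
  qed (rule that)
  define J where "J = (\<lambda>(c,r). {g (c - r)..g (c + r)})"
  have J: "J i \<in> lmeasurable" for i by (cases i) (auto simp: J_def)
  have le: "measure lebesgue (\<Union>i\<in>I. J i) \<le> p * measure lebesgue U" if I: "I \<subseteq> C" "finite I" for I
  proof -
    have "measure lebesgue (\<Union>i\<in>I. J i) \<le> (\<Sum>i\<in>I. measure lebesgue (J i))"
      using I J by (intro measure_UNION_le) (auto simp: fmeasurableD)
    also have "\<dots> \<le> (\<Sum>i\<in>I. p * measure lebesgue (cball (fst i) (snd i)))"
    proof (rule sum_mono)
      fix i assume "i \<in> I"
      then obtain c r where i: "i = (c,r)" "0 < r" "g (c + r) - g (c - r) \<le> p * (2 * r)"
        using I C by (auto simp: K_def)
      have "g (c - r) \<le> g (c + r)" using i by (intro monoD [OF mono]) auto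
      then show "measure lebesgue (J i) \<le> p * measure lebesgue (cball (fst i) (snd i))"
        using i by (simp add: J_def cball_eq_atLeastAtMost)
    qed
    also have "\<dots> = p * (\<Sum>i\<in>I. measure lebesgue (cball (fst i) (snd i)))"
      by (simp add: sum_distrib_left)
    also have "(\<Sum>i\<in>I. measure lebesgue (cball (fst i) (snd i))) = measure lebesgue (\<Union>i\<in>I. cball (fst i) (snd i))"
      by (rule measure_UNION' [symmetric]) (use I C in \<open>auto intro: pairwise_mono\<close>)
    also have "p * \<dots> \<le> p * measure lebesgue U"
    proof (rule mult_left_mono [OF measure_mono_fmeasurable])
      show "(\<Union>i\<in>I. cball (fst i) (snd i)) \<subseteq> U"
        using I C unfolding K_def by fastforce
      show "(\<Union>i\<in>I. cball (fst i) (snd i)) \<in> sets lebesgue"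
        using I by (intro sets.finite_UN) auto
    qed (use U p in auto)
    finally show ?thesis .
  qed
  define N where "N = g ` (E - (\<Union>i \<in> C. cball (fst i) (snd i)))"
  have N: "negligible N" unfolding N_def
  proof (rule negligible_locally_Lipschitz_image [OF order_refl C(4)])
    fix x
    show "\<exists>T b. open T \<and> x \<in> T \<and> (\<forall>y\<in>(E - (\<Union>i \<in> C. cball (fst i) (snd i))) \<inter> T. norm (g y - g x) \<le> b * norm (y - x))"
      using lip by (intro exI [of _ UNIV] exI [of _ B]) auto
  qed
  have JU: "(\<Union>i\<in>C. J i) \<in> lmeasurable" "measure lebesgue (\<Union>i\<in>C. J i) \<le> p * measure lebesgue U"
    using J le by (auto intro!: fmeasurable_UN_bound [OF C(1)] measure_UN_bound [OF C(1)])
  have sub: "g ` E \<subseteq> (\<Union>i\<in>C. J i) \<union> N"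
  proof
    fix y assume "y \<in> g ` E"
    then obtain x where x: "x \<in> E" "y = g x" by auto
    show "y \<in> (\<Union>i\<in>C. J i) \<union> N"
    proof (cases "x \<in> (\<Union>i \<in> C. cball (fst i) (snd i))")
      case True
      then obtain c r where cr: "(c, r) \<in> C" "x \<in> cball c r" by auto
      then have "y \<in> J (c, r)" using x monoD [OF mono]
        by (auto simp: J_def cball_eq_atLeastAtMost)
      then show ?thesis using cr by blast
    qed (use x in \<open>auto simp: N_def\<close>)
  qed
  have "(\<Union>i\<in>C. J i) \<union> N \<in> lmeasurable"
    using JU N by (simp add: fmeasurable.Un negligible_imp_measurable)
  moreover have "measure lebesgue ((\<Union>i\<in>C. J i) \<union> N) = measure lebesgue (\<Union>i\<in>C. J i)"
    by (rule measure_negligible_symdiff [OF JU(1)]) (auto intro: negligible_subset [OF N])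
  ultimately show ?thesis using sub JU by metis
qed

lemma lmeasurable_outer_open:
  fixes T :: "real set"
  assumes "T \<in> lmeasurable" "\<eta> > 0"
  obtains U where "open U" "T \<subseteq> U" "U \<in> lmeasurable" "measure lebesgue U \<le> measure lebesgue T + \<eta>"
proof -
  obtain U where U: "open U" "T \<subseteq> U" "U - T \<in> lmeasurable" "emeasure lebesgue (U - T) < ennreal \<eta>"
    using sets_lebesgue_outer_open [of T \<eta>] assms by (metis fmeasurableD)
  have eq: "U = T \<union> (U - T)" using U by auto
  then have Um: "U \<in> lmeasurable" by (metis U(3) assms(1) fmeasurable.Un)
  have "measure lebesgue (U - T) \<le> \<eta>"
    using U assms by (metis emeasure_eq_measure2 ennreal_less_iff less_imp_le measure_nonneg)
  then have "measure lebesgue U \<le> measure lebesgue T + \<eta>"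
    using measure_Un_le [of T lebesgue "U - T"] assms U eq
    by (metis add_left_mono fmeasurableD order_trans)
  with U Um that show ?thesis by blast
qed

text \<open>
After adding \<open>2 K x\<close>, the function is an increasing homeomorphism \<open>g\<close> that is Lipschitz in both
directions, and the two slopes become \<open>0 < P < Q\<close>.  The bound on images of sets with small slopes,
applied to \<open>g\<close> on \<open>E\<close> with \<open>P\<close> and then to the inverse of \<open>g\<close> on the image of \<open>E\<close> with \<open>1/Q\<close>, shows
that the outer measure of \<open>E\<close> is at most \<open>P/Q < 1\<close> times itself.
\<close>

lemma oscillating_slopes_negligible:
  fixes f :: "real \<Rightarrow> real"
  assumes lip: "\<And>x y. \<bar>f x - f y\<bar> \<le> K * \<bar>x - y\<bar>" and K: "K > 0" and pq: "p < q"
    and bnd: "bounded E"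
    and Ep: "\<And>x d. \<lbrakk>x \<in> E; d > 0\<rbrakk> \<Longrightarrow> \<exists>a b. a < b \<and> a \<le> x \<and> x \<le> b \<and> b - a < d \<and> f b - f a \<le> p * (b - a)"
    and Eq: "\<And>x d. \<lbrakk>x \<in> E; d > 0\<rbrakk> \<Longrightarrow> \<exists>a b. a < b \<and> a \<le> x \<and> x \<le> b \<and> b - a < d \<and> f b - f a \<ge> q * (b - a)"
  shows "negligible E"
proof (cases "E = {}")
  case False
  \<comment> \<open>All slopes of \<open>g\<close> lie between \<open>K\<close> and \<open>3 K\<close>.\<close>
  define g where "g = (\<lambda>x. f x + 2 * K * x)"
  define P where "P = p + 2 * K"
  define Q where "Q = q + 2 * K"
  have slope: "K * (y - x) \<le> g y - g x" "g y - g x \<le> 3 * K * (y - x)" if "x \<le> y" for x y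
    using lip [of x y] that by (auto simp: g_def abs_if algebra_simps split: if_splits)
  have strict: "g x < g y" if "x < y" for x y
  proof -
    have "0 < K * (y - x)" using K that by simp
    then show ?thesis using slope(1) [of x y] that by linarith
  qed
  have mono: "mono g" by (rule monoI) (use strict in \<open>auto simp: le_less\<close>)
  have glip: "\<bar>g x - g y\<bar> \<le> (3 * K) * \<bar>x - y\<bar>" for x y
  proof (cases "x \<le> y")
    case True then show ?thesis using slope [of x y] monoD [OF mono, of x y] by (simp add: abs_if algebra_simps)
  next
    case False then show ?thesis using slope [of y x] monoD [OF mono, of y x] by (simp add: abs_if algebra_simps)
  qed
  have inj: "inj g"
  proof (rule injI)
    fix x y assume "g x = g y"
    then show "x = y" using strict [of x y] strict [of y x] by linarith
  qed
  have cont: "continuous_on UNIV g"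
    by (rule lipschitz_on_continuous_on [where L = "3 * K"])
      (use glip K in \<open>auto simp: lipschitz_on_def dist_real_def\<close>)
  have surj: "surj g"
  proof (unfold surj_def, rule allI)
    fix y
    define r where "r = (\<bar>y\<bar> + \<bar>g 0\<bar>) / K"
    have r: "r \<ge> 0" "K * r = \<bar>y\<bar> + \<bar>g 0\<bar>" using K by (auto simp: r_def)
    have "g (- r) \<le> y" "y \<le> g r"
      using slope(1) [of "-r" 0] slope(1) [of 0 r] r by (auto simp: algebra_simps abs_if split: if_splits)
    then show "\<exists>x. y = g x"
      using IVT' [of g "- r" y r] r continuous_on_subset [OF cont] by auto
  qed
  define g' where "g' = inv g"
  have g'g: "g' (g x) = x" and gg': "g (g' y) = y" for x y
    using inj surj by (simp_all add: g'_def surj_f_inv_f)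
  have mono': "mono g'"
  proof (rule monoI, rule ccontr)
    fix x y assume "x \<le> y" "\<not> g' x \<le> g' y"
    then show False using strict [of "g' y" "g' x"] by (simp add: gg')
  qed
  have lip': "\<bar>g' x - g' y\<bar> \<le> (1 / K) * \<bar>x - y\<bar>" for x y
  proof (cases "x \<le> y")
    case True
    then have "g' x \<le> g' y" using monoD [OF mono'] by simp
    then show ?thesis using slope(1) [of "g' x" "g' y"] True K by (simp add: gg' field_simps)
  next
    case False
    then have "g' y \<le> g' x" using monoD [OF mono'] by simp
    then show ?thesis using slope(1) [of "g' y" "g' x"] False K by (simp add: gg' field_simps)
  qed
  have PK: "P \<ge> K"
  proof -
    obtain x where "x \<in> E" using False by auto
    then obtain a b where ab: "a < b" "f b - f a \<le> p * (b - a)" using Ep [of x 1] by auto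
    have "- K * (b - a) \<le> f b - f a" using lip [of b a] ab(1) by (auto simp: abs_if split: if_splits)
    then have "- K * (b - a) \<le> p * (b - a)" using ab by linarith
    then have "- K \<le> p" using ab mult_right_le_imp_le [of "- K" "b - a" p] by simp
    then show ?thesis by (simp add: P_def)
  qed
  have PQ: "P < Q" "0 < P" "0 < Q" using pq K PK by (auto simp: P_def Q_def)
  have shrink: "\<exists>T'. E \<subseteq> T' \<and> T' \<in> lmeasurable \<and> measure lebesgue T' \<le> (P * (measure lebesgue T + \<eta>) + \<eta>) / Q"
    if T: "E \<subseteq> T" "T \<in> lmeasurable" and \<eta>: "\<eta> > 0" for T \<eta>
  proof -
    obtain U where U: "open U" "T \<subseteq> U" "U \<in> lmeasurable" "measure lebesgue U \<le> measure lebesgue T + \<eta>"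
      using lmeasurable_outer_open [OF T(2) \<eta>] .
    have "\<exists>S. g ` E \<subseteq> S \<and> S \<in> lmeasurable \<and> measure lebesgue S \<le> P * measure lebesgue U"
    proof (rule small_slope_image_measure [OF mono glip])
      fix x d :: real assume "x \<in> E" "d > 0"
      from Ep [OF this] show "\<exists>a b. a < b \<and> a \<le> x \<and> x \<le> b \<and> b - a < d \<and> g b - g a \<le> P * (b - a)"
        by (simp add: g_def P_def algebra_simps)
    qed (use U T PQ in auto)
    then obtain S where S: "g ` E \<subseteq> S" "S \<in> lmeasurable" "measure lebesgue S \<le> P * measure lebesgue U" by blast
    obtain V where V: "open V" "S \<subseteq> V" "V \<in> lmeasurable" "measure lebesgue V \<le> measure lebesgue S + \<eta>"
      using lmeasurable_outer_open [OF S(2) \<eta>] .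
    have "\<exists>T'. g' ` (g ` E) \<subseteq> T' \<and> T' \<in> lmeasurable \<and> measure lebesgue T' \<le> (1 / Q) * measure lebesgue V"
    proof (rule small_slope_image_measure [OF mono' lip'])
      fix y d :: real assume y: "y \<in> g ` E" and d: "d > 0"
      then obtain x where x: "x \<in> E" "y = g x" by auto
      obtain a b where ab: "a < b" "a \<le> x" "x \<le> b" "b - a < d / (3 * K)" "f b - f a \<ge> q * (b - a)"
        using Eq [OF x(1), of "d / (3 * K)"] d K by auto
      have "Q * (b - a) \<le> g b - g a" using ab by (simp add: g_def Q_def algebra_simps)
      then have "b - a \<le> 1 / Q * (g b - g a)" using PQ by (simp add: field_simps)
      moreover have "3 * K * (b - a) < d" using ab K by (simp add: field_simps)
      then have "g b - g a < d" using slope(2) [of a b] ab by linarith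
      ultimately show "\<exists>a b. a < b \<and> a \<le> y \<and> y \<le> b \<and> b - a < d \<and> g' b - g' a \<le> 1 / Q * (b - a)"
        using ab x strict monoD [OF mono] by (intro exI [of _ "g a"] exI [of _ "g b"]) (auto simp: g'g)
    qed (use V S PQ in auto)
    then obtain T' where T': "E \<subseteq> T'" "T' \<in> lmeasurable" "measure lebesgue T' \<le> (1 / Q) * measure lebesgue V"
      by (auto simp: image_image g'g)
    have "measure lebesgue V \<le> P * measure lebesgue U + \<eta>" using V S by linarith
    also have "\<dots> \<le> P * (measure lebesgue T + \<eta>) + \<eta>" using U PQ by simp
    finally have "(1 / Q) * measure lebesgue V \<le> (P * (measure lebesgue T + \<eta>) + \<eta>) / Q"
      using PQ by (simp add: divide_right_mono)
    with T' show ?thesis by (meson order_trans)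
  qed
  define M where "M = measure lebesgue ` {T. E \<subseteq> T \<and> T \<in> lmeasurable}"
  define m where "m = Inf M"
  have M0: "bdd_below M" by (rule bdd_belowI [of _ 0]) (auto simp: M_def)
  have Mne: "M \<noteq> {}"
  proof -
    obtain R where "E \<subseteq> ball 0 R" using bounded_subset_ballD [OF bnd] by blast
    then have "ball 0 R \<in> {T. E \<subseteq> T \<and> T \<in> lmeasurable}" by simp
    then show ?thesis unfolding M_def by blast
  qed
  have "Q * m \<le> P * m"
  proof (rule field_le_epsilon)
    fix e :: real assume e: "e > 0"
    define \<eta> where "\<eta> = e / (2 * P + 1)"
    have "\<eta> * (2 * P + 1) = e" using PQ by (simp add: \<eta>_def)
    moreover have "P * (m + \<eta> + \<eta>) + \<eta> = P * m + \<eta> * (2 * P + 1)" by (simp add: algebra_simps)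
    ultimately have \<eta>: "\<eta> > 0" "P * (m + \<eta> + \<eta>) + \<eta> = P * m + e"
      using e PQ by (auto simp: \<eta>_def)
    have "\<exists>v\<in>M. v < m + \<eta>" using cInf_less_iff [OF Mne M0, of "m + \<eta>"] \<eta> by (simp add: m_def)
    then obtain T where T: "E \<subseteq> T" "T \<in> lmeasurable" "measure lebesgue T < m + \<eta>" by (auto simp: M_def)
    obtain T' where T': "E \<subseteq> T'" "T' \<in> lmeasurable" "measure lebesgue T' \<le> (P * (measure lebesgue T + \<eta>) + \<eta>) / Q"
      using shrink [OF T(1,2) \<eta>(1)] by auto
    have "m \<le> measure lebesgue T'" unfolding m_def by (rule cInf_lower [OF _ M0]) (use T' in \<open>auto simp: M_def\<close>)
    also have "\<dots> \<le> (P * (m + \<eta> + \<eta>) + \<eta>) / Q"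
      by (rule order_trans [OF T'(3)]) (use T PQ in \<open>auto intro!: divide_right_mono mult_left_mono\<close>)
    finally show "Q * m \<le> P * m + e" using PQ \<eta> by (simp add: field_simps)
  qed
  then have "m \<le> 0" using PQ by (metis linorder_not_le mult_less_cancel_right)
  show ?thesis
  proof (simp only: negligible_outer, intro allI impI)
    fix e :: real assume "e > 0"
    then have "\<exists>v\<in>M. v < e" using cInf_less_iff [OF Mne M0, of e] \<open>m \<le> 0\<close> by (simp add: m_def)
    then show "\<exists>T. E \<subseteq> T \<and> T \<in> lmeasurable \<and> measure lebesgue T < e" by (auto simp: M_def)
  qed
qed auto

lemma frequently_slope_interval:
  fixes f :: "real \<Rightarrow> real"
  assumes fr: "\<exists>\<^sub>F y in at x. P ((f y - f x) / (y - x))" and d: "d > 0"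
  shows "\<exists>a b. a < b \<and> a \<le> x \<and> x \<le> b \<and> b - a < d \<and> P ((f b - f a) / (b - a))"
proof -
  have "\<exists>\<^sub>F y in at x. P ((f y - f x) / (y - x)) \<and> (y \<noteq> x \<and> dist y x < d)"
    using fr by (rule frequently_eventually_frequently) (auto simp: eventually_at intro: exI [of _ d] d)
  then obtain y where y: "P ((f y - f x) / (y - x))" "y \<noteq> x" "dist y x < d"
    by (auto dest: frequently_ex)
  have sw: "(f y - f x) / (y - x) = (f x - f y) / (x - y)"
    by (metis minus_diff_eq minus_divide_divide)
  show ?thesis
  proof (cases "x < y")
    case True then show ?thesis using y by (intro exI [of _ x] exI [of _ y]) (auto simp: dist_real_def)
  next
    case False then show ?thesis using y sw by (intro exI [of _ y] exI [of _ x]) (auto simp: dist_real_def)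
  qed
qed

text \<open>
Where a Lipschitz function is not differentiable, the lower and the upper limit of its difference
quotients are separated by two rationals, so the exceptional set is a countable union of sets with
oscillating slopes.
\<close>

lemma Lipschitz_real_differentiable_negligible:
  fixes f :: "real \<Rightarrow> real"
  assumes lip: "\<And>x y. \<bar>f x - f y\<bar> \<le> K * \<bar>x - y\<bar>"
  shows "negligible {x. \<not> f differentiable (at x)}"
proof -
  define K' where "K' = \<bar>K\<bar> + 1"
  have K': "K' > 0" by (simp add: K'_def)
  have lip': "\<bar>f x - f y\<bar> \<le> K' * \<bar>x - y\<bar>" for x y
    by (rule order_trans [OF lip]) (auto simp: K'_def intro: mult_right_mono)
  define \<phi> where "\<phi> = (\<lambda>x y. (f y - f x) / (y - x))"
  define E where "E = (\<lambda>(p, q, n::nat). {x \<in> ball 0 (real n).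
     (\<exists>\<^sub>F y in at x. \<phi> x y < of_rat p) \<and> (\<exists>\<^sub>F y in at x. \<phi> x y > of_rat q)})"
  have neg: "negligible (E (p, q, n))" if "p < q" for p q n
  proof (rule oscillating_slopes_negligible [OF lip' K', where p = "of_rat p" and q = "of_rat q"])
    show "real_of_rat p < of_rat q" using that by (simp add: of_rat_less)
    show "bounded (E (p, q, n))"
      by (rule bounded_subset [OF bounded_ball [of 0 "real n"]]) (auto simp: E_def)
    fix x d :: real assume x: "x \<in> E (p, q, n)" and d: "d > 0"
    show "\<exists>a b. a < b \<and> a \<le> x \<and> x \<le> b \<and> b - a < d \<and> f b - f a \<le> of_rat p * (b - a)"
    proof -
      have "\<exists>\<^sub>F y in at x. (f y - f x) / (y - x) < of_rat p" using x by (simp add: E_def \<phi>_def)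
      from frequently_slope_interval [where P = "\<lambda>s. s < of_rat p", OF this d]
      obtain a b where "a < b" "a \<le> x" "x \<le> b" "b - a < d" "(f b - f a) / (b - a) < of_rat p" by blast
      then show ?thesis by (intro exI [of _ a] exI [of _ b]) (simp add: divide_less_eq)
    qed
    show "\<exists>a b. a < b \<and> a \<le> x \<and> x \<le> b \<and> b - a < d \<and> f b - f a \<ge> of_rat q * (b - a)"
    proof -
      have "\<exists>\<^sub>F y in at x. (f y - f x) / (y - x) > of_rat q" using x by (simp add: E_def \<phi>_def)
      from frequently_slope_interval [where P = "\<lambda>s. s > of_rat q", OF this d]
      obtain a b where "a < b" "a \<le> x" "x \<le> b" "b - a < d" "(f b - f a) / (b - a) > of_rat q" by blast
      then show ?thesis by (intro exI [of _ a] exI [of _ b]) (simp add: less_divide_eq)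
    qed
  qed
  have sub: "{x. \<not> f differentiable (at x)} \<subseteq> (\<Union>i\<in>{i. fst i < fst (snd i)}. E i)"
  proof
    fix x assume "x \<in> {x. \<not> f differentiable (at x)}"
    then have nd: "\<not> f differentiable (at x)" by simp
    define l where "l = Liminf (at x) (\<lambda>y. ereal (\<phi> x y))"
    define u where "u = Limsup (at x) (\<lambda>y. ereal (\<phi> x y))"
    have bd: "\<bar>\<phi> x y\<bar> \<le> K'" if "y \<noteq> x" for y
      using lip' [of y x] that by (simp add: \<phi>_def abs_divide divide_le_eq)
    have ev: "\<forall>\<^sub>F y in at x. ereal (- K') \<le> ereal (\<phi> x y)" "\<forall>\<^sub>F y in at x. ereal (\<phi> x y) \<le> ereal K'"
      using bd by (auto simp: eventually_at abs_le_iff minus_le_iff intro!: exI [of _ 1])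
    have lK: "ereal (- K') \<le> l" unfolding l_def by (rule Liminf_bounded [OF ev(1)])
    have uK: "u \<le> ereal K'" unfolding u_def by (rule Limsup_bounded [OF ev(2)])
    have lu: "l \<le> u" unfolding l_def u_def by (rule Liminf_le_Limsup) simp
    have "l \<noteq> u"
    proof
      assume eq: "l = u"
      obtain c where c: "l = ereal c" using lK uK eq by (cases l) auto
      have "((\<lambda>y. ereal (\<phi> x y)) \<longlongrightarrow> ereal c) (at x)"
        using eq c by (intro Liminf_eq_Limsup) (auto simp: l_def u_def trivial_limit_at)
      then have "(\<phi> x \<longlongrightarrow> c) (at x)" by simp
      then have "(f has_field_derivative c) (at x)"
        by (simp add: has_field_derivative_iff \<phi>_def)
      then show False using nd by (auto simp: real_differentiable_def)
    qed
    with lu have "l < u" by simp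
    then obtain q where q: "l < ereal (of_rat q)" "ereal (of_rat q) < u"
      using ereal_dense3 by blast
    then obtain p where p: "l < ereal (of_rat p)" "ereal (of_rat p) < ereal (of_rat q)"
      using ereal_dense3 by blast
    have "\<exists>\<^sub>F y in at x. \<phi> x y < of_rat p"
    proof (rule ccontr)
      assume "\<not> ?thesis"
      then have "\<forall>\<^sub>F y in at x. ereal (of_rat p) \<le> ereal (\<phi> x y)"
        by (simp add: frequently_def not_less)
      then have "ereal (of_rat p) \<le> l" unfolding l_def by (rule Liminf_bounded)
      then show False using p by simp
    qed
    moreover have "\<exists>\<^sub>F y in at x. \<phi> x y > of_rat q"
    proof (rule ccontr)
      assume "\<not> ?thesis"
      then have "\<forall>\<^sub>F y in at x. ereal (\<phi> x y) \<le> ereal (of_rat q)"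
        by (simp add: frequently_def not_less)
      then have "u \<le> ereal (of_rat q)" unfolding u_def by (rule Limsup_bounded)
      then show False using q by simp
    qed
    moreover obtain n :: nat where "norm x < real n" using reals_Archimedean2 by blast
    ultimately have "x \<in> E (p, q, n)" by (simp add: E_def)
    moreover have "p < q" using p by (simp add: of_rat_less)
    ultimately show "x \<in> (\<Union>i\<in>{i. fst i < fst (snd i)}. E i)"
      by (intro UN_I [of "(p, q, n)"]) auto
  qed
  show ?thesis
  proof (rule negligible_subset [OF _ sub])
    show "negligible (\<Union>i\<in>{i. fst i < fst (snd i)}. E i)"
      by (rule negligible_countable_Union) (use neg in \<open>auto intro: countable_subset [of _ UNIV]\<close>)
  qed
qed

text \<open>
Clamping the argument to \<open>[a,b]\<close> extends each component of the path to a Lipschitz function on the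
whole line.
\<close>

lemma Lipschitz_path_differentiable_negligible:
  fixes f :: "real \<Rightarrow> real^'n"
  assumes lip: "\<And>x y. \<lbrakk>x \<in> {a..b}; y \<in> {a..b}\<rbrakk> \<Longrightarrow> norm (f x - f y) \<le> K * \<bar>x - y\<bar>"
  shows "negligible {x \<in> {a<..<b}. \<not> f differentiable (at x)}"
proof (cases "a < b")
  case True
  define c where "c = (\<lambda>x. max a (min b x))"
  have c: "c x \<in> {a..b}" "\<bar>c x - c y\<bar> \<le> \<bar>x - y\<bar>" for x y using True by (auto simp: c_def)
  have "0 \<le> norm (f a - f b)" by simp
  also have "\<dots> \<le> K * \<bar>a - b\<bar>" by (rule lip) (use True in auto)
  finally have K: "K \<ge> 0" using True by (simp add: zero_le_mult_iff)
  have neg: "negligible {x. \<not> (\<lambda>x. f (c x) \<bullet> i) differentiable (at x)}" if "i \<in> Basis" for i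
  proof (rule Lipschitz_real_differentiable_negligible [where K = K])
    fix x y
    have "\<bar>f (c x) \<bullet> i - f (c y) \<bullet> i\<bar> \<le> norm (f (c x) - f (c y))"
      using Basis_le_norm [OF that, of "f (c x) - f (c y)"] by (simp add: inner_diff_left)
    also have "\<dots> \<le> K * \<bar>c x - c y\<bar>" using lip c by blast
    also have "\<dots> \<le> K * \<bar>x - y\<bar>" using c K by (simp add: mult_left_mono)
    finally show "\<bar>f (c x) \<bullet> i - f (c y) \<bullet> i\<bar> \<le> K * \<bar>x - y\<bar>" .
  qed
  show ?thesis
  proof (rule negligible_subset)
    show "negligible (\<Union>i\<in>Basis. {x. \<not> (\<lambda>x. f (c x) \<bullet> i) differentiable (at x)})"
      using neg by (intro negligible_Union) auto
    show "{x \<in> {a<..<b}. \<not> f differentiable (at x)} \<subseteq> (\<Union>i\<in>Basis. {x. \<not> (\<lambda>x. f (c x) \<bullet> i) differentiable (at x)})"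
    proof (clarsimp, rule ccontr)
      fix x assume x: "a < x" "x < b" and nd: "\<not> f differentiable at x"
        and "\<not> (\<exists>i\<in>Basis. \<not> (\<lambda>x. f (c x) \<bullet> i) differentiable (at x))"
      then have "(\<lambda>x. f (c x)) differentiable (at x)"
        by (subst differentiable_componentwise_within) auto
      then obtain D where "((\<lambda>x. f (c x)) has_derivative D) (at x)" by (auto simp: differentiable_def)
      then have "(f has_derivative D) (at x)"
        by (rule has_derivative_transform_within_open [where s = "{a<..<b}"]) (use x in \<open>auto simp: c_def\<close>)
      then show False using nd by (auto simp: differentiable_def)
    qed
  qed
qed auto

section \<open>Right-continuous paths and their running suprema\<close>

lemma path_space_extensional: "x \<in> path_space T \<Longrightarrow> x \<in> extensional {0..T}"
  by (simp add: path_space_def)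

text \<open>
The one-sided limits bound the path near each point of the interval, which is compact.
\<close>

lemma path_space_bounded:
  fixes x :: "real \<Rightarrow> real^'n"
  assumes x: "x \<in> path_space T"
  shows "bounded (x ` {0..T})"
proof -
  have loc: "\<exists>U. open U \<and> t \<in> U \<and> bounded (x ` (U \<inter> {0..T}))" if t: "t \<in> {0..T}" for t
  proof -
    have tend: "\<exists>B. \<forall>\<^sub>F s in F. norm (x s) \<le> B" if "(x \<longlongrightarrow> l) F" for l F
    proof
      have "\<forall>\<^sub>F s in F. dist (x s) l < 1" using that by (rule tendstoD) simp
      then show "\<forall>\<^sub>F s in F. norm (x s) \<le> norm l + 1"
      proof eventually_elim
        case (elim s)
        then show ?case using norm_triangle_ineq2 [of "x s" l] by (simp add: dist_norm)
      qed
    qed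
    have "\<exists>b>t. bounded (x ` ({t<..<b} \<inter> {0..T}))"
    proof (cases "t < T")
      case True
      then have "(x \<longlongrightarrow> x t) (at_right t)"
        using x t by (simp add: path_space_def continuous_within)
      then obtain B where "\<forall>\<^sub>F s in at_right t. norm (x s) \<le> B" using tend by blast
      then obtain b where "b > t" "\<And>s. t < s \<Longrightarrow> s < b \<Longrightarrow> norm (x s) \<le> B"
        by (auto simp: eventually_at_right_field)
      then show ?thesis by (intro exI [of _ b]) (auto simp: bounded_iff intro!: exI [of _ B])
    next
      case False
      then have "{t<..<t+1} \<inter> {0..T} = {}" using t by auto
      then show ?thesis by (intro exI [of _ "t + 1"]) (simp del: Int_atLeastAtMostR2)
    qed
    then obtain b where b: "b > t" "bounded (x ` ({t<..<b} \<inter> {0..T}))" by blast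
    have "\<exists>a<t. bounded (x ` ({a<..<t} \<inter> {0..T}))"
    proof (cases "0 < t")
      case True
      then have "t \<in> {0<..T}" using t by auto
      then obtain l where "(x \<longlongrightarrow> l) (at_left t)"
        using x unfolding path_space_def by blast
      then obtain B where "\<forall>\<^sub>F s in at_left t. norm (x s) \<le> B" using tend by blast
      then obtain a where "a < t" "\<And>s. a < s \<Longrightarrow> s < t \<Longrightarrow> norm (x s) \<le> B"
        by (auto simp: eventually_at_left_field)
      then show ?thesis by (intro exI [of _ a]) (auto simp: bounded_iff intro!: exI [of _ B])
    next
      case False
      then have "{t-1<..<t} \<inter> {0..T} = {}" using t by auto
      then show ?thesis by (intro exI [of _ "t - 1"]) simp
    qed
    then obtain a where a: "a < t" "bounded (x ` ({a<..<t} \<inter> {0..T}))" by blast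
    have "{a<..<b} \<inter> {0..T} \<subseteq> ({a<..<t} \<inter> {0..T}) \<union> {t} \<union> ({t<..<b} \<inter> {0..T})" by auto
    then have "x ` ({a<..<b} \<inter> {0..T}) \<subseteq> x ` ({a<..<t} \<inter> {0..T}) \<union> {x t} \<union> x ` ({t<..<b} \<inter> {0..T})"
      by blast
    then have "bounded (x ` ({a<..<b} \<inter> {0..T}))"
      by (rule bounded_subset [rotated]) (use a b in auto)
    then show ?thesis using a b by (intro exI [of _ "{a<..<b}"]) auto
  qed
  then have "\<forall>t\<in>{0..T}. \<exists>U. open U \<and> t \<in> U \<and> bounded (x ` (U \<inter> {0..T}))" by blast
  then obtain U where U: "\<forall>t\<in>{0..T}. open (U t) \<and> t \<in> U t \<and> bounded (x ` (U t \<inter> {0..T}))"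
    by (rule bchoice [THEN exE])
  obtain C where C: "C \<subseteq> {0..T}" "finite C" "{0..T} \<subseteq> (\<Union>t\<in>C. U t)"
  proof (rule compactE_image [of "{0..T}" "{0..T}" U])
    show "open (U t)" if "t \<in> {0..T}" for t using U that by blast
    show "{0..T} \<subseteq> (\<Union>t\<in>{0..T}. U t)" using U by blast
  qed auto
  have "x ` {0..T} \<subseteq> (\<Union>t\<in>C. x ` (U t \<inter> {0..T}))" using C by force
  moreover have "bounded (\<Union>t\<in>C. x ` (U t \<inter> {0..T}))"
    using C U by (intro bounded_UN) auto
  ultimately show ?thesis using bounded_subset by blast
qed

lemma path_space_bdd_above_norm:
  fixes x :: "real \<Rightarrow> real^'n"
  assumes "x \<in> path_space T" "t \<le> T"
  shows "bdd_above ((\<lambda>s. norm (x s)) ` {0..t})"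
proof -
  obtain B where "\<forall>s\<in>{0..T}. norm (x s) \<le> B"
    using path_space_bounded [OF assms(1)] unfolding bounded_iff by blast
  then show ?thesis using assms by (intro bdd_aboveI2 [of _ _ B]) auto
qed

lemma norm_le_running_sup:
  fixes x :: "real \<Rightarrow> real^'n"
  assumes "x \<in> path_space T" "0 \<le> s" "s \<le> t" "t \<le> T"
  shows "norm (x s) \<le> running_sup x t"
  unfolding running_sup_def
  by (rule cSUP_upper) (use assms path_space_bdd_above_norm in auto)

lemma running_sup_nonneg:
  fixes x :: "real \<Rightarrow> real^'n"
  assumes "x \<in> path_space T" "0 \<le> t" "t \<le> T"
  shows "0 \<le> running_sup x t"
  using norm_le_running_sup [OF assms(1) assms(2) order_refl assms(3)] norm_ge_zero order_trans by blast

lemma running_sup_le: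
  fixes x :: "real \<Rightarrow> real^'n"
  assumes "0 \<le> t" "\<And>s. \<lbrakk>0 \<le> s; s \<le> t\<rbrakk> \<Longrightarrow> norm (x s) \<le> B"
  shows "running_sup x t \<le> B"
  unfolding running_sup_def by (rule cSUP_least) (use assms in auto)

lemma running_sup_mono:
  fixes x :: "real \<Rightarrow> real^'n"
  assumes "x \<in> path_space T" "0 \<le> s" "s \<le> t" "t \<le> T"
  shows "running_sup x s \<le> running_sup x t"
  using assms norm_le_running_sup [OF assms(1), of _ t] by (intro running_sup_le) auto

lemma running_sup_cong:
  fixes x :: "real \<Rightarrow> real^'n"
  assumes "\<And>s. \<lbrakk>0 \<le> s; s \<le> t\<rbrakk> \<Longrightarrow> x s = x' s"
  shows "running_sup x t = running_sup x' t"
  unfolding running_sup_def by (rule SUP_cong) (use assms in auto)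

text \<open>
The membership criterion for every path constructed below: keep a given path until \<open>t\<^sub>0\<close> and continue
it continuously.
\<close>

lemma path_space_continuation:
  fixes x :: "real \<Rightarrow> real^'n"
  assumes x0: "x\<^sub>0 \<in> path_space T" and t0: "t\<^sub>0 \<in> {0..T}"
    and ext: "x \<in> extensional {0..T}"
    and eq: "\<And>r. \<lbrakk>0 \<le> r; r \<le> t\<^sub>0\<rbrakk> \<Longrightarrow> x r = x\<^sub>0 r"
    and cont: "continuous_on {t\<^sub>0..T} x"
  shows "x \<in> path_space T"
proof -
  have "continuous (at_right t) x" if t: "t \<in> {0..<T}" for t
  proof (cases "t < t\<^sub>0")
    case True
    have "(x\<^sub>0 \<longlongrightarrow> x\<^sub>0 t) (at_right t)"
      using x0 t by (simp add: path_space_def continuous_within)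
    moreover have "\<forall>\<^sub>F s in at_right t. x\<^sub>0 s = x s"
      unfolding eventually_at_right_field using True t eq by (intro exI [of _ t\<^sub>0]) auto
    ultimately have "(x \<longlongrightarrow> x\<^sub>0 t) (at_right t)" by (rule Lim_transform_eventually)
    then show ?thesis using eq True t by (simp add: continuous_within)
  next
    case False
    then have "(x \<longlongrightarrow> x t) (at t within {t\<^sub>0..T})"
      using cont t by (auto simp: continuous_on_def)
    then have "(x \<longlongrightarrow> x t) (at t within {t..T})"
      by (rule tendsto_within_subset) (use False t0 in auto)
    then show ?thesis using t by (simp add: continuous_within at_within_Icc_at_right)
  qed
  moreover have "\<exists>l. (x \<longlongrightarrow> l) (at_left t)" if t: "t \<in> {0<..T}" for t
  proof (cases "t \<le> t\<^sub>0")
    case True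
    obtain l where "(x\<^sub>0 \<longlongrightarrow> l) (at_left t)"
      using x0 t unfolding path_space_def by blast
    moreover have "\<forall>\<^sub>F s in at_left t. x\<^sub>0 s = x s"
      unfolding eventually_at_left_field using True t eq by (intro exI [of _ 0]) auto
    ultimately have "(x \<longlongrightarrow> l) (at_left t)" by (rule Lim_transform_eventually)
    then show ?thesis by blast
  next
    case False
    then have "(x \<longlongrightarrow> x t) (at t within {t\<^sub>0..T})"
      using cont t by (auto simp: continuous_on_def)
    then have "(x \<longlongrightarrow> x t) (at t within {t\<^sub>0..t})"
      by (rule tendsto_within_subset) (use False t in auto)
    then show ?thesis using False by (auto simp: at_within_Icc_at_left)
  qed
  ultimately show ?thesis using ext by (auto simp: path_space_def)
qed

section \<open>The path sets without derivatives\<close>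

text \<open>
The unknown value appears on both sides of \<open>step\<close>.  On steps so short that its factor on the right is
at most \<open>1/2\<close>, the value at most doubles; \<open>N\<close> steps reach \<open>b\<close>.
\<close>

lemma discrete_Gronwall:
  fixes \<phi> :: "real \<Rightarrow> real"
  assumes ab: "a \<le> b" and L: "L \<ge> 0" and N: "2 * L * (b - a) \<le> real N" "N > 0"
    and nonneg: "\<And>t. \<lbrakk>a \<le> t; t \<le> b\<rbrakk> \<Longrightarrow> 0 \<le> \<phi> t"
    and step: "\<And>s t. \<lbrakk>a \<le> s; s \<le> t; t \<le> b\<rbrakk> \<Longrightarrow> \<phi> t \<le> \<phi> s + L * (t - s) * \<phi> t"
  shows "\<phi> b \<le> 2 ^ N * \<phi> a"
proof -
  define \<delta> where "\<delta> = (b - a) / N"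
  have \<delta>: "\<delta> \<ge> 0" "real N * \<delta> = b - a" "L * \<delta> \<le> 1 / 2"
    using assms by (auto simp: \<delta>_def field_simps)
  have "\<phi> (a + real i * \<delta>) \<le> 2 ^ i * \<phi> a" if "i \<le> N" for i
    using that
  proof (induction i)
    case (Suc i)
    have le: "a + real i * \<delta> \<le> a + real (Suc i) * \<delta>" "a + real (Suc i) * \<delta> \<le> b" "a \<le> a + real i * \<delta>"
      using \<delta> mult_right_mono [of "real (Suc i)" "real N" \<delta>] Suc.prems by (auto simp: algebra_simps)
    have "\<phi> (a + real (Suc i) * \<delta>) \<le> \<phi> (a + real i * \<delta>) + L * \<delta> * \<phi> (a + real (Suc i) * \<delta>)"
      using step [OF le(3,1,2)] by (simp add: algebra_simps)
    moreover have "L * \<delta> * \<phi> (a + real (Suc i) * \<delta>) \<le> 1/2 * \<phi> (a + real (Suc i) * \<delta>)"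
      using \<delta> le by (intro mult_right_mono nonneg) auto
    moreover have "\<phi> (a + real i * \<delta>) \<le> 2 ^ i * \<phi> a" using Suc by simp
    ultimately show ?case by simp
  qed simp
  from this [of N] show ?thesis using \<delta> by simp
qed

text \<open>
Integrating the derivative of an absolutely continuous path bounds its increments, because the
running supremum is monotone and so the velocity bound at \<open>b\<close> dominates all earlier ones.  The other
two facts express the integral of \<open>x' \<bullet> z\<close> through increments of \<open>x\<close>.
\<close>

lemma X_set_imp_Lipschitz:
  fixes x :: "real \<Rightarrow> real^'n"
  assumes L: "L \<ge> 0" and s0: "0 \<le> s\<^sub>0" and x: "x \<in> X_set T L s\<^sub>0 x\<^sub>0"
    and ab: "s\<^sub>0 \<le> a" "a \<le> b" "b \<le> T"
  shows "norm (x b - x a) \<le> L * (1 + running_sup x b) * (b - a)"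
    and "((\<lambda>s. vector_derivative x (at s) \<bullet> z) has_integral (x b - x a) \<bullet> z) {a..b}"
    and "(\<lambda>s. vector_derivative x (at s) \<bullet> z) absolutely_integrable_on {a..b}"
proof -
  have xp: "x \<in> path_space T" using x by (simp add: X_set_def)
  have ae: "AE t in lebesgue. s\<^sub>0 < t \<and> t < T \<longrightarrow>
        x differentiable (at t) \<and> norm (vector_derivative x (at t)) \<le> L * (1 + running_sup x t)"
    using x by (simp add: X_set_def)
  then obtain N where N: "N \<in> null_sets lebesgue"
    "\<And>t. \<lbrakk>t \<notin> N; s\<^sub>0 < t; t < T\<rbrakk> \<Longrightarrow> x differentiable (at t) \<and>
        norm (vector_derivative x (at t)) \<le> L * (1 + running_sup x t)"
    by (auto simp: eventually_ae_filter)
  define N' where "N' = N \<union> {a, b}"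
  have neg: "negligible N'" using N by (simp add: N'_def negligible_iff_null_sets [symmetric])
  define f where "f = (\<lambda>t. if t \<in> N' then 0 else vector_derivative x (at t))"
  have ac: "absolutely_continuous_path a b x"
  proof -
    have "absolutely_continuous_path s\<^sub>0 T x" using x by (simp add: X_set_def)
    moreover have "S \<subseteq> {s\<^sub>0..T}" if "S \<subseteq> {a..b}" for S using that ab by auto
    ultimately show ?thesis unfolding absolutely_continuous_path_def by meson
  qed
  have f: "(f has_integral (x b - x a)) {a..b}"
  proof (rule absolutely_continuous_path_has_integral [OF ac ab(2) neg])
    fix t assume t: "t \<in> {a<..<b} - N'"
    then have "x differentiable (at t)" using N(2) [of t] ab by (auto simp: N'_def)
    then show "(x has_vector_derivative f t) (at t)"
      using t by (simp add: f_def vector_derivative_works)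
  qed
  define B where "B = L * (1 + running_sup x b)"
  have B: "B \<ge> 0" using L running_sup_nonneg [OF xp, of b] s0 ab by (simp add: B_def)
  have fB: "norm (f t) \<le> B" if t: "t \<in> {a..b}" for t
  proof (cases "t \<in> N'")
    case False
    then have "norm (f t) \<le> L * (1 + running_sup x t)"
      using N(2) [of t] t ab by (auto simp: f_def N'_def)
    also have "\<dots> \<le> B" unfolding B_def
      using running_sup_mono [OF xp, of t b] t ab s0 L by (intro mult_left_mono) auto
    finally show ?thesis .
  qed (use B in \<open>simp add: f_def\<close>)
  show "norm (x b - x a) \<le> L * (1 + running_sup x b) * (b - a)"
    using has_integral_bound_real [OF B finite.emptyI f] fB ab by (simp add: B_def)
  have fz: "((\<lambda>s. f s \<bullet> z) has_integral (x b - x a) \<bullet> z) {a..b}"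
    using has_integral_linear [OF f bounded_linear_inner_left [of z]] by (simp add: o_def)
  show "((\<lambda>s. vector_derivative x (at s) \<bullet> z) has_integral (x b - x a) \<bullet> z) {a..b}"
    by (rule has_integral_spike [OF neg _ fz]) (simp add: f_def)
  have "(\<lambda>s. f s \<bullet> z) absolutely_integrable_on {a..b}"
  proof (rule absolutely_integrable_integrable_bound)
    show "norm (f t \<bullet> z) \<le> B * norm z" if "t \<in> {a..b}" for t
      using fB [OF that] Cauchy_Schwarz_ineq2 [of "f t" z] mult_right_mono [of "norm (f t)" B "norm z"]
      by simp
    show "(\<lambda>s. f s \<bullet> z) integrable_on {a..b}" using fz by blast
  qed auto
  then show "(\<lambda>s. vector_derivative x (at s) \<bullet> z) absolutely_integrable_on {a..b}"
    by (rule absolutely_integrable_spike [OF _ neg]) (simp add: f_def)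
qed

text \<open>
Allowing \<open>K + 1\<close> instead of \<open>K\<close> makes the modulus \<open>\<epsilon> / (K + 1)\<close> work for \<open>K = 0\<close> as well.
\<close>

lemma Lipschitz_imp_absolutely_continuous_path:
  fixes x :: "real \<Rightarrow> real^'n"
  assumes K: "K \<ge> 0" and lip: "\<And>u v. \<lbrakk>a \<le> u; u \<le> v; v \<le> b\<rbrakk> \<Longrightarrow> norm (x v - x u) \<le> K * (v - u)"
  shows "absolutely_continuous_path a b x"
  unfolding absolutely_continuous_path_def
proof (intro allI impI)
  fix \<epsilon> :: real assume \<epsilon>: "\<epsilon> > 0"
  show "\<exists>\<delta>>0. \<forall>D S. D division_of S \<and> S \<subseteq> {a..b} \<and> (\<Sum>K\<in>D. Sup K - Inf K) < \<delta> \<longrightarrow>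
      (\<Sum>K\<in>D. norm (x (Sup K) - x (Inf K))) < \<epsilon>"
  proof (intro exI [of _ "\<epsilon> / (K + 1)"] conjI allI impI; (elim conjE)?)
    show "\<epsilon> / (K + 1) > 0" using \<epsilon> K by simp
    fix D S assume D: "D division_of S" and S: "S \<subseteq> {a..b}" and sm: "(\<Sum>K\<in>D. Sup K - Inf K) < \<epsilon> / (K + 1)"
    have "(\<Sum>J\<in>D. norm (x (Sup J) - x (Inf J))) \<le> (\<Sum>J\<in>D. (K + 1) * (Sup J - Inf J))"
    proof (rule sum_mono)
      fix J assume J: "J \<in> D"
      then obtain u v where uv: "J = {u..v}" using division_ofD(4) [OF D J] by auto
      have "J \<noteq> {}" "J \<subseteq> S" using division_ofD(2,3) [OF D J] by auto
      then have "u \<le> v" using uv by simp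
      have "{u..v} \<subseteq> {a..b}" using uv S \<open>J \<subseteq> S\<close> by (simp only: order_trans)
      then have "a \<le> u" "v \<le> b" using \<open>u \<le> v\<close> by auto
      then have "norm (x v - x u) \<le> K * (v - u)" "0 \<le> v - u" using lip \<open>u \<le> v\<close> by auto
      then show "norm (x (Sup J) - x (Inf J)) \<le> (K + 1) * (Sup J - Inf J)"
        using uv \<open>u \<le> v\<close> by (simp add: algebra_simps)
    qed
    also have "\<dots> = (K + 1) * (\<Sum>J\<in>D. Sup J - Inf J)" by (simp add: sum_distrib_left)
    also have "\<dots> < \<epsilon>" using sm K by (simp add: field_simps)
    finally show "(\<Sum>J\<in>D. norm (x (Sup J) - x (Inf J))) < \<epsilon>" .
  qed
qed

text \<open>
The increment condition contains no derivative and is therefore closed under uniform limits and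
stable under concatenation; it is the working definition of the path sets from here on.
\<close>

lemma X_set_iff:
  fixes x :: "real \<Rightarrow> real^'n"
  assumes L: "L \<ge> 0" and s0: "s\<^sub>0 \<in> {0..T}"
  shows "x \<in> X_set T L s\<^sub>0 x\<^sub>0 \<longleftrightarrow> x \<in> path_space T \<and> (\<forall>t\<in>{0..s\<^sub>0}. x t = x\<^sub>0 t) \<and>
    (\<forall>a b. s\<^sub>0 \<le> a \<longrightarrow> a \<le> b \<longrightarrow> b \<le> T \<longrightarrow> norm (x b - x a) \<le> L * (1 + running_sup x b) * (b - a))"
    (is "?lhs \<longleftrightarrow> ?rhs")
proof
  assume ?lhs
  then show ?rhs using X_set_imp_Lipschitz(1) [OF L _ \<open>?lhs\<close>] s0 by (auto simp: X_set_def)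
next
  assume rhs: ?rhs
  then have xp: "x \<in> path_space T" by blast
  define K where "K = L * (1 + running_sup x T)"
  have K: "K \<ge> 0" using L running_sup_nonneg [OF xp, of T] s0 by (auto simp: K_def)
  have lip: "norm (x v - x u) \<le> K * (v - u)" if "s\<^sub>0 \<le> u" "u \<le> v" "v \<le> T" for u v
  proof -
    have "norm (x v - x u) \<le> L * (1 + running_sup x v) * (v - u)" using rhs that by blast
    also have "\<dots> \<le> K * (v - u)" unfolding K_def
      using that L s0 running_sup_mono [OF xp, of v T] by (intro mult_right_mono mult_left_mono) auto
    finally show ?thesis .
  qed
  have "norm (x u - x v) \<le> K * \<bar>u - v\<bar>" if "u \<in> {s\<^sub>0..T}" "v \<in> {s\<^sub>0..T}" for u v
    using lip [of u v] lip [of v u] that by (cases "u \<le> v") (auto simp: norm_minus_commute)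
  then have neg: "negligible {t \<in> {s\<^sub>0<..<T}. \<not> x differentiable (at t)}"
    by (rule Lipschitz_path_differentiable_negligible)
  have der: "norm (vector_derivative x (at t)) \<le> L * (1 + running_sup x t)"
    if t: "s\<^sub>0 < t" "t < T" and d: "x differentiable (at t)" for t
  proof -
    let ?v = "vector_derivative x (at t)" and ?B = "L * (1 + running_sup x t)"
    have hd: "(x has_derivative (\<lambda>h. h *\<^sub>R ?v)) (at t)"
      using d by (simp add: vector_derivative_works has_vector_derivative_def)
    show ?thesis
    proof (rule field_le_epsilon)
      fix e :: real assume "e > 0"
      then obtain \<delta> where \<delta>: "\<delta> > 0"
        "\<And>s. norm (s - t) < \<delta> \<Longrightarrow> norm (x s - x t - (s - t) *\<^sub>R ?v) \<le> e * norm (s - t)"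
        using hd unfolding has_derivative_at_alt by blast
      \<comment> \<open>A point to the left of \<open>t\<close>, so that the increment bound involves the running supremum at \<open>t\<close> itself.\<close>
      define s where "s = (max s\<^sub>0 (t - \<delta>) + t) / 2"
      have "max s\<^sub>0 (t - \<delta>) < s" "s < t" using t(1) \<delta>(1) by (auto simp: s_def)
      then have s: "s\<^sub>0 < s" "s < t" "norm (s - t) < \<delta>" by auto
      have "norm (x t - x s) \<le> ?B * (t - s)" using rhs s t by auto
      moreover have "norm (x s - x t - (s - t) *\<^sub>R ?v) \<le> e * (t - s)" using \<delta>(2) [OF s(3)] s by simp
      moreover have "norm ((s - t) *\<^sub>R ?v) \<le> norm (x t - x s) + norm (x s - x t - (s - t) *\<^sub>R ?v)"
        using norm_triangle_ineq4 [of "x s - x t" "x s - x t - (s - t) *\<^sub>R ?v"] by (simp add: norm_minus_commute)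
      moreover have "norm ((s - t) *\<^sub>R ?v) = (t - s) * norm ?v" using s by simp
      ultimately have "(t - s) * norm ?v \<le> ?B * (t - s) + e * (t - s)" by linarith
      then have "(t - s) * norm ?v \<le> (t - s) * (?B + e)" by (simp add: algebra_simps)
      then show "norm ?v \<le> ?B + e" using s by (simp add: mult_le_cancel_left_pos)
    qed
  qed
  have "AE t in lebesgue. s\<^sub>0 < t \<and> t < T \<longrightarrow>
        x differentiable (at t) \<and> norm (vector_derivative x (at t)) \<le> L * (1 + running_sup x t)"
    by (rule AE_I' [of "{t \<in> {s\<^sub>0<..<T}. \<not> x differentiable (at t)}"])
       (use neg der in \<open>auto simp: negligible_iff_null_sets\<close>)
  then show ?lhs
    using rhs Lipschitz_imp_absolutely_continuous_path [OF K lip] by (auto simp: X_set_def)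
qed

lemma X_setD:
  fixes x :: "real \<Rightarrow> real^'n"
  assumes "x \<in> X_set T L s\<^sub>0 x\<^sub>0"
  shows "x \<in> path_space T" "\<And>t. \<lbrakk>0 \<le> t; t \<le> s\<^sub>0\<rbrakk> \<Longrightarrow> x t = x\<^sub>0 t"
  using assms by (auto simp: X_set_def)

lemma X_set_Lipschitz:
  fixes x :: "real \<Rightarrow> real^'n"
  assumes L: "L \<ge> 0" and s0: "s\<^sub>0 \<in> {0..T}" and x: "x \<in> X_set T L s\<^sub>0 x\<^sub>0"
    and "u \<in> {s\<^sub>0..T}" "v \<in> {s\<^sub>0..T}" and K: "L * (1 + running_sup x T) \<le> K"
  shows "norm (x u - x v) \<le> K * \<bar>u - v\<bar>"
proof -
  note xp = X_setD(1) [OF x]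
  have lip: "norm (x v - x u) \<le> K * (v - u)" if "s\<^sub>0 \<le> u" "u \<le> v" "v \<le> T" for u v
  proof -
    have "norm (x v - x u) \<le> L * (1 + running_sup x v) * (v - u)"
      by (rule X_set_imp_Lipschitz(1) [OF L _ x]) (use s0 that in auto)
    also have "\<dots> \<le> L * (1 + running_sup x T) * (v - u)"
      using that L s0 running_sup_mono [OF xp, of v T] by (intro mult_right_mono mult_left_mono) auto
    also have "\<dots> \<le> K * (v - u)" using K that by (intro mult_right_mono) auto
    finally show ?thesis .
  qed
  then show ?thesis
    using lip [of u v] lip [of v u] assms(4,5) by (cases "u \<le> v") (auto simp: norm_minus_commute)
qed

lemma X_set_continuous_on:
  fixes x :: "real \<Rightarrow> real^'n"
  assumes L: "L \<ge> 0" and s0: "s\<^sub>0 \<in> {0..T}" and x: "x \<in> X_set T L s\<^sub>0 x\<^sub>0"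
  shows "continuous_on {s\<^sub>0..T} x"
proof (rule lipschitz_on_continuous_on)
  show "(L * (1 + running_sup x T))-lipschitz_on {s\<^sub>0..T} x"
    using X_set_Lipschitz [OF L s0 x _ _ order_refl] running_sup_nonneg [OF X_setD(1) [OF x], of T] s0 L
    by (auto simp: lipschitz_on_def dist_norm)
qed

lemma X_set_trans:
  fixes x :: "real \<Rightarrow> real^'n"
  assumes L: "L \<ge> 0" and s0: "s\<^sub>0 \<in> {0..T}" and x: "x \<in> X_set T L s\<^sub>0 x\<^sub>0"
    and t: "t \<in> {s\<^sub>0..T}" and x': "x' \<in> X_set T L t x"
  shows "x' \<in> X_set T L s\<^sub>0 x\<^sub>0"
proof -
  have t': "t \<in> {0..T}" using s0 t by auto
  note X = x [unfolded X_set_iff [OF L s0]] and X' = x' [unfolded X_set_iff [OF L t']]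
  have "norm (x' b - x' a) \<le> L * (1 + running_sup x' b) * (b - a)"
    if ab: "s\<^sub>0 \<le> a" "a \<le> b" "b \<le> T" for a b
  proof -
    have eq: "x' r = x r" if "0 \<le> r" "r \<le> t" for r using X' that by auto
    have low: "norm (x' b - x' a) \<le> L * (1 + running_sup x' b) * (b - a)" if "s\<^sub>0 \<le> a" "a \<le> b" "b \<le> t" for a b
    proof -
      have "running_sup x b = running_sup x' b" by (rule running_sup_cong) (use eq that in auto)
      moreover have "norm (x b - x a) \<le> L * (1 + running_sup x b) * (b - a)"
        using X that t by auto
      ultimately show ?thesis using that eq [of a] eq [of b] s0 by simp
    qed
    consider "b \<le> t" | "t \<le> a" | "a < t" "t < b" by linarith
    then show ?thesis
    proof cases
      case 3
      have "norm (x' b - x' a) \<le> norm (x' b - x' t) + norm (x' t - x' a)"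
        using norm_triangle_ineq [of "x' b - x' t" "x' t - x' a"] by simp
      also have "\<dots> \<le> L * (1 + running_sup x' b) * (b - t) + L * (1 + running_sup x' t) * (t - a)"
        using X' low [of a t] 3 ab by (intro add_mono) auto
      also have "\<dots> \<le> L * (1 + running_sup x' b) * (b - t) + L * (1 + running_sup x' b) * (t - a)"
        using running_sup_mono [of x' T t b] X' 3 ab s0 L t
        by (intro add_left_mono mult_right_mono mult_left_mono) auto
      finally show ?thesis by (simp add: algebra_simps)
    qed (use low ab X' in auto)
  qed
  moreover have "x' r = x\<^sub>0 r" if "r \<in> {0..s\<^sub>0}" for r
    using that X X' t by auto
  ultimately show ?thesis using X' by (auto simp: X_set_iff [OF L s0])
qed

definition stop_path :: "real \<Rightarrow> (real \<Rightarrow> real^'n) \<Rightarrow> real \<Rightarrow> real \<Rightarrow> real^'n" where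
  "stop_path T x t = restrict (\<lambda>r. x (min r t)) {0..T}"

lemma stop_path_in_X_set:
  fixes x :: "real \<Rightarrow> real^'n"
  assumes L: "L \<ge> 0" and t: "t \<in> {0..T}" and x: "x \<in> path_space T"
  shows "stop_path T x t \<in> X_set T L t x"
proof -
  have eq: "stop_path T x t r = x t" if "r \<in> {t..T}" for r
    using that t by (auto simp: stop_path_def min_def)
  have sp: "stop_path T x t \<in> path_space T"
  proof (rule path_space_continuation [OF x t])
    show "continuous_on {t..T} (stop_path T x t)"
      by (subst continuous_on_cong [OF refl eq]) auto
  qed (use t in \<open>auto simp: stop_path_def\<close>)
  show ?thesis unfolding X_set_iff [OF L t]
  proof (intro conjI allI impI ballI)
    fix a b assume ab: "t \<le> a" "a \<le> b" "b \<le> T"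
    then have "0 \<le> L * (1 + running_sup (stop_path T x t) b) * (b - a)"
      using L running_sup_nonneg [OF sp, of b] t by auto
    then show "norm (stop_path T x t b - stop_path T x t a) \<le> L * (1 + running_sup (stop_path T x t) b) * (b - a)"
      using ab eq by simp
  qed (use t sp in \<open>auto simp: stop_path_def\<close>)
qed

text \<open>
The velocity grows at most linearly in the running supremum, so a Gronwall argument bounds all paths
of a path set in terms of their common initial part.
\<close>

lemma X_set_running_sup_bound:
  fixes x :: "real \<Rightarrow> real^'n"
  assumes L: "L \<ge> 0" and s0: "s\<^sub>0 \<in> {0..T}" and x: "x \<in> X_set T L s\<^sub>0 x\<^sub>0"
    and N: "2 * L * T \<le> real N" "N > 0"
  shows "1 + running_sup x T \<le> 2 ^ N * (1 + running_sup x\<^sub>0 s\<^sub>0)"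
proof -
  note X = x [unfolded X_set_iff [OF L s0]]
  then have xp: "x \<in> path_space T" by blast
  have "(\<lambda>t. 1 + running_sup x t) T \<le> 2 ^ N * (\<lambda>t. 1 + running_sup x t) s\<^sub>0"
  proof (rule discrete_Gronwall [where L = L and \<phi> = "\<lambda>t. 1 + running_sup x t"])
    have "2 * L * (T - s\<^sub>0) \<le> 2 * L * T" using L s0 by (intro mult_left_mono) auto
    then show "2 * L * (T - s\<^sub>0) \<le> real N" using N by linarith
    show "0 \<le> 1 + running_sup x t" if "s\<^sub>0 \<le> t" "t \<le> T" for t
      using running_sup_nonneg [OF xp, of t] that s0 by auto
    fix s t assume st: "s\<^sub>0 \<le> s" "s \<le> t" "t \<le> T"
    have nn: "0 \<le> L * (1 + running_sup x t)" using L running_sup_nonneg [OF xp, of t] st s0 by auto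
    have "running_sup x t \<le> running_sup x s + L * (t - s) * (1 + running_sup x t)"
    proof (rule running_sup_le)
      fix r assume r: "0 \<le> r" "r \<le> t"
      show "norm (x r) \<le> running_sup x s + L * (t - s) * (1 + running_sup x t)"
      proof (cases "r \<le> s")
        case True
        then have "norm (x r) \<le> running_sup x s" using norm_le_running_sup [OF xp, of r s] r st by auto
        moreover have "0 \<le> L * (t - s) * (1 + running_sup x t)"
          using nn st mult_nonneg_nonneg [OF nn, of "t - s"] by (simp add: mult.commute mult.left_commute)
        ultimately show ?thesis by linarith
      next
        case False
        have "norm (x r) \<le> norm (x s) + norm (x r - x s)"
          by (metis add.commute diff_add_cancel norm_triangle_ineq)
        also have "norm (x s) \<le> running_sup x s" using norm_le_running_sup [OF xp, of s s] st s0 by auto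
        also have "norm (x r - x s) \<le> L * (1 + running_sup x r) * (r - s)" using X False r st by auto
        also have "\<dots> \<le> L * (1 + running_sup x t) * (t - s)"
          using False r st L running_sup_mono [OF xp, of r t] nn
          by (intro mult_mono mult_left_mono) auto
        finally show ?thesis by (simp add: algebra_simps)
      qed
    qed (use st s0 in auto)
    then show "1 + running_sup x t \<le> 1 + running_sup x s + L * (t - s) * (1 + running_sup x t)" by simp
  qed (use s0 L N in auto)
  moreover have "running_sup x s\<^sub>0 = running_sup x\<^sub>0 s\<^sub>0"
    by (rule running_sup_cong) (use X in auto)
  ultimately show ?thesis by simp
qed

section \<open>The pseudo-metric and compactness of the path sets\<close>

lemma d_infty_bdd_above:
  fixes x x' :: "real \<Rightarrow> real^'n"
  assumes "x \<in> path_space T" "x' \<in> path_space T" "t \<in> {0..T}" "s \<in> {0..T}"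
  shows "bdd_above ((\<lambda>r. norm (x (min r t) - x' (min r s))) ` {0..T})"
proof (rule bdd_aboveI2)
  fix r assume r: "r \<in> {0..T}"
  have "norm (x (min r t) - x' (min r s)) \<le> norm (x (min r t)) + norm (x' (min r s))"
    by (rule norm_triangle_ineq4)
  also have "\<dots> \<le> running_sup x T + running_sup x' T"
    using assms r by (intro add_mono norm_le_running_sup) (auto simp: min_def)
  finally show "norm (x (min r t) - x' (min r s)) \<le> running_sup x T + running_sup x' T" .
qed

lemma d_infty_ge:
  fixes x x' :: "real \<Rightarrow> real^'n"
  assumes "x \<in> path_space T" "x' \<in> path_space T" "t \<in> {0..T}" "s \<in> {0..T}"
  shows "\<bar>t - s\<bar> \<le> d_infty T (t, x) (s, x')"
    and "r \<in> {0..T} \<Longrightarrow> norm (x (min r t) - x' (min r s)) \<le> d_infty T (t, x) (s, x')"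
proof -
  let ?f = "\<lambda>r. norm (x (min r t) - x' (min r s))"
  have le: "?f r \<le> (SUP r\<in>{0..T}. ?f r)" if "r \<in> {0..T}" for r
    using d_infty_bdd_above [OF assms] that by (rule cSUP_upper [rotated])
  have "0 \<le> ?f 0" by simp
  also have "\<dots> \<le> (SUP r\<in>{0..T}. ?f r)" by (rule le) (use assms in auto)
  finally show "\<bar>t - s\<bar> \<le> d_infty T (t, x) (s, x')" by (simp add: d_infty_def)
  show "?f r \<le> d_infty T (t, x) (s, x')" if "r \<in> {0..T}"
    using le [OF that] by (simp add: d_infty_def add_increasing)
qed

lemma d_infty_le:
  fixes x x' :: "real \<Rightarrow> real^'n"
  assumes "0 \<le> T" "\<And>r. r \<in> {0..T} \<Longrightarrow> norm (x (min r t) - x' (min r s)) \<le> B"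
  shows "d_infty T (t, x) (s, x') \<le> \<bar>t - s\<bar> + B"
proof -
  have "(SUP r\<in>{0..T}. norm (x (min r t) - x' (min r s))) \<le> B"
    by (rule cSUP_least) (use assms in auto)
  then show ?thesis by (simp add: d_infty_def)
qed

lemma d_infty_tendsto_times:
  fixes x0s :: "nat \<Rightarrow> real \<Rightarrow> real^'n"
  assumes ts: "\<And>n. ts n \<in> {0..T}" and t0: "t\<^sub>0 \<in> {0..T}"
    and x0s: "\<And>n. x0s n \<in> path_space T" and x0: "x\<^sub>0 \<in> path_space T"
    and conv: "(\<lambda>n. d_infty T (t\<^sub>0, x\<^sub>0) (ts n, x0s n)) \<longlonglongrightarrow> 0"
  shows "ts \<longlonglongrightarrow> t\<^sub>0"
proof -
  have "\<bar>ts n - t\<^sub>0\<bar> \<le> d_infty T (t\<^sub>0, x\<^sub>0) (ts n, x0s n)" for n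
    using d_infty_ge(1) [OF x0 x0s t0 ts, of n n] by (simp add: abs_minus_commute)
  then have "\<forall>\<^sub>F n in sequentially. norm (ts n - t\<^sub>0) \<le> d_infty T (t\<^sub>0, x\<^sub>0) (ts n, x0s n)" by simp
  from Lim_null_comparison [OF this conv] show ?thesis by (simp add: LIM_zero_iff)
qed

lemma running_sup_diff_le:
  fixes x x' :: "real \<Rightarrow> real^'n"
  assumes "x' \<in> path_space T" "0 \<le> t" "t \<le> T"
    "\<And>s. \<lbrakk>0 \<le> s; s \<le> t\<rbrakk> \<Longrightarrow> norm (x s - x' s) \<le> e"
  shows "running_sup x t \<le> running_sup x' t + e"
proof (rule running_sup_le [OF assms(2)])
  fix s assume s: "0 \<le> s" "s \<le> t"
  have "norm (x s) \<le> norm (x' s) + norm (x s - x' s)"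
    by (metis add.commute diff_add_cancel norm_triangle_ineq)
  then show "norm (x s) \<le> running_sup x' t + e"
    using assms(4) [OF s] norm_le_running_sup [OF assms(1) s assms(3)] by linarith
qed

text \<open>
By the a priori bound the paths are uniformly bounded and equi-Lipschitz after their starting times,
so the Arzela-Ascoli theorem applies, and the increment condition passes to the limit.  The starting
points are allowed to vary because the envelopes below are approximated from nearby points.
\<close>

theorem X_set_compact:
  fixes xs x0s :: "nat \<Rightarrow> real \<Rightarrow> real^'n"
  assumes L: "L \<ge> 0" and ts: "\<And>n. ts n \<in> {0..T}" and t0: "t\<^sub>0 \<in> {0..T}"
    and x0s: "\<And>n. x0s n \<in> path_space T" and x0: "x\<^sub>0 \<in> path_space T"
    and xs: "\<And>n. xs n \<in> X_set T L (ts n) (x0s n)"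
    and conv: "(\<lambda>n. d_infty T (t\<^sub>0, x\<^sub>0) (ts n, x0s n)) \<longlonglongrightarrow> 0"
  obtains r x where "strict_mono r" "x \<in> X_set T L t\<^sub>0 x\<^sub>0" "uniform_limit {0..T} (xs \<circ> r) x sequentially"
proof -
  define \<Delta> where "\<Delta> = (\<lambda>n. d_infty T (t\<^sub>0, x\<^sub>0) (ts n, x0s n))"
  have \<Delta>t: "\<bar>t\<^sub>0 - ts n\<bar> \<le> \<Delta> n" for n
    unfolding \<Delta>_def by (rule d_infty_ge(1)) (use ts t0 x0s x0 in auto)
  have \<Delta>x: "norm (x\<^sub>0 (min r t\<^sub>0) - x0s n (min r (ts n))) \<le> \<Delta> n" if "r \<in> {0..T}" for r n
    unfolding \<Delta>_def by (rule d_infty_ge(2)) (use ts t0 x0s x0 that in auto)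
  have \<Delta>0: "\<Delta> n \<ge> 0" for n using \<Delta>t [of n] by linarith
  have \<Delta>lim: "\<Delta> \<longlonglongrightarrow> 0" using conv by (simp add: \<Delta>_def)
  obtain D where D: "\<And>n. \<Delta> n \<le> D"
    using convergent_imp_Bseq [OF convergentI [OF \<Delta>lim]] \<Delta>0 by (auto simp: Bseq_def abs_le_iff)
  define N where "N = Suc (nat \<lceil>2 * L * T\<rceil>)"
  have N: "2 * L * T \<le> real N" "N > 0" by (auto simp: N_def le_of_int_ceiling) linarith
  define R where "R = 2 ^ N * (1 + (running_sup x\<^sub>0 T + D))"
  have xsp: "xs n \<in> path_space T" for n using xs X_setD by blast
  have R: "1 + running_sup (xs n) T \<le> R" for n
  proof -
    have "1 + running_sup (xs n) T \<le> 2 ^ N * (1 + running_sup (x0s n) (ts n))"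
      by (rule X_set_running_sup_bound [OF L ts xs N])
    also have "running_sup (x0s n) (ts n) \<le> running_sup x\<^sub>0 T + D"
    proof (rule running_sup_le)
      fix s assume s: "0 \<le> s" "s \<le> ts n"
      then have "norm (x\<^sub>0 (min s t\<^sub>0) - x0s n s) \<le> D"
        using \<Delta>x [of s n] D [of n] ts [of n] by (auto simp: min_def split: if_splits)
      moreover have "norm (x\<^sub>0 (min s t\<^sub>0)) \<le> running_sup x\<^sub>0 T"
        using x0 t0 s ts [of n] by (intro norm_le_running_sup) auto
      moreover have "norm (x0s n s) \<le> norm (x\<^sub>0 (min s t\<^sub>0)) + norm (x\<^sub>0 (min s t\<^sub>0) - x0s n s)"
        by (metis norm_minus_commute norm_triangle_sub)
      ultimately show "norm (x0s n s) \<le> running_sup x\<^sub>0 T + D" by linarith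
    qed (use ts in auto)
    finally show ?thesis by (simp add: R_def)
  qed
  define K where "K = L * R"
  have K: "norm (xs n u - xs n v) \<le> K * \<bar>u - v\<bar>" if "u \<in> {ts n..T}" "v \<in> {ts n..T}" for n u v
    by (rule X_set_Lipschitz [OF L ts xs that]) (use R L in \<open>auto simp: K_def intro: mult_left_mono\<close>)
  have K0: "K \<ge> 0"
  proof -
    have "0 \<le> running_sup (xs 0) T" using running_sup_nonneg [OF xsp, of T] t0 by auto
    then have "0 \<le> R" using R [of 0] by linarith
    then show ?thesis using L by (simp add: K_def)
  qed
  \<comment> \<open>Constant before the starting times, so that all functions are Lipschitz on the whole interval.\<close>
  define F where "F = (\<lambda>n r. xs n (max r (ts n)))"
  have FK: "norm (F n u - F n v) \<le> K * \<bar>u - v\<bar>" if "u \<in> {0..T}" "v \<in> {0..T}" for n u v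
  proof -
    have "norm (F n u - F n v) \<le> K * \<bar>max u (ts n) - max v (ts n)\<bar>"
      unfolding F_def by (rule K) (use that ts [of n] in auto)
    also have "\<dots> \<le> K * \<bar>u - v\<bar>" using K0 by (intro mult_left_mono) auto
    finally show ?thesis .
  qed
  have FR: "norm (F n u) \<le> R" if "u \<in> {0..T}" for n u
  proof -
    have "norm (F n u) \<le> running_sup (xs n) T"
      unfolding F_def by (rule norm_le_running_sup [OF xsp]) (use that ts [of n] in auto)
    then show ?thesis using R [of n] by linarith
  qed
  obtain g k where g: "continuous_on {0..T} g" and k: "strict_mono (k :: nat \<Rightarrow> nat)"
    and Fg: "\<And>e. 0 < e \<Longrightarrow> \<exists>N. \<forall>n x. n \<ge> N \<and> x \<in> {0..T} \<longrightarrow> norm (F (k n) x - g x) < e"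
  proof (rule Arzela_Ascoli [of "{0..T}" F R])
    fix u e :: real assume u: "u \<in> {0..T}" and e: "0 < e"
    show "\<exists>d. 0 < d \<and> (\<forall>n v. v \<in> {0..T} \<and> norm (u - v) < d \<longrightarrow> norm (F n u - F n v) < e)"
    proof (intro exI [of _ "e / (K + 1)"] conjI allI impI; (elim conjE)?)
      show "0 < e / (K + 1)" using e K0 by simp
      fix n v assume v: "v \<in> {0..T}" "norm (u - v) < e / (K + 1)"
      have "norm (F n u - F n v) \<le> K * \<bar>u - v\<bar>" by (rule FK [OF u v(1)])
      also have "\<dots> \<le> (K + 1) * \<bar>u - v\<bar>" by (intro mult_right_mono) auto
      also have "\<dots> < e" using v K0 by (simp add: field_simps)
      finally show "norm (F n u - F n v) < e" .
    qed
  qed (use FR in auto)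
  have \<Delta>k: "(\<lambda>n. \<Delta> (k n)) \<longlonglongrightarrow> 0"
    using LIMSEQ_subseq_LIMSEQ [OF \<Delta>lim k] by (simp add: o_def)
  have Fgu: "uniform_limit {0..T} (\<lambda>n. F (k n)) g sequentially"
    unfolding uniform_limit_iff eventually_sequentially dist_norm using Fg by meson
  have Fg_lim: "(\<lambda>n. F (k n) u) \<longlonglongrightarrow> g u" if "u \<in> {0..T}" for u
    by (rule tendsto_uniform_limitI [OF Fgu that])
  have g0: "g t\<^sub>0 = x\<^sub>0 t\<^sub>0"
  proof -
    have "norm (F n t\<^sub>0 - x\<^sub>0 t\<^sub>0) \<le> (K + 1) * \<Delta> n" for n
    proof -
      have "norm (F n t\<^sub>0 - F n (ts n)) \<le> K * \<Delta> n"
        using FK [OF t0 ts, of n n] \<Delta>t [of n] mult_left_mono [OF _ K0] order_trans by blast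
      moreover have "norm (F n (ts n) - x\<^sub>0 t\<^sub>0) \<le> \<Delta> n"
      proof -
        have "max (ts n) t\<^sub>0 \<in> {0..T}" using ts [of n] t0 by auto
        from \<Delta>x [OF this, of n] have "norm (x\<^sub>0 t\<^sub>0 - x0s n (ts n)) \<le> \<Delta> n" by (simp add: min.absorb2)
        moreover have "F n (ts n) = x0s n (ts n)"
          using X_setD(2) [OF xs, of "ts n" n] ts [of n] by (simp add: F_def)
        ultimately show ?thesis by (simp add: norm_minus_commute)
      qed
      ultimately have "norm (F n t\<^sub>0 - F n (ts n)) + norm (F n (ts n) - x\<^sub>0 t\<^sub>0) \<le> (K + 1) * \<Delta> n"
        by (simp add: algebra_simps)
      then show ?thesis using norm_triangle_ineq [of "F n t\<^sub>0 - F n (ts n)" "F n (ts n) - x\<^sub>0 t\<^sub>0"] by simp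
    qed
    then have ev: "\<forall>\<^sub>F n in sequentially. norm (F (k n) t\<^sub>0 - x\<^sub>0 t\<^sub>0) \<le> (K + 1) * \<Delta> (k n)" by simp
    have "(\<lambda>n. (K + 1) * \<Delta> (k n)) \<longlonglongrightarrow> 0" using tendsto_mult_right_zero [OF \<Delta>k] .
    from Lim_null_comparison [OF ev this]
    have "(\<lambda>n. F (k n) t\<^sub>0 - x\<^sub>0 t\<^sub>0) \<longlonglongrightarrow> 0" .
    then have "(\<lambda>n. F (k n) t\<^sub>0) \<longlonglongrightarrow> x\<^sub>0 t\<^sub>0" by (simp add: LIM_zero_iff)
    then show ?thesis using Fg_lim [OF t0] LIMSEQ_unique by blast
  qed
  define x where "x = restrict (\<lambda>r. if r \<le> t\<^sub>0 then x\<^sub>0 r else g r) {0..T}"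
  have xg: "x r = g r" if "r \<in> {t\<^sub>0..T}" for r
    using that t0 g0 by (auto simp: x_def)
  have xx0: "x r = x\<^sub>0 r" if "0 \<le> r" "r \<le> t\<^sub>0" for r
    using that t0 by (auto simp: x_def)
  have xcont: "continuous_on {t\<^sub>0..T} x"
    by (subst continuous_on_cong [OF refl xg]) (use t0 in \<open>auto intro: continuous_on_subset [OF g]\<close>)
  have xp: "x \<in> path_space T"
    by (rule path_space_continuation [OF x0 t0 _ xx0 xcont]) (auto simp: x_def)
  \<comment> \<open>The starting time \<open>ts n\<close> may lie on either side of \<open>t\<^sub>0\<close>; between the two, the paths are compared through their values at the starting times.\<close>
  have close: "norm (xs n r - x r) \<le> (K + 2) * \<Delta> n + (if t\<^sub>0 < r then norm (F n r - g r) else 0)"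
    if r: "r \<in> {0..T}" for n r
  proof (cases "r \<le> t\<^sub>0")
    case True
    have x: "x r = x\<^sub>0 r" using True r xx0 by simp
    show ?thesis
    proof (cases "r \<le> ts n")
      case le: True
      have "norm (x\<^sub>0 r - x0s n r) \<le> \<Delta> n" using \<Delta>x [OF r, of n] True le by (simp add: min_def)
      moreover have "xs n r = x0s n r" using X_setD(2) [OF xs] le r by auto
      ultimately have "norm (xs n r - x r) \<le> \<Delta> n" using x by (simp add: norm_minus_commute)
      also have "\<dots> \<le> (K + 2) * \<Delta> n" using K0 \<Delta>0 [of n] by (simp add: algebra_simps)
      finally show ?thesis using True by simp
    next
      case False
      have "norm (x\<^sub>0 r - x0s n (ts n)) \<le> \<Delta> n" using \<Delta>x [OF r, of n] True False by (simp add: min_def)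
      moreover have "xs n (ts n) = x0s n (ts n)" using X_setD(2) [OF xs] ts [of n] by auto
      moreover have "norm (xs n r - xs n (ts n)) \<le> K * \<Delta> n"
      proof -
        have "norm (xs n r - xs n (ts n)) \<le> K * \<bar>r - ts n\<bar>"
          by (rule K) (use False r ts [of n] in auto)
        also have "\<dots> \<le> K * \<Delta> n" using False True \<Delta>t [of n] K0 by (intro mult_left_mono) auto
        finally show ?thesis .
      qed
      ultimately have "norm (xs n r - xs n (ts n)) + norm (xs n (ts n) - x r) \<le> (K + 1) * \<Delta> n"
        using x by (simp add: norm_minus_commute algebra_simps)
      then have "norm (xs n r - x r) \<le> (K + 1) * \<Delta> n"
        using norm_triangle_ineq [of "xs n r - xs n (ts n)" "xs n (ts n) - x r"] by simp
      also have "\<dots> \<le> (K + 2) * \<Delta> n" using \<Delta>0 [of n] by (simp add: algebra_simps)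
      finally show ?thesis using True by simp
    qed
  next
    case False
    then have x: "x r = g r" using r xg by auto
    have "norm (xs n r - F n r) \<le> 2 * \<Delta> n"
    proof (cases "r \<le> ts n")
      case True
      have "norm (x\<^sub>0 t\<^sub>0 - x0s n r) \<le> \<Delta> n" using \<Delta>x [OF r, of n] True False by (simp add: min_def)
      moreover have "norm (x\<^sub>0 t\<^sub>0 - x0s n (ts n)) \<le> \<Delta> n"
        using \<Delta>x [OF ts, of n n] True False by (simp add: min_def split: if_splits)
      moreover have "xs n (ts n) = x0s n (ts n)" "xs n r = x0s n r"
        using X_setD(2) [OF xs] ts [of n] True r by auto
      moreover have "F n r = xs n (ts n)" using True by (simp add: F_def)
      moreover have "norm (x0s n r - x0s n (ts n)) \<le> norm (x\<^sub>0 t\<^sub>0 - x0s n r) + norm (x\<^sub>0 t\<^sub>0 - x0s n (ts n))"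
        using norm_triangle_ineq4 [of "x\<^sub>0 t\<^sub>0 - x0s n (ts n)" "x\<^sub>0 t\<^sub>0 - x0s n r"] by (simp add: add.commute)
      ultimately show ?thesis by simp
    qed (use \<Delta>0 [of n] in \<open>auto simp: F_def max_def\<close>)
    also have "\<dots> \<le> (K + 2) * \<Delta> n" using K0 \<Delta>0 [of n] by (simp add: algebra_simps)
    finally have "norm (xs n r - F n r) + norm (F n r - x r) \<le> (K + 2) * \<Delta> n + norm (F n r - g r)"
      using x by simp
    then show ?thesis using False norm_triangle_ineq [of "xs n r - F n r" "F n r - x r"] by simp
  qed
  have ul: "uniform_limit {0..T} (xs \<circ> k) x sequentially"
    unfolding uniform_limit_iff
  proof (intro allI impI)
    fix e :: real assume e: "e > 0"
    have "(\<lambda>n. (K + 2) * \<Delta> (k n)) \<longlonglongrightarrow> 0" using tendsto_mult_right_zero [OF \<Delta>k] .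
    then have "\<forall>\<^sub>F n in sequentially. (K + 2) * \<Delta> (k n) < e / 2"
      by (rule order_tendstoD(2)) (use e in simp)
    moreover have "\<forall>\<^sub>F n in sequentially. \<forall>r\<in>{0..T}. dist (F (k n) r) (g r) < e / 2"
      using Fgu half_gt_zero [OF e] unfolding uniform_limit_iff by blast
    ultimately show "\<forall>\<^sub>F n in sequentially. \<forall>r\<in>{0..T}. dist ((xs \<circ> k) n r) (x r) < e"
    proof eventually_elim
      case (elim n)
      show ?case
      proof
        fix r assume r: "r \<in> {0..T}"
        have "norm (F (k n) r - g r) < e / 2" using elim r by (simp add: dist_norm)
        then show "dist ((xs \<circ> k) n r) (x r) < e"
          using close [OF r, of "k n"] elim(1) e by (auto simp: dist_norm split: if_splits)
      qed
    qed
  qed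
  have xlim: "(\<lambda>n. xs (k n) r) \<longlonglongrightarrow> x r" if "r \<in> {0..T}" for r
    using tendsto_uniform_limitI [OF ul that] by (simp add: o_def)
  have lip1: "norm (x b - x a) \<le> L * (1 + running_sup x b) * (b - a)"
    if ab: "t\<^sub>0 < a" "a \<le> b" "b \<le> T" for a b
  proof (rule field_le_epsilon)
    fix e :: real assume e: "e > 0"
    define e' where "e' = e / (L * T + 1)"
    have T0: "T \<ge> 0" using t0 by auto
    have e': "e' > 0" using e L T0 by (simp add: e'_def add_nonneg_pos)
    have "\<forall>\<^sub>F n in sequentially. \<Delta> (k n) < a - t\<^sub>0"
      by (rule order_tendstoD(2) [OF \<Delta>k]) (use ab in simp)
    moreover have "\<forall>\<^sub>F n in sequentially. \<forall>r\<in>{0..T}. dist ((xs \<circ> k) n r) (x r) < e'"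
      using ul e' unfolding uniform_limit_iff by blast
    ultimately have ev: "\<forall>\<^sub>F n in sequentially. norm (xs (k n) b - xs (k n) a) \<le> L * (1 + running_sup x b) * (b - a) + e"
    proof eventually_elim
      case (elim n)
      have tsa: "ts (k n) \<le> a" using \<Delta>t [of "k n"] elim(1) by linarith
      have "running_sup (xs (k n)) b \<le> running_sup x b + e'"
        by (rule running_sup_diff_le [OF xp]) (use elim(2) ab t0 in \<open>auto simp: dist_norm less_imp_le\<close>)
      have "norm (xs (k n) b - xs (k n) a) \<le> L * (1 + running_sup (xs (k n)) b) * (b - a)"
        by (rule X_set_imp_Lipschitz(1) [OF L _ xs]) (use ts [of "k n"] tsa ab in auto)
      also have "\<dots> \<le> L * (1 + (running_sup x b + e')) * (b - a)"
        using \<open>running_sup (xs (k n)) b \<le> running_sup x b + e'\<close> L ab by (intro mult_right_mono mult_left_mono) auto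
      also have "\<dots> = L * (1 + running_sup x b) * (b - a) + e' * (L * (b - a))" by (simp add: algebra_simps)
      also have "e' * (L * (b - a)) \<le> e' * (L * T + 1)"
        using e' L ab t0 by (intro mult_left_mono) (auto simp: add_increasing2 mult_left_mono)
      also have "\<dots> = e"
      proof -
        have "L * T + 1 > 0" using L T0 by (simp add: add_nonneg_pos)
        then show ?thesis by (simp add: e'_def)
      qed
      finally show ?case by simp
    qed
    have "(\<lambda>n. norm (xs (k n) b - xs (k n) a)) \<longlonglongrightarrow> norm (x b - x a)"
      by (intro tendsto_intros xlim) (use ab t0 in auto)
    then show "norm (x b - x a) \<le> L * (1 + running_sup x b) * (b - a) + e"
      using ev by (rule tendsto_upperbound) simp
  qed
  have lip: "norm (x b - x a) \<le> L * (1 + running_sup x b) * (b - a)"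
    if ab: "t\<^sub>0 \<le> a" "a \<le> b" "b \<le> T" for a b
  proof (cases "t\<^sub>0 < a \<or> a = b")
    case False
    then have a: "a = t\<^sub>0" "t\<^sub>0 < b" using ab by auto
    have "(x \<longlongrightarrow> x t\<^sub>0) (at t\<^sub>0 within {t\<^sub>0..T})"
      using xcont a ab by (auto simp: continuous_on_def)
    then have "(x \<longlongrightarrow> x t\<^sub>0) (at t\<^sub>0 within {t\<^sub>0..b})"
      by (rule tendsto_within_subset) (use ab in auto)
    then have R: "(x \<longlongrightarrow> x t\<^sub>0) (at_right t\<^sub>0)" using a by (simp add: at_within_Icc_at_right)
    have l1: "((\<lambda>a. norm (x b - x a)) \<longlongrightarrow> norm (x b - x t\<^sub>0)) (at_right t\<^sub>0)"
      by (intro tendsto_intros R)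
    have l2: "((\<lambda>a. L * (1 + running_sup x b) * (b - a)) \<longlongrightarrow> L * (1 + running_sup x b) * (b - t\<^sub>0)) (at_right t\<^sub>0)"
      by (intro tendsto_intros)
    show ?thesis unfolding a(1)
    proof (rule tendsto_le [OF _ l2 l1])
      show "\<forall>\<^sub>F a in at_right t\<^sub>0. norm (x b - x a) \<le> L * (1 + running_sup x b) * (b - a)"
        unfolding eventually_at_right_field using a lip1 ab by (intro exI [of _ b]) auto
    qed simp
  qed (use lip1 [of a b] ab in auto)
  have "x \<in> X_set T L t\<^sub>0 x\<^sub>0"
    unfolding X_set_iff [OF L t0] using xp xx0 lip by auto
  with k ul that show ?thesis by blast
qed

section \<open>The Hamiltonian along paths\<close>

text \<open>
The hypotheses on \<open>h\<close> and \<open>H\<close> speak of the metric topology on paths, whereas limits below are uniform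
limits of functions; this lemma connects the two.
\<close>

lemma limitin_path_metric:
  fixes xs :: "nat \<Rightarrow> real \<Rightarrow> real^'n"
  assumes T: "0 \<le> T" and xs: "\<And>n. xs n \<in> path_space T" and x: "x \<in> path_space T"
    and lim: "uniform_limit {0..T} xs x sequentially"
  shows "limitin (mtopology_of (path_metric T)) xs x sequentially"
proof -
  let ?S = "{0..T}"
  interpret P: Metric_space "mspace (path_metric T)" "mdist (path_metric T)"
    by (rule Metric_space_mspace_mdist)
  have fs: "f \<in> Met_TC.fspace ?S" if "f \<in> path_space T" for f :: "real \<Rightarrow> real^'n"
    using path_space_extensional [OF that] path_space_bounded [OF that] by (simp add: Met_TC.fspace_def)
  have sp: "mspace (path_metric T) = path_space T \<inter> Met_TC.fspace ?S"
    by (simp add: path_metric_def)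
  have ds: "mdist (path_metric T) = Met_TC.fdist ?S"
    by (simp add: path_metric_def)
  have "(\<lambda>n. Met_TC.fdist ?S (xs n) x) \<longlonglongrightarrow> 0"
  proof (rule LIMSEQ_I)
    fix e :: real assume e: "e > 0"
    then have "\<forall>\<^sub>F n in sequentially. \<forall>r\<in>?S. dist (xs n r) (x r) < e / 2"
      using lim half_gt_zero [OF e] unfolding uniform_limit_iff by blast
    then obtain N where N: "\<And>n r. \<lbrakk>n \<ge> N; r \<in> ?S\<rbrakk> \<Longrightarrow> dist (xs n r) (x r) < e / 2"
      unfolding eventually_sequentially by blast
    show "\<exists>N. \<forall>n\<ge>N. norm (Met_TC.fdist ?S (xs n) x - 0) < e"
    proof (intro exI allI impI)
      fix n assume n: "n \<ge> N"
      have "Met_TC.fdist ?S (xs n) x \<le> e / 2"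
      proof -
        have "?S \<noteq> {}" using T by simp
        then show ?thesis
          unfolding Met_TC.funspace_mdist_le [OF fs [OF xs] fs [OF x] \<open>?S \<noteq> {}\<close>]
          using N [OF n] less_imp_le by blast
      qed
      moreover have "0 \<le> Met_TC.fdist ?S (xs n) x"
        using Metric_space.nonneg [OF Met_TC.Metric_space_funspace] by blast
      ultimately show "norm (Met_TC.fdist ?S (xs n) x - 0) < e" using e by simp
    qed
  qed
  then show ?thesis
    unfolding mtopology_of_def P.limitin_metric_dist_null
    using xs x fs by (simp add: sp ds)
qed

lemma continuous_on_Icc_bounded:
  fixes y :: "real \<Rightarrow> real"
  assumes "continuous_on {a..b} y"
  obtains M where "\<And>t. t \<in> {a..b} \<Longrightarrow> \<bar>y t\<bar> \<le> M"
proof -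
  have "compact (y ` {a..b})" by (intro compact_continuous_image assms) auto
  then have "bounded (y ` {a..b})" by (rule compact_imp_bounded)
  then obtain M where "\<forall>t\<in>{a..b}. \<bar>y t\<bar> \<le> M" unfolding bounded_iff by auto
  then show ?thesis using that by blast
qed

text \<open>
The step hypothesis lets the increment depend on any bound \<open>M\<close> of \<open>y\<close> up to time \<open>t\<close>, which is how
the growth condition on \<open>H\<close> enters.  It implies the discrete inequality for the running supremum of
\<open>y\<close>.
\<close>

lemma sup_Gronwall:
  fixes y :: "real \<Rightarrow> real"
  assumes cont: "continuous_on {a..b} y" and ab: "a \<le> b" and K: "K \<ge> 0" and R: "R \<ge> 0"
    and N: "2 * K * (b - a) \<le> real N" "N > 0"
    and step: "\<And>s t M. \<lbrakk>a \<le> s; s \<le> t; t \<le> b; \<And>r. \<lbrakk>a \<le> r; r \<le> t\<rbrakk> \<Longrightarrow> \<bar>y r\<bar> \<le> M\<rbrakk>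
      \<Longrightarrow> \<bar>y t - y s\<bar> \<le> K * (R + M) * (t - s)"
    and t: "t \<in> {a..b}"
  shows "\<bar>y t\<bar> \<le> 2 ^ N * (R + \<bar>y a\<bar>)"
proof -
  define S where "S = (\<lambda>t. SUP r\<in>{a..t}. \<bar>y r\<bar>)"
  have bdd: "bdd_above ((\<lambda>r. \<bar>y r\<bar>) ` {a..t})" if "t \<le> b" for t
  proof -
    have "compact ((\<lambda>r. \<bar>y r\<bar>) ` {a..b})"
      by (intro compact_continuous_image continuous_intros cont) auto
    then have "bdd_above ((\<lambda>r. \<bar>y r\<bar>) ` {a..b})"
      by (intro bounded_imp_bdd_above compact_imp_bounded)
    then show ?thesis by (rule bdd_above_mono) (use that in auto)
  qed
  have S: "\<bar>y r\<bar> \<le> S t" if "a \<le> r" "r \<le> t" "t \<le> b" for r t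
    unfolding S_def by (rule cSUP_upper [OF _ bdd]) (use that in auto)
  have S0: "0 \<le> S t" if "a \<le> t" "t \<le> b" for t
    using S [OF that(1) order_refl that(2)] by linarith
  have "R + S b \<le> 2 ^ N * (R + S a)"
  proof (rule discrete_Gronwall [where \<phi> = "\<lambda>t. R + S t" and L = K, OF ab K N])
    show "0 \<le> R + S t" if "a \<le> t" "t \<le> b" for t using S0 [OF that] R by simp
    fix s t assume st: "a \<le> s" "s \<le> t" "t \<le> b"
    have nn: "0 \<le> K * (R + S t)" using K R S0 [of t] st by auto
    have "(SUP r\<in>{a..t}. \<bar>y r\<bar>) \<le> S s + K * (R + S t) * (t - s)"
    proof (rule cSUP_least)
      fix r assume r: "r \<in> {a..t}"
      show "\<bar>y r\<bar> \<le> S s + K * (R + S t) * (t - s)"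
      proof (cases "r \<le> s")
        case True
        then show ?thesis using S [of r s] r st mult_nonneg_nonneg [OF nn, of "t - s"] by auto
      next
        case False
        have "\<bar>y r - y s\<bar> \<le> K * (R + S t) * (r - s)"
          by (rule step) (use S False r st in auto)
        also have "\<dots> \<le> K * (R + S t) * (t - s)" using nn r by (intro mult_left_mono) auto
        finally show ?thesis using S [of s s] st by linarith
      qed
    qed (use st in auto)
    then have "S t \<le> S s + K * (R + S t) * (t - s)" by (simp add: S_def)
    then show "R + S t \<le> R + S s + K * (t - s) * (R + S t)" by (simp add: algebra_simps)
  qed
  moreover have "S a = \<bar>y a\<bar>" by (simp add: S_def)
  ultimately show ?thesis using S [of t b] t R by simp
qed

context tvp_data
begin

definition growth_constant :: real where
  "growth_constant = (SOME C. C \<ge> 0 \<and> (AE t in lebesgue. 0 < t \<and> t < T \<longrightarrow>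
     (\<forall>x\<in>path_space T. \<forall>y. \<bar>H t x y 0\<bar> \<le> C * (1 + running_sup x t + \<bar>y\<bar>))))"

lemma growth_constant:
  "growth_constant \<ge> 0"
  "AE t in lebesgue. 0 < t \<and> t < T \<longrightarrow>
     (\<forall>x\<in>path_space T. \<forall>y. \<bar>H t x y 0\<bar> \<le> growth_constant * (1 + running_sup x t + \<bar>y\<bar>))"
  using someI_ex [OF H_growth] by (auto simp: growth_constant_def)

text \<open>
The conditions on \<open>H\<close> that hold for almost every time are collected once, so that later arguments
are pointwise on a set of full measure.  The Lipschitz condition in \<open>x\<close> cannot be included: its
exceptional set depends on the two paths and on \<open>y\<close> and \<open>z\<close>.
\<close>

definition good_times :: "real set" where
  "good_times = {t \<in> {0<..<T}.
     continuous_map (prod_topology (mtopology_of (path_metric T)) (euclidean :: (real \<times> (real^'n)) topology))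
          euclidean (\<lambda>(x, y, z). H t x y z) \<and>
     (\<forall>x\<in>path_space T. \<forall>y z z'. \<bar>H t x y z - H t x y z'\<bar> \<le> L\<^sub>H * (1 + running_sup x t) * norm (z - z')) \<and>
     (\<forall>x\<in>path_space T. \<forall>z. antimono (\<lambda>y. H t x y z)) \<and>
     (\<forall>x\<in>path_space T. \<forall>y. \<bar>H t x y 0\<bar> \<le> growth_constant * (1 + running_sup x t + \<bar>y\<bar>))}"

lemma T_nonneg: "0 \<le> T" using T_pos by simp

lemma good_timesD: "t \<in> good_times \<Longrightarrow> 0 < t \<and> t < T"
  by (simp add: good_times_def)

lemma negligible_bad_times: "negligible ({0..T} - good_times)"
proof -
  have "AE t in lebesgue. 0 < t \<and> t < T \<longrightarrow> t \<in> good_times"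
    using H_continuous H_Lipschitz_z H_antimono_y growth_constant(2)
    by eventually_elim (auto simp: good_times_def)
  then obtain N where N: "N \<in> null_sets lebesgue" "\<And>t. \<lbrakk>t \<notin> N; 0 < t; t < T\<rbrakk> \<Longrightarrow> t \<in> good_times"
    by (auto simp: eventually_ae_filter)
  have "negligible (N \<union> {0, T})"
    using N by (simp add: negligible_iff_null_sets [symmetric])
  then show ?thesis
  proof (rule negligible_subset, intro subsetI)
    fix t assume "t \<in> {0..T} - good_times"
    then show "t \<in> N \<union> {0, T}" using N(2) [of t] by (cases "t = T") (auto simp: less_le)
  qed
qed

lemma good_times_measurable: "good_times \<in> sets lebesgue"
proof -
  have "good_times = {0..T} - ({0..T} - good_times)" using good_timesD by fastforce
  moreover have "{0..T} - ({0..T} - good_times) \<in> sets lebesgue"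
    by (rule sets.Diff [OF _ negligible_imp_sets [OF negligible_bad_times]]) simp
  ultimately show ?thesis by metis
qed

text \<open>
The factor of linear growth of \<open>H\<close> in \<open>(x,y)\<close> for a fixed slope \<open>z\<close>.
\<close>

definition H_slope :: "real^'n \<Rightarrow> real" where
  "H_slope z = growth_constant + L\<^sub>H * norm z"

lemma H_slope_nonneg: "H_slope z \<ge> 0"
  using growth_constant(1) L_H_nonneg by (simp add: H_slope_def)

lemma H_bound:
  assumes t: "t \<in> good_times" and x: "x \<in> path_space T"
  shows "\<bar>H t x y z\<bar> \<le> H_slope z * (1 + running_sup x t + \<bar>y\<bar>)"
proof -
  have R: "0 \<le> running_sup x t" using running_sup_nonneg [OF x] good_timesD [OF t] by auto
  have "\<bar>H t x y z - H t x y 0\<bar> \<le> L\<^sub>H * (1 + running_sup x t) * norm (z - 0)"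
    using t x unfolding good_times_def by blast
  moreover have "L\<^sub>H * (1 + running_sup x t) * norm (z - 0) \<le> L\<^sub>H * (1 + running_sup x t + \<bar>y\<bar>) * norm z"
    using L_H_nonneg R by (simp add: mult_left_mono mult_right_mono)
  moreover have "\<bar>H t x y 0\<bar> \<le> growth_constant * (1 + running_sup x t + \<bar>y\<bar>)"
    using t x unfolding good_times_def by blast
  ultimately show ?thesis by (simp add: H_slope_def algebra_simps)
qed

lemma H_bound':
  assumes t: "t \<in> good_times" and x: "x \<in> path_space T"
    and R: "1 + running_sup x t \<le> R" and M: "\<bar>y\<bar> \<le> M"
  shows "\<bar>H t x y z\<bar> \<le> H_slope z * (R + M)"
  by (rule order_trans [OF H_bound [OF t x]]) (use R M H_slope_nonneg in \<open>auto intro: mult_left_mono\<close>)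

lemma H_antimono:
  assumes "t \<in> good_times" "x \<in> path_space T" "y \<le> y'"
  shows "H t x y' z \<le> H t x y z"
proof -
  have "antimono (\<lambda>y. H t x y z)" using assms unfolding good_times_def by blast
  then show ?thesis using assms(3) by (rule antimonoD)
qed

lemma H_Lipschitz:
  assumes "t \<in> good_times" "x \<in> path_space T"
  shows "\<bar>H t x y z - H t x y z'\<bar> \<le> L\<^sub>H * (1 + running_sup x t) * norm (z - z')"
  using assms unfolding good_times_def by blast

lemma h_tendsto:
  assumes xs: "\<And>n. xs n \<in> path_space T" and x: "x \<in> path_space T"
    and lim: "uniform_limit {0..T} xs x sequentially"
  shows "(\<lambda>n. h (xs n)) \<longlonglongrightarrow> h x"
  using continuous_map_limit [OF h_continuous limitin_path_metric [OF T_nonneg xs x lim]]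
  by (simp add: o_def)

lemma H_tendsto:
  assumes t: "t \<in> good_times" and xs: "\<And>n. xs n \<in> path_space T" and x: "x \<in> path_space T"
    and lim: "uniform_limit {0..T} xs x sequentially" and y: "ys \<longlonglongrightarrow> y"
  shows "(\<lambda>n. H t (xs n) (ys n) z) \<longlonglongrightarrow> H t x y z"
proof -
  have "limitin (prod_topology (mtopology_of (path_metric T)) (euclidean :: (real \<times> (real^'n)) topology))
     (\<lambda>n. (xs n, ys n, z)) (x, y, z) sequentially"
    using limitin_path_metric [OF T_nonneg xs x lim] tendsto_Pair [OF y tendsto_const [of z]]
    by (simp add: limitin_pairwise o_def)
  moreover have "continuous_map (prod_topology (mtopology_of (path_metric T)) (euclidean :: (real \<times> (real^'n)) topology))
          euclidean (\<lambda>(x, y, z). H t x y z)"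
    using t unfolding good_times_def by blast
  ultimately show ?thesis
    using continuous_map_limit by (force simp: o_def)
qed

lemma H_frozen_measurable:
  assumes x: "x \<in> path_space T" and ab: "0 \<le> a" "b \<le> T"
  shows "(\<lambda>t. H t x y z) \<in> borel_measurable (lebesgue_on {a..b})"
proof -
  have "(\<lambda>t. indicator {0..T} t *\<^sub>R H t x y z) \<in> borel_measurable borel"
    using H_measurable [OF x, of y z] by (subst (asm) borel_measurable_restrict_space_iff) auto
  then have "(\<lambda>t. indicator {0..T} t *\<^sub>R H t x y z) \<in> borel_measurable lebesgue"
    by (intro measurable_completion) auto
  then have "(\<lambda>t. indicator {0..T} t *\<^sub>R H t x y z) \<in> borel_measurable (lebesgue_on {a..b})"
    by (rule measurable_restrict_space1)
  then show ?thesis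
    by (rule measurable_cong [THEN iffD1, rotated]) (use ab in \<open>auto simp: space_restrict_space\<close>)
qed

lemma good_spike:
  assumes ab: "0 \<le> a" "b \<le> T" and eq: "\<And>s. \<lbrakk>s \<in> {a..b}; s \<in> good_times\<rbrakk> \<Longrightarrow> f s = g s"
  shows "f integrable_on {a..b} \<longleftrightarrow> g integrable_on {a..b}" "integral {a..b} f = integral {a..b} g"
proof -
  have neg: "negligible ({a..b} - good_times)"
    by (rule negligible_subset [OF negligible_bad_times]) (use ab in auto)
  show "f integrable_on {a..b} \<longleftrightarrow> g integrable_on {a..b}"
  proof
    show "g integrable_on {a..b}" if "f integrable_on {a..b}"
      by (rule integrable_spike [OF that neg]) (use eq in auto)
    show "f integrable_on {a..b}" if "g integrable_on {a..b}"
      by (rule integrable_spike [OF that neg]) (use eq in auto)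
  qed
  show "integral {a..b} f = integral {a..b} g"
    using eq by (intro integral_spike [OF neg]) auto
qed

lemma integral_good_mono:
  fixes f g :: "real \<Rightarrow> real"
  assumes ab: "0 \<le> a" "b \<le> T" and int: "f integrable_on {a..b}" "g integrable_on {a..b}"
    and le: "\<And>s. \<lbrakk>s \<in> {a..b}; s \<in> good_times\<rbrakk> \<Longrightarrow> f s \<le> g s"
  shows "integral {a..b} f \<le> integral {a..b} g"
proof -
  define f' where "f' = (\<lambda>s. if s \<in> good_times then f s else g s)"
  have "f' integrable_on {a..b}" "integral {a..b} f' = integral {a..b} f"
    using good_spike [OF ab, of f' f] int by (auto simp: f'_def)
  moreover have "integral {a..b} f' \<le> integral {a..b} g"
    by (rule integral_le) (use calculation int le in \<open>auto simp: f'_def\<close>)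
  ultimately show ?thesis by simp
qed

lemma integral_good_bound:
  fixes f :: "real \<Rightarrow> real"
  assumes ab: "0 \<le> a" "a \<le> b" "b \<le> T" and int: "f integrable_on {a..b}"
    and le: "\<And>s. \<lbrakk>s \<in> {a..b}; s \<in> good_times\<rbrakk> \<Longrightarrow> \<bar>f s\<bar> \<le> B"
  shows "\<bar>integral {a..b} f\<bar> \<le> B * (b - a)"
proof -
  have "integral {a..b} f \<le> integral {a..b} (\<lambda>_. B)"
    by (rule integral_good_mono) (use ab int le in \<open>auto simp: abs_le_iff\<close>)
  moreover have "integral {a..b} (\<lambda>_. - B) \<le> integral {a..b} f"
    by (rule integral_good_mono) (use ab int le in \<open>auto simp: abs_le_iff minus_le_iff\<close>)
  ultimately show ?thesis using ab by (simp add: abs_le_iff mult.commute)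
qed

text \<open>
The growth bound provides the dominating constant and the continuity of \<open>H\<close> the pointwise limit.
The paths may depend on the integration variable: below, they are stopped at a grid point that
depends on it.
\<close>

lemma H_dominated_limit:
  fixes X :: "nat \<Rightarrow> real \<Rightarrow> real \<Rightarrow> real^'n"
  assumes ab: "0 \<le> a" "b \<le> T"
    and int: "\<And>n. (\<lambda>s. H s (X n s) (\<eta> n s) z) integrable_on {a..b}"
    and X: "\<And>n s. s \<in> {a..b} \<Longrightarrow> X n s \<in> path_space T" and x: "\<And>s. s \<in> {a..b} \<Longrightarrow> x s \<in> path_space T"
    and Xlim: "\<And>s. s \<in> {a..b} \<Longrightarrow> uniform_limit {0..T} (\<lambda>n. X n s) (x s) sequentially"
    and \<eta>lim: "\<And>s. s \<in> {a..b} \<Longrightarrow> (\<lambda>n. \<eta> n s) \<longlonglongrightarrow> y s"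
    and bdd: "\<And>n s. s \<in> {a..b} \<Longrightarrow> 1 + running_sup (X n s) s \<le> R" "\<And>n s. s \<in> {a..b} \<Longrightarrow> \<bar>\<eta> n s\<bar> \<le> M"
  shows "(\<lambda>s. H s (x s) (y s) z) integrable_on {a..b}"
    and "(\<lambda>n. integral {a..b} (\<lambda>s. H s (X n s) (\<eta> n s) z)) \<longlonglongrightarrow> integral {a..b} (\<lambda>s. H s (x s) (y s) z)"
proof -
  define f where "f = (\<lambda>n s. if s \<in> good_times then H s (X n s) (\<eta> n s) z else 0)"
  define g where "g = (\<lambda>s. if s \<in> good_times then H s (x s) (y s) z else 0)"
  have f: "(f n) integrable_on {a..b}" "integral {a..b} (f n) = integral {a..b} (\<lambda>s. H s (X n s) (\<eta> n s) z)" for n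
    using good_spike [OF ab, of "f n" "\<lambda>s. H s (X n s) (\<eta> n s) z"] int [of n] by (auto simp: f_def)
  have bound: "norm (f n s) \<le> \<bar>H_slope z * (R + M)\<bar>" if "s \<in> {a..b}" for n s
    using H_bound' [OF _ X [OF that] bdd(1) [OF that] bdd(2) [OF that]]
    by (auto simp: f_def intro: order_trans [OF _ abs_ge_self])
  have lim: "(\<lambda>n. f n s) \<longlonglongrightarrow> g s" if "s \<in> {a..b}" for s
    using H_tendsto [OF _ X [OF that] x [OF that] Xlim [OF that] \<eta>lim [OF that]] by (auto simp: f_def g_def)
  have const: "(\<lambda>_::real. \<bar>H_slope z * (R + M)\<bar>) integrable_on {a..b}" by auto
  have A: "g integrable_on {a..b}" "(\<lambda>n. integral {a..b} (f n)) \<longlonglongrightarrow> integral {a..b} g"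
    by (rule dominated_convergence [where f = f, OF f(1) const bound lim], assumption+)+
  moreover have "(\<lambda>s. H s (x s) (y s) z) integrable_on {a..b}"
      "integral {a..b} g = integral {a..b} (\<lambda>s. H s (x s) (y s) z)"
    using good_spike [OF ab, of g "\<lambda>s. H s (x s) (y s) z"] A(1) by (auto simp: g_def)
  ultimately show "(\<lambda>s. H s (x s) (y s) z) integrable_on {a..b}"
    and "(\<lambda>n. integral {a..b} (\<lambda>s. H s (X n s) (\<eta> n s) z)) \<longlonglongrightarrow> integral {a..b} (\<lambda>s. H s (x s) (y s) z)"
    using f by simp_all
qed

lemma measurable_bounded_integrable:
  fixes f :: "real \<Rightarrow> real"
  assumes ab: "0 \<le> a" "b \<le> T" and meas: "f \<in> borel_measurable (lebesgue_on {a..b})"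
    and bdd: "\<And>s. \<lbrakk>s \<in> {a..b}; s \<in> good_times\<rbrakk> \<Longrightarrow> \<bar>f s\<bar> \<le> B"
  shows "f integrable_on {a..b}"
proof -
  define g where "g = (\<lambda>s. indicator good_times s * f s)"
  have "indicator good_times \<in> borel_measurable (lebesgue_on {a..b})"
    by (rule measurable_restrict_space1) (use good_times_measurable in auto)
  then have "g \<in> borel_measurable (lebesgue_on {a..b})"
    unfolding g_def using meas by (rule borel_measurable_times)
  then have "g integrable_on {a..b}"
    by (rule measurable_bounded_by_integrable_imp_integrable [where g = "\<lambda>_. \<bar>B\<bar>"])
      (use bdd in \<open>force simp: g_def indicator_def\<close>)+
  then show ?thesis using good_spike(1) [OF ab, of g f] by (simp add: g_def)
qed

text \<open>
The last point of the mesh of width \<open>\<delta>\<close> starting in \<open>t\<^sub>0\<close>, clamped to \<open>[t\<^sub>0,T]\<close> so that a path can be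
stopped there for every real argument.
\<close>

definition grid :: "real \<Rightarrow> real \<Rightarrow> real \<Rightarrow> real" where
  "grid t\<^sub>0 \<delta> s = max t\<^sub>0 (min T (t\<^sub>0 + \<delta> * of_int \<lfloor>(s - t\<^sub>0) / \<delta>\<rfloor>))"

lemma grid:
  assumes "\<delta> > 0" "t\<^sub>0 \<le> s" "s \<le> T"
  shows "t\<^sub>0 \<le> grid t\<^sub>0 \<delta> s" "grid t\<^sub>0 \<delta> s \<le> s" "s - \<delta> \<le> grid t\<^sub>0 \<delta> s"
proof -
  define i :: real where "i = of_int \<lfloor>(s - t\<^sub>0) / \<delta>\<rfloor>"
  define w where "w = \<delta> * i"
  have "i \<le> (s - t\<^sub>0) / \<delta>" "(s - t\<^sub>0) / \<delta> < i + 1" unfolding i_def by linarith+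
  then have "w \<le> s - t\<^sub>0" "s - t\<^sub>0 \<le> w + \<delta>"
    using assms(1) by (auto simp: field_simps w_def)
  moreover have "grid t\<^sub>0 \<delta> s = max t\<^sub>0 (min T (t\<^sub>0 + w))" by (simp add: grid_def w_def i_def)
  ultimately show "t\<^sub>0 \<le> grid t\<^sub>0 \<delta> s" "grid t\<^sub>0 \<delta> s \<le> s" "s - \<delta> \<le> grid t\<^sub>0 \<delta> s"
    using assms by auto
qed

text \<open>
Measurability in time is assumed only for frozen arguments of \<open>H\<close>.  On a grid the arguments are
frozen on each of countably many cells.
\<close>

lemma grid_measurable:
  assumes ab: "0 \<le> a" "b \<le> T" and t0: "t\<^sub>0 \<in> {0..T}"
    and X: "\<And>t. t \<in> {t\<^sub>0..T} \<Longrightarrow> X t \<in> path_space T"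
  shows "(\<lambda>s. H s (X (grid t\<^sub>0 \<delta> s)) (\<eta> (grid t\<^sub>0 \<delta> s)) z) \<in> borel_measurable (lebesgue_on {a..b})"
proof -
  define c where "c = (\<lambda>i::int. max t\<^sub>0 (min T (t\<^sub>0 + \<delta> * of_int i)))"
  have c: "c i \<in> {t\<^sub>0..T}" for i using t0 by (auto simp: c_def)
  have "(\<lambda>s. (\<lambda>i s. H s (X (c i)) (\<eta> (c i)) z) \<lfloor>(s - t\<^sub>0) / \<delta>\<rfloor> s) \<in> borel_measurable (lebesgue_on {a..b})"
  proof (rule measurable_compose_countable)
    show "(\<lambda>s. H s (X (c i)) (\<eta> (c i)) z) \<in> borel_measurable (lebesgue_on {a..b})" for i
      by (rule H_frozen_measurable [OF X [OF c] ab])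
    have "(\<lambda>s. \<lfloor>(s - t\<^sub>0) / \<delta>\<rfloor>) \<in> measurable lebesgue (count_space UNIV)"
      by (rule measurable_completion) simp
    then show "(\<lambda>s. \<lfloor>(s - t\<^sub>0) / \<delta>\<rfloor>) \<in> measurable (lebesgue_on {a..b}) (count_space UNIV)"
      by (rule measurable_restrict_space1)
  qed
  then show ?thesis by (simp add: grid_def c_def)
qed

lemma grid_integrable:
  assumes ab: "0 \<le> t\<^sub>0" "t\<^sub>0 \<le> a" "b \<le> T" and t0: "t\<^sub>0 \<in> {0..T}" and \<delta>: "\<delta> > 0"
    and X: "\<And>t. t \<in> {t\<^sub>0..T} \<Longrightarrow> X t \<in> path_space T"
    and R: "\<And>t. t \<in> {t\<^sub>0..T} \<Longrightarrow> 1 + running_sup (X t) T \<le> R"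
    and M: "\<And>t. t \<in> {t\<^sub>0..T} \<Longrightarrow> \<bar>\<eta> t\<bar> \<le> M"
  shows "(\<lambda>s. H s (X (grid t\<^sub>0 \<delta> s)) (\<eta> (grid t\<^sub>0 \<delta> s)) z) integrable_on {a..b}"
proof (rule measurable_bounded_integrable)
  show "(\<lambda>s. H s (X (grid t\<^sub>0 \<delta> s)) (\<eta> (grid t\<^sub>0 \<delta> s)) z) \<in> borel_measurable (lebesgue_on {a..b})"
    by (rule grid_measurable) (use assms in auto)
  fix s assume s: "s \<in> {a..b}" "s \<in> good_times"
  have g: "grid t\<^sub>0 \<delta> s \<in> {t\<^sub>0..T}" using grid(1,2) [OF \<delta>, of t\<^sub>0 s] s ab by auto
  have "running_sup (X (grid t\<^sub>0 \<delta> s)) s \<le> running_sup (X (grid t\<^sub>0 \<delta> s)) T"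
    by (rule running_sup_mono [OF X [OF g]]) (use s ab in auto)
  then have "1 + running_sup (X (grid t\<^sub>0 \<delta> s)) s \<le> R" using R [OF g] by linarith
  then show "\<bar>H s (X (grid t\<^sub>0 \<delta> s)) (\<eta> (grid t\<^sub>0 \<delta> s)) z\<bar> \<le> H_slope z * (R + M)"
    using H_bound' [OF s(2) X [OF g] _ M [OF g]] by blast
qed (use ab in auto)

text \<open>
Evaluating \<open>y\<close> on ever finer grids reduces the claim to frozen arguments.
\<close>

lemma H_integrable:
  assumes x: "x \<in> path_space T" and ab: "0 \<le> a" "b \<le> T" and y: "continuous_on {a..b} y"
  shows "(\<lambda>s. H s x (y s) z) integrable_on {a..b}"
proof (cases "a \<le> b")
  case True
  define \<delta> where "\<delta> = (\<lambda>n. inverse (real (Suc n)))"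
  have \<delta>: "\<delta> n > 0" for n by (simp add: \<delta>_def)
  have ga: "grid a (\<delta> n) s \<in> {a..b}" "\<bar>grid a (\<delta> n) s - s\<bar> \<le> \<delta> n" if "s \<in> {a..b}" for n s
    using grid [OF \<delta>, of a s n] that ab by auto
  define y' where "y' = (\<lambda>t. y (min t b))"
  obtain M where M: "\<And>t. t \<in> {a..b} \<Longrightarrow> \<bar>y t\<bar> \<le> M"
    using continuous_on_Icc_bounded [OF y] by blast
  show ?thesis
  proof (rule H_dominated_limit(1) [where X = "\<lambda>n s. x" and \<eta> = "\<lambda>n s. y' (grid a (\<delta> n) s)"
        and x = "\<lambda>s. x" and R = "1 + running_sup x T" and M = M, OF ab])
    show "(\<lambda>s. H s x (y' (grid a (\<delta> n) s)) z) integrable_on {a..b}" for n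
      by (rule grid_integrable [where X = "\<lambda>_. x" and \<eta> = y' and M = M and R = "1 + running_sup x T"])
         (use ab True x M \<delta> in \<open>auto simp: y'_def\<close>)
    show "(\<lambda>n. y' (grid a (\<delta> n) s)) \<longlonglongrightarrow> y s" if s: "s \<in> {a..b}" for s
    proof -
      have "(\<lambda>n. grid a (\<delta> n) s - s) \<longlonglongrightarrow> 0"
        by (rule Lim_null_comparison [of _ \<delta>]) (use ga(2) [OF s] LIMSEQ_inverse_real_of_nat in \<open>auto simp: \<delta>_def\<close>)
      then have "(\<lambda>n. grid a (\<delta> n) s) \<longlonglongrightarrow> s" by (simp add: LIM_zero_iff)
      then have "(\<lambda>n. y (grid a (\<delta> n) s)) \<longlonglongrightarrow> y s"
        by (rule continuous_on_tendsto_compose [OF y _ s]) (use ga(1) [OF s] in auto)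
      then show ?thesis using ga(1) [OF s] by (simp add: y'_def min_absorb1)
    qed
    show "1 + running_sup x s \<le> 1 + running_sup x T" if "s \<in> {a..b}" for s
      using running_sup_mono [OF x, of s T] that ab by auto
    show "\<bar>y' (grid a (\<delta> n) s)\<bar> \<le> M" if "s \<in> {a..b}" for n s
      using M ga(1) [OF that, of n] by (simp add: y'_def min_absorb1)
  qed (use x in \<open>auto intro: uniform_limit_const\<close>)
qed (auto intro: integrable_on_empty)

lemma H_absolutely_integrable:
  assumes x: "x \<in> path_space T" and ab: "0 \<le> a" "b \<le> T" and y: "continuous_on {a..b} y"
  shows "(\<lambda>s. H s x (y s) z) absolutely_integrable_on {a..b}"
proof -
  obtain M where M: "\<And>t. t \<in> {a..b} \<Longrightarrow> \<bar>y t\<bar> \<le> M"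
    using continuous_on_Icc_bounded [OF y] by blast
  define g where "g = (\<lambda>s. if s \<in> good_times then H s x (y s) z else 0)"
  have "g absolutely_integrable_on {a..b}"
  proof (rule absolutely_integrable_integrable_bound)
    show "g integrable_on {a..b}"
      using good_spike(1) [OF ab, of g "\<lambda>s. H s x (y s) z"] H_integrable [OF assms] by (simp add: g_def)
    show "norm (g s) \<le> \<bar>H_slope z * (1 + running_sup x T + M)\<bar>" if s: "s \<in> {a..b}" for s
      using H_bound' [OF _ x _ M [OF s], of s "1 + running_sup x T" z] running_sup_mono [OF x, of s T] s ab
      by (auto simp: g_def intro: order_trans)
  qed auto
  then show ?thesis
    by (rule absolutely_integrable_spike [where S = "{0..T} - good_times", OF _ negligible_bad_times])
      (use ab in \<open>auto simp: g_def\<close>)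
qed

end

section \<open>Characteristics and the reflection symmetry\<close>

text \<open>
Reflecting \<open>y\<close>, \<open>z\<close> and \<open>H\<close> turns characteristics into characteristics.  Every statement about
supersolutions thereby yields the one about subsolutions.
\<close>

lemma Y_set_dual:
  fixes H :: "real \<Rightarrow> (real \<Rightarrow> real^'n) \<Rightarrow> real \<Rightarrow> real^'n \<Rightarrow> real"
  assumes "(x, y) \<in> Y_set T H L s\<^sub>0 x\<^sub>0 y\<^sub>0 z"
  shows "(x, restrict (\<lambda>t. - y t) {s\<^sub>0..T}) \<in> Y_set T (\<lambda>t x y z. - H t x (- y) (- z)) L s\<^sub>0 x\<^sub>0 (- y\<^sub>0) (- z)"
proof -
  let ?f = "\<lambda>s. vector_derivative x (at s) \<bullet> z - H s x (y s) z"
  let ?y = "restrict (\<lambda>t. - y t) {s\<^sub>0..T}"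
  let ?g = "\<lambda>s. vector_derivative x (at s) \<bullet> (- z) - - H s x (- ?y s) (- (- z))"
  have g: "?g s = - ?f s" if "s \<in> {s\<^sub>0..T}" for s using that by simp
  note Y = assms [unfolded Y_set_def mem_Collect_eq case_prod_conv]
  have "continuous_on {s\<^sub>0..T} ?y"
    by (subst continuous_on_cong [OF refl, of _ _ "\<lambda>t. - y t"]) (use Y in \<open>auto intro: continuous_intros\<close>)
  moreover have "set_integrable lebesgue {s\<^sub>0..T} ?g"
  proof -
    have "set_integrable lebesgue {s\<^sub>0..T} (\<lambda>s. - ?f s)"
      using Y unfolding set_integrable_def scaleR_minus_right by (intro Bochner_Integration.integrable_minus) blast
    then show ?thesis by (subst set_integrable_cong [OF refl refl g]) auto
  qed
  moreover have "?y t = - y\<^sub>0 + (LINT s:{s\<^sub>0..t}|lebesgue. ?g s)" if t: "t \<in> {s\<^sub>0..T}" for t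
  proof -
    have "(LINT s:{s\<^sub>0..t}|lebesgue. ?g s) = (LINT s:{s\<^sub>0..t}|lebesgue. - ?f s)"
      by (rule set_lebesgue_integral_cong) (use t g in auto)
    also have "\<dots> = - (LINT s:{s\<^sub>0..t}|lebesgue. ?f s)"
      by (rule set_integral_uminus) (use Y t in \<open>auto intro: set_integrable_subset\<close>)
    finally show ?thesis using Y t by auto
  qed
  ultimately show ?thesis using Y by (simp add: Y_set_def)
qed

lemma uniform_limit_running_sup_bounded:
  fixes xs :: "nat \<Rightarrow> real \<Rightarrow> real^'n"
  assumes T: "0 \<le> T" and xs: "\<And>n. xs n \<in> path_space T" and x: "x \<in> path_space T"
    and lim: "uniform_limit {0..T} xs x sequentially"
  obtains R where "\<And>n. 1 + running_sup (xs n) T \<le> R"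
proof -
  have "\<forall>\<^sub>F n in sequentially. \<forall>r\<in>{0..T}. dist (xs n r) (x r) < 1"
    using lim zero_less_one unfolding uniform_limit_iff by blast
  then obtain N where N: "\<And>n r. \<lbrakk>n \<ge> N; r \<in> {0..T}\<rbrakk> \<Longrightarrow> dist (xs n r) (x r) < 1"
    unfolding eventually_sequentially by blast
  have "running_sup (xs n) T \<le> running_sup x T + 1" if "n \<ge> N" for n
    by (rule running_sup_diff_le [OF x T]) (use N [OF that] in \<open>auto simp: dist_norm less_imp_le\<close>)
  then have A: "1 + running_sup (xs n) T \<le> 1 + (running_sup x T + 1) + (\<Sum>i<N. 1 + running_sup (xs i) T)" for n
  proof (cases "n \<ge> N")
    case True
    moreover have "0 \<le> (\<Sum>i<N. 1 + running_sup (xs i) T)"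
      using running_sup_nonneg [OF xs T order_refl] by (intro sum_nonneg) simp
    ultimately show ?thesis using \<open>\<And>n. n \<ge> N \<Longrightarrow> _ n\<close> [of n] by linarith
  next
    case False
    then have "1 + running_sup (xs n) T \<le> (\<Sum>i<N. 1 + running_sup (xs i) T)"
      using running_sup_nonneg [OF xs T order_refl] by (intro member_le_sum) auto
    then show ?thesis using running_sup_nonneg [OF x T order_refl] by linarith
  qed
  then show ?thesis using that by blast
qed

text \<open>
The compactness argument for pairs \<open>(x,y)\<close>, with the equation for \<open>y\<close> left out, so that it serves
both for characteristics and for their Euler approximations.  As the domains of the functions \<open>ys n\<close>
vary, uniform convergence is expressed by evaluation along convergent sequences of times.
\<close>

lemma X_set_y_compact:
  fixes xs x0s :: "nat \<Rightarrow> real \<Rightarrow> real^'n" and ys :: "nat \<Rightarrow> real \<Rightarrow> real"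
  assumes L: "L \<ge> 0" and ts: "\<And>n. ts n \<in> {0..T}" and t0: "t\<^sub>0 \<in> {0..T}"
    and x0s: "\<And>n. x0s n \<in> path_space T" and x0: "x\<^sub>0 \<in> path_space T"
    and xs: "\<And>n. xs n \<in> X_set T L (ts n) (x0s n)"
    and conv: "(\<lambda>n. d_infty T (t\<^sub>0, x\<^sub>0) (ts n, x0s n)) \<longlonglongrightarrow> 0"
    and K: "\<And>n u v. \<lbrakk>u \<in> {ts n..T}; v \<in> {ts n..T}\<rbrakk> \<Longrightarrow> \<bar>ys n u - ys n v\<bar> \<le> K * \<bar>u - v\<bar>"
    and y0: "(\<lambda>n. ys n (ts n)) \<longlonglongrightarrow> y\<^sub>0"
  obtains r x y where "strict_mono (r :: nat \<Rightarrow> nat)" "x \<in> X_set T L t\<^sub>0 x\<^sub>0"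
    "uniform_limit {0..T} (xs \<circ> r) x sequentially"
    "continuous_on {t\<^sub>0..T} y" "y \<in> extensional {t\<^sub>0..T}" "y t\<^sub>0 = y\<^sub>0"
    "\<And>\<tau> t. \<lbrakk>\<forall>\<^sub>F n in sequentially. \<tau> n \<in> {ts (r n)..T}; \<tau> \<longlonglongrightarrow> t\<rbrakk> \<Longrightarrow> (\<lambda>n. ys (r n) (\<tau> n)) \<longlonglongrightarrow> y t"
proof -
  obtain r1 x where r1: "strict_mono r1" and x: "x \<in> X_set T L t\<^sub>0 x\<^sub>0"
    and xlim: "uniform_limit {0..T} (xs \<circ> r1) x sequentially"
    using X_set_compact [OF L ts t0 x0s x0 xs conv] .
  have tslim: "ts \<longlonglongrightarrow> t\<^sub>0" by (rule d_infty_tendsto_times [OF ts t0 x0s x0 conv])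
  define F where "F = (\<lambda>n u. ys (r1 n) (max u (ts (r1 n))))"
  define K' where "K' = \<bar>K\<bar> + 1"
  have K': "K' > 0" "K \<le> K'" by (auto simp: K'_def)
  have ysK: "\<bar>ys n u - ys n v\<bar> \<le> K' * \<bar>u - v\<bar>" if "u \<in> {ts n..T}" "v \<in> {ts n..T}" for n u v
    by (rule order_trans [OF K [OF that]]) (use K' in \<open>auto intro: mult_right_mono\<close>)
  have FK: "\<bar>F n u - F n v\<bar> \<le> K' * \<bar>u - v\<bar>" if "u \<in> {0..T}" "v \<in> {0..T}" for n u v
  proof -
    have "\<bar>F n u - F n v\<bar> \<le> K' * \<bar>max u (ts (r1 n)) - max v (ts (r1 n))\<bar>"
      unfolding F_def by (rule ysK) (use that ts [of "r1 n"] in auto)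
    also have "\<dots> \<le> K' * \<bar>u - v\<bar>" using K' by (intro mult_left_mono) auto
    finally show ?thesis .
  qed
  obtain B where B: "\<And>n. \<bar>ys n (ts n)\<bar> \<le> B"
    using convergent_imp_Bseq [OF convergentI [OF y0]] by (auto simp: Bseq_def)
  have FB: "\<bar>F n u\<bar> \<le> B + K' * T" if u: "u \<in> {0..T}" for n u
  proof -
    have "\<bar>F n u - F n (ts (r1 n))\<bar> \<le> K' * \<bar>u - ts (r1 n)\<bar>" by (rule FK [OF u ts])
    also have "\<dots> \<le> K' * T" using K' u ts [of "r1 n"] by (intro mult_left_mono) auto
    finally show ?thesis using B [of "r1 n"] by (simp add: F_def)
  qed
  obtain g k where g: "continuous_on {0..T} g" and k: "strict_mono (k :: nat \<Rightarrow> nat)"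
    and Fg: "\<And>e. 0 < e \<Longrightarrow> \<exists>N. \<forall>n x. n \<ge> N \<and> x \<in> {0..T} \<longrightarrow> norm (F (k n) x - g x) < e"
  proof (rule Arzela_Ascoli [of "{0..T}" F "B + K' * T"])
    fix u e :: real assume u: "u \<in> {0..T}" and e: "0 < e"
    show "\<exists>d. 0 < d \<and> (\<forall>n v. v \<in> {0..T} \<and> norm (u - v) < d \<longrightarrow> norm (F n u - F n v) < e)"
    proof (intro exI [of _ "e / K'"] conjI allI impI; (elim conjE)?)
      show "0 < e / K'" using e K' by simp
      fix n v assume v: "v \<in> {0..T}" "norm (u - v) < e / K'"
      have "\<bar>F n u - F n v\<bar> \<le> K' * \<bar>u - v\<bar>" by (rule FK [OF u v(1)])
      also have "\<dots> < e" using v K' by (simp add: field_simps)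
      finally show "norm (F n u - F n v) < e" by simp
    qed
  qed (use FB in auto)
  have Fgu: "uniform_limit {0..T} (\<lambda>n. F (k n)) g sequentially"
    unfolding uniform_limit_iff eventually_sequentially dist_norm using Fg by meson
  define r where "r = r1 \<circ> k"
  have r: "strict_mono r" unfolding r_def by (rule strict_mono_o [OF r1 k])
  define y where "y = restrict g {t\<^sub>0..T}"
  have tsr: "(\<lambda>n. ts (r n)) \<longlonglongrightarrow> t\<^sub>0"
    using LIMSEQ_subseq_LIMSEQ [OF tslim r] by (simp add: o_def)
  have ylim: "(\<lambda>n. ys (r n) (\<tau> n)) \<longlonglongrightarrow> y t"
    if \<tau>: "\<forall>\<^sub>F n in sequentially. \<tau> n \<in> {ts (r n)..T}" "\<tau> \<longlonglongrightarrow> t" for \<tau> t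
  proof -
    have t: "t\<^sub>0 \<le> t" by (rule tendsto_le [OF _ \<tau>(2) tsr]) (use \<tau>(1) in \<open>auto elim: eventually_mono\<close>)
    have t': "t \<le> T" by (rule tendsto_upperbound [OF \<tau>(2)]) (use \<tau>(1) in \<open>auto elim: eventually_mono\<close>)
    have mem: "t \<in> {0..T}" using t t' t0 by auto
    have "\<forall>\<^sub>F n in sequentially. norm (ys (r n) (\<tau> n) - F (k n) t) \<le> K' * \<bar>\<tau> n - t\<bar>"
      using \<tau>(1)
    proof eventually_elim
      case (elim n)
      then have \<tau>n: "\<tau> n \<in> {0..T}" using ts [of "r n"] by auto
      have "F (k n) (\<tau> n) = ys (r n) (\<tau> n)" using elim by (simp add: F_def r_def max_absorb1)
      then show ?case using FK [OF \<tau>n mem, of "k n"] by simp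
    qed
    moreover have "(\<lambda>n. K' * \<bar>\<tau> n - t\<bar>) \<longlonglongrightarrow> 0"
      by (rule tendsto_mult_right_zero) (rule tendsto_rabs_zero, simp add: LIM_zero_iff \<tau>(2))
    ultimately have d: "(\<lambda>n. ys (r n) (\<tau> n) - F (k n) t) \<longlonglongrightarrow> 0" by (rule Lim_null_comparison)
    have "(\<lambda>n. F (k n) t) \<longlonglongrightarrow> g t" by (rule tendsto_uniform_limitI [OF Fgu mem])
    from tendsto_add [OF d this] show ?thesis using t t' by (simp add: y_def)
  qed
  have yt0: "y t\<^sub>0 = y\<^sub>0"
  proof -
    have "(\<lambda>n. ys (r n) (ts (r n))) \<longlonglongrightarrow> y t\<^sub>0" by (rule ylim) (use ts tsr in auto)
    moreover have "(\<lambda>n. ys (r n) (ts (r n))) \<longlonglongrightarrow> y\<^sub>0"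
      using LIMSEQ_subseq_LIMSEQ [OF y0 r] by (simp add: o_def)
    ultimately show ?thesis by (rule LIMSEQ_unique)
  qed
  have ycont: "continuous_on {t\<^sub>0..T} y"
    by (subst continuous_on_cong [OF refl, of _ _ g])
       (use t0 in \<open>auto simp: y_def intro: continuous_on_subset [OF g]\<close>)
  have "uniform_limit {0..T} (xs \<circ> r) x sequentially"
    unfolding uniform_limit_iff
  proof (intro allI impI)
    fix e :: real assume "e > 0"
    then have "\<forall>\<^sub>F n in sequentially. \<forall>u\<in>{0..T}. dist ((xs \<circ> r1) n u) (x u) < e"
      using xlim unfolding uniform_limit_iff by blast
    then have "\<forall>\<^sub>F n in sequentially. \<forall>u\<in>{0..T}. dist ((xs \<circ> r1) (k n) u) (x u) < e"
      by (rule eventually_subseq [OF k])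
    then show "\<forall>\<^sub>F n in sequentially. \<forall>u\<in>{0..T}. dist ((xs \<circ> r) n u) (x u) < e"
      by (simp add: r_def o_def)
  qed
  moreover have "y \<in> extensional {t\<^sub>0..T}" by (simp add: y_def)
  ultimately show ?thesis using that [OF r x _ ycont _ yt0 ylim] by blast
qed

context tvp_data
begin

lemma tvp_data_dual: "tvp_data T (\<lambda>x. - h x) (\<lambda>t x y z. - H t x (- y) (- z)) L\<^sub>H"
proof
  show "T > 0" "L\<^sub>H \<ge> 0" by (rule T_pos L_H_nonneg)+
  show "continuous_map (mtopology_of (path_metric T)) euclidean (\<lambda>x. - h x)"
    using h_continuous by (rule continuous_map_minus)
  show "- H t x (- y) (- z) = - H t x' (- y) (- z)"
    if "t \<in> {0..T}" "x \<in> path_space T" "x' \<in> path_space T" "\<And>s. s \<in> {0..t} \<Longrightarrow> x s = x' s" for t x x' y z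
    using H_nonanticipating [OF that] by simp
  show "AE t in lebesgue. 0 < t \<and> t < T \<longrightarrow>
        continuous_map (prod_topology (mtopology_of (path_metric T)) (euclidean :: (real \<times> (real^'n)) topology))
          euclidean (\<lambda>(x, y, z). - H t x (- y) (- z))"
    using H_continuous
  proof eventually_elim
    case (elim t)
    let ?X = "prod_topology (mtopology_of (path_metric T)) (euclidean :: (real \<times> (real^'n)) topology)"
    show ?case
    proof
      assume t: "0 < t \<and> t < T"
      have m: "continuous_map (euclidean :: (real \<times> (real^'n)) topology) euclidean (\<lambda>(y, z). (- y, - z))"
        by (simp add: continuous_map_iff_continuous2 case_prod_unfold continuous_intros)
      have "continuous_map ?X ?X (\<lambda>(x, p). (x, (\<lambda>(y, z). (- y, - z)) p))"
        using m by (simp add: continuous_map_prod_top [where f = id and g = "\<lambda>(y, z). (- y, - z)", simplified id_def])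
      then have "continuous_map ?X ?X (\<lambda>(x, y, z). (x, - y, - z))" by (simp add: case_prod_unfold)
      from continuous_map_compose [OF this] elim t
      have "continuous_map ?X euclidean ((\<lambda>(x, y, z). H t x y z) \<circ> (\<lambda>(x, y, z). (x, - y, - z)))" by blast
      then have "continuous_map ?X euclidean (\<lambda>p. - ((\<lambda>(x, y, z). H t x y z) \<circ> (\<lambda>(x, y, z). (x, - y, - z))) p)"
        by (rule continuous_map_minus)
      then show "continuous_map ?X euclidean (\<lambda>(x, y, z). - H t x (- y) (- z))"
        by (simp add: case_prod_unfold o_def)
    qed
  qed
  show "(\<lambda>t. - H t x (- y) (- z)) \<in> borel_measurable (restrict_space borel {0..T})"
    if "x \<in> path_space T" for x y z
    using H_measurable [OF that, of "- y" "- z"] by (rule borel_measurable_uminus)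
  show "AE t in lebesgue. 0 < t \<and> t < T \<longrightarrow>
        (\<forall>x\<in>path_space T. \<forall>y z z'.
          \<bar>- H t x (- y) (- z) - - H t x (- y) (- z')\<bar> \<le> L\<^sub>H * (1 + running_sup x t) * norm (z - z'))"
    using H_Lipschitz_z
  proof eventually_elim
    case (elim t)
    show ?case
    proof (intro impI ballI allI)
      fix x :: "real \<Rightarrow> real^'n" and y z z' assume "0 < t \<and> t < T" "x \<in> path_space T"
      then have "\<bar>H t x (- y) (- z') - H t x (- y) (- z)\<bar> \<le> L\<^sub>H * (1 + running_sup x t) * norm (- z' - - z)"
        using elim by blast
      then show "\<bar>- H t x (- y) (- z) - - H t x (- y) (- z')\<bar> \<le> L\<^sub>H * (1 + running_sup x t) * norm (z - z')"
        by (simp add: algebra_simps norm_minus_commute)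
    qed
  qed
  show "\<exists>M\<ge>0. \<forall>t\<^sub>0\<in>{0..<T}. \<forall>x\<^sub>0\<in>path_space T.
        \<forall>x\<in>X_set T L t\<^sub>0 x\<^sub>0. \<forall>x'\<in>X_set T L t\<^sub>0 x\<^sub>0. \<forall>y z.
          AE t in lebesgue. t\<^sub>0 < t \<and> t < T \<longrightarrow>
            \<bar>- H t x (- y) (- z) - - H t x' (- y) (- z)\<bar>
              \<le> M * (1 + \<bar>y\<bar> + norm z) * (SUP s\<in>{0..t}. norm (x s - x' s))" if L: "L \<ge> 0" for L
  proof -
    obtain M where M: "M \<ge> 0" "\<forall>t\<^sub>0\<in>{0..<T}. \<forall>x\<^sub>0\<in>path_space T.
        \<forall>x\<in>X_set T L t\<^sub>0 x\<^sub>0. \<forall>x'\<in>X_set T L t\<^sub>0 x\<^sub>0. \<forall>y z.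
          AE t in lebesgue. t\<^sub>0 < t \<and> t < T \<longrightarrow>
            \<bar>H t x y z - H t x' y z\<bar>
              \<le> M * (1 + \<bar>y\<bar> + norm z) * (SUP s\<in>{0..t}. norm (x s - x' s))"
      using H_Lipschitz_x [OF L] by blast
    show ?thesis
    proof (intro exI [of _ M] conjI M(1) ballI allI)
      fix t\<^sub>0 y :: real and x\<^sub>0 x x' :: "real \<Rightarrow> real^'n" and z :: "real^'n"
      assume a: "t\<^sub>0 \<in> {0..<T}" "x\<^sub>0 \<in> path_space T" "x \<in> X_set T L t\<^sub>0 x\<^sub>0" "x' \<in> X_set T L t\<^sub>0 x\<^sub>0"
      have "AE t in lebesgue. t\<^sub>0 < t \<and> t < T \<longrightarrow>
            \<bar>H t x (- y) (- z) - H t x' (- y) (- z)\<bar>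
              \<le> M * (1 + \<bar>- y\<bar> + norm (- z)) * (SUP s\<in>{0..t}. norm (x s - x' s))"
        using M(2) a by blast
      then show "AE t in lebesgue. t\<^sub>0 < t \<and> t < T \<longrightarrow>
            \<bar>- H t x (- y) (- z) - - H t x' (- y) (- z)\<bar>
              \<le> M * (1 + \<bar>y\<bar> + norm z) * (SUP s\<in>{0..t}. norm (x s - x' s))"
        by eventually_elim (simp add: abs_minus_commute)
    qed
  qed
  show "AE t in lebesgue. 0 < t \<and> t < T \<longrightarrow>
        (\<forall>x\<in>path_space T. \<forall>z. antimono (\<lambda>y. - H t x (- y) (- z)))"
    using H_antimono_y
  proof eventually_elim
    case (elim t)
    show ?case
    proof (intro impI ballI allI antimonoI)
      fix x :: "real \<Rightarrow> real^'n" and z y y' assume "0 < t \<and> t < T" "x \<in> path_space T" "(y::real) \<le> y'"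
      then show "- H t x (- y') (- z) \<le> - H t x (- y) (- z)"
        using elim antimonoD [of "\<lambda>y. H t x y (- z)" "- y'" "- y"] by auto
    qed
  qed
  show "\<exists>C\<ge>0. AE t in lebesgue. 0 < t \<and> t < T \<longrightarrow>
        (\<forall>x\<in>path_space T. \<forall>y. \<bar>- H t x (- y) (- 0)\<bar> \<le> C * (1 + running_sup x t + \<bar>y\<bar>))"
  proof (intro exI [of _ growth_constant] conjI growth_constant(1))
    show "AE t in lebesgue. 0 < t \<and> t < T \<longrightarrow>
        (\<forall>x\<in>path_space T. \<forall>y. \<bar>- H t x (- y) (- 0)\<bar> \<le> growth_constant * (1 + running_sup x t + \<bar>y\<bar>))"
      using growth_constant(2)
    proof eventually_elim
      case (elim t)
      show ?case
      proof (intro impI ballI allI)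
        fix x :: "real \<Rightarrow> real^'n" and y assume "0 < t \<and> t < T" "x \<in> path_space T"
        then have "\<bar>H t x (- y) 0\<bar> \<le> growth_constant * (1 + running_sup x t + \<bar>- y\<bar>)" using elim by blast
        then show "\<bar>- H t x (- y) (- 0)\<bar> \<le> growth_constant * (1 + running_sup x t + \<bar>y\<bar>)" by simp
      qed
    qed
  qed
qed

text \<open>
Both parts of the integrand are integrable on their own: the derivative by the path bound, and \<open>H\<close>
because \<open>y\<close> is continuous.  So the integral of \<open>x' \<bullet> z\<close> can be replaced by an increment of \<open>x\<close>.
\<close>

lemma Y_set_iff:
  assumes L: "L \<ge> 0" and s0: "s\<^sub>0 \<in> {0..T}"
  shows "(x, y) \<in> Y_set T H L s\<^sub>0 x\<^sub>0 y\<^sub>0 z \<longleftrightarrow>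
    x \<in> X_set T L s\<^sub>0 x\<^sub>0 \<and> y \<in> extensional {s\<^sub>0..T} \<and> continuous_on {s\<^sub>0..T} y \<and>
    (\<forall>t\<in>{s\<^sub>0..T}. y t = y\<^sub>0 + (x t - x s\<^sub>0) \<bullet> z - integral {s\<^sub>0..t} (\<lambda>s. H s x (y s) z))"
proof (cases "x \<in> X_set T L s\<^sub>0 x\<^sub>0 \<and> continuous_on {s\<^sub>0..T} y")
  case True
  then have x: "x \<in> X_set T L s\<^sub>0 x\<^sub>0" and y: "continuous_on {s\<^sub>0..T} y" by auto
  let ?d = "\<lambda>s. vector_derivative x (at s) \<bullet> z" and ?H = "\<lambda>s. H s x (y s) z"
  have d: "set_integrable lebesgue {s\<^sub>0..t} ?d" "(LINT s:{s\<^sub>0..t}|lebesgue. ?d s) = (x t - x s\<^sub>0) \<bullet> z"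
    if t: "t \<in> {s\<^sub>0..T}" for t
  proof -
    show ai: "set_integrable lebesgue {s\<^sub>0..t} ?d"
      by (rule X_set_imp_Lipschitz(3) [OF L _ x]) (use t s0 in auto)
    have "(?d has_integral (x t - x s\<^sub>0) \<bullet> z) {s\<^sub>0..t}"
      by (rule X_set_imp_Lipschitz(2) [OF L _ x]) (use t s0 in auto)
    then show "(LINT s:{s\<^sub>0..t}|lebesgue. ?d s) = (x t - x s\<^sub>0) \<bullet> z"
      using set_lebesgue_integral_eq_integral(2) [OF ai] by (simp add: integral_unique)
  qed
  have Hi: "set_integrable lebesgue {s\<^sub>0..t} ?H" "(LINT s:{s\<^sub>0..t}|lebesgue. ?H s) = integral {s\<^sub>0..t} ?H"
    if t: "t \<in> {s\<^sub>0..T}" for t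
  proof -
    show ai: "set_integrable lebesgue {s\<^sub>0..t} ?H"
      by (rule H_absolutely_integrable [OF X_setD(1) [OF x]])
         (use t s0 in \<open>auto intro: continuous_on_subset [OF y]\<close>)
    show "(LINT s:{s\<^sub>0..t}|lebesgue. ?H s) = integral {s\<^sub>0..t} ?H"
      by (rule set_lebesgue_integral_eq_integral(2) [OF ai])
  qed
  have "set_integrable lebesgue {s\<^sub>0..t} (\<lambda>s. ?d s - ?H s)"
      "(LINT s:{s\<^sub>0..t}|lebesgue. ?d s - ?H s) = (x t - x s\<^sub>0) \<bullet> z - integral {s\<^sub>0..t} ?H"
    if "t \<in> {s\<^sub>0..T}" for t
    using set_integral_diff [OF d(1) [OF that] Hi(1) [OF that]] d(2) [OF that] Hi(2) [OF that] by auto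
  then show ?thesis using True s0 by (auto simp: Y_set_def)
qed (auto simp: Y_set_def)

lemma Y_setD:
  assumes "(x, y) \<in> Y_set T H L s\<^sub>0 x\<^sub>0 y\<^sub>0 z"
  shows "x \<in> X_set T L s\<^sub>0 x\<^sub>0" "continuous_on {s\<^sub>0..T} y" "y \<in> extensional {s\<^sub>0..T}" "x \<in> path_space T"
  using assms by (auto simp: Y_set_def X_set_def)

lemma Y_set_initial:
  assumes L: "L \<ge> 0" and s0: "s\<^sub>0 \<in> {0..T}" and Y: "(x, y) \<in> Y_set T H L s\<^sub>0 x\<^sub>0 y\<^sub>0 z"
  shows "y s\<^sub>0 = y\<^sub>0"
  using Y s0 by (auto simp: Y_set_iff [OF L s0])

lemma Y_set_increment:
  assumes L: "L \<ge> 0" and s0: "s\<^sub>0 \<in> {0..T}" and Y: "(x, y) \<in> Y_set T H L s\<^sub>0 x\<^sub>0 y\<^sub>0 z"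
    and ab: "s\<^sub>0 \<le> a" "a \<le> b" "b \<le> T"
  shows "y b - y a = (x b - x a) \<bullet> z - integral {a..b} (\<lambda>s. H s x (y s) z)"
    and "(\<lambda>s. H s x (y s) z) integrable_on {a..b}"
proof -
  note D = Y_setD [OF Y]
  have int: "(\<lambda>s. H s x (y s) z) integrable_on {c..d}" if "s\<^sub>0 \<le> c" "d \<le> T" for c d
    by (rule H_integrable [OF D(4)]) (use that s0 in \<open>auto intro: continuous_on_subset [OF D(2)]\<close>)
  show "(\<lambda>s. H s x (y s) z) integrable_on {a..b}" using int ab by auto
  have eq: "y t = y\<^sub>0 + (x t - x s\<^sub>0) \<bullet> z - integral {s\<^sub>0..t} (\<lambda>s. H s x (y s) z)" if "t \<in> {s\<^sub>0..T}" for t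
    using Y that by (auto simp: Y_set_iff [OF L s0])
  have "integral {s\<^sub>0..a} (\<lambda>s. H s x (y s) z) + integral {a..b} (\<lambda>s. H s x (y s) z) = integral {s\<^sub>0..b} (\<lambda>s. H s x (y s) z)"
    by (rule Henstock_Kurzweil_Integration.integral_combine) (use ab int in auto)
  then show "y b - y a = (x b - x a) \<bullet> z - integral {a..b} (\<lambda>s. H s x (y s) z)"
    using eq [of a] eq [of b] ab by (simp add: algebra_simps inner_diff_left)
qed

text \<open>
Increments over intervals that stay away from the initial time suffice, by continuity.  In limits of
characteristics only these are accessible, since the approximating ones may start later than \<open>s\<^sub>0\<close>.
\<close>

lemma Y_setI_increments:
  assumes L: "L \<ge> 0" and s0: "s\<^sub>0 \<in> {0..T}" and x: "x \<in> X_set T L s\<^sub>0 x\<^sub>0"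
    and ext: "y \<in> extensional {s\<^sub>0..T}" and y: "continuous_on {s\<^sub>0..T} y" and y0: "y s\<^sub>0 = y\<^sub>0"
    and inc: "\<And>a b. \<lbrakk>s\<^sub>0 < a; a \<le> b; b \<le> T\<rbrakk> \<Longrightarrow> y b - y a = (x b - x a) \<bullet> z - integral {a..b} (\<lambda>s. H s x (y s) z)"
  shows "(x, y) \<in> Y_set T H L s\<^sub>0 x\<^sub>0 y\<^sub>0 z"
proof -
  let ?f = "\<lambda>s. H s x (y s) z"
  have int: "?f integrable_on {c..d}" if "s\<^sub>0 \<le> c" "d \<le> T" for c d
    by (rule H_integrable [OF X_setD(1) [OF x]]) (use that s0 in \<open>auto intro: continuous_on_subset [OF y]\<close>)
  have "y t = y\<^sub>0 + (x t - x s\<^sub>0) \<bullet> z - integral {s\<^sub>0..t} ?f" if t: "t \<in> {s\<^sub>0..T}" for t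
  proof (cases "s\<^sub>0 < t")
    case True
    define E where "E = (\<lambda>a. y a - x a \<bullet> z + integral {s\<^sub>0..a} ?f)"
    have cl: "closure {s\<^sub>0<..<t} = {s\<^sub>0..t}" using True by (rule closure_greaterThanLessThan)
    have Ec: "continuous_on {s\<^sub>0..t} E" unfolding E_def
    proof (intro continuous_intros)
      show "continuous_on {s\<^sub>0..t} y" "continuous_on {s\<^sub>0..t} x"
        using t y X_set_continuous_on [OF L s0 x] by (auto elim: continuous_on_subset)
      show "continuous_on {s\<^sub>0..t} (\<lambda>a. integral {s\<^sub>0..a} ?f)"
        by (rule indefinite_integral_continuous_1) (use int t in auto)
    qed
    have "E a = E t" if a: "a \<in> {s\<^sub>0<..<t}" for a
    proof -
      have "integral {s\<^sub>0..a} ?f + integral {a..t} ?f = integral {s\<^sub>0..t} ?f"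
        by (rule Henstock_Kurzweil_Integration.integral_combine) (use a t int in auto)
      then show ?thesis using inc [of a t] a t by (simp add: E_def algebra_simps inner_diff_left)
    qed
    then have "E s\<^sub>0 = E t"
      by (rule continuous_constant_on_closure [of "{s\<^sub>0<..<t}" E, rotated]) (use Ec cl True in auto)
    then show ?thesis using y0 by (simp add: E_def algebra_simps inner_diff_left)
  qed (use t y0 in auto)
  then show ?thesis unfolding Y_set_iff [OF L s0] using x ext y by blast
qed

text \<open>
Non-anticipation of \<open>H\<close> is what allows the path to be replaced after time \<open>t\<close> without disturbing the
equation before \<open>t\<close>.
\<close>

lemma Y_set_glue:
  assumes L: "L \<ge> 0" and s0: "s\<^sub>0 \<in> {0..T}" and Y: "(x, y) \<in> Y_set T H L s\<^sub>0 x\<^sub>0 y\<^sub>0 z"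
    and t: "t \<in> {s\<^sub>0..T}" and Y': "(x', y') \<in> Y_set T H L t x (y t) z"
  shows "(x', restrict (\<lambda>r. if r \<le> t then y r else y' r) {s\<^sub>0..T}) \<in> Y_set T H L s\<^sub>0 x\<^sub>0 y\<^sub>0 z"
proof -
  define w where "w = restrict (\<lambda>r. if r \<le> t then y r else y' r) {s\<^sub>0..T}"
  have t': "t \<in> {0..T}" using t s0 by auto
  note D = Y_setD [OF Y] and D' = Y_setD [OF Y']
  have yt: "y' t = y t" by (rule Y_set_initial [OF L t' Y'])
  have w1: "w r = y r" if "r \<in> {s\<^sub>0..t}" for r using that t by (auto simp: w_def)
  have w2: "w r = y' r" if "r \<in> {t..T}" for r using that t yt by (auto simp: w_def)
  have xx: "x' r = x r" if "0 \<le> r" "r \<le> t" for r using X_setD(2) [OF D'(1)] that by auto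
  have wc: "continuous_on {s\<^sub>0..T} w"
  proof -
    have "continuous_on {s\<^sub>0..t} w"
      by (subst continuous_on_cong [OF refl w1]) (use t in \<open>auto intro: continuous_on_subset [OF D(2)]\<close>)
    moreover have "continuous_on {t..T} w"
      by (subst continuous_on_cong [OF refl w2]) (use D'(2) in auto)
    ultimately have "continuous_on ({s\<^sub>0..t} \<union> {t..T}) w"
      by (intro continuous_on_closed_Un) auto
    then show ?thesis using t by (simp add: ivl_disj_un_two_touch)
  qed
  have Heq: "H s x' (w s) z = H s x (y s) z" if "s \<in> {s\<^sub>0..t}" for s
    using H_nonanticipating [of s x' x] D D' xx that t s0 by (simp add: w1)
  show ?thesis unfolding w_def [symmetric]
  proof (rule Y_setI_increments [OF L s0])
    show "x' \<in> X_set T L s\<^sub>0 x\<^sub>0" by (rule X_set_trans [OF L s0 D(1) t D'(1)])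
    show "w \<in> extensional {s\<^sub>0..T}" by (simp add: w_def)
    show "w s\<^sub>0 = y\<^sub>0" using Y_set_initial [OF L s0 Y] w1 [of s\<^sub>0] t by simp
    fix a b assume ab: "s\<^sub>0 < a" "a \<le> b" "b \<le> T"
    have low: "w d - w c = (x' d - x' c) \<bullet> z - integral {c..d} (\<lambda>s. H s x' (w s) z)"
      if "s\<^sub>0 \<le> c" "c \<le> d" "d \<le> t" for c d
    proof -
      have "integral {c..d} (\<lambda>s. H s x' (w s) z) = integral {c..d} (\<lambda>s. H s x (y s) z)"
        by (rule Henstock_Kurzweil_Integration.integral_cong) (use Heq that in auto)
      then show ?thesis
        using Y_set_increment(1) [OF L s0 Y, of c d] that t s0 w1 [of c] w1 [of d] xx [of c] xx [of d] by simp
    qed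
    have up: "w d - w c = (x' d - x' c) \<bullet> z - integral {c..d} (\<lambda>s. H s x' (w s) z)"
      if "t \<le> c" "c \<le> d" "d \<le> T" for c d
    proof -
      have "integral {c..d} (\<lambda>s. H s x' (w s) z) = integral {c..d} (\<lambda>s. H s x' (y' s) z)"
        by (rule Henstock_Kurzweil_Integration.integral_cong) (use w2 that in auto)
      then show ?thesis
        using Y_set_increment(1) [OF L t' Y', of c d] that w2 [of c] w2 [of d] by simp
    qed
    consider "b \<le> t" | "t \<le> a" | "a < t" "t < b" by linarith
    then show "w b - w a = (x' b - x' a) \<bullet> z - integral {a..b} (\<lambda>s. H s x' (w s) z)"
    proof cases
      case 3
      have "integral {a..t} (\<lambda>s. H s x' (w s) z) + integral {t..b} (\<lambda>s. H s x' (w s) z)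
          = integral {a..b} (\<lambda>s. H s x' (w s) z)"
        by (rule Henstock_Kurzweil_Integration.integral_combine)
           (use 3 ab s0 in \<open>auto intro!: H_integrable D'(4) continuous_on_subset [OF wc]\<close>)
      then show ?thesis using low [of a t] up [of t b] 3 ab by (simp add: algebra_simps inner_diff_left)
    qed (use low up ab in auto)
  qed (rule wc)
qed

lemma Y_set_estimates:
  assumes L: "L \<ge> 0" and s0: "s\<^sub>0 \<in> {0..T}" and Y: "(x, y) \<in> Y_set T H L s\<^sub>0 x\<^sub>0 y\<^sub>0 z"
    and R: "1 + running_sup x T \<le> R"
  shows "\<lbrakk>s\<^sub>0 \<le> a; a \<le> b; b \<le> T; \<And>r. \<lbrakk>a \<le> r; r \<le> b\<rbrakk> \<Longrightarrow> \<bar>y r\<bar> \<le> M\<rbrakk>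
      \<Longrightarrow> \<bar>y b - y a\<bar> \<le> (L * norm z + H_slope z) * (R + M) * (b - a)"
    and "\<lbrakk>2 * (L * norm z + H_slope z) * T \<le> real N; N > 0; t \<in> {s\<^sub>0..T}\<rbrakk> \<Longrightarrow> \<bar>y t\<bar> \<le> 2 ^ N * (R + \<bar>y\<^sub>0\<bar>)"
proof -
  note D = Y_setD [OF Y]
  have R0: "0 \<le> R" using R running_sup_nonneg [OF D(4), of T] T_nonneg by auto
  show inc: "\<bar>y b - y a\<bar> \<le> (L * norm z + H_slope z) * (R + M) * (b - a)"
    if ab: "s\<^sub>0 \<le> a" "a \<le> b" "b \<le> T" and M: "\<And>r. \<lbrakk>a \<le> r; r \<le> b\<rbrakk> \<Longrightarrow> \<bar>y r\<bar> \<le> M" for a b M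
  proof -
    have M0: "0 \<le> M" using M [of a] ab by auto
    have "norm (x b - x a) \<le> L * R * \<bar>b - a\<bar>"
      by (rule X_set_Lipschitz [OF L s0 D(1)]) (use ab R L in \<open>auto intro: mult_left_mono\<close>)
    also have "\<bar>b - a\<bar> = b - a" using ab by simp
    also have "L * R * (b - a) \<le> L * (R + M) * (b - a)"
      by (rule mult_right_mono [OF mult_left_mono]) (use L M0 ab in auto)
    finally have "norm (x b - x a) * norm z \<le> L * (R + M) * (b - a) * norm z"
      by (rule mult_right_mono) simp
    then have 1: "\<bar>(x b - x a) \<bullet> z\<bar> \<le> L * norm z * (R + M) * (b - a)"
      using Cauchy_Schwarz_ineq2 [of "x b - x a" z] by (simp add: algebra_simps)
    have 2: "\<bar>integral {a..b} (\<lambda>s. H s x (y s) z)\<bar> \<le> H_slope z * (R + M) * (b - a)"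
    proof (rule integral_good_bound)
      fix s assume s: "s \<in> {a..b}" "s \<in> good_times"
      have "1 + running_sup x s \<le> R" using running_sup_mono [OF D(4), of s T] R s ab s0 by auto
      then show "\<bar>H s x (y s) z\<bar> \<le> H_slope z * (R + M)"
        using H_bound' [OF s(2) D(4) _ M [of s]] s by auto
    qed (use ab s0 Y_set_increment(2) [OF L s0 Y ab] in auto)
    have "\<bar>y b - y a\<bar> \<le> \<bar>(x b - x a) \<bullet> z\<bar> + \<bar>integral {a..b} (\<lambda>s. H s x (y s) z)\<bar>"
      unfolding Y_set_increment(1) [OF L s0 Y ab] by (rule abs_triangle_ineq4)
    also have "\<dots> \<le> (L * norm z + H_slope z) * (R + M) * (b - a)"
      using 1 2 by (simp add: algebra_simps)
    finally show ?thesis .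
  qed
  show "\<bar>y t\<bar> \<le> 2 ^ N * (R + \<bar>y\<^sub>0\<bar>)"
    if N: "2 * (L * norm z + H_slope z) * T \<le> real N" "N > 0" and t: "t \<in> {s\<^sub>0..T}" for N t
  proof -
    have K: "0 \<le> L * norm z + H_slope z" using L H_slope_nonneg by simp
    have "2 * (L * norm z + H_slope z) * (T - s\<^sub>0) \<le> 2 * (L * norm z + H_slope z) * T"
      using K s0 by (intro mult_left_mono) auto
    then have "2 * (L * norm z + H_slope z) * (T - s\<^sub>0) \<le> real N" using N by linarith
    from sup_Gronwall [OF D(2) _ K R0 this N(2) _ t] inc s0 t
    have "\<bar>y t\<bar> \<le> 2 ^ N * (R + \<bar>y s\<^sub>0\<bar>)" by auto
    then show ?thesis by (simp add: Y_set_initial [OF L s0 Y])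
  qed
qed

section \<open>Shifting characteristics, and compactness\<close>

text \<open>
For a fixed path, iterate the integral operator of the equation, starting from \<open>y + c\<close>.  Since \<open>H\<close> is
non-increasing in \<open>y\<close>, the operator is monotone and its first application already moves up, so the
iterates increase.  They stay bounded by Gronwall, and their limit solves the equation by dominated
convergence.
\<close>

lemma Y_set_shift_up:
  assumes L: "L \<ge> 0" and s0: "s\<^sub>0 \<in> {0..T}" and Y: "(x, y) \<in> Y_set T H L s\<^sub>0 x\<^sub>0 y\<^sub>0 z" and c: "c \<ge> 0"
  shows "\<exists>v. (x, v) \<in> Y_set T H L s\<^sub>0 x\<^sub>0 (y\<^sub>0 + c) z \<and> (\<forall>t\<in>{s\<^sub>0..T}. y t + c \<le> v t)"
proof -
  note D = Y_setD [OF Y]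
  let ?S = "{s\<^sub>0..T}"
  define \<Psi> where "\<Psi> = (\<lambda>v t. y\<^sub>0 + c + (x t - x s\<^sub>0) \<bullet> z - integral {s\<^sub>0..t} (\<lambda>s. H s x (v s) z))"
  define v where "v = (\<lambda>k. (\<Psi> ^^ k) (\<lambda>t. y t + c))"
  have v0: "v 0 t = y t + c" and vS: "v (Suc k) t = \<Psi> (v k) t" for k t by (auto simp: v_def)
  have int: "(\<lambda>s. H s x (w s) z) integrable_on {a..b}"
    if "continuous_on ?S w" "s\<^sub>0 \<le> a" "b \<le> T" for w a b
    by (rule H_integrable [OF D(4)]) (use that s0 in \<open>auto intro: continuous_on_subset [OF that(1)]\<close>)
  have xc: "continuous_on ?S x" by (rule X_set_continuous_on [OF L s0 D(1)])
  have \<Psi>c: "continuous_on ?S (\<Psi> w)" if "(\<lambda>s. H s x (w s) z) integrable_on ?S" for w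
    unfolding \<Psi>_def
    by (intro continuous_intros xc indefinite_integral_continuous_1 [OF that])
  have vc: "continuous_on ?S (v k)" for k
  proof (induction k)
    case 0 show ?case using D(2) by (simp add: v0 [abs_def] continuous_intros)
  next
    case (Suc k) show ?case unfolding vS [abs_def] by (rule \<Psi>c [OF int [OF Suc order_refl order_refl]])
  qed
  have vk: "(\<lambda>s. H s x (v k s) z) integrable_on {a..b}" if "s\<^sub>0 \<le> a" "b \<le> T" for k a b
    using int [OF vc that] .
  have mono_step: "\<Psi> w t \<le> \<Psi> w' t"
    if w: "continuous_on ?S w" "continuous_on ?S w'" and le: "\<And>t. t \<in> ?S \<Longrightarrow> w t \<le> w' t" and t: "t \<in> ?S" for w w' t
  proof -
    have "integral {s\<^sub>0..t} (\<lambda>s. H s x (w' s) z) \<le> integral {s\<^sub>0..t} (\<lambda>s. H s x (w s) z)"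
    proof (rule integral_good_mono)
      show "H s x (w' s) z \<le> H s x (w s) z" if "s \<in> {s\<^sub>0..t}" "s \<in> good_times" for s
        by (rule H_antimono [OF that(2) D(4) le]) (use that t in auto)
    qed (use s0 t int w in auto)
    then show ?thesis by (simp add: \<Psi>_def)
  qed
  have inc: "v k t \<le> v (Suc k) t" if "t \<in> ?S" for k t
    using that
  proof (induction k arbitrary: t)
    case 0
    have "integral {s\<^sub>0..t} (\<lambda>s. H s x (y s + c) z) \<le> integral {s\<^sub>0..t} (\<lambda>s. H s x (y s) z)"
    proof (rule integral_good_mono)
      show "H s x (y s + c) z \<le> H s x (y s) z" if "s \<in> {s\<^sub>0..t}" "s \<in> good_times" for s
        by (rule H_antimono [OF that(2) D(4)]) (use c in simp)
    qed (use s0 0 int [of "\<lambda>t. y t + c" s\<^sub>0 t] int [OF D(2)] continuous_on_add [OF D(2) continuous_on_const] in auto)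
    moreover have "y t - y s\<^sub>0 = (x t - x s\<^sub>0) \<bullet> z - integral {s\<^sub>0..t} (\<lambda>s. H s x (y s) z)"
      by (rule Y_set_increment(1) [OF L s0 Y]) (use 0 in auto)
    ultimately show ?case using Y_set_initial [OF L s0 Y] by (simp add: vS v0 \<Psi>_def)
  next
    case (Suc k)
    show ?case
      using mono_step [OF vc [of k] vc [of "Suc k"] Suc.IH Suc.prems] vS [of k t] vS [of "Suc k" t] by linarith
  qed
  have mono: "v k t \<le> v j t" if "k \<le> j" "t \<in> ?S" for k j t
    using that(1) by (rule lift_Suc_mono_le [of "\<lambda>k. v k t", rotated]) (rule inc [OF that(2)])
  define R where "R = 1 + running_sup x T"
  have R1: "R \<ge> 1" using running_sup_nonneg [OF D(4) T_nonneg order_refl] by (simp add: R_def)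
  define K where "K = L * norm z + H_slope z"
  have K: "K \<ge> 0" using L H_slope_nonneg by (simp add: K_def)
  obtain B0 where B0: "\<And>t. t \<in> ?S \<Longrightarrow> \<bar>v 0 t\<bar> \<le> B0"
    using continuous_on_Icc_bounded [OF vc] by blast
  have B00: "B0 \<ge> 0" using B0 [of s\<^sub>0] s0 by force
  define N where "N = Suc (nat \<lceil>2 * K * (T - s\<^sub>0)\<rceil>)"
  have N: "2 * K * (T - s\<^sub>0) \<le> real N" "N > 0" unfolding N_def by linarith+
  \<comment> \<open>Gronwall applies to the new iterate alone, since the old one lies between it and the first one.\<close>
  have bnd: "\<bar>v (Suc k) t\<bar> \<le> 2 ^ N * ((R + B0) + \<bar>v (Suc k) s\<^sub>0\<bar>)" if t: "t \<in> ?S" for k t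
  proof (rule sup_Gronwall [OF vc _ K _ N _ t])
    fix s t M assume st: "s\<^sub>0 \<le> s" "s \<le> t" "t \<le> T" and M: "\<And>r. \<lbrakk>s\<^sub>0 \<le> r; r \<le> t\<rbrakk> \<Longrightarrow> \<bar>v (Suc k) r\<bar> \<le> M"
    have M0: "M \<ge> 0" using M [of s] st by auto
    have "v (Suc k) t - v (Suc k) s = (x t - x s) \<bullet> z - integral {s..t} (\<lambda>s. H s x (v k s) z)"
    proof -
      have "integral {s\<^sub>0..s} (\<lambda>s. H s x (v k s) z) + integral {s..t} (\<lambda>s. H s x (v k s) z) = integral {s\<^sub>0..t} (\<lambda>s. H s x (v k s) z)"
        by (rule Henstock_Kurzweil_Integration.integral_combine) (use st vk in auto)
      then show ?thesis by (simp add: vS \<Psi>_def algebra_simps inner_diff_left)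
    qed
    also have "\<bar>\<dots>\<bar> \<le> \<bar>(x t - x s) \<bullet> z\<bar> + \<bar>integral {s..t} (\<lambda>s. H s x (v k s) z)\<bar>" by (rule abs_triangle_ineq4)
    also have "\<dots> \<le> L * norm z * (R + B0 + M) * (t - s) + H_slope z * (R + (B0 + M)) * (t - s)"
    proof (rule add_mono)
      have "norm (x t - x s) \<le> L * R * \<bar>t - s\<bar>"
        by (rule X_set_Lipschitz [OF L s0 D(1)]) (use st in \<open>auto simp: R_def\<close>)
      also have "\<bar>t - s\<bar> = t - s" using st by simp
      also have "L * R * (t - s) \<le> L * (R + B0 + M) * (t - s)"
        by (rule mult_right_mono [OF mult_left_mono]) (use L M0 B00 st in auto)
      finally have "norm (x t - x s) * norm z \<le> L * (R + B0 + M) * (t - s) * norm z"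
        by (rule mult_right_mono) simp
      then show "\<bar>(x t - x s) \<bullet> z\<bar> \<le> L * norm z * (R + B0 + M) * (t - s)"
        using Cauchy_Schwarz_ineq2 [of "x t - x s" z] by (simp add: algebra_simps)
      show "\<bar>integral {s..t} (\<lambda>s. H s x (v k s) z)\<bar> \<le> H_slope z * (R + (B0 + M)) * (t - s)"
      proof (rule integral_good_bound)
        fix r assume r: "r \<in> {s..t}" "r \<in> good_times"
        have "1 + running_sup x r \<le> R" using running_sup_mono [OF D(4), of r T] r st s0 by (auto simp: R_def)
        moreover have "\<bar>v k r\<bar> \<le> B0 + M"
          using mono [of 0 k r] inc [of r k] B0 [of r] M [of r] B00 M0 r st by (auto simp: abs_le_iff)
        ultimately show "\<bar>H r x (v k r) z\<bar> \<le> H_slope z * (R + (B0 + M))" by (rule H_bound' [OF r(2) D(4)])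
      qed (use st s0 vk in auto)
    qed
    finally show "\<bar>v (Suc k) t - v (Suc k) s\<bar> \<le> K * (R + B0 + M) * (t - s)"
      by (simp add: K_def algebra_simps)
  qed (use s0 R1 B00 in auto)
  define B where "B = 2 ^ N * ((R + B0) + (\<bar>y\<^sub>0\<bar> + c)) + B0"
  have vB: "\<bar>v k t\<bar> \<le> B" if t: "t \<in> ?S" for k t
  proof (cases k)
    case 0
    have "0 \<le> 2 ^ N * ((R + B0) + (\<bar>y\<^sub>0\<bar> + c))" using R1 B00 c by simp
    then show ?thesis using 0 B0 [OF t] by (simp add: B_def)
  next
    case (Suc j)
    have "v (Suc j) s\<^sub>0 = y\<^sub>0 + c" by (simp add: vS \<Psi>_def)
    then have "\<bar>v (Suc j) s\<^sub>0\<bar> \<le> \<bar>y\<^sub>0\<bar> + c" using c by simp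
    then have "2 ^ N * ((R + B0) + \<bar>v (Suc j) s\<^sub>0\<bar>) \<le> 2 ^ N * ((R + B0) + (\<bar>y\<^sub>0\<bar> + c))" by simp
    then show ?thesis using bnd [OF t, of j] B00 unfolding Suc B_def by linarith
  qed
  define w where "w = restrict (\<lambda>t. SUP k. v k t) ?S"
  have wlim: "(\<lambda>k. v k t) \<longlonglongrightarrow> w t" if t: "t \<in> ?S" for t
  proof -
    have "bdd_above (range (\<lambda>k. v k t))" using vB [OF t] by (intro bdd_aboveI2 [of _ _ B]) (auto simp: abs_le_iff)
    then have "(\<lambda>k. v k t) \<longlonglongrightarrow> (SUP k. v k t)"
      by (intro LIMSEQ_incseq_SUP) (auto simp: incseq_def mono [OF _ t])
    then show ?thesis using t by (simp add: w_def)
  qed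
  have lim: "(\<lambda>s. H s x (w s) z) integrable_on {s\<^sub>0..t}"
      "(\<lambda>k. integral {s\<^sub>0..t} (\<lambda>s. H s x (v k s) z)) \<longlonglongrightarrow> integral {s\<^sub>0..t} (\<lambda>s. H s x (w s) z)"
    if t: "t \<in> ?S" for t
  proof -
    note A = H_dominated_limit [of s\<^sub>0 t "\<lambda>k s. x" v z "\<lambda>s. x" w R B]
    have 1: "0 \<le> s\<^sub>0" "t \<le> T" using s0 t by auto
    have 2: "(\<lambda>s. H s x (v n s) z) integrable_on {s\<^sub>0..t}" for n using vk t by auto
    have 3: "1 + running_sup x s \<le> R" if "s \<in> {s\<^sub>0..t}" for s
      using running_sup_mono [OF D(4), of s T] that t s0 by (auto simp: R_def)
    show "(\<lambda>s. H s x (w s) z) integrable_on {s\<^sub>0..t}"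
      by (rule A(1)) (use 1 2 3 D(4) wlim vB t in \<open>auto intro: uniform_limit_const\<close>)
    show "(\<lambda>k. integral {s\<^sub>0..t} (\<lambda>s. H s x (v k s) z)) \<longlonglongrightarrow> integral {s\<^sub>0..t} (\<lambda>s. H s x (w s) z)"
      by (rule A(2)) (use 1 2 3 D(4) wlim vB t in \<open>auto intro: uniform_limit_const\<close>)
  qed
  have weq: "w t = \<Psi> w t" if t: "t \<in> ?S" for t
  proof (rule LIMSEQ_unique)
    show "(\<lambda>k. v (Suc k) t) \<longlonglongrightarrow> w t" using wlim [OF t] by (rule LIMSEQ_Suc)
    show "(\<lambda>k. v (Suc k) t) \<longlonglongrightarrow> \<Psi> w t"
      unfolding vS \<Psi>_def by (intro tendsto_intros lim(2) t)
  qed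
  have "continuous_on ?S (\<Psi> w)" using \<Psi>c lim(1) [of T] s0 by auto
  then have "continuous_on ?S w" by (rule continuous_on_eq) (rule weq [symmetric])
  moreover have "w \<in> extensional ?S" by (simp add: w_def)
  ultimately have "(x, w) \<in> Y_set T H L s\<^sub>0 x\<^sub>0 (y\<^sub>0 + c) z"
    unfolding Y_set_iff [OF L s0] using D(1) weq [unfolded \<Psi>_def] by blast
  moreover have "y t + c \<le> w t" if t: "t \<in> ?S" for t
    by (rule LIMSEQ_le_const [OF wlim [OF t]]) (use mono [of 0 _ t] t v0 in auto)
  ultimately show ?thesis by blast
qed

lemma Y_set_shift_down:
  assumes L: "L \<ge> 0" and s0: "s\<^sub>0 \<in> {0..T}" and Y: "(x, y) \<in> Y_set T H L s\<^sub>0 x\<^sub>0 y\<^sub>0 z" and c: "c \<ge> 0"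
  shows "\<exists>v. (x, v) \<in> Y_set T H L s\<^sub>0 x\<^sub>0 (y\<^sub>0 - c) z \<and> (\<forall>t\<in>{s\<^sub>0..T}. v t \<le> y t - c)"
proof -
  interpret dual: tvp_data T "\<lambda>x. - h x" "\<lambda>t x y z. - H t x (- y) (- z)" L\<^sub>H
    by (rule tvp_data_dual)
  obtain v where v: "(x, v) \<in> Y_set T (\<lambda>t x y z. - H t x (- y) (- z)) L s\<^sub>0 x\<^sub>0 (- y\<^sub>0 + c) (- z)"
      "\<forall>t\<in>{s\<^sub>0..T}. restrict (\<lambda>t. - y t) {s\<^sub>0..T} t + c \<le> v t"
    using dual.Y_set_shift_up [OF L s0 Y_set_dual [OF Y] c] by blast
  have "(x, restrict (\<lambda>t. - v t) {s\<^sub>0..T}) \<in> Y_set T H L s\<^sub>0 x\<^sub>0 (y\<^sub>0 - c) z"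
    using Y_set_dual [OF v(1)] by simp
  then show ?thesis using v(2) by (intro exI [of _ "restrict (\<lambda>t. - v t) {s\<^sub>0..T}"]) auto
qed

text \<open>
The growth bound makes the functions \<open>ys\<close> uniformly bounded and equi-Lipschitz along a subsequence of
uniformly convergent paths; the increment equation passes to the limit by dominated convergence.
\<close>

theorem Y_set_compact:
  fixes xs x0s :: "nat \<Rightarrow> real \<Rightarrow> real^'n"
  assumes L: "L \<ge> 0" and ts: "\<And>n. ts n \<in> {0..T}" and t0: "t\<^sub>0 \<in> {0..T}"
    and x0s: "\<And>n. x0s n \<in> path_space T" and x0: "x\<^sub>0 \<in> path_space T"
    and conv: "(\<lambda>n. d_infty T (t\<^sub>0, x\<^sub>0) (ts n, x0s n)) \<longlonglongrightarrow> 0"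
    and Y: "\<And>n. (xs n, ys n) \<in> Y_set T H L (ts n) (x0s n) (y0s n) z"
    and y0: "y0s \<longlonglongrightarrow> y\<^sub>0"
  obtains r x y where "strict_mono (r :: nat \<Rightarrow> nat)" "(x, y) \<in> Y_set T H L t\<^sub>0 x\<^sub>0 y\<^sub>0 z"
    "uniform_limit {0..T} (xs \<circ> r) x sequentially"
    "\<And>\<tau> t. \<lbrakk>\<forall>\<^sub>F n in sequentially. \<tau> n \<in> {ts (r n)..T}; \<tau> \<longlonglongrightarrow> t\<rbrakk> \<Longrightarrow> (\<lambda>n. ys (r n) (\<tau> n)) \<longlonglongrightarrow> y t"
proof -
  note D = Y_setD [OF Y]
  obtain r1 x1 where r1: "strict_mono r1" and x1: "x1 \<in> X_set T L t\<^sub>0 x\<^sub>0"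
    and x1lim: "uniform_limit {0..T} (xs \<circ> r1) x1 sequentially"
    using X_set_compact [OF L ts t0 x0s x0 D(1) conv] .
  obtain R where R: "\<And>n. 1 + running_sup (xs (r1 n)) T \<le> R"
    using uniform_limit_running_sup_bounded [OF T_nonneg _ X_setD(1) [OF x1] x1lim] D(4) by auto
  obtain B where B: "\<And>n. \<bar>y0s n\<bar> \<le> B"
    using convergent_imp_Bseq [OF convergentI [OF y0]] by (auto simp: Bseq_def)
  define K where "K = L * norm z + H_slope z"
  have K: "K \<ge> 0" using L H_slope_nonneg by (simp add: K_def)
  define N where "N = Suc (nat \<lceil>2 * K * T\<rceil>)"
  have N: "2 * (L * norm z + H_slope z) * T \<le> real N" "N > 0" unfolding N_def K_def by linarith+
  define M where "M = 2 ^ N * (R + B)"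
  have yM: "\<bar>ys (r1 n) t\<bar> \<le> M" if t: "t \<in> {ts (r1 n)..T}" for n t
  proof -
    have "\<bar>ys (r1 n) t\<bar> \<le> 2 ^ N * (R + \<bar>y0s (r1 n)\<bar>)"
      by (rule Y_set_estimates(2) [OF L ts Y R N t])
    also have "\<dots> \<le> M" unfolding M_def using B by simp
    finally show ?thesis .
  qed
  have lip: "\<bar>ys (r1 n) u - ys (r1 n) v\<bar> \<le> K * (R + M) * \<bar>u - v\<bar>"
    if uv: "u \<in> {ts (r1 n)..T}" "v \<in> {ts (r1 n)..T}" for n u v
  proof -
    have "\<bar>ys (r1 n) b - ys (r1 n) a\<bar> \<le> K * (R + M) * (b - a)" if "ts (r1 n) \<le> a" "a \<le> b" "b \<le> T" for a b
      unfolding K_def by (rule Y_set_estimates(1) [OF L ts Y R that]) (use yM that in auto)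
    from this [of u v] this [of v u] show ?thesis using uv by (cases "u \<le> v") (auto simp: abs_minus_commute)
  qed
  have conv': "(\<lambda>n. d_infty T (t\<^sub>0, x\<^sub>0) (ts (r1 n), x0s (r1 n))) \<longlonglongrightarrow> 0"
    using LIMSEQ_subseq_LIMSEQ [OF conv r1] by (simp add: o_def)
  have y0': "(\<lambda>n. ys (r1 n) (ts (r1 n))) \<longlonglongrightarrow> y\<^sub>0"
    using LIMSEQ_subseq_LIMSEQ [OF y0 r1] by (simp add: o_def Y_set_initial [OF L ts Y])
  obtain r2 x y where r2: "strict_mono (r2 :: nat \<Rightarrow> nat)" and x: "x \<in> X_set T L t\<^sub>0 x\<^sub>0"
    and xlim: "uniform_limit {0..T} ((\<lambda>n. xs (r1 n)) \<circ> r2) x sequentially"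
    and y: "continuous_on {t\<^sub>0..T} y" "y \<in> extensional {t\<^sub>0..T}" "y t\<^sub>0 = y\<^sub>0"
    and ylim: "\<And>\<tau> t. \<lbrakk>\<forall>\<^sub>F n in sequentially. \<tau> n \<in> {ts (r1 (r2 n))..T}; \<tau> \<longlonglongrightarrow> t\<rbrakk>
        \<Longrightarrow> (\<lambda>n. ys (r1 (r2 n)) (\<tau> n)) \<longlonglongrightarrow> y t"
    by (rule X_set_y_compact [of L "\<lambda>n. ts (r1 n)" T t\<^sub>0 "\<lambda>n. x0s (r1 n)" x\<^sub>0 "\<lambda>n. xs (r1 n)" "\<lambda>n. ys (r1 n)" "K * (R + M)" y\<^sub>0,
        OF L ts t0 x0s x0 D(1) conv' lip y0'], assumption, assumption, rule that; (assumption | blast))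
  define r where "r = (\<lambda>n. r1 (r2 n))"
  have r: "strict_mono r" unfolding r_def using strict_mono_o [OF r1 r2] by (simp add: o_def)
  have tsr: "(\<lambda>n. ts (r n)) \<longlonglongrightarrow> t\<^sub>0"
    using LIMSEQ_subseq_LIMSEQ [OF d_infty_tendsto_times [OF ts t0 x0s x0 conv] r] by (simp add: o_def)
  have xr: "uniform_limit {0..T} (\<lambda>n. xs (r n)) x sequentially" using xlim by (simp add: r_def o_def)
  have "(x, y) \<in> Y_set T H L t\<^sub>0 x\<^sub>0 y\<^sub>0 z"
  proof (rule Y_setI_increments [OF L t0 x y(2,1,3)])
    fix a b assume ab: "t\<^sub>0 < a" "a \<le> b" "b \<le> T"
    have "\<forall>\<^sub>F n in sequentially. ts (r n) < a" by (rule order_tendstoD(2) [OF tsr ab(1)])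
    then obtain n0 where n0: "\<And>n. n \<ge> n0 \<Longrightarrow> ts (r n) < a" by (auto simp: eventually_sequentially)
    define q where "q = (\<lambda>n. r (n + n0))"
    have tsq: "ts (q n) \<le> a" for n using n0 [of "n + n0"] by (simp add: q_def)
    have xq: "uniform_limit {0..T} (\<lambda>n. xs (q n)) x sequentially"
    proof -
      have "strict_mono (\<lambda>n. n + n0)" by (simp add: strict_mono_def)
      from eventually_subseq [OF this] show ?thesis
        using xr unfolding uniform_limit_iff q_def by blast
    qed
    have yq: "(\<lambda>n. ys (q n) s) \<longlonglongrightarrow> y s" if s: "s \<in> {a..b}" for s
    proof -
      have "(\<lambda>n. ys (r n) s) \<longlonglongrightarrow> y s" unfolding r_def
      proof (rule ylim)
        show "\<forall>\<^sub>F n in sequentially. s \<in> {ts (r1 (r2 n))..T}"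
          using n0 s ab by (auto simp: eventually_sequentially r_def less_imp_le intro!: exI [of _ n0] order_trans [of _ a s])
      qed simp
      from LIMSEQ_ignore_initial_segment [OF this] show ?thesis by (simp add: q_def)
    qed
    have inc: "ys (q n) b - ys (q n) a = (xs (q n) b - xs (q n) a) \<bullet> z - integral {a..b} (\<lambda>s. H s (xs (q n)) (ys (q n) s) z)"
      and int: "(\<lambda>s. H s (xs (q n)) (ys (q n) s) z) integrable_on {a..b}" for n
      using Y_set_increment [OF L ts Y tsq ab(2,3)] by auto
    note A = H_dominated_limit(2) [of a b "\<lambda>n s. xs (q n)" "\<lambda>n. ys (q n)" z "\<lambda>s. x" y R M]
    have lim: "(\<lambda>n. integral {a..b} (\<lambda>s. H s (xs (q n)) (ys (q n) s) z)) \<longlonglongrightarrow> integral {a..b} (\<lambda>s. H s x (y s) z)"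
    proof (rule A)
      show "1 + running_sup (xs (q n)) s \<le> R" if "s \<in> {a..b}" for n s
        using R [of "r2 (n + n0)"] running_sup_mono [OF D(4), of s T "q n"] that ab t0
        by (auto simp: q_def r_def)
      show "\<bar>ys (q n) s\<bar> \<le> M" if "s \<in> {a..b}" for n s
        using yM [of s "r2 (n + n0)"] tsq [of n] that ab by (auto simp: q_def r_def)
    qed (use int D(4) X_setD(1) [OF x] xq yq ab t0 in auto)
    have q1: "(\<lambda>n. xs (q n) s) \<longlonglongrightarrow> x s" if "s \<in> {0..T}" for s
      by (rule tendsto_uniform_limitI [OF xq that])
    have "(\<lambda>n. (xs (q n) b - xs (q n) a) \<bullet> z - integral {a..b} (\<lambda>s. H s (xs (q n)) (ys (q n) s) z))
        \<longlonglongrightarrow> (x b - x a) \<bullet> z - integral {a..b} (\<lambda>s. H s x (y s) z)"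
      by (intro tendsto_intros q1 lim) (use ab t0 in auto)
    then have "(\<lambda>n. ys (q n) b - ys (q n) a) \<longlonglongrightarrow> (x b - x a) \<bullet> z - integral {a..b} (\<lambda>s. H s x (y s) z)"
      by (simp add: inc)
    moreover have "(\<lambda>n. ys (q n) b - ys (q n) a) \<longlonglongrightarrow> y b - y a"
      by (intro tendsto_intros yq) (use ab in auto)
    ultimately show "y b - y a = (x b - x a) \<bullet> z - integral {a..b} (\<lambda>s. H s x (y s) z)"
      using LIMSEQ_unique by blast
  qed
  moreover have "uniform_limit {0..T} (xs \<circ> r) x sequentially" using xr by (simp add: o_def)
  moreover have "(\<lambda>n. ys (r n) (\<tau> n)) \<longlonglongrightarrow> y t"
    if "\<forall>\<^sub>F n in sequentially. \<tau> n \<in> {ts (r n)..T}" "\<tau> \<longlonglongrightarrow> t" for \<tau> t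
    using ylim that unfolding r_def by blast
  ultimately show ?thesis using that [OF r] by blast
qed

section \<open>Characteristics common to two slopes\<close>

lemma grid_less:
  assumes "\<delta> > 0" "s < t\<^sub>0 + real (Suc k) * \<delta>"
  shows "grid t\<^sub>0 \<delta> s \<le> t\<^sub>0 + real k * \<delta>"
proof -
  define i where "i = \<lfloor>(s - t\<^sub>0) / \<delta>\<rfloor>"
  have "(s - t\<^sub>0) / \<delta> < real (Suc k)" using assms by (simp add: field_simps)
  then have "i < int (Suc k)" unfolding i_def by (simp only: floor_less_iff of_int_of_nat_eq)
  then have "real_of_int i \<le> real k" by linarith
  then have "\<delta> * real_of_int i \<le> real k * \<delta>" using assms(1) by (simp add: mult.commute)
  moreover have "0 \<le> real k * \<delta>" using assms(1) by simp
  ultimately show ?thesis unfolding grid_def i_def [symmetric] by auto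
qed

text \<open>
The integral of \<open>H\<close> with path and value delayed to the preceding grid point, so that an equation with
this integral can be solved one grid cell after the other.
\<close>

definition euler_integral where
  "euler_integral t\<^sub>0 \<delta> p z t = integral {t\<^sub>0..t}
     (\<lambda>s. H s (stop_path T (fst p) (grid t\<^sub>0 \<delta> s)) (snd p (grid t\<^sub>0 \<delta> s)) z)"

text \<open>
Subtracting the equations for the slopes \<open>z\<close> and \<open>z'\<close> leaves \<open>x' \<bullet> (z - z') = H(z) - H(z')\<close>; the
solution of minimal norm is the multiple of \<open>z - z'\<close> used here.  For \<open>z = z'\<close> the quotient is zero
by convention and the path rests, which is correct as well.
\<close>

definition euler_step where
  "euler_step t\<^sub>0 x\<^sub>0 y\<^sub>0 z z' \<delta> p =
    (let x = restrict (\<lambda>t. if t \<le> t\<^sub>0 then x\<^sub>0 t else x\<^sub>0 t\<^sub>0 +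
          ((euler_integral t\<^sub>0 \<delta> p z t - euler_integral t\<^sub>0 \<delta> p z' t) / (norm (z - z'))\<^sup>2) *\<^sub>R (z - z')) {0..T}
     in (x, \<lambda>t. y\<^sub>0 + (x t - x t\<^sub>0) \<bullet> z - euler_integral t\<^sub>0 \<delta> p z t))"

lemma stopped_running_sup_le:
  assumes x: "x \<in> path_space T" and c: "0 \<le> c" "c \<le> s" and s: "s \<le> b" "b \<le> T"
  shows "running_sup (stop_path T x c) s \<le> running_sup x b"
proof (rule running_sup_le)
  fix r assume r: "0 \<le> r" "r \<le> s"
  then have "norm (x (min r c)) \<le> running_sup x b"
    by (intro norm_le_running_sup [OF x]) (use c s in auto)
  then show "norm (stop_path T x c r) \<le> running_sup x b" using r s by (simp add: stop_path_def)
qed (use c in auto)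

lemma stop_path_in_path_space:
  "\<lbrakk>x \<in> path_space T; c \<in> {0..T}\<rbrakk> \<Longrightarrow> stop_path T x c \<in> path_space T"
  using X_setD(1) [OF stop_path_in_X_set [OF order_refl]] by blast

lemma euler_integrable:
  assumes x: "x \<in> path_space T" and y: "continuous_on {t\<^sub>0..T} y" and t0: "t\<^sub>0 \<in> {0..T}"
    and \<delta>: "\<delta> > 0" and ab: "t\<^sub>0 \<le> a" "b \<le> T"
  shows "(\<lambda>s. H s (stop_path T x (grid t\<^sub>0 \<delta> s)) (y (grid t\<^sub>0 \<delta> s)) z) integrable_on {a..b}"
proof -
  obtain M where M: "\<And>t. t \<in> {t\<^sub>0..T} \<Longrightarrow> \<bar>y t\<bar> \<le> M"
    using continuous_on_Icc_bounded [OF y] by blast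
  show ?thesis
  proof (rule grid_integrable [where M = M and R = "1 + running_sup x T"])
    show "1 + running_sup (stop_path T x t) T \<le> 1 + running_sup x T" if "t \<in> {t\<^sub>0..T}" for t
      using stopped_running_sup_le [OF x, of t T T] that t0 by auto
  qed (use M t0 ab \<delta> x in \<open>auto intro: stop_path_in_path_space\<close>)
qed

lemma euler_integral_diff:
  assumes x: "fst p \<in> path_space T" and y: "continuous_on {t\<^sub>0..T} (snd p)" and t0: "t\<^sub>0 \<in> {0..T}"
    and \<delta>: "\<delta> > 0" and ab: "t\<^sub>0 \<le> a" "a \<le> b" "b \<le> T"
  shows "euler_integral t\<^sub>0 \<delta> p z b - euler_integral t\<^sub>0 \<delta> p z a = integral {a..b}
     (\<lambda>s. H s (stop_path T (fst p) (grid t\<^sub>0 \<delta> s)) (snd p (grid t\<^sub>0 \<delta> s)) z)"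
proof -
  let ?f = "\<lambda>s. H s (stop_path T (fst p) (grid t\<^sub>0 \<delta> s)) (snd p (grid t\<^sub>0 \<delta> s)) z"
  have "integral {t\<^sub>0..a} ?f + integral {a..b} ?f = integral {t\<^sub>0..b} ?f"
    by (rule Henstock_Kurzweil_Integration.integral_combine)
       (use ab euler_integrable [OF x y t0 \<delta>] in auto)
  then show ?thesis by (simp add: euler_integral_def)
qed

lemma euler_step_continuous:
  assumes x0: "x\<^sub>0 \<in> path_space T" and t0: "t\<^sub>0 \<in> {0..T}" and \<delta>: "\<delta> > 0"
    and p: "fst p \<in> path_space T" "continuous_on {t\<^sub>0..T} (snd p)"
  shows "fst (euler_step t\<^sub>0 x\<^sub>0 y\<^sub>0 z z' \<delta> p) \<in> path_space T"
    and "continuous_on {t\<^sub>0..T} (snd (euler_step t\<^sub>0 x\<^sub>0 y\<^sub>0 z z' \<delta> p))"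
proof -
  define x where "x = fst (euler_step t\<^sub>0 x\<^sub>0 y\<^sub>0 z z' \<delta> p)"
  have Ec: "continuous_on {t\<^sub>0..T} (euler_integral t\<^sub>0 \<delta> p \<zeta>)" for \<zeta>
    unfolding euler_integral_def
    by (rule indefinite_integral_continuous_1 [OF euler_integrable [OF p t0 \<delta>]]) auto
  have E0: "euler_integral t\<^sub>0 \<delta> p \<zeta> t\<^sub>0 = 0" for \<zeta> by (simp add: euler_integral_def)
  have eq: "x t = x\<^sub>0 t\<^sub>0 +
          ((euler_integral t\<^sub>0 \<delta> p z t - euler_integral t\<^sub>0 \<delta> p z' t) / (norm (z - z'))\<^sup>2) *\<^sub>R (z - z')"
    if "t \<in> {t\<^sub>0..T}" for t
    using that t0 E0 by (cases "t = t\<^sub>0") (auto simp: x_def euler_step_def Let_def)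
  have xc: "continuous_on {t\<^sub>0..T} x"
    by (subst continuous_on_cong [OF refl eq], assumption) 
       (cases "z = z'", auto intro!: continuous_intros Ec)
  show "x \<in> path_space T"
    by (rule path_space_continuation [OF x0 t0 _ _ xc]) (use t0 in \<open>auto simp: x_def euler_step_def Let_def\<close>)
  have "snd (euler_step t\<^sub>0 x\<^sub>0 y\<^sub>0 z z' \<delta> p) = (\<lambda>t. y\<^sub>0 + (x t - x t\<^sub>0) \<bullet> z - euler_integral t\<^sub>0 \<delta> p z t)"
    by (simp add: x_def euler_step_def Let_def)
  then show "continuous_on {t\<^sub>0..T} (snd (euler_step t\<^sub>0 x\<^sub>0 y\<^sub>0 z z' \<delta> p))"
    by (auto intro!: continuous_intros xc Ec)
qed

text \<open>
Because of the delay, the integral up to the end of a grid cell depends only on the data up to its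
beginning.  The end point itself is removed as a null set.
\<close>

lemma euler_integral_cong:
  assumes \<delta>: "\<delta> > 0" and t0: "t\<^sub>0 \<in> {0..T}" and t: "t \<in> {t\<^sub>0..T}" "t \<le> t\<^sub>0 + real (Suc k) * \<delta>"
    and eqx: "\<And>r. \<lbrakk>0 \<le> r; r \<le> T; r \<le> t\<^sub>0 + real k * \<delta>\<rbrakk> \<Longrightarrow> fst p r = fst q r"
    and eqy: "\<And>r. \<lbrakk>t\<^sub>0 \<le> r; r \<le> T; r \<le> t\<^sub>0 + real k * \<delta>\<rbrakk> \<Longrightarrow> snd p r = snd q r"
  shows "euler_integral t\<^sub>0 \<delta> p z t = euler_integral t\<^sub>0 \<delta> q z t"
  unfolding euler_integral_def
proof (rule integral_spike [of "{t\<^sub>0 + real (Suc k) * \<delta>}"])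
  fix s assume s: "s \<in> {t\<^sub>0..t} - {t\<^sub>0 + real (Suc k) * \<delta>}"
  then have "s < t\<^sub>0 + real (Suc k) * \<delta>" using t by auto
  then have g: "grid t\<^sub>0 \<delta> s \<le> t\<^sub>0 + real k * \<delta>" by (rule grid_less [OF \<delta>])
  have g': "t\<^sub>0 \<le> grid t\<^sub>0 \<delta> s" "grid t\<^sub>0 \<delta> s \<le> T"
    using grid(1,2) [OF \<delta>, of t\<^sub>0 s] s t by auto
  have "stop_path T (fst p) (grid t\<^sub>0 \<delta> s) = stop_path T (fst q) (grid t\<^sub>0 \<delta> s)"
    unfolding stop_path_def by (rule restrict_ext, rule eqx) (use g g' t0 in auto)
  then show "H s (stop_path T (fst q) (grid t\<^sub>0 \<delta> s)) (snd q (grid t\<^sub>0 \<delta> s)) z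
      = H s (stop_path T (fst p) (grid t\<^sub>0 \<delta> s)) (snd p (grid t\<^sub>0 \<delta> s)) z"
    using eqy g g' by simp
qed simp

text \<open>
Each iteration of the delayed step settles one more grid cell, so after finitely many iterations
nothing changes on \<open>[0,T]\<close>.
\<close>

lemma euler_fixpoint:
  assumes x0: "x\<^sub>0 \<in> path_space T" and t0: "t\<^sub>0 \<in> {0..T}" and \<delta>: "\<delta> > 0"
  obtains x y where "x \<in> path_space T" "continuous_on {t\<^sub>0..T} y"
    "\<And>t. \<lbrakk>0 \<le> t; t \<le> T\<rbrakk> \<Longrightarrow> fst (euler_step t\<^sub>0 x\<^sub>0 y\<^sub>0 z z' \<delta> (x, y)) t = x t"
    "\<And>t. \<lbrakk>t\<^sub>0 \<le> t; t \<le> T\<rbrakk> \<Longrightarrow> snd (euler_step t\<^sub>0 x\<^sub>0 y\<^sub>0 z z' \<delta> (x, y)) t = y t"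
proof -
  let ?\<Phi> = "euler_step t\<^sub>0 x\<^sub>0 y\<^sub>0 z z' \<delta>"
  define P where "P = (\<lambda>k. (?\<Phi> ^^ k) (stop_path T x\<^sub>0 t\<^sub>0, \<lambda>_. y\<^sub>0))"
  have P0: "P 0 = (stop_path T x\<^sub>0 t\<^sub>0, \<lambda>_. y\<^sub>0)" and PS: "P (Suc k) = ?\<Phi> (P k)" for k
    by (auto simp: P_def)
  have good: "fst (P k) \<in> path_space T \<and> continuous_on {t\<^sub>0..T} (snd (P k))" for k
  proof (induction k)
    case 0 show ?case using stop_path_in_path_space [OF x0 t0] by (simp add: P0)
  next
    case (Suc k) then show ?case unfolding PS using euler_step_continuous [OF x0 t0 \<delta>] by blast
  qed
  have agree: "(\<forall>r. 0 \<le> r \<longrightarrow> r \<le> T \<longrightarrow> r \<le> t\<^sub>0 + real k * \<delta> \<longrightarrow> fst (P (Suc k)) r = fst (P k) r) \<and>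
      (\<forall>r. t\<^sub>0 \<le> r \<longrightarrow> r \<le> T \<longrightarrow> r \<le> t\<^sub>0 + real k * \<delta> \<longrightarrow> snd (P (Suc k)) r = snd (P k) r)" for k
  proof (induction k)
    case 0
    show ?case unfolding PS P0
      using t0 by (auto simp: euler_step_def Let_def stop_path_def euler_integral_def min_def)
  next
    case (Suc k)
    have E: "euler_integral t\<^sub>0 \<delta> (P (Suc k)) \<zeta> t = euler_integral t\<^sub>0 \<delta> (P k) \<zeta> t"
      if "t \<in> {t\<^sub>0..T}" "t \<le> t\<^sub>0 + real (Suc k) * \<delta>" for \<zeta> t
      by (rule euler_integral_cong [OF \<delta> t0 that]) (use Suc in auto)
    have X: "fst (P (Suc (Suc k))) r = fst (P (Suc k)) r"
      if "0 \<le> r" "r \<le> T" "r \<le> t\<^sub>0 + real (Suc k) * \<delta>" for r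
      unfolding PS [of "Suc k"] PS [of k]
      using that E [of r, unfolded PS [of k]] by (auto simp: euler_step_def Let_def)
    have Y: "snd (P (Suc (Suc k))) r = snd (P (Suc k)) r"
      if "t\<^sub>0 \<le> r" "r \<le> T" "r \<le> t\<^sub>0 + real (Suc k) * \<delta>" for r
    proof -
      have *: "snd (?\<Phi> p) t = y\<^sub>0 + (fst (?\<Phi> p) t - fst (?\<Phi> p) t\<^sub>0) \<bullet> z - euler_integral t\<^sub>0 \<delta> p z t" for p t
        by (simp add: euler_step_def Let_def)
      have "fst (?\<Phi> (P (Suc k))) r = fst (?\<Phi> (P k)) r" "fst (?\<Phi> (P (Suc k))) t\<^sub>0 = fst (?\<Phi> (P k)) t\<^sub>0"
        using X [of r] X [of t\<^sub>0] that t0 \<delta> by (auto simp: PS)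
      then show ?thesis using E [of r z] that by (simp add: PS *)
    qed
    show ?case using X Y by blast
  qed
  obtain k where "T - t\<^sub>0 < real k * \<delta>"
    using reals_Archimedean3 [OF \<delta>] by blast
  then have k: "T - t\<^sub>0 \<le> real k * \<delta>" by simp
  show ?thesis
  proof (rule that [of "fst (P k)" "snd (P k)"])
    show "fst (?\<Phi> (fst (P k), snd (P k))) t = fst (P k) t" if "0 \<le> t" "t \<le> T" for t
      using agree [of k] that k by (simp add: PS)
    show "snd (?\<Phi> (fst (P k), snd (P k))) t = snd (P k) t" if "t\<^sub>0 \<le> t" "t \<le> T" for t
      using agree [of k] that k by (simp add: PS)
  qed (use good in auto)
qed

text \<open>
The velocity of the fixed point has length \<open>|H(z) - H(z')| / |z - z'|\<close>, which the Lipschitz condition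
in \<open>z\<close> bounds by \<open>L\<^sub>H\<close> times \<open>1\<close> plus the running supremum.  This is why characteristics with the
constant \<open>L\<^sub>H\<close> suffice.
\<close>

lemma euler_approximation:
  assumes x0: "x\<^sub>0 \<in> path_space T" and t0: "t\<^sub>0 \<in> {0..T}" and \<delta>: "\<delta> > 0"
  obtains x y where "x \<in> X_set T L\<^sub>H t\<^sub>0 x\<^sub>0" "continuous_on {t\<^sub>0..T} y" "y t\<^sub>0 = y\<^sub>0"
    "\<And>a b \<zeta>. \<lbrakk>\<zeta> \<in> {z, z'}; t\<^sub>0 \<le> a; a \<le> b; b \<le> T\<rbrakk> \<Longrightarrow> y b - y a = (x b - x a) \<bullet> \<zeta> -
        integral {a..b} (\<lambda>s. H s (stop_path T x (grid t\<^sub>0 \<delta> s)) (y (grid t\<^sub>0 \<delta> s)) \<zeta>)"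
proof -
  obtain x y where x: "x \<in> path_space T" and y: "continuous_on {t\<^sub>0..T} y"
    and fx: "\<And>t. \<lbrakk>0 \<le> t; t \<le> T\<rbrakk> \<Longrightarrow> fst (euler_step t\<^sub>0 x\<^sub>0 y\<^sub>0 z z' \<delta> (x, y)) t = x t"
    and fy: "\<And>t. \<lbrakk>t\<^sub>0 \<le> t; t \<le> T\<rbrakk> \<Longrightarrow> snd (euler_step t\<^sub>0 x\<^sub>0 y\<^sub>0 z z' \<delta> (x, y)) t = y t"
    by (rule euler_fixpoint [OF x0 t0 \<delta>, of y\<^sub>0 z z'], rule that; (assumption | blast))
  let ?E = "euler_integral t\<^sub>0 \<delta> (x, y)"
  let ?f = "\<lambda>\<zeta> s. H s (stop_path T x (grid t\<^sub>0 \<delta> s)) (y (grid t\<^sub>0 \<delta> s)) \<zeta>"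
  have E0: "?E \<zeta> t\<^sub>0 = 0" for \<zeta> by (simp add: euler_integral_def)
  have xx0: "x t = x\<^sub>0 t" if "0 \<le> t" "t \<le> t\<^sub>0" for t
    using fx [of t] that t0 by (simp add: euler_step_def Let_def)
  have xe: "x t = x\<^sub>0 t\<^sub>0 + ((?E z t - ?E z' t) / (norm (z - z'))\<^sup>2) *\<^sub>R (z - z')" if "t \<in> {t\<^sub>0..T}" for t
    using fx [of t] that t0 E0 by (cases "t = t\<^sub>0") (auto simp: euler_step_def Let_def)
  have ye: "y t = y\<^sub>0 + (x t - x t\<^sub>0) \<bullet> z - ?E z t" if "t \<in> {t\<^sub>0..T}" for t
    using fy [of t] fx [of t] fx [of t\<^sub>0] that t0 by (simp add: euler_step_def Let_def)
  have Ed: "?E \<zeta> b - ?E \<zeta> a = integral {a..b} (?f \<zeta>)" if "t\<^sub>0 \<le> a" "a \<le> b" "b \<le> T" for \<zeta> a b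
    using euler_integral_diff [of "(x, y)", OF _ _ t0 \<delta> that] x y by simp
  have fi: "?f \<zeta> integrable_on {a..b}" if "t\<^sub>0 \<le> a" "b \<le> T" for \<zeta> a b
    using euler_integrable [OF x y t0 \<delta> that] .
  have xd: "x b - x a = (integral {a..b} (\<lambda>s. ?f z s - ?f z' s) / (norm (z - z'))\<^sup>2) *\<^sub>R (z - z')"
    if ab: "t\<^sub>0 \<le> a" "a \<le> b" "b \<le> T" for a b
  proof -
    have "integral {a..b} (\<lambda>s. ?f z s - ?f z' s) = (?E z b - ?E z' b) - (?E z a - ?E z' a)"
      using Ed [OF ab, of z] Ed [OF ab, of z'] fi ab by (simp add: Henstock_Kurzweil_Integration.integral_diff)
    then show ?thesis using xe [of a] xe [of b] ab
      by (simp add: scaleR_diff_left [symmetric] diff_divide_distrib)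
  qed
  have fb: "\<bar>integral {a..b} (\<lambda>s. ?f z s - ?f z' s)\<bar> \<le> L\<^sub>H * (1 + running_sup x b) * norm (z - z') * (b - a)"
    if ab: "t\<^sub>0 \<le> a" "a \<le> b" "b \<le> T" for a b
  proof (rule integral_good_bound)
    fix s assume s: "s \<in> {a..b}" "s \<in> good_times"
    have g: "t\<^sub>0 \<le> grid t\<^sub>0 \<delta> s" "grid t\<^sub>0 \<delta> s \<le> s" using grid(1,2) [OF \<delta>, of t\<^sub>0 s] s ab by auto
    have "\<bar>?f z s - ?f z' s\<bar> \<le> L\<^sub>H * (1 + running_sup (stop_path T x (grid t\<^sub>0 \<delta> s)) s) * norm (z - z')"
      by (rule H_Lipschitz [OF s(2) stop_path_in_path_space [OF x]]) (use g s ab t0 in auto)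
    also have "\<dots> \<le> L\<^sub>H * (1 + running_sup x b) * norm (z - z')"
    proof (rule mult_right_mono [OF mult_left_mono])
      show "1 + running_sup (stop_path T x (grid t\<^sub>0 \<delta> s)) s \<le> 1 + running_sup x b"
        using stopped_running_sup_le [OF x, of "grid t\<^sub>0 \<delta> s" s b] g s ab t0 by auto
    qed (use L_H_nonneg in auto)
    finally show "\<bar>?f z s - ?f z' s\<bar> \<le> L\<^sub>H * (1 + running_sup x b) * norm (z - z')" .
  qed (use ab t0 fi in \<open>auto intro: Henstock_Kurzweil_Integration.integrable_diff\<close>)
  have lip: "norm (x b - x a) \<le> L\<^sub>H * (1 + running_sup x b) * (b - a)" if ab: "t\<^sub>0 \<le> a" "a \<le> b" "b \<le> T" for a b
  proof (cases "z = z'")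
    case True
    then show ?thesis using xd [OF ab] L_H_nonneg running_sup_nonneg [OF x, of b] ab t0 by simp
  next
    case False
    then have n: "norm (z - z') > 0" by simp
    have "norm (x b - x a) = \<bar>integral {a..b} (\<lambda>s. ?f z s - ?f z' s)\<bar> / norm (z - z')"
      using n xd [OF ab] by (simp add: power2_eq_square)
    also have "\<dots> \<le> L\<^sub>H * (1 + running_sup x b) * (b - a)"
    proof (rule pos_divide_le_eq [OF n, THEN iffD2])
      show "\<bar>integral {a..b} (\<lambda>s. ?f z s - ?f z' s)\<bar> \<le> L\<^sub>H * (1 + running_sup x b) * (b - a) * norm (z - z')"
        using fb [OF ab] by (simp only: mult.assoc mult.commute [of "norm (z - z')"])
    qed
    finally show ?thesis .
  qed
  have X: "x \<in> X_set T L\<^sub>H t\<^sub>0 x\<^sub>0"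
    unfolding X_set_iff [OF L_H_nonneg t0] using x xx0 lip by auto
  have yz: "y b - y a = (x b - x a) \<bullet> z - integral {a..b} (?f z)" if ab: "t\<^sub>0 \<le> a" "a \<le> b" "b \<le> T" for a b
    using ye [of a] ye [of b] Ed [OF ab, of z] ab by (simp add: inner_diff_left)
  have yz': "y b - y a = (x b - x a) \<bullet> z' - integral {a..b} (?f z')" if ab: "t\<^sub>0 \<le> a" "a \<le> b" "b \<le> T" for a b
  proof -
    have "(x b - x a) \<bullet> (z - z') = integral {a..b} (\<lambda>s. ?f z s - ?f z' s)"
      using xd [OF ab] by (cases "z = z'") (auto simp: power2_norm_eq_inner)
    also have "\<dots> = integral {a..b} (?f z) - integral {a..b} (?f z')"
      using fi ab by (simp add: Henstock_Kurzweil_Integration.integral_diff)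
    finally show ?thesis using yz [OF ab] by (simp add: inner_diff_right)
  qed
  show ?thesis
  proof (rule that [OF X y])
    show "y t\<^sub>0 = y\<^sub>0" using ye [of t\<^sub>0] E0 t0 by simp
    show "y b - y a = (x b - x a) \<bullet> \<zeta> - integral {a..b} (?f \<zeta>)"
      if "\<zeta> \<in> {z, z'}" "t\<^sub>0 \<le> a" "a \<le> b" "b \<le> T" for a b \<zeta>
      using that(1) yz [OF that(2-4)] yz' [OF that(2-4)] by blast
  qed
qed

lemma grid_refine:
  assumes "t\<^sub>0 \<le> s" "s \<le> T"
  shows "(\<lambda>n. grid t\<^sub>0 (inverse (real (Suc n))) s) \<longlonglongrightarrow> s"
proof -
  have "norm (grid t\<^sub>0 (inverse (real (Suc n))) s - s) \<le> inverse (real (Suc n))" for n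
    using grid(2,3) [of "inverse (real (Suc n))" t\<^sub>0 s] assms by simp
  then have "\<forall>\<^sub>F n in sequentially. norm (grid t\<^sub>0 (inverse (real (Suc n))) s - s) \<le> inverse (real (Suc n))" by simp
  from Lim_null_comparison [OF this LIMSEQ_inverse_real_of_nat] show ?thesis by (simp add: LIM_zero_iff)
qed

text \<open>
Stopping at a slightly earlier time changes the limit path little, because that path is Lipschitz
after \<open>t\<^sub>0\<close>; the approximating paths enter only through their uniform distance to it.
\<close>

lemma stop_path_tendsto:
  fixes xs :: "nat \<Rightarrow> real \<Rightarrow> real^'n"
  assumes L: "L \<ge> 0" and t0: "t\<^sub>0 \<in> {0..T}" and x: "x \<in> X_set T L t\<^sub>0 x\<^sub>0"
    and lim: "uniform_limit {0..T} xs x sequentially"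
    and c: "\<And>n. t\<^sub>0 \<le> c n" "\<And>n. c n \<le> s" "c \<longlonglongrightarrow> s" and s: "s \<le> T"
  shows "uniform_limit {0..T} (\<lambda>n. stop_path T (xs n) (c n)) (stop_path T x s) sequentially"
  unfolding uniform_limit_iff
proof (intro allI impI)
  fix e :: real assume e: "e > 0"
  define K where "K = L * (1 + running_sup x T) + 1"
  have K: "K > 0" using L running_sup_nonneg [OF X_setD(1) [OF x] T_nonneg order_refl] by (simp add: K_def add_nonneg_pos)
  have "\<forall>\<^sub>F n in sequentially. \<forall>r\<in>{0..T}. dist (xs n r) (x r) < e / 2"
    using lim half_gt_zero [OF e] unfolding uniform_limit_iff by blast
  moreover have "\<forall>\<^sub>F n in sequentially. dist (c n) s < e / (2 * K)"
    by (rule tendstoD [OF c(3)]) (use e K in simp)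
  ultimately show "\<forall>\<^sub>F n in sequentially. \<forall>r\<in>{0..T}. dist (stop_path T (xs n) (c n) r) (stop_path T x s r) < e"
  proof eventually_elim
    case (elim n)
    show ?case
    proof
      fix r assume r: "r \<in> {0..T}"
      have cn: "t\<^sub>0 \<le> c n" "c n \<le> s" using c by auto
      have 1: "dist (xs n (min r (c n))) (x (min r (c n))) < e / 2" using elim(1) r cn t0 by auto
      have "norm (x (min r (c n)) - x (min r s)) \<le> K * \<bar>c n - s\<bar>"
      proof (cases "r \<le> c n")
        case True
        then show ?thesis using K cn by simp
      next
        case False
        have "norm (x (min r (c n)) - x (min r s)) \<le> K * \<bar>min r (c n) - min r s\<bar>"
          by (rule X_set_Lipschitz [OF L t0 x]) (use False cn r s in \<open>auto simp: K_def\<close>)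
        also have "\<dots> \<le> K * \<bar>c n - s\<bar>" using K by (intro mult_left_mono) auto
        finally show ?thesis .
      qed
      also have "\<dots> < e / 2" using elim(2) K by (simp add: dist_real_def field_simps)
      finally have "dist (x (min r (c n))) (x (min r s)) < e / 2" by (simp add: dist_norm)
      with 1 have "dist (xs n (min r (c n))) (x (min r s)) < e"
        using dist_triangle [of "xs n (min r (c n))" "x (min r s)" "x (min r (c n))"] by linarith
      then show "dist (stop_path T (xs n) (c n) r) (stop_path T x s r) < e" using r by (simp add: stop_path_def)
    qed
  qed
qed

text \<open>
The delayed approximations with finer and finer grids satisfy both equations up to the delay;
compactness gives a limit, and non-anticipation of \<open>H\<close> removes the stopping of the path.
\<close>

theorem characteristic_exists:
  assumes x0: "x\<^sub>0 \<in> path_space T" and t0: "t\<^sub>0 \<in> {0..T}"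
  shows "\<exists>x y. (x, y) \<in> Y_set T H L\<^sub>H t\<^sub>0 x\<^sub>0 y\<^sub>0 z \<and> (x, y) \<in> Y_set T H L\<^sub>H t\<^sub>0 x\<^sub>0 y\<^sub>0 z'"
proof -
  define \<delta> where "\<delta> = (\<lambda>n. inverse (real (Suc n)))"
  have \<delta>: "\<delta> n > 0" for n by (simp add: \<delta>_def)
  define approx where "approx = (\<lambda>n x y. x \<in> X_set T L\<^sub>H t\<^sub>0 x\<^sub>0 \<and> continuous_on {t\<^sub>0..T} y \<and> y t\<^sub>0 = y\<^sub>0 \<and>
    (\<forall>a b \<zeta>. \<zeta> \<in> {z, z'} \<longrightarrow> t\<^sub>0 \<le> a \<longrightarrow> a \<le> b \<longrightarrow> b \<le> T \<longrightarrow> y b - y a = (x b - x a) \<bullet> \<zeta> -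
        integral {a..b} (\<lambda>s. H s (stop_path T x (grid t\<^sub>0 (\<delta> n) s)) (y (grid t\<^sub>0 (\<delta> n) s)) \<zeta>)))"
  have "\<exists>x y. approx n x y" for n
    by (rule euler_approximation [OF x0 t0 \<delta>, of y\<^sub>0 z z' n]) (unfold approx_def, blast)
  then obtain xs ys where ap: "\<And>n. approx n (xs n) (ys n)" by metis
  have xs: "\<And>n. xs n \<in> X_set T L\<^sub>H t\<^sub>0 x\<^sub>0" and ysc: "\<And>n. continuous_on {t\<^sub>0..T} (ys n)"
    and ys0: "\<And>n. ys n t\<^sub>0 = y\<^sub>0"
    and inc: "\<And>n a b \<zeta>. \<lbrakk>\<zeta> \<in> {z, z'}; t\<^sub>0 \<le> a; a \<le> b; b \<le> T\<rbrakk> \<Longrightarrow> ys n b - ys n a = (xs n b - xs n a) \<bullet> \<zeta> -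
        integral {a..b} (\<lambda>s. H s (stop_path T (xs n) (grid t\<^sub>0 (\<delta> n) s)) (ys n (grid t\<^sub>0 (\<delta> n) s)) \<zeta>)"
    using ap unfolding approx_def by blast+
  note xsp = X_setD(1) [OF xs]
  define N1 where "N1 = Suc (nat \<lceil>2 * L\<^sub>H * T\<rceil>)"
  have N1: "2 * L\<^sub>H * T \<le> real N1" "N1 > 0" unfolding N1_def by linarith+
  define R where "R = 2 ^ N1 * (1 + running_sup x\<^sub>0 t\<^sub>0)"
  have R: "1 + running_sup (xs n) T \<le> R" for n
    unfolding R_def by (rule X_set_running_sup_bound [OF L_H_nonneg t0 xs N1])
  have R0: "R \<ge> 0" using R [of 0] running_sup_nonneg [OF xsp T_nonneg order_refl, of 0] by linarith
  have g: "t\<^sub>0 \<le> grid t\<^sub>0 (\<delta> n) s" "grid t\<^sub>0 (\<delta> n) s \<le> s" if "t\<^sub>0 \<le> s" "s \<le> T" for n s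
    using grid(1,2) [OF \<delta> that] by auto
  have sR: "1 + running_sup (stop_path T (xs n) (grid t\<^sub>0 (\<delta> n) s)) s \<le> R" if "t\<^sub>0 \<le> s" "s \<le> T" for n s
    using stopped_running_sup_le [OF xsp, of "grid t\<^sub>0 (\<delta> n) s" s T n] g [OF that, of n] R [of n] that t0 by auto
  have sp: "stop_path T (xs n) (grid t\<^sub>0 (\<delta> n) s) \<in> path_space T" if "t\<^sub>0 \<le> s" "s \<le> T" for n s
    by (rule stop_path_in_path_space [OF xsp]) (use g [OF that, of n] that t0 in auto)
  have fi: "(\<lambda>s. H s (stop_path T (xs n) (grid t\<^sub>0 (\<delta> n) s)) (ys n (grid t\<^sub>0 (\<delta> n) s)) \<zeta>) integrable_on {a..b}"
    if "t\<^sub>0 \<le> a" "b \<le> T" for n a b \<zeta>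
    by (rule euler_integrable [OF xsp ysc t0 \<delta> that])
  define K where "K = L\<^sub>H * norm z + H_slope z"
  have K: "K \<ge> 0" using L_H_nonneg H_slope_nonneg by (simp add: K_def)
  have step: "\<bar>ys n t - ys n s\<bar> \<le> K * (R + M) * (t - s)"
    if st: "t\<^sub>0 \<le> s" "s \<le> t" "t \<le> T" and M: "\<And>r. \<lbrakk>t\<^sub>0 \<le> r; r \<le> t\<rbrakk> \<Longrightarrow> \<bar>ys n r\<bar> \<le> M" for n s t M
  proof -
    let ?f = "\<lambda>s. H s (stop_path T (xs n) (grid t\<^sub>0 (\<delta> n) s)) (ys n (grid t\<^sub>0 (\<delta> n) s)) z"
    have M0: "M \<ge> 0" using M [of s] st by auto
    have "norm (xs n t - xs n s) \<le> L\<^sub>H * R * \<bar>t - s\<bar>"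
      by (rule X_set_Lipschitz [OF L_H_nonneg t0 xs]) (use st R L_H_nonneg in \<open>auto intro: mult_left_mono\<close>)
    also have "\<bar>t - s\<bar> = t - s" using st by simp
    also have "L\<^sub>H * R * (t - s) \<le> L\<^sub>H * (R + M) * (t - s)"
      by (rule mult_right_mono [OF mult_left_mono]) (use L_H_nonneg M0 st in auto)
    finally have "norm (xs n t - xs n s) * norm z \<le> L\<^sub>H * (R + M) * (t - s) * norm z"
      by (rule mult_right_mono) simp
    then have 1: "\<bar>(xs n t - xs n s) \<bullet> z\<bar> \<le> L\<^sub>H * norm z * (R + M) * (t - s)"
      using Cauchy_Schwarz_ineq2 [of "xs n t - xs n s" z] by (simp add: algebra_simps)
    have 2: "\<bar>integral {s..t} ?f\<bar> \<le> H_slope z * (R + M) * (t - s)"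
    proof (rule integral_good_bound)
      fix r assume r: "r \<in> {s..t}" "r \<in> good_times"
      then have r': "t\<^sub>0 \<le> r" "r \<le> T" using st by auto
      show "\<bar>?f r\<bar> \<le> H_slope z * (R + M)"
        by (rule H_bound' [OF r(2) sp [OF r'] sR [OF r'] M]) (use g [OF r', of n] r in auto)
    qed (use st t0 fi in auto)
    have "\<bar>ys n t - ys n s\<bar> \<le> \<bar>(xs n t - xs n s) \<bullet> z\<bar> + \<bar>integral {s..t} ?f\<bar>"
      using inc [of z s t n] st abs_triangle_ineq4 [of "(xs n t - xs n s) \<bullet> z" "integral {s..t} ?f"] by simp
    then show ?thesis using 1 2 by (simp add: K_def algebra_simps)
  qed
  define N where "N = Suc (nat \<lceil>2 * K * (T - t\<^sub>0)\<rceil>)"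
  have N: "2 * K * (T - t\<^sub>0) \<le> real N" "N > 0" unfolding N_def by linarith+
  define M where "M = 2 ^ N * (R + \<bar>y\<^sub>0\<bar>)"
  have yM: "\<bar>ys n t\<bar> \<le> M" if t: "t \<in> {t\<^sub>0..T}" for n t
  proof -
    have "t\<^sub>0 \<le> T" using t0 by simp
    have "\<bar>ys n t\<bar> \<le> 2 ^ N * (R + \<bar>ys n t\<^sub>0\<bar>)"
      by (rule sup_Gronwall [OF ysc \<open>t\<^sub>0 \<le> T\<close> K R0 N _ t]) (rule step)
    then show ?thesis by (simp add: M_def ys0)
  qed
  have lip: "\<bar>ys n u - ys n v\<bar> \<le> K * (R + M) * \<bar>u - v\<bar>" if uv: "u \<in> {t\<^sub>0..T}" "v \<in> {t\<^sub>0..T}" for n u v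
  proof (cases "u \<le> v")
    case True
    then have "\<bar>ys n v - ys n u\<bar> \<le> K * (R + M) * (v - u)" by (intro step yM) (use uv in auto)
    then show ?thesis using True by (simp add: abs_minus_commute)
  next
    case False
    then have "\<bar>ys n u - ys n v\<bar> \<le> K * (R + M) * (u - v)" by (intro step yM) (use uv in auto)
    then show ?thesis using False by simp
  qed
  have "d_infty T (t\<^sub>0, x\<^sub>0) (t\<^sub>0, x\<^sub>0) = 0"
    using d_infty_le [OF T_nonneg, of x\<^sub>0 t\<^sub>0 x\<^sub>0 t\<^sub>0 0] d_infty_ge(1) [OF x0 x0 t0 t0] by simp
  then have conv: "(\<lambda>n. d_infty T (t\<^sub>0, x\<^sub>0) (t\<^sub>0, x\<^sub>0)) \<longlonglongrightarrow> 0" by simp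
  obtain r x y where r: "strict_mono (r :: nat \<Rightarrow> nat)" and x: "x \<in> X_set T L\<^sub>H t\<^sub>0 x\<^sub>0"
    and xlim: "uniform_limit {0..T} (xs \<circ> r) x sequentially"
    and y: "continuous_on {t\<^sub>0..T} y" "y \<in> extensional {t\<^sub>0..T}" "y t\<^sub>0 = y\<^sub>0"
    and ylim: "\<And>\<tau> t. \<lbrakk>\<forall>\<^sub>F n in sequentially. \<tau> n \<in> {t\<^sub>0..T}; \<tau> \<longlonglongrightarrow> t\<rbrakk> \<Longrightarrow> (\<lambda>n. ys (r n) (\<tau> n)) \<longlonglongrightarrow> y t"
    by (rule X_set_y_compact [of L\<^sub>H "\<lambda>n. t\<^sub>0" T t\<^sub>0 "\<lambda>n. x\<^sub>0" x\<^sub>0 xs ys "K * (R + M)" y\<^sub>0,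
        OF L_H_nonneg t0 t0 x0 x0 xs conv lip]) (assumption | simp add: ys0 | rule that; (assumption | blast))+
  have xr: "uniform_limit {0..T} (\<lambda>n. xs (r n)) x sequentially" using xlim by (simp add: o_def)
  have xpt: "(\<lambda>n. xs (r n) s) \<longlonglongrightarrow> x s" if "s \<in> {0..T}" for s
    by (rule tendsto_uniform_limitI [OF xr that])
  have ypt: "(\<lambda>n. ys (r n) s) \<longlonglongrightarrow> y s" if "s \<in> {t\<^sub>0..T}" for s
    by (rule ylim) (use that in auto)
  have gr: "(\<lambda>n. grid t\<^sub>0 (\<delta> (r n)) s) \<longlonglongrightarrow> s" if "t\<^sub>0 \<le> s" "s \<le> T" for s
    using LIMSEQ_subseq_LIMSEQ [OF grid_refine [OF that] r] by (simp add: o_def \<delta>_def)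
  have "(x, y) \<in> Y_set T H L\<^sub>H t\<^sub>0 x\<^sub>0 y\<^sub>0 \<zeta>" if \<zeta>: "\<zeta> \<in> {z, z'}" for \<zeta>
  proof (rule Y_setI_increments [OF L_H_nonneg t0 x y(2,1,3)])
    fix a b assume ab: "t\<^sub>0 < a" "a \<le> b" "b \<le> T"
    let ?X = "\<lambda>n s. stop_path T (xs (r n)) (grid t\<^sub>0 (\<delta> (r n)) s)"
    let ?\<eta> = "\<lambda>n s. ys (r n) (grid t\<^sub>0 (\<delta> (r n)) s)"
    note A = H_dominated_limit(2) [of a b ?X ?\<eta> \<zeta> "stop_path T x" y R M]
    have "(\<lambda>n. integral {a..b} (\<lambda>s. H s (?X n s) (?\<eta> n s) \<zeta>)) \<longlonglongrightarrow> integral {a..b} (\<lambda>s. H s (stop_path T x s) (y s) \<zeta>)"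
    proof (rule A)
      fix s assume s: "s \<in> {a..b}"
      then have s': "t\<^sub>0 \<le> s" "s \<le> T" using ab by auto
      show "uniform_limit {0..T} (\<lambda>n. ?X n s) (stop_path T x s) sequentially"
        by (rule stop_path_tendsto [OF L_H_nonneg t0 x xr g(1) [OF s'] g(2) [OF s'] gr [OF s'] s'(2)])
      show "(\<lambda>n. ?\<eta> n s) \<longlonglongrightarrow> y s"
        by (rule ylim [OF _ gr [OF s']]) (use g [OF s'] s' in \<open>auto intro: always_eventually order_trans\<close>)
      show "\<bar>?\<eta> n s\<bar> \<le> M" for n
        by (rule yM) (use g [OF s', of "r n"] s' in auto)
      show "?X n s \<in> path_space T" for n by (rule sp [OF s'])
      show "1 + running_sup (?X n s) s \<le> R" for n by (rule sR [OF s'])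
      show "stop_path T x s \<in> path_space T"
        by (rule stop_path_in_path_space [OF X_setD(1) [OF x]]) (use s' t0 in auto)
    qed (use ab t0 fi in auto)
    also have "integral {a..b} (\<lambda>s. H s (stop_path T x s) (y s) \<zeta>) = integral {a..b} (\<lambda>s. H s x (y s) \<zeta>)"
    proof (rule Henstock_Kurzweil_Integration.integral_cong)
      fix s assume s: "s \<in> {a..b}"
      show "H s (stop_path T x s) (y s) \<zeta> = H s x (y s) \<zeta>"
        by (rule H_nonanticipating [OF _ stop_path_in_path_space [OF X_setD(1) [OF x]] X_setD(1) [OF x]])
           (use s ab t0 in \<open>auto simp: stop_path_def\<close>)
    qed
    finally have lim: "(\<lambda>n. integral {a..b} (\<lambda>s. H s (?X n s) (?\<eta> n s) \<zeta>)) \<longlonglongrightarrow> integral {a..b} (\<lambda>s. H s x (y s) \<zeta>)" .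
    have "(\<lambda>n. (xs (r n) b - xs (r n) a) \<bullet> \<zeta> - integral {a..b} (\<lambda>s. H s (?X n s) (?\<eta> n s) \<zeta>))
        \<longlonglongrightarrow> (x b - x a) \<bullet> \<zeta> - integral {a..b} (\<lambda>s. H s x (y s) \<zeta>)"
      by (intro tendsto_intros xpt lim) (use ab t0 in auto)
    moreover have "(xs (r n) b - xs (r n) a) \<bullet> \<zeta> - integral {a..b} (\<lambda>s. H s (?X n s) (?\<eta> n s) \<zeta>) = ys (r n) b - ys (r n) a" for n
      using inc [OF \<zeta>, of a b "r n"] ab by simp
    ultimately have "(\<lambda>n. ys (r n) b - ys (r n) a) \<longlonglongrightarrow> (x b - x a) \<bullet> \<zeta> - integral {a..b} (\<lambda>s. H s x (y s) \<zeta>)"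
      by simp
    moreover have "(\<lambda>n. ys (r n) b - ys (r n) a) \<longlonglongrightarrow> y b - y a"
      by (intro tendsto_intros ypt) (use ab in auto)
    ultimately show "y b - y a = (x b - x a) \<bullet> \<zeta> - integral {a..b} (\<lambda>s. H s x (y s) \<zeta>)"
      using LIMSEQ_unique by blast
  qed
  then show ?thesis by blast
qed

end

section \<open>Lower semicontinuous envelopes\<close>

lemma d_infty_triangle:
  fixes x x' x'' :: "real \<Rightarrow> real^'n"
  assumes "x \<in> path_space T" "x' \<in> path_space T" "x'' \<in> path_space T" "t \<in> {0..T}" "s \<in> {0..T}" "r \<in> {0..T}"
  shows "d_infty T (t, x) (r, x'') \<le> d_infty T (t, x) (s, x') + d_infty T (s, x') (r, x'')"
proof -
  let ?f = "\<lambda>q. norm (x (min q t) - x' (min q s))" and ?g = "\<lambda>q. norm (x' (min q s) - x'' (min q r))"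
  have "(SUP q\<in>{0..T}. norm (x (min q t) - x'' (min q r))) \<le> (SUP q\<in>{0..T}. ?f q) + (SUP q\<in>{0..T}. ?g q)"
  proof (rule cSUP_least)
    fix q assume q: "q \<in> {0..T}"
    have "norm (x (min q t) - x'' (min q r)) \<le> ?f q + ?g q"
      using norm_triangle_ineq [of "x (min q t) - x' (min q s)" "x' (min q s) - x'' (min q r)"] by simp
    moreover have "?f q \<le> (SUP q\<in>{0..T}. ?f q)"
      using d_infty_bdd_above [of x T x' t s] assms q by (intro cSUP_upper) auto
    moreover have "?g q \<le> (SUP q\<in>{0..T}. ?g q)"
      using d_infty_bdd_above [of x' T x'' s r] assms q by (intro cSUP_upper) auto
    ultimately show "norm (x (min q t) - x'' (min q r)) \<le> (SUP q\<in>{0..T}. ?f q) + (SUP q\<in>{0..T}. ?g q)"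
      by linarith
  qed (use assms in auto)
  then show ?thesis by (simp add: d_infty_def)
qed

lemma d_infty_self:
  fixes x :: "real \<Rightarrow> real^'n"
  assumes "x \<in> path_space T" "t \<in> {0..T}"
  shows "d_infty T (t, x) (t, x) = 0"
  using d_infty_le [of T x t x t 0] d_infty_ge(1) [OF assms(1) assms(1) assms(2) assms(2)] assms by simp

lemma d_infty_commute: "d_infty T p q = d_infty T q p"
  by (cases p; cases q) (simp add: d_infty_def norm_minus_commute)

lemma d_infty_cong:
  fixes x x' :: "real \<Rightarrow> real^'n"
  assumes "\<And>r. \<lbrakk>0 \<le> r; r \<le> t\<rbrakk> \<Longrightarrow> x r = x' r" "0 \<le> t"
  shows "d_infty T (t, x) p = d_infty T (t, x') p"
proof -
  have "(SUP r\<in>{0..T}. norm (x (min r t) - snd p (min r (fst p)))) = (SUP r\<in>{0..T}. norm (x' (min r t) - snd p (min r (fst p))))"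
    by (rule SUP_cong) (use assms in auto)
  then show ?thesis by (cases p) (simp add: d_infty_def)
qed

text \<open>
The limit path is Lipschitz after \<open>s\<^sub>0\<close>, so moving the stopping time changes the stopped path little.
\<close>

lemma d_infty_tendsto_0:
  fixes xs :: "nat \<Rightarrow> real \<Rightarrow> real^'n"
  assumes L: "L \<ge> 0" and s0: "s\<^sub>0 \<in> {0..T}" and x: "x \<in> X_set T L s\<^sub>0 x\<^sub>0"
    and lim: "uniform_limit {0..T} xs x sequentially"
    and ts: "\<forall>\<^sub>F n in sequentially. ts n \<in> {s\<^sub>0..T}" "ts \<longlonglongrightarrow> t" and t: "t \<in> {s\<^sub>0..T}" and e: "e > 0"
  shows "\<forall>\<^sub>F n in sequentially. d_infty T (t, x) (ts n, xs n) < e"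
proof -
  have T0: "0 \<le> T" using s0 by auto
  define K where "K = L * (1 + running_sup x T) + 1"
  have K: "K \<ge> 1" using L running_sup_nonneg [OF X_setD(1) [OF x] T0 order_refl] by (simp add: K_def)
  have "\<forall>\<^sub>F n in sequentially. dist (ts n) t < e / (4 * K)"
    by (rule tendstoD [OF ts(2)]) (use e K in simp)
  moreover have "\<forall>\<^sub>F n in sequentially. \<forall>r\<in>{0..T}. dist (xs n r) (x r) < e / 4"
  proof -
    have "e / 4 > 0" using e by simp
    then show ?thesis using lim unfolding uniform_limit_iff by blast
  qed
  ultimately show ?thesis using ts(1)
  proof eventually_elim
    case (elim n)
    have Kt: "K * \<bar>t - ts n\<bar> < e / 4" using elim(1) K by (simp add: dist_real_def field_simps abs_minus_commute)
    have t4: "\<bar>t - ts n\<bar> \<le> K * \<bar>t - ts n\<bar>" using mult_right_mono [OF K, of "\<bar>t - ts n\<bar>"] by simp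
    have "d_infty T (t, x) (ts n, xs n) \<le> \<bar>t - ts n\<bar> + e / 2"
    proof (rule d_infty_le [OF T0])
      fix r assume r: "r \<in> {0..T}"
      have "norm (x (min r (ts n)) - xs n (min r (ts n))) < e / 4"
        using elim(2,3) r s0 by (auto simp: dist_norm norm_minus_commute)
      moreover have "norm (x (min r t) - x (min r (ts n))) \<le> K * \<bar>t - ts n\<bar>"
      proof (cases "s\<^sub>0 \<le> r")
        case True
        have "norm (x (min r t) - x (min r (ts n))) \<le> K * \<bar>min r t - min r (ts n)\<bar>"
          by (rule X_set_Lipschitz [OF L s0 x]) (use True r t elim(3) in \<open>auto simp: K_def\<close>)
        also have "\<dots> \<le> K * \<bar>t - ts n\<bar>" using K by (intro mult_left_mono) auto
        finally show ?thesis .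
      next
        case False
        then have "min r t = r" "min r (ts n) = r" using t elim(3) by auto
        then show ?thesis using K by simp
      qed
      moreover have "norm (x (min r t) - xs n (min r (ts n))) \<le>
          norm (x (min r t) - x (min r (ts n))) + norm (x (min r (ts n)) - xs n (min r (ts n)))"
        using norm_triangle_ineq [of "x (min r t) - x (min r (ts n))" "x (min r (ts n)) - xs n (min r (ts n))"] by simp
      ultimately show "norm (x (min r t) - xs n (min r (ts n))) \<le> e / 2" using Kt by linarith
    qed
    then show ?case using Kt t4 e by linarith
  qed
qed

definition lsc_envelope ::
  "real \<Rightarrow> (real \<Rightarrow> (real \<Rightarrow> real^'n) \<Rightarrow> ereal) \<Rightarrow> real \<Rightarrow> (real \<Rightarrow> real^'n) \<Rightarrow> ereal" where
  "lsc_envelope T u t x = (SUP \<delta>\<in>{0<..}. INF p\<in>{(s, x'). s \<in> {0..T} \<and> x' \<in> path_space T \<and> d_infty T (t, x) (s, x') < \<delta>}.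
      u (fst p) (snd p))"

lemma lsc_envelope_cong:
  fixes x x' :: "real \<Rightarrow> real^'n"
  assumes "\<And>r. \<lbrakk>0 \<le> r; r \<le> t\<rbrakk> \<Longrightarrow> x r = x' r" "0 \<le> t"
  shows "lsc_envelope T u t x = lsc_envelope T u t x'"
  unfolding lsc_envelope_def by (simp add: d_infty_cong [of t x x', OF assms])

lemma lsc_envelope_le:
  fixes x :: "real \<Rightarrow> real^'n"
  assumes "x \<in> path_space T" "t \<in> {0..T}"
  shows "lsc_envelope T u t x \<le> u t x"
  unfolding lsc_envelope_def
proof (rule SUP_least)
  fix \<delta> :: real assume "\<delta> \<in> {0<..}"
  then show "(INF p\<in>{(s, x'). s \<in> {0..T} \<and> x' \<in> path_space T \<and> d_infty T (t, x) (s, x') < \<delta>}. u (fst p) (snd p)) \<le> u t x"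
    by (intro INF_lower2 [of "(t, x)"]) (use assms d_infty_self [OF assms] in auto)
qed

lemma lsc_envelope_approx:
  fixes x :: "real \<Rightarrow> real^'n"
  assumes "lsc_envelope T u t x < c" "\<delta> > 0"
  obtains s x' where "s \<in> {0..T}" "x' \<in> path_space T" "d_infty T (t, x) (s, x') < \<delta>" "u s x' < c"
proof -
  let ?A = "{(s, x'). s \<in> {0..T} \<and> x' \<in> path_space T \<and> d_infty T (t, x) (s, x') < \<delta>}"
  have "(INF p\<in>?A. u (fst p) (snd p)) \<le> lsc_envelope T u t x"
    unfolding lsc_envelope_def by (rule SUP_upper) (use assms in auto)
  then have "(INF p\<in>?A. u (fst p) (snd p)) < c" using assms by order
  then obtain p where "p \<in> ?A" "u (fst p) (snd p) < c" by (auto simp: INF_less_iff)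
  then show ?thesis using that by (cases p) auto
qed

text \<open>
Both conclusions hold with one radius: \<open>u\<close> exceeds \<open>c\<close> on a ball around \<open>(t,x)\<close>, hence the envelope
does on the ball of half the radius.
\<close>

lemma lsc_envelope_lower:
  fixes x :: "real \<Rightarrow> real^'n"
  assumes "c < lsc_envelope T u t x"
  obtains \<delta> where "\<delta> > 0" "\<And>s x'. \<lbrakk>s \<in> {0..T}; x' \<in> path_space T; d_infty T (t, x) (s, x') < \<delta>\<rbrakk> \<Longrightarrow> c < u s x'"
    "\<And>s x'. \<lbrakk>t \<in> {0..T}; x \<in> path_space T; s \<in> {0..T}; x' \<in> path_space T; d_infty T (t, x) (s, x') < \<delta>\<rbrakk>
      \<Longrightarrow> c < lsc_envelope T u s x'"
proof -
  let ?A = "\<lambda>\<delta>. {(s, x'). s \<in> {0..T} \<and> x' \<in> path_space T \<and> d_infty T (t, x) (s, x') < \<delta>}"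
  obtain \<delta> where \<delta>: "\<delta> > 0" "c < (INF p\<in>?A \<delta>. u (fst p) (snd p))"
    using assms unfolding lsc_envelope_def less_SUP_iff by auto
  have 1: "c < u s x'" if "s \<in> {0..T}" "x' \<in> path_space T" "d_infty T (t, x) (s, x') < \<delta>" for s x'
  proof -
    have "(INF p\<in>?A \<delta>. u (fst p) (snd p)) \<le> u s x'" by (rule INF_lower2 [of "(s, x')"]) (use that in auto)
    then show ?thesis using \<delta>(2) by order
  qed
  have 2: "c < lsc_envelope T u s x'"
    if tx: "t \<in> {0..T}" "x \<in> path_space T" and s: "s \<in> {0..T}" "x' \<in> path_space T" "d_infty T (t, x) (s, x') < \<delta> / 2" for s x'
  proof -
    let ?B = "{(r, x''). r \<in> {0..T} \<and> x'' \<in> path_space T \<and> d_infty T (s, x') (r, x'') < \<delta> / 2}"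
    have "?B \<subseteq> ?A \<delta>"
    proof clarsimp
      fix r x'' assume r: "0 \<le> r" "r \<le> T" "x'' \<in> path_space T" "d_infty T (s, x') (r, x'') * 2 < \<delta>"
      have "d_infty T (t, x) (r, x'') \<le> d_infty T (t, x) (s, x') + d_infty T (s, x') (r, x'')"
        by (rule d_infty_triangle) (use tx s r in auto)
      then show "d_infty T (t, x) (r, x'') < \<delta>" using s(3) r(4) by linarith
    qed
    then have "(INF p\<in>?A \<delta>. u (fst p) (snd p)) \<le> (INF p\<in>?B. u (fst p) (snd p))" by (rule INF_superset_mono) simp
    also have "\<dots> \<le> lsc_envelope T u s x'"
      unfolding lsc_envelope_def by (rule SUP_upper) (use \<delta> in auto)
    finally show ?thesis using \<delta>(2) by order
  qed
  show ?thesis by (rule that [of "\<delta> / 2"]) (use \<delta>(1) 1 2 in auto)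
qed

lemma Y_set_cong_initial:
  assumes "\<And>r. \<lbrakk>0 \<le> r; r \<le> s\<^sub>0\<rbrakk> \<Longrightarrow> x\<^sub>0 r = x\<^sub>0' r"
  shows "Y_set T H L s\<^sub>0 x\<^sub>0 y\<^sub>0 z = Y_set T H L s\<^sub>0 x\<^sub>0' y\<^sub>0 z"
proof -
  have "X_set T L s\<^sub>0 x\<^sub>0 = X_set T L s\<^sub>0 x\<^sub>0'" using assms by (auto simp: X_set_def)
  then show ?thesis by (simp add: Y_set_def)
qed

lemma minimax_supersolution_cong:
  assumes eq: "\<And>t x. \<lbrakk>t \<in> {0..T}; x \<in> path_space T\<rbrakk> \<Longrightarrow> u t x = v t x" and T: "0 \<le> T"
    and u: "minimax_supersolution T h H L u"
  shows "minimax_supersolution T h H L v"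
  unfolding minimax_supersolution_def
proof (intro conjI ballI allI impI)
  show "lsc_on_paths T v"
    using u eq unfolding minimax_supersolution_def lsc_on_paths_def by (metis (no_types, lifting))
  show "h x \<le> v T x" if "x \<in> path_space T" for x
    using u eq [of T x] that T unfolding minimax_supersolution_def by auto
  fix s\<^sub>0 x\<^sub>0 z y\<^sub>0 assume a: "s\<^sub>0 \<in> {0..<T}" "x\<^sub>0 \<in> path_space T" "v s\<^sub>0 x\<^sub>0 \<le> y\<^sub>0"
  then have "u s\<^sub>0 x\<^sub>0 \<le> y\<^sub>0" using eq [of s\<^sub>0 x\<^sub>0] by auto
  then obtain x y where xy: "(x, y) \<in> Y_set T H L s\<^sub>0 x\<^sub>0 y\<^sub>0 z" "\<forall>t\<in>{s\<^sub>0..T}. u t x \<le> y t"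
    using u a unfolding minimax_supersolution_def by blast
  have "x \<in> path_space T" using xy(1) by (auto simp: Y_set_def X_set_def)
  then have "\<forall>t\<in>{s\<^sub>0..T}. v t x \<le> y t" using xy(2) eq a by auto
  then show "\<exists>(x, y)\<in>Y_set T H L s\<^sub>0 x\<^sub>0 y\<^sub>0 z. \<forall>t\<in>{s\<^sub>0..T}. v t x \<le> y t" using xy(1) by blast
qed

lemma minimax_subsolution_dual:
  "minimax_subsolution T h H L u \<longleftrightarrow>
     minimax_supersolution T (\<lambda>x. - h x) (\<lambda>t x y z. - H t x (- y) (- z)) L (\<lambda>t x. - u t x)"
proof -
  let ?H = "\<lambda>t x y z. - H t x (- y) (- z)"
  have usc: "usc_on_paths T u \<longleftrightarrow> lsc_on_paths T (\<lambda>t x. - u t x)"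
  proof -
    have "(- u t x - e < - u s x') = (u s x' < u t x + e)" for t x s x' e by auto
    then show ?thesis unfolding usc_on_paths_def lsc_on_paths_def by simp
  qed
  have tr: "(\<forall>s\<^sub>0\<in>{0..<T}. \<forall>x\<^sub>0\<in>path_space T. \<forall>z. \<forall>y\<^sub>0. y\<^sub>0 \<le> u s\<^sub>0 x\<^sub>0 \<longrightarrow>
      (\<exists>(x, y)\<in>Y_set T H L s\<^sub>0 x\<^sub>0 y\<^sub>0 z. \<forall>t\<in>{s\<^sub>0..T}. y t \<le> u t x)) \<longleftrightarrow>
    (\<forall>s\<^sub>0\<in>{0..<T}. \<forall>x\<^sub>0\<in>path_space T. \<forall>z. \<forall>y\<^sub>0. - u s\<^sub>0 x\<^sub>0 \<le> y\<^sub>0 \<longrightarrow>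
      (\<exists>(x, y)\<in>Y_set T ?H L s\<^sub>0 x\<^sub>0 y\<^sub>0 z. \<forall>t\<in>{s\<^sub>0..T}. - u t x \<le> y t))" (is "?A \<longleftrightarrow> ?B")
  proof
    assume A: ?A
    show ?B
    proof (intro ballI allI impI)
      fix s\<^sub>0 x\<^sub>0 z y\<^sub>0 assume a: "s\<^sub>0 \<in> {0..<T}" "x\<^sub>0 \<in> path_space T" "- u s\<^sub>0 x\<^sub>0 \<le> y\<^sub>0"
      then have "- y\<^sub>0 \<le> u s\<^sub>0 x\<^sub>0" by simp
      then obtain x y where xy: "(x, y) \<in> Y_set T H L s\<^sub>0 x\<^sub>0 (- y\<^sub>0) (- z)" "\<forall>t\<in>{s\<^sub>0..T}. y t \<le> u t x"
        using A a by blast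
      show "\<exists>(x, y)\<in>Y_set T ?H L s\<^sub>0 x\<^sub>0 y\<^sub>0 z. \<forall>t\<in>{s\<^sub>0..T}. - u t x \<le> y t"
        using Y_set_dual [OF xy(1)] xy(2) by (intro bexI [of _ "(x, restrict (\<lambda>t. - y t) {s\<^sub>0..T})"]) auto
    qed
  next
    assume B: ?B
    show ?A
    proof (intro ballI allI impI)
      fix s\<^sub>0 x\<^sub>0 z y\<^sub>0 assume a: "s\<^sub>0 \<in> {0..<T}" "x\<^sub>0 \<in> path_space T" "y\<^sub>0 \<le> u s\<^sub>0 x\<^sub>0"
      then have "- u s\<^sub>0 x\<^sub>0 \<le> - y\<^sub>0" by simp
      then obtain x y where xy: "(x, y) \<in> Y_set T ?H L s\<^sub>0 x\<^sub>0 (- y\<^sub>0) (- z)" "\<forall>t\<in>{s\<^sub>0..T}. - u t x \<le> y t"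
        using B a by blast
      show "\<exists>(x, y)\<in>Y_set T H L s\<^sub>0 x\<^sub>0 y\<^sub>0 z. \<forall>t\<in>{s\<^sub>0..T}. y t \<le> u t x"
        using Y_set_dual [OF xy(1)] xy(2) by (intro bexI [of _ "(x, restrict (\<lambda>t. - y t) {s\<^sub>0..T})"]) auto
    qed
  qed
  show ?thesis unfolding minimax_subsolution_def minimax_supersolution_def usc tr by auto
qed

context tvp_data
begin

section \<open>One-step properties of the Perron infimum\<close>

text \<open>
The defining property of non-continuous supersolutions with a strict inequality at the end.  Unlike
an infimum that is at most zero, it provides an actual characteristic.
\<close>

definition one_step_super :: "(real \<Rightarrow> (real \<Rightarrow> real^'n) \<Rightarrow> ereal) \<Rightarrow> bool" where
  "one_step_super u \<longleftrightarrow> (\<forall>t\<^sub>0\<in>{0..<T}. \<forall>x\<^sub>0\<in>path_space T. \<forall>z y\<^sub>0. u t\<^sub>0 x\<^sub>0 < ereal y\<^sub>0 \<longrightarrow>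
     (\<forall>T\<^sub>0\<in>{t\<^sub>0<..T}. \<exists>(x, y)\<in>Y_set T H L\<^sub>H t\<^sub>0 x\<^sub>0 y\<^sub>0 z. u T\<^sub>0 x < ereal (y T\<^sub>0)))"

definition one_step_sub :: "(real \<Rightarrow> (real \<Rightarrow> real^'n) \<Rightarrow> ereal) \<Rightarrow> bool" where
  "one_step_sub u \<longleftrightarrow> (\<forall>t\<^sub>0\<in>{0..<T}. \<forall>x\<^sub>0\<in>path_space T. \<forall>z y\<^sub>0. ereal y\<^sub>0 < u t\<^sub>0 x\<^sub>0 \<longrightarrow>
     (\<forall>T\<^sub>0\<in>{t\<^sub>0<..T}. \<exists>(x, y)\<in>Y_set T H L\<^sub>H t\<^sub>0 x\<^sub>0 y\<^sub>0 z. ereal (y T\<^sub>0) < u T\<^sub>0 x))"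

text \<open>
An infimum that is at most zero gives a characteristic ending above \<open>u\<close> up to a small error.  Starting
it at a smaller \<open>y1 > u\<close> leaves the room \<open>y\<^sub>0 - y1\<close>, and shifting the characteristic up by this amount
removes the error.
\<close>

lemma noncontinuous_imp_one_step_super:
  assumes u: "noncontinuous_minimax_supersolution T h H L\<^sub>H u"
  shows "one_step_super u"
  unfolding one_step_super_def
proof (intro ballI allI impI)
  fix t\<^sub>0 x\<^sub>0 z y\<^sub>0 T\<^sub>0
  assume t0: "t\<^sub>0 \<in> {0..<T}" and x0: "x\<^sub>0 \<in> path_space T" and y0: "u t\<^sub>0 x\<^sub>0 < ereal y\<^sub>0" and T0: "T\<^sub>0 \<in> {t\<^sub>0<..T}"
  obtain y1 where y1: "u t\<^sub>0 x\<^sub>0 < ereal y1" "y1 < y\<^sub>0"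
    using ereal_dense2 [OF y0] by auto
  have "(INF (x, y)\<in>Y_set T H L\<^sub>H t\<^sub>0 x\<^sub>0 y1 z. u T\<^sub>0 x - ereal (y T\<^sub>0)) \<le> 0"
    using u t0 x0 y1(1) T0 unfolding noncontinuous_minimax_supersolution_def by blast
  also have "0 < ereal (y\<^sub>0 - y1)" using y1 by simp
  finally obtain x y where xy: "(x, y) \<in> Y_set T H L\<^sub>H t\<^sub>0 x\<^sub>0 y1 z" "u T\<^sub>0 x - ereal (y T\<^sub>0) < ereal (y\<^sub>0 - y1)"
    by (auto simp: INF_less_iff)
  obtain v where v: "(x, v) \<in> Y_set T H L\<^sub>H t\<^sub>0 x\<^sub>0 (y1 + (y\<^sub>0 - y1)) z" "\<forall>t\<in>{t\<^sub>0..T}. y t + (y\<^sub>0 - y1) \<le> v t"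
    using Y_set_shift_up [OF L_H_nonneg _ xy(1), of "y\<^sub>0 - y1"] t0 y1 by auto
  have "u T\<^sub>0 x < ereal (y T\<^sub>0 + (y\<^sub>0 - y1))"
    using xy(2) by (cases "u T\<^sub>0 x") auto
  also have "\<dots> \<le> ereal (v T\<^sub>0)" using v(2) T0 by auto
  finally show "\<exists>(x, y)\<in>Y_set T H L\<^sub>H t\<^sub>0 x\<^sub>0 y\<^sub>0 z. u T\<^sub>0 x < ereal (y T\<^sub>0)" using v(1) by auto
qed

lemma INF_diff_nonpos:
  fixes f :: "'b \<Rightarrow> ereal" and g :: "'b \<Rightarrow> real"
  assumes "p \<in> A" "f p \<le> ereal (g p)"
  shows "(INF p\<in>A. f p - ereal (g p)) \<le> 0"
proof -
  have "(INF p\<in>A. f p - ereal (g p)) \<le> f p - ereal (g p)" by (rule INF_lower [OF assms(1)])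
  also have "\<dots> \<le> 0" using assms(2) by (cases "f p") auto
  finally show ?thesis .
qed

lemma perron_infimum_le:
  "noncontinuous_minimax_supersolution T h H L\<^sub>H u \<Longrightarrow> perron_infimum T h H L\<^sub>H t x \<le> u t x"
  unfolding perron_infimum_def by (rule Inf_lower) blast

text \<open>
The function that equals \<open>h\<close> at time \<open>T\<close> and is infinite before is a competitor, so the infimum is
not taken over the empty family.
\<close>

lemma perron_infimum_terminal:
  assumes x: "x \<in> path_space T"
  shows "perron_infimum T h H L\<^sub>H T x = ereal (h x)"
proof -
  define w where "w = (\<lambda>t x. if t = T then ereal (h x) else \<infinity>)"
  have "noncontinuous_minimax_supersolution T h H L\<^sub>H w"
    by (auto simp: noncontinuous_minimax_supersolution_def w_def)
  from perron_infimum_le [OF this, of T x] have "perron_infimum T h H L\<^sub>H T x \<le> ereal (h x)"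
    by (simp add: w_def)
  moreover have "ereal (h x) \<le> perron_infimum T h H L\<^sub>H T x"
    unfolding perron_infimum_def
    by (rule Inf_greatest) (use x in \<open>auto simp: noncontinuous_minimax_supersolution_def\<close>)
  ultimately show ?thesis by (rule antisym)
qed

lemma perron_infimum_one_step_super: "one_step_super (perron_infimum T h H L\<^sub>H)"
  unfolding one_step_super_def
proof (intro ballI allI impI)
  fix t\<^sub>0 x\<^sub>0 z y\<^sub>0 T\<^sub>0
  assume t0: "t\<^sub>0 \<in> {0..<T}" and x0: "x\<^sub>0 \<in> path_space T" and y0: "perron_infimum T h H L\<^sub>H t\<^sub>0 x\<^sub>0 < ereal y\<^sub>0"
    and T0: "T\<^sub>0 \<in> {t\<^sub>0<..T}"
  obtain u where u: "noncontinuous_minimax_supersolution T h H L\<^sub>H u" "u t\<^sub>0 x\<^sub>0 < ereal y\<^sub>0"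
    using y0 unfolding perron_infimum_def Inf_less_iff by blast
  obtain x y where "(x, y) \<in> Y_set T H L\<^sub>H t\<^sub>0 x\<^sub>0 y\<^sub>0 z" "u T\<^sub>0 x < ereal (y T\<^sub>0)"
    using noncontinuous_imp_one_step_super [OF u(1)] t0 x0 u(2) T0 unfolding one_step_super_def by blast
  moreover from this(2) have "perron_infimum T h H L\<^sub>H T\<^sub>0 x < ereal (y T\<^sub>0)"
    using perron_infimum_le [OF u(1), of T\<^sub>0 x] by order
  ultimately show "\<exists>(x, y)\<in>Y_set T H L\<^sub>H t\<^sub>0 x\<^sub>0 y\<^sub>0 z. perron_infimum T h H L\<^sub>H T\<^sub>0 x < ereal (y T\<^sub>0)" by blast
qed

text \<open>
The function \<open>w\<close> below replaces the infimum \<open>u\<close> before \<open>\<tau>\<close> by the largest initial value from which a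
characteristic of slope \<open>\<zeta>\<close> ends below \<open>u\<close> at time \<open>\<tau>\<close>.  To see that \<open>w\<close> is a competitor, let
\<open>y\<^sub>0 > w(t\<^sub>0,x\<^sub>0)\<close> and take a characteristic from \<open>y\<^sub>0\<close> that serves both for the test slope \<open>z\<close> and for
\<open>\<zeta>\<close>.  By the choice of \<open>w\<close> it is above \<open>w\<close> before \<open>\<tau>\<close> and strictly above \<open>u\<close> at \<open>\<tau>\<close>, from where
the one-step property of \<open>u\<close> from above takes over.  As \<open>u\<close> lies below every competitor, \<open>u \<le> w\<close>.
\<close>

lemma perron_infimum_one_step_sub: "one_step_sub (perron_infimum T h H L\<^sub>H)"
  unfolding one_step_sub_def
proof (intro ballI allI impI)
  fix t\<^sub>1 x\<^sub>1 \<zeta> y\<^sub>1 \<tau>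
  let ?u = "perron_infimum T h H L\<^sub>H"
  assume t1: "t\<^sub>1 \<in> {0..<T}" and x1: "x\<^sub>1 \<in> path_space T" and y1: "ereal y\<^sub>1 < ?u t\<^sub>1 x\<^sub>1" and \<tau>: "\<tau> \<in> {t\<^sub>1<..T}"
  define A where "A = (\<lambda>t x. {y\<^sub>0. \<exists>(x', y)\<in>Y_set T H L\<^sub>H t x y\<^sub>0 \<zeta>. ereal (y \<tau>) \<le> ?u \<tau> x'})"
  define w where "w = (\<lambda>t x. if t < \<tau> then (SUP y\<^sub>0\<in>A t x. ereal y\<^sub>0) else ?u t x)"
  have w_upper: "ereal y\<^sub>0 \<le> w t x"
    if "t < \<tau>" "(x', y) \<in> Y_set T H L\<^sub>H t x y\<^sub>0 \<zeta>" "ereal (y \<tau>) \<le> ?u \<tau> x'" for t x y\<^sub>0 x' y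
    unfolding w_def using that by (auto simp: A_def intro!: SUP_upper)
  have "noncontinuous_minimax_supersolution T h H L\<^sub>H w"
    unfolding noncontinuous_minimax_supersolution_def
  proof (intro conjI ballI allI impI)
    show "w T x = ereal (h x)" if "x \<in> path_space T" for x
      using perron_infimum_terminal [OF that] \<tau> by (simp add: w_def)
    fix t\<^sub>0 x\<^sub>0 z y\<^sub>0 T\<^sub>0
    assume t0: "t\<^sub>0 \<in> {0..<T}" and x0: "x\<^sub>0 \<in> path_space T" and y0: "w t\<^sub>0 x\<^sub>0 < ereal y\<^sub>0" and T0: "T\<^sub>0 \<in> {t\<^sub>0<..T}"
    have t0': "t\<^sub>0 \<in> {0..T}" using t0 by auto
    have suff: "(INF (x, y)\<in>Y_set T H L\<^sub>H t\<^sub>0 x\<^sub>0 y\<^sub>0 z. w T\<^sub>0 x - ereal (y T\<^sub>0)) \<le> 0" if "(x, y) \<in> Y_set T H L\<^sub>H t\<^sub>0 x\<^sub>0 y\<^sub>0 z" "w T\<^sub>0 x \<le> ereal (y T\<^sub>0)" for x y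
      using INF_diff_nonpos [of "(x, y)" _ "\<lambda>p. w T\<^sub>0 (fst p)" "\<lambda>p. snd p T\<^sub>0"] that
      by (simp add: case_prod_unfold)
    show "(INF (x, y)\<in>Y_set T H L\<^sub>H t\<^sub>0 x\<^sub>0 y\<^sub>0 z. w T\<^sub>0 x - ereal (y T\<^sub>0)) \<le> 0"
    proof (cases "t\<^sub>0 < \<tau>")
      case False
      then have "?u t\<^sub>0 x\<^sub>0 < ereal y\<^sub>0" using y0 by (simp add: w_def)
      then obtain x y where xy: "(x, y) \<in> Y_set T H L\<^sub>H t\<^sub>0 x\<^sub>0 y\<^sub>0 z" "?u T\<^sub>0 x < ereal (y T\<^sub>0)"
        using perron_infimum_one_step_super t0 x0 T0 unfolding one_step_super_def by blast
      show ?thesis by (rule suff [OF xy(1)]) (use xy(2) False T0 in \<open>auto simp: w_def\<close>)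
    next
      case True
      obtain x y where xz: "(x, y) \<in> Y_set T H L\<^sub>H t\<^sub>0 x\<^sub>0 y\<^sub>0 z" and x\<zeta>: "(x, y) \<in> Y_set T H L\<^sub>H t\<^sub>0 x\<^sub>0 y\<^sub>0 \<zeta>"
        using characteristic_exists [OF x0 t0'] by blast
      have xp: "x \<in> path_space T" by (rule Y_setD(4) [OF xz])
      show ?thesis
      proof (cases "T\<^sub>0 < \<tau>")
        case T0\<tau>: True
        \<comment> \<open>Otherwise a characteristic of slope \<open>\<zeta>\<close> from above \<open>y T\<^sub>0\<close>, shifted down and glued to \<open>(x, y)\<close>, would show \<open>y\<^sub>0 \<le> w t\<^sub>0 x\<^sub>0\<close>.\<close>
        have "w T\<^sub>0 x \<le> ereal (y T\<^sub>0)"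
        proof (rule ccontr)
          assume "\<not> ?thesis"
          then have "ereal (y T\<^sub>0) < (SUP y\<^sub>0\<in>A T\<^sub>0 x. ereal y\<^sub>0)" using T0\<tau> by (simp add: w_def)
          then obtain y2 where y2: "y2 \<in> A T\<^sub>0 x" "y T\<^sub>0 < y2" by (auto simp: less_SUP_iff)
          then obtain x' y' where x'y': "(x', y') \<in> Y_set T H L\<^sub>H T\<^sub>0 x y2 \<zeta>" "ereal (y' \<tau>) \<le> ?u \<tau> x'"
            by (auto simp: A_def)
          have T0': "T\<^sub>0 \<in> {0..T}" using T0 t0 by auto
          obtain v where v: "(x', v) \<in> Y_set T H L\<^sub>H T\<^sub>0 x (y2 - (y2 - y T\<^sub>0)) \<zeta>" "\<forall>t\<in>{T\<^sub>0..T}. v t \<le> y' t - (y2 - y T\<^sub>0)"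
            using Y_set_shift_down [OF L_H_nonneg T0' x'y'(1), of "y2 - y T\<^sub>0"] y2 by auto
          have "(x', restrict (\<lambda>r. if r \<le> T\<^sub>0 then y r else v r) {t\<^sub>0..T}) \<in> Y_set T H L\<^sub>H t\<^sub>0 x\<^sub>0 y\<^sub>0 \<zeta>"
            by (rule Y_set_glue [OF L_H_nonneg t0' x\<zeta>]) (use v(1) T0 in auto)
          moreover have "ereal (restrict (\<lambda>r. if r \<le> T\<^sub>0 then y r else v r) {t\<^sub>0..T} \<tau>) \<le> ?u \<tau> x'"
          proof -
            have "v \<tau> \<le> y' \<tau>" using v(2) y2(2) T0\<tau> \<tau> by (force dest: bspec [of _ _ \<tau>])
            then have "ereal (v \<tau>) \<le> ?u \<tau> x'" using x'y'(2) order_trans ereal_less_eq(3) by blast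
            then show ?thesis using T0\<tau> \<tau> True by simp
          qed
          ultimately have "ereal y\<^sub>0 \<le> w t\<^sub>0 x\<^sub>0" by (rule w_upper [OF True])
          then show False using y0 by simp
        qed
        then show ?thesis by (rule suff [OF xz])
      next
        case F: False
        have y\<tau>: "?u \<tau> x < ereal (y \<tau>)"
        proof (rule ccontr)
          assume "\<not> ?thesis"
          then have "ereal (y \<tau>) \<le> ?u \<tau> x" by simp
          then have "ereal y\<^sub>0 \<le> w t\<^sub>0 x\<^sub>0" by (rule w_upper [OF True x\<zeta>])
          then show False using y0 by simp
        qed
        show ?thesis
        proof (cases "T\<^sub>0 = \<tau>")
          case True
          show ?thesis by (rule suff [OF xz]) (use True y\<tau> in \<open>auto simp: w_def\<close>)
        next
          case False
          then have \<tau>T0: "\<tau> < T\<^sub>0" using F by simp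
          then have "\<tau> \<in> {0..<T}" "T\<^sub>0 \<in> {\<tau><..T}" using t1 \<tau> T0 by auto
          then obtain x' y' where x': "(x', y') \<in> Y_set T H L\<^sub>H \<tau> x (y \<tau>) z" "?u T\<^sub>0 x' < ereal (y' T\<^sub>0)"
            using perron_infimum_one_step_super xp y\<tau> unfolding one_step_super_def by blast
          have "(x', restrict (\<lambda>r. if r \<le> \<tau> then y r else y' r) {t\<^sub>0..T}) \<in> Y_set T H L\<^sub>H t\<^sub>0 x\<^sub>0 y\<^sub>0 z"
            by (rule Y_set_glue [OF L_H_nonneg t0' xz _ x'(1)]) (use True \<tau> in auto)
          then show ?thesis
            by (rule suff) (use x'(2) \<tau>T0 T0 in \<open>auto simp: w_def\<close>)
        qed
      qed
    qed
  qed
  then have "?u t\<^sub>1 x\<^sub>1 \<le> w t\<^sub>1 x\<^sub>1" by (rule perron_infimum_le)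
  then have "ereal y\<^sub>1 < (SUP y\<^sub>0\<in>A t\<^sub>1 x\<^sub>1. ereal y\<^sub>0)" using y1 \<tau> by (simp add: w_def)
  then obtain y2 where y2: "y2 \<in> A t\<^sub>1 x\<^sub>1" "y\<^sub>1 < y2" by (auto simp: less_SUP_iff)
  then obtain x y where xy: "(x, y) \<in> Y_set T H L\<^sub>H t\<^sub>1 x\<^sub>1 y2 \<zeta>" "ereal (y \<tau>) \<le> ?u \<tau> x"
    by (auto simp: A_def)
  have t1': "t\<^sub>1 \<in> {0..T}" using t1 by auto
  obtain v where v: "(x, v) \<in> Y_set T H L\<^sub>H t\<^sub>1 x\<^sub>1 (y2 - (y2 - y\<^sub>1)) \<zeta>" "\<forall>t\<in>{t\<^sub>1..T}. v t \<le> y t - (y2 - y\<^sub>1)"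
    using Y_set_shift_down [OF L_H_nonneg t1' xy(1), of "y2 - y\<^sub>1"] y2 by auto
  have "v \<tau> < y \<tau>" using v(2) y2(2) \<tau> by (force dest: bspec [of _ _ \<tau>])
  then have "ereal (v \<tau>) < ?u \<tau> x" using xy(2) less_le_trans less_ereal.simps(1) by blast
  then show "\<exists>(x, y)\<in>Y_set T H L\<^sub>H t\<^sub>1 x\<^sub>1 y\<^sub>1 \<zeta>. ereal (y \<tau>) < ?u \<tau> x" using v(1) by auto
qed

lemma one_step_sub_dual:
  assumes "one_step_sub u"
  shows "tvp_data.one_step_super T (\<lambda>t x y z. - H t x (- y) (- z)) L\<^sub>H (\<lambda>t x. - u t x)"
proof -
  interpret dual: tvp_data T "\<lambda>x. - h x" "\<lambda>t x y z. - H t x (- y) (- z)" L\<^sub>H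
    by (rule tvp_data_dual)
  show ?thesis unfolding dual.one_step_super_def
  proof (intro ballI allI impI)
    fix t\<^sub>0 x\<^sub>0 z y\<^sub>0 T\<^sub>0
    assume t0: "t\<^sub>0 \<in> {0..<T}" and x0: "x\<^sub>0 \<in> path_space T" and y0: "- u t\<^sub>0 x\<^sub>0 < ereal y\<^sub>0" and T0: "T\<^sub>0 \<in> {t\<^sub>0<..T}"
    have "ereal (- y\<^sub>0) < u t\<^sub>0 x\<^sub>0" using y0 by (cases "u t\<^sub>0 x\<^sub>0") auto
    then obtain x y where xy: "(x, y) \<in> Y_set T H L\<^sub>H t\<^sub>0 x\<^sub>0 (- y\<^sub>0) (- z)" "ereal (y T\<^sub>0) < u T\<^sub>0 x"
      using assms t0 x0 T0 unfolding one_step_sub_def by blast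
    have "(x, restrict (\<lambda>t. - y t) {t\<^sub>0..T}) \<in> Y_set T (\<lambda>t x y z. - H t x (- y) (- z)) L\<^sub>H t\<^sub>0 x\<^sub>0 y\<^sub>0 z"
      using Y_set_dual [OF xy(1)] by simp
    moreover have "- u T\<^sub>0 x < ereal (restrict (\<lambda>t. - y t) {t\<^sub>0..T} T\<^sub>0)"
      using xy(2) T0 by (cases "u T\<^sub>0 x") auto
    ultimately show "\<exists>(x, y)\<in>Y_set T (\<lambda>t x y z. - H t x (- y) (- z)) L\<^sub>H t\<^sub>0 x\<^sub>0 y\<^sub>0 z. - u T\<^sub>0 x < ereal (y T\<^sub>0)"
      by blast
  qed
qed

section \<open>Envelopes of one-step supersolutions\<close>

lemma Y_set_terminal:
  assumes x: "x \<in> path_space T"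
  shows "(x, restrict (\<lambda>_. y\<^sub>0) {T..T}) \<in> Y_set T H L\<^sub>H T x y\<^sub>0 z"
proof (rule Y_setI_increments [OF L_H_nonneg])
  show "x \<in> X_set T L\<^sub>H T x"
  proof (subst X_set_iff [OF L_H_nonneg], use T_pos in simp, intro conjI allI impI x)
    fix a b assume "T \<le> a" "a \<le> b" "b \<le> T"
    then have "a = b" by simp
    then show "norm (x b - x a) \<le> L\<^sub>H * (1 + running_sup x b) * (b - a)" by simp
  qed simp
qed (use T_pos in auto)

lemma one_step_super_terminal:
  assumes u: "one_step_super u" and uT: "\<And>x. x \<in> path_space T \<Longrightarrow> u T x = ereal (h x)"
    and t0: "t\<^sub>0 \<in> {0..T}" and x0: "x\<^sub>0 \<in> path_space T" and y0: "u t\<^sub>0 x\<^sub>0 < ereal y\<^sub>0"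
  obtains x y where "(x, y) \<in> Y_set T H L\<^sub>H t\<^sub>0 x\<^sub>0 y\<^sub>0 z" "h x \<le> y T"
proof (cases "t\<^sub>0 < T")
  case True
  then obtain x y where xy: "(x, y) \<in> Y_set T H L\<^sub>H t\<^sub>0 x\<^sub>0 y\<^sub>0 z" "u T x < ereal (y T)"
    using u t0 x0 y0 unfolding one_step_super_def by force
  then show ?thesis using that [OF xy(1)] uT [OF Y_setD(4) [OF xy(1)]] by simp
next
  case False
  then have "t\<^sub>0 = T" using t0 by simp
  then show ?thesis using that Y_set_terminal [OF x0, of y\<^sub>0 z] uT [OF x0] y0 by simp
qed

text \<open>
Otherwise there are points converging to \<open>(t\<^sub>0,x\<^sub>0)\<close> at which \<open>u < -n\<close>.  The characteristics starting
there with value \<open>-n\<close> that end above \<open>h\<close>, shifted up by \<open>n\<close>, start with value \<open>0\<close> and end above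
\<open>h + n\<close>, which contradicts compactness.
\<close>

lemma lsc_envelope_not_MInf:
  assumes u: "one_step_super u" and uT: "\<And>x. x \<in> path_space T \<Longrightarrow> u T x = ereal (h x)"
    and t0: "t\<^sub>0 \<in> {0..T}" and x0: "x\<^sub>0 \<in> path_space T"
  shows "lsc_envelope T u t\<^sub>0 x\<^sub>0 \<noteq> - \<infinity>"
proof
  assume inf: "lsc_envelope T u t\<^sub>0 x\<^sub>0 = - \<infinity>"
  define P where "P = (\<lambda>n s x' x y. s \<in> {0..T} \<and> x' \<in> path_space T \<and> d_infty T (t\<^sub>0, x\<^sub>0) (s, x') < inverse (real (Suc n)) \<and>
      (x, y) \<in> Y_set T H L\<^sub>H s x' 0 0 \<and> h x + real n \<le> y T)"
  have "\<exists>s x' x y. P n s x' x y" for n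
  proof -
    have "lsc_envelope T u t\<^sub>0 x\<^sub>0 < ereal (- real n)" by (simp add: inf)
    then obtain s x' where s: "s \<in> {0..T}" "x' \<in> path_space T" "d_infty T (t\<^sub>0, x\<^sub>0) (s, x') < inverse (real (Suc n))"
        "u s x' < ereal (- real n)"
      by (rule lsc_envelope_approx [of T u t\<^sub>0 x\<^sub>0 _ "inverse (real (Suc n))"]) auto
    obtain x y where xy: "(x, y) \<in> Y_set T H L\<^sub>H s x' (- real n) 0" "h x \<le> y T"
      by (rule one_step_super_terminal [OF u uT s(1,2,4)])
    obtain v where "(x, v) \<in> Y_set T H L\<^sub>H s x' (- real n + real n) 0" "\<forall>t\<in>{s..T}. y t + real n \<le> v t"
      using Y_set_shift_up [OF L_H_nonneg s(1) xy(1), of "real n"] by auto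
    moreover from this(2) have "h x + real n \<le> v T" using xy(2) s(1) by force
    ultimately show ?thesis using s unfolding P_def by auto
  qed
  then obtain s x' xs ys where P: "\<And>n. P n (s n) (x' n) (xs n) (ys n)" by metis
  have s: "s n \<in> {0..T}" "x' n \<in> path_space T" and d: "d_infty T (t\<^sub>0, x\<^sub>0) (s n, x' n) < inverse (real (Suc n))"
    and Y: "(xs n, ys n) \<in> Y_set T H L\<^sub>H (s n) (x' n) 0 0" and hy: "h (xs n) + real n \<le> ys n T" for n
    using P [of n] unfolding P_def by auto
  have conv: "(\<lambda>n. d_infty T (t\<^sub>0, x\<^sub>0) (s n, x' n)) \<longlonglongrightarrow> 0"
  proof (rule tendsto_sandwich [OF _ _ tendsto_const LIMSEQ_inverse_real_of_nat])
    show "\<forall>\<^sub>F n in sequentially. 0 \<le> d_infty T (t\<^sub>0, x\<^sub>0) (s n, x' n)"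
      using d_infty_ge(1) [OF x0 s(2) t0 s(1)] by (intro always_eventually allI) (rule order_trans [OF abs_ge_zero])
  qed (use d in \<open>auto simp: less_imp_le\<close>)
  obtain r x y where r: "strict_mono (r :: nat \<Rightarrow> nat)" and xy: "(x, y) \<in> Y_set T H L\<^sub>H t\<^sub>0 x\<^sub>0 0 0"
    and xlim: "uniform_limit {0..T} (xs \<circ> r) x sequentially"
    and ylim: "\<And>\<tau> t. \<lbrakk>\<forall>\<^sub>F n in sequentially. \<tau> n \<in> {s (r n)..T}; \<tau> \<longlonglongrightarrow> t\<rbrakk> \<Longrightarrow> (\<lambda>n. ys (r n) (\<tau> n)) \<longlonglongrightarrow> y t"
    by (rule Y_set_compact [OF L_H_nonneg s(1) t0 s(2) x0 conv Y tendsto_const], rule that; (assumption | blast))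
  have "(\<lambda>n. h ((xs \<circ> r) n)) \<longlonglongrightarrow> h x"
    by (rule h_tendsto [OF _ Y_setD(4) [OF xy] xlim]) (use Y_setD(4) [OF Y] in auto)
  moreover have "(\<lambda>n. ys (r n) T) \<longlonglongrightarrow> y T" by (rule ylim) (use s(1) in auto)
  ultimately have "(\<lambda>n. ys (r n) T - h ((xs \<circ> r) n)) \<longlonglongrightarrow> y T - h x" by (intro tendsto_diff)
  then have "Bseq (\<lambda>n. ys (r n) T - h ((xs \<circ> r) n))" by (rule convergent_imp_Bseq [OF convergentI])
  then obtain B where B: "\<And>n. \<bar>ys (r n) T - h ((xs \<circ> r) n)\<bar> \<le> B" by (auto simp: Bseq_def)
  obtain n :: nat where n: "B < real n" using reals_Archimedean2 by blast
  have "real n \<le> real (r n)" using seq_suble [OF r, of n] by simp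
  then show False using hy [of "r n"] B [of n] n by (simp add: abs_le_iff)
qed

text \<open>
The function \<open>u\<close> may depend on the future of a path, and each extension of the chain changes the path after the current partition point.  So the inequality at a partition point is stated
for some path that agrees with the final one up to that point.  A step length of zero occurs when the
chain starts at time \<open>T\<close>.
\<close>

lemma one_step_super_chain:
  assumes u: "one_step_super u" and t0: "t\<^sub>0 \<in> {0..T}" and x0: "x\<^sub>0 \<in> path_space T" and y0: "u t\<^sub>0 x\<^sub>0 < ereal y\<^sub>0"
    and \<delta>: "\<delta> \<ge> 0" and i: "t\<^sub>0 + real i * \<delta> \<le> T"
  shows "\<exists>(x, y)\<in>Y_set T H L\<^sub>H t\<^sub>0 x\<^sub>0 y\<^sub>0 z. \<forall>j\<le>i. \<exists>x'\<in>path_space T.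
    (\<forall>r. 0 \<le> r \<longrightarrow> r \<le> t\<^sub>0 + real j * \<delta> \<longrightarrow> x r = x' r) \<and> u (t\<^sub>0 + real j * \<delta>) x' < ereal (y (t\<^sub>0 + real j * \<delta>))"
  using i
proof (induction i)
  case 0
  obtain x y where xy: "(x, y) \<in> Y_set T H L\<^sub>H t\<^sub>0 x\<^sub>0 y\<^sub>0 z" using characteristic_exists [OF x0 t0] by blast
  show ?case
    using x0 y0 Y_set_initial [OF L_H_nonneg t0 xy] X_setD(2) [OF Y_setD(1) [OF xy]]
    by (intro bexI [OF _ xy]) auto
next
  case (Suc i)
  let ?\<tau> = "\<lambda>j. t\<^sub>0 + real j * \<delta>"
  have le: "?\<tau> i \<le> ?\<tau> (Suc i)" using \<delta> by (simp add: mult_right_mono)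
  then have "?\<tau> i \<le> T" using Suc.prems by linarith
  then obtain x y where xy: "(x, y) \<in> Y_set T H L\<^sub>H t\<^sub>0 x\<^sub>0 y\<^sub>0 z"
    and IH: "\<And>j. j \<le> i \<Longrightarrow> \<exists>x'\<in>path_space T. (\<forall>r. 0 \<le> r \<longrightarrow> r \<le> ?\<tau> j \<longrightarrow> x r = x' r) \<and> u (?\<tau> j) x' < ereal (y (?\<tau> j))"
    using Suc.IH by blast
  show ?case
  proof (cases "\<delta> = 0")
    case True
    then have "?\<tau> (Suc i) = ?\<tau> i" by simp
    then show ?thesis using IH by (intro bexI [OF _ xy]) (auto simp: le_Suc_eq simp del: of_nat_Suc)
  next
    case False
    then have lt: "?\<tau> i < ?\<tau> (Suc i)" using \<delta> by simp
    have \<tau>i: "?\<tau> i \<in> {t\<^sub>0..T}" using \<delta> lt Suc.prems by auto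
    obtain x' where x': "x' \<in> path_space T" "\<And>r. \<lbrakk>0 \<le> r; r \<le> ?\<tau> i\<rbrakk> \<Longrightarrow> x r = x' r" "u (?\<tau> i) x' < ereal (y (?\<tau> i))"
      using IH [OF order_refl] by blast
    have "?\<tau> i \<in> {0..<T}" "?\<tau> (Suc i) \<in> {?\<tau> i<..T}" using \<tau>i t0 lt Suc.prems by auto
    then obtain x2 y2 where xy2: "(x2, y2) \<in> Y_set T H L\<^sub>H (?\<tau> i) x' (y (?\<tau> i)) z" "u (?\<tau> (Suc i)) x2 < ereal (y2 (?\<tau> (Suc i)))"
      using u x' unfolding one_step_super_def by blast
    have xy2': "(x2, y2) \<in> Y_set T H L\<^sub>H (?\<tau> i) x (y (?\<tau> i)) z"
      using xy2(1) Y_set_cong_initial [of "?\<tau> i" x x', OF x'(2)] by blast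
    let ?w = "restrict (\<lambda>r. if r \<le> ?\<tau> i then y r else y2 r) {t\<^sub>0..T}"
    have g: "(x2, ?w) \<in> Y_set T H L\<^sub>H t\<^sub>0 x\<^sub>0 y\<^sub>0 z"
      by (rule Y_set_glue [OF L_H_nonneg t0 xy \<tau>i xy2'])
    have xx: "x2 r = x r" if "0 \<le> r" "r \<le> ?\<tau> i" for r
      using X_setD(2) [OF Y_setD(1) [OF xy2']] that by blast
    have "\<exists>x'\<in>path_space T. (\<forall>r. 0 \<le> r \<longrightarrow> r \<le> ?\<tau> j \<longrightarrow> x2 r = x' r) \<and> u (?\<tau> j) x' < ereal (?w (?\<tau> j))"
      if j: "j \<le> Suc i" for j
    proof (cases "j = Suc i")
      case True
      have "?w (?\<tau> (Suc i)) = y2 (?\<tau> (Suc i))" using lt Suc.prems \<tau>i by (simp del: of_nat_Suc)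
      then show ?thesis unfolding True using xy2(2) Y_setD(4) [OF xy2(1)] by (intro bexI [of _ x2]) auto
    next
      case False
      then have "j \<le> i" using j by simp
      then have "?\<tau> j \<le> ?\<tau> i" "t\<^sub>0 \<le> ?\<tau> j" using \<delta> by (auto simp: mult_right_mono)
      moreover from this have "?w (?\<tau> j) = y (?\<tau> j)" using \<tau>i by auto
      moreover obtain x'' where "x'' \<in> path_space T" "\<forall>r. 0 \<le> r \<longrightarrow> r \<le> ?\<tau> j \<longrightarrow> x r = x'' r" "u (?\<tau> j) x'' < ereal (y (?\<tau> j))"
        using IH [OF \<open>j \<le> i\<close>] by blast
      ultimately show ?thesis using xx by (intro bexI [of _ x'']) auto
    qed
    then show ?thesis by (intro bexI [OF _ g]) auto
  qed
qed

text \<open>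
A value \<open>y\<^sub>0\<close> above the envelope at \<open>(s\<^sub>0,x\<^sub>0)\<close> is approximated by values above \<open>u\<close> at nearby points.
From these, chains of one-step characteristics with more and more links stay above \<open>u\<close> at all
partition points.  A limit of the chains is a characteristic from \<open>(x\<^sub>0,y\<^sub>0)\<close>, and at each time \<open>t\<close> it
is above the envelope, because the partition points and the paths there converge to \<open>(t,x)\<close> in the
pseudo-metric.  The terminal inequality is the same argument with starting time \<open>T\<close>.
\<close>

theorem lsc_envelope_minimax_supersolution:
  assumes u: "one_step_super u" and uT: "\<And>x. x \<in> path_space T \<Longrightarrow> u T x = ereal (h x)"
    and fin: "\<And>t x. \<lbrakk>t \<in> {0..T}; x \<in> path_space T\<rbrakk> \<Longrightarrow> u t x \<noteq> \<infinity>"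
  shows "minimax_supersolution T h H L\<^sub>H (\<lambda>t x. real_of_ereal (lsc_envelope T u t x))"
proof -
  define v where "v = (\<lambda>t x. real_of_ereal (lsc_envelope T u t x))"
  have v: "lsc_envelope T u t x = ereal (v t x)" if "t \<in> {0..T}" "x \<in> path_space T" for t x
  proof -
    have "lsc_envelope T u t x \<noteq> \<infinity>" using lsc_envelope_le [OF that(2,1), of u] fin [OF that] by auto
    then show ?thesis using lsc_envelope_not_MInf [OF u uT that] by (auto simp: v_def ereal_real)
  qed
  have approx: "\<exists>ts x's. (\<forall>n. ts n \<in> {0..T} \<and> x's n \<in> path_space T \<and> u (ts n) (x's n) < ereal (y\<^sub>0 + inverse (real (Suc n)))) \<and>
      (\<lambda>n. d_infty T (s\<^sub>0, x\<^sub>0) (ts n, x's n)) \<longlonglongrightarrow> 0"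
    if s0: "s\<^sub>0 \<in> {0..T}" and x0: "x\<^sub>0 \<in> path_space T" and y0: "v s\<^sub>0 x\<^sub>0 \<le> y\<^sub>0"
    for s\<^sub>0 y\<^sub>0 :: real and x\<^sub>0 :: "real \<Rightarrow> real^'n"
  proof -
    define P where "P = (\<lambda>n s x'. s \<in> {0..T} \<and> x' \<in> path_space T \<and> u s x' < ereal (y\<^sub>0 + inverse (real (Suc n))) \<and>
        d_infty T (s\<^sub>0, x\<^sub>0) (s, x') < inverse (real (Suc n)))"
    have "\<exists>s x'. P n s x'" for n
    proof -
      have "lsc_envelope T u s\<^sub>0 x\<^sub>0 < ereal (y\<^sub>0 + inverse (real (Suc n)))"
      proof -
        have "0 < inverse (real (Suc n))" by simp
        then have "v s\<^sub>0 x\<^sub>0 < y\<^sub>0 + inverse (real (Suc n))" using y0 by linarith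
        then show ?thesis using v [OF s0 x0] by simp
      qed
      then show ?thesis unfolding P_def
        by (rule lsc_envelope_approx [of T u s\<^sub>0 x\<^sub>0 _ "inverse (real (Suc n))"]) auto
    qed
    then obtain ts x's where P: "\<And>n. P n (ts n) (x's n)" by metis
    have "(\<lambda>n. d_infty T (s\<^sub>0, x\<^sub>0) (ts n, x's n)) \<longlonglongrightarrow> 0"
    proof (rule tendsto_sandwich [OF _ _ tendsto_const LIMSEQ_inverse_real_of_nat])
      have "0 \<le> d_infty T (s\<^sub>0, x\<^sub>0) (ts n, x's n)" for n
        using d_infty_ge(1) [OF x0 _ s0, of "x's n" "ts n"] P [of n] by (auto simp: P_def)
      then show "\<forall>\<^sub>F n in sequentially. 0 \<le> d_infty T (s\<^sub>0, x\<^sub>0) (ts n, x's n)" by simp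
      have "d_infty T (s\<^sub>0, x\<^sub>0) (ts n, x's n) \<le> inverse (real (Suc n))" for n
        using P [of n] by (simp add: P_def)
      then show "\<forall>\<^sub>F n in sequentially. d_infty T (s\<^sub>0, x\<^sub>0) (ts n, x's n) \<le> inverse (real (Suc n))" by simp
    qed
    then show ?thesis using P unfolding P_def by blast
  qed
  have y0lim: "(\<lambda>n. y\<^sub>0 + inverse (real (Suc n))) \<longlonglongrightarrow> y\<^sub>0" for y\<^sub>0
    using tendsto_add [OF tendsto_const LIMSEQ_inverse_real_of_nat, of y\<^sub>0] by simp
  have "minimax_supersolution T h H L\<^sub>H v"
    unfolding minimax_supersolution_def
  proof (intro conjI ballI allI impI)
    show "lsc_on_paths T v" unfolding lsc_on_paths_def
    proof (intro ballI allI impI)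
      fix t and x :: "real \<Rightarrow> real^'n" and \<epsilon> :: real assume t: "t \<in> {0..T}" and x: "x \<in> path_space T" and \<epsilon>: "\<epsilon> > 0"
      have "ereal (v t x - \<epsilon>) < lsc_envelope T u t x" using v [OF t x] \<epsilon> by simp
      then obtain \<delta> where \<delta>: "\<delta> > 0" "\<And>s x'. \<lbrakk>s \<in> {0..T}; x' \<in> path_space T; d_infty T (t, x) (s, x') < \<delta>\<rbrakk>
          \<Longrightarrow> ereal (v t x - \<epsilon>) < lsc_envelope T u s x'"
        by (rule lsc_envelope_lower) (use t x in blast)
      show "\<exists>\<delta>>0. \<forall>s\<in>{0..T}. \<forall>x'\<in>path_space T. d_infty T (t, x) (s, x') < \<delta> \<longrightarrow> v t x - \<epsilon> < v s x'"
      proof (intro exI [of _ \<delta>] conjI ballI impI \<delta>(1))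
        fix s and x' :: "real \<Rightarrow> real^'n" assume s: "s \<in> {0..T}" "x' \<in> path_space T" "d_infty T (t, x) (s, x') < \<delta>"
        show "v t x - \<epsilon> < v s x'" using \<delta>(2) [OF s] v [OF s(1,2)] by simp
      qed
    qed
  next
    fix x\<^sub>0 :: "real \<Rightarrow> real^'n" assume x0: "x\<^sub>0 \<in> path_space T"
    have TT: "T \<in> {0..T}" using T_pos by simp
    obtain ts x's where ts: "\<And>n. ts n \<in> {0..T}" and x's: "\<And>n. x's n \<in> path_space T"
      and un: "\<And>n. u (ts n) (x's n) < ereal (v T x\<^sub>0 + inverse (real (Suc n)))"
      and conv: "(\<lambda>n. d_infty T (T, x\<^sub>0) (ts n, x's n)) \<longlonglongrightarrow> 0"
      using approx [OF TT x0 order_refl] by blast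
    have "\<exists>x y. (x, y) \<in> Y_set T H L\<^sub>H (ts n) (x's n) (v T x\<^sub>0 + inverse (real (Suc n))) 0 \<and> h x \<le> y T" for n
      by (rule one_step_super_terminal [OF u uT ts [of n] x's [of n] un [of n], where z = 0]) blast+
    then obtain xs ys where Y: "\<And>n. (xs n, ys n) \<in> Y_set T H L\<^sub>H (ts n) (x's n) (v T x\<^sub>0 + inverse (real (Suc n))) 0"
      and hy: "\<And>n. h (xs n) \<le> ys n T" by metis
    obtain r x y where r: "strict_mono (r :: nat \<Rightarrow> nat)" and xy: "(x, y) \<in> Y_set T H L\<^sub>H T x\<^sub>0 (v T x\<^sub>0) 0"
      and xlim: "uniform_limit {0..T} (xs \<circ> r) x sequentially"
      and ylim: "\<And>\<tau> t. \<lbrakk>\<forall>\<^sub>F n in sequentially. \<tau> n \<in> {ts (r n)..T}; \<tau> \<longlonglongrightarrow> t\<rbrakk> \<Longrightarrow> (\<lambda>n. ys (r n) (\<tau> n)) \<longlonglongrightarrow> y t"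
      by (rule Y_set_compact [OF L_H_nonneg ts TT x's x0 conv Y y0lim], rule that; (assumption | blast))
    have "x = x\<^sub>0"
    proof
      fix t show "x t = x\<^sub>0 t"
        using X_setD(2) [OF Y_setD(1) [OF xy], of t] path_space_extensional [OF Y_setD(4) [OF xy]] path_space_extensional [OF x0]
        by (cases "t \<in> {0..T}") (auto simp: extensional_def)
    qed
    have "(\<lambda>n. h ((xs \<circ> r) n)) \<longlonglongrightarrow> h x"
      by (rule h_tendsto [OF _ Y_setD(4) [OF xy] xlim]) (use Y_setD(4) [OF Y] in auto)
    moreover have "(\<lambda>n. ys (r n) T) \<longlonglongrightarrow> y T" by (rule ylim) (use ts in auto)
    ultimately have "h x \<le> y T" by (rule LIMSEQ_le) (use hy in auto)
    then show "h x\<^sub>0 \<le> v T x\<^sub>0"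
      using Y_set_initial [OF L_H_nonneg TT xy] \<open>x = x\<^sub>0\<close> by simp
  next
    fix s\<^sub>0 y\<^sub>0 :: real and x\<^sub>0 :: "real \<Rightarrow> real^'n" and z assume s0': "s\<^sub>0 \<in> {0..<T}" and x0: "x\<^sub>0 \<in> path_space T" and y0: "v s\<^sub>0 x\<^sub>0 \<le> y\<^sub>0"
    have s0: "s\<^sub>0 \<in> {0..T}" using s0' by auto
    obtain ts x's where ts: "\<And>n. ts n \<in> {0..T}" and x's: "\<And>n. x's n \<in> path_space T"
      and un: "\<And>n. u (ts n) (x's n) < ereal (y\<^sub>0 + inverse (real (Suc n)))"
      and conv: "(\<lambda>n. d_infty T (s\<^sub>0, x\<^sub>0) (ts n, x's n)) \<longlonglongrightarrow> 0"
      using approx [OF s0 x0 y0] by blast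
    define \<delta> where "\<delta> = (\<lambda>n. (T - ts n) / real (Suc n))"
    have \<delta>: "\<delta> n \<ge> 0" "real (Suc n) * \<delta> n = T - ts n" "\<delta> n \<le> T * inverse (real (Suc n))" for n
      using ts [of n] by (auto simp: \<delta>_def divide_inverse intro: mult_right_mono)
    define P where "P = (\<lambda>n x y. (x, y) \<in> Y_set T H L\<^sub>H (ts n) (x's n) (y\<^sub>0 + inverse (real (Suc n))) z \<and>
      (\<forall>j\<le>Suc n. \<exists>x'\<in>path_space T. (\<forall>r. 0 \<le> r \<longrightarrow> r \<le> ts n + real j * \<delta> n \<longrightarrow> x r = x' r) \<and>
        u (ts n + real j * \<delta> n) x' < ereal (y (ts n + real j * \<delta> n))))"
    have "\<exists>x y. P n x y" for n
    proof -
      have "ts n + real (Suc n) * \<delta> n \<le> T" using \<delta>(2) [of n] by simp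
      from one_step_super_chain [OF u ts x's un \<delta>(1) this, of z] show ?thesis unfolding P_def by blast
    qed
    then obtain xs ys where P: "\<And>n. P n (xs n) (ys n)" by metis
    have Y: "(xs n, ys n) \<in> Y_set T H L\<^sub>H (ts n) (x's n) (y\<^sub>0 + inverse (real (Suc n))) z" for n
      using P unfolding P_def by blast
    obtain r x y where r: "strict_mono (r :: nat \<Rightarrow> nat)" and xy: "(x, y) \<in> Y_set T H L\<^sub>H s\<^sub>0 x\<^sub>0 y\<^sub>0 z"
      and xlim: "uniform_limit {0..T} (xs \<circ> r) x sequentially"
      and ylim: "\<And>\<tau> t. \<lbrakk>\<forall>\<^sub>F n in sequentially. \<tau> n \<in> {ts (r n)..T}; \<tau> \<longlonglongrightarrow> t\<rbrakk> \<Longrightarrow> (\<lambda>n. ys (r n) (\<tau> n)) \<longlonglongrightarrow> y t"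
      by (rule Y_set_compact [OF L_H_nonneg ts s0 x's x0 conv Y y0lim], rule that; (assumption | blast))
    have xp: "x \<in> path_space T" by (rule Y_setD(4) [OF xy])
    have tslim: "(\<lambda>n. ts (r n)) \<longlonglongrightarrow> s\<^sub>0"
      using LIMSEQ_subseq_LIMSEQ [OF d_infty_tendsto_times [OF ts s0 x's x0 conv] r] by (simp add: o_def)
    have "v t x \<le> y t" if t: "t \<in> {s\<^sub>0..T}" for t
    proof (cases "t = s\<^sub>0")
      case True
      have "lsc_envelope T u s\<^sub>0 x = lsc_envelope T u s\<^sub>0 x\<^sub>0"
        by (rule lsc_envelope_cong) (use X_setD(2) [OF Y_setD(1) [OF xy]] s0 in auto)
      then have "v s\<^sub>0 x = v s\<^sub>0 x\<^sub>0" by (simp add: v_def)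
      then show ?thesis using True y0 Y_set_initial [OF L_H_nonneg s0 xy] by simp
    next
      case False
      then have t': "s\<^sub>0 < t" "t \<le> T" "t \<in> {0..T}" using t s0 by auto
      \<comment> \<open>\<open>\<tau> n\<close> is the last point of the \<open>n\<close>-th partition that does not exceed \<open>t\<close>.\<close>
      define j where "j = (\<lambda>n. nat \<lfloor>real (Suc n) * max 0 (t - ts n) / (T - ts n)\<rfloor>)"
      define \<tau> where "\<tau> = (\<lambda>n. ts (r n) + real (j (r n)) * \<delta> (r n))"
      have jn: "j n \<le> Suc n \<and> ts n + real (j n) * \<delta> n \<le> t \<and> t - \<delta> n \<le> ts n + real (j n) * \<delta> n" if tn: "ts n < t" for n
      proof -
        define q where "q = real (Suc n) * (t - ts n) / (T - ts n)"
        have Tn: "T - ts n > 0" using tn t' by linarith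
        have q0: "q \<ge> 0" using tn Tn by (simp add: q_def)
        have jq: "j n = nat \<lfloor>q\<rfloor>" using tn by (simp add: j_def q_def)
        have fl: "real (j n) \<le> q" "q < real (j n) + 1" using q0 jq by linarith+
        have q\<delta>: "q * \<delta> n = t - ts n" using Tn by (simp add: q_def \<delta>_def)
        have "q \<le> real (Suc n)" using t' Tn tn by (simp add: q_def divide_le_eq mult_left_mono)
        then have "j n \<le> Suc n" using fl by linarith
        moreover have "real (j n) * \<delta> n \<le> q * \<delta> n" using fl \<delta>(1) by (intro mult_right_mono) auto
        moreover have "q * \<delta> n \<le> (real (j n) + 1) * \<delta> n" using fl \<delta>(1) by (intro mult_right_mono) auto
        ultimately show ?thesis using q\<delta> by (simp add: algebra_simps)
      qed
      have evt: "\<forall>\<^sub>F n in sequentially. ts (r n) < t" by (rule order_tendstoD(2) [OF tslim t'(1)])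
      have \<tau>lim: "\<tau> \<longlonglongrightarrow> t"
      proof -
        have "\<forall>\<^sub>F n in sequentially. norm (\<tau> n - t) \<le> T * inverse (real (Suc (r n)))"
          using evt
        proof eventually_elim
          case (elim n)
          then show ?case using jn [OF elim] \<delta>(3) [of "r n"] by (simp add: \<tau>_def)
        qed
        moreover have "(\<lambda>n. T * inverse (real (Suc (r n)))) \<longlonglongrightarrow> 0"
          using tendsto_mult_right_zero [OF LIMSEQ_subseq_LIMSEQ [OF LIMSEQ_inverse_real_of_nat r], of T] by (simp add: o_def)
        ultimately have "(\<lambda>n. \<tau> n - t) \<longlonglongrightarrow> 0" by (rule Lim_null_comparison)
        then show ?thesis by (simp add: LIM_zero_iff)
      qed
      have ev\<tau>: "\<forall>\<^sub>F n in sequentially. \<tau> n \<in> {ts (r n)..T} \<and> \<tau> n \<le> t"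
        using evt
      proof eventually_elim
        case (elim n)
        then show ?case using jn [OF elim] \<delta>(1) [of "r n"] t' by (simp add: \<tau>_def)
      qed
      have ylim': "(\<lambda>n. ys (r n) (\<tau> n)) \<longlonglongrightarrow> y t"
        by (rule ylim [OF _ \<tau>lim]) (use ev\<tau> in \<open>auto elim: eventually_mono\<close>)
      have "\<exists>x'\<in>path_space T. (\<forall>p. 0 \<le> p \<longrightarrow> p \<le> \<tau> n \<longrightarrow> xs (r n) p = x' p) \<and> u (\<tau> n) x' < ereal (ys (r n) (\<tau> n))"
        if "ts (r n) < t" for n
        using P [of "r n"] jn [OF that] unfolding P_def \<tau>_def by blast
      then have "\<forall>n. \<exists>x'. ts (r n) < t \<longrightarrow> x' \<in> path_space T \<and> (\<forall>p. 0 \<le> p \<longrightarrow> p \<le> \<tau> n \<longrightarrow> xs (r n) p = x' p) \<and> u (\<tau> n) x' < ereal (ys (r n) (\<tau> n))"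
        by blast
      then obtain w where w: "\<And>n. ts (r n) < t \<Longrightarrow> w n \<in> path_space T \<and> (\<forall>p. 0 \<le> p \<longrightarrow> p \<le> \<tau> n \<longrightarrow> xs (r n) p = w n p) \<and>
          u (\<tau> n) (w n) < ereal (ys (r n) (\<tau> n))" by metis
      have close: "\<forall>\<^sub>F n in sequentially. d_infty T (t, x) (\<tau> n, w n) < \<epsilon>" if \<epsilon>: "\<epsilon> > 0" for \<epsilon>
      proof -
        have "\<forall>\<^sub>F n in sequentially. \<tau> n \<in> {s\<^sub>0..T}"
          using order_tendstoD(1) [OF \<tau>lim t'(1)] ev\<tau> by eventually_elim auto
        then have "\<forall>\<^sub>F n in sequentially. d_infty T (t, x) (\<tau> n, (xs \<circ> r) n) < \<epsilon>"
          by (rule d_infty_tendsto_0 [OF L_H_nonneg s0 Y_setD(1) [OF xy] xlim _ \<tau>lim t \<epsilon>])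
        with evt ev\<tau> show ?thesis
        proof eventually_elim
          case (elim n)
          have "d_infty T (\<tau> n, xs (r n)) (t, x) = d_infty T (\<tau> n, w n) (t, x)"
            by (rule d_infty_cong) (use elim w [of n] ts [of "r n"] in auto)
          then show ?case using elim(3) by (simp add: d_infty_commute [of T "(t, x)"])
        qed
      qed
      show ?thesis
      proof (rule ccontr)
        assume "\<not> v t x \<le> y t"
        then obtain c where c: "y t < c" "c < v t x" using dense not_le by blast
        have "ereal c < lsc_envelope T u t x" using v [OF t'(3) xp] c by simp
        then obtain \<epsilon> where \<epsilon>: "\<epsilon> > 0"
          "\<And>s x'. \<lbrakk>s \<in> {0..T}; x' \<in> path_space T; d_infty T (t, x) (s, x') < \<epsilon>\<rbrakk> \<Longrightarrow> ereal c < u s x'"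
          by (rule lsc_envelope_lower) blast
        have "\<forall>\<^sub>F n in sequentially. ys (r n) (\<tau> n) < c" by (rule order_tendstoD(2) [OF ylim' c(1)])
        then have "\<forall>\<^sub>F n in sequentially. False" using close [OF \<epsilon>(1)] ev\<tau> evt
        proof eventually_elim
          case (elim n)
          have "ereal c < u (\<tau> n) (w n)"
            by (rule \<epsilon>(2)) (use elim w [of n] ts [of "r n"] in auto)
          also have "\<dots> < ereal (ys (r n) (\<tau> n))" using w [of n] elim by blast
          finally show False using elim(1) by simp
        qed
        then show False by simp
      qed
    qed
    then show "\<exists>(x, y)\<in>Y_set T H L\<^sub>H s\<^sub>0 x\<^sub>0 y\<^sub>0 z. \<forall>t\<in>{s\<^sub>0..T}. v t x \<le> y t" using xy by blast
  qed
  then show ?thesis by (simp add: v_def)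
qed

end

section \<open>A smooth substitute for the squared supremum norm\<close>

text \<open>
Here \<open>m\<close> stands for the supremum of a path so far and \<open>w\<close> for its current value, so \<open>|w| \<le> m\<close>.
The function lies between \<open>m\<^sup>2\<close> and \<open>2 m\<^sup>2\<close>.  The supremum grows only while \<open>|w| = m\<close>, and there the
derivative \<open>2 m - 2 |w|\<^sup>4 / m\<^sup>3\<close> in \<open>m\<close> vanishes; hence to first order the function changes only through
\<open>w\<close>.  For \<open>m = 0\<close> also \<open>w = 0\<close>, and division by zero gives the correct value \<open>0\<close>.
\<close>

definition sup_lyapunov :: "real \<Rightarrow> 'a::real_inner \<Rightarrow> real" where
  "sup_lyapunov m w = m\<^sup>2 + (norm w) ^ 4 / m\<^sup>2"

text \<open>
The partial gradient of the function above in \<open>w\<close>.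
\<close>

definition sup_lyapunov_grad :: "real \<Rightarrow> 'a::real_inner \<Rightarrow> 'a" where
  "sup_lyapunov_grad m w = (4 * (norm w)\<^sup>2 / m\<^sup>2) *\<^sub>R w"

lemma sup_lyapunov_ge: "m\<^sup>2 \<le> sup_lyapunov m w"
  by (simp add: sup_lyapunov_def)

lemma norm_sup_lyapunov_grad_le:
  assumes "norm w \<le> m"
  shows "norm (sup_lyapunov_grad m w) \<le> 4 * m"
proof (cases "m = 0")
  case False
  then have m: "m > 0" using assms norm_ge_zero [of w] by linarith
  have "(norm w)\<^sup>2 * norm w \<le> m\<^sup>2 * m" using assms m by (intro mult_mono power_mono) auto
  then have "4 * (norm w)\<^sup>2 / m\<^sup>2 * norm w \<le> 4 * m" using m by (simp add: divide_le_eq ac_simps)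
  then show ?thesis by (simp add: sup_lyapunov_grad_def)
qed (simp add: sup_lyapunov_grad_def)

lemma norm_power4_expansion:
  fixes w w' :: "'a::real_inner"
  assumes "norm w \<le> m" "norm w' \<le> m" "norm (w' - w) \<le> \<Delta>"
  shows "(norm w') ^ 4 \<le> (norm w) ^ 4 + 4 * (norm w)\<^sup>2 * (w \<bullet> (w' - w)) + 6 * m\<^sup>2 * \<Delta>\<^sup>2"
proof -
  define a b d where "a = (norm w)\<^sup>2" and "b = (norm w')\<^sup>2" and "d = norm (w' - w)"
  have m: "m \<ge> 0" using assms(1) norm_ge_zero order_trans by blast
  have ba: "b - a = 2 * (w \<bullet> (w' - w)) + d\<^sup>2"
    by (simp add: a_def b_def d_def power2_norm_eq_inner inner_diff inner_commute)
  have d: "0 \<le> d" "d\<^sup>2 \<le> \<Delta>\<^sup>2" using assms(3) by (auto simp: d_def intro: power_mono)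
  have am: "a \<le> m\<^sup>2" "0 \<le> a" using assms(1) by (auto simp: a_def intro: power_mono)
  have "\<bar>norm w' - norm w\<bar> \<le> d" unfolding d_def by (rule norm_triangle_ineq3)
  moreover have "\<bar>b - a\<bar> = \<bar>norm w' - norm w\<bar> * (norm w' + norm w)"
    by (simp add: a_def b_def power2_eq_square square_diff_square_factored abs_mult)
  ultimately have "\<bar>b - a\<bar> \<le> d * (2 * m)" using assms d by (auto intro!: mult_mono)
  then have "(b - a)\<^sup>2 \<le> (d * (2 * m))\<^sup>2" by (metis abs_ge_zero power2_abs power_mono)
  also have "\<dots> = 4 * m\<^sup>2 * d\<^sup>2" by (simp add: power2_eq_square)
  also have "\<dots> \<le> 4 * m\<^sup>2 * \<Delta>\<^sup>2" using d by (intro mult_left_mono) auto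
  finally have 1: "(b - a)\<^sup>2 \<le> 4 * m\<^sup>2 * \<Delta>\<^sup>2" .
  have 2: "a * d\<^sup>2 \<le> m\<^sup>2 * \<Delta>\<^sup>2" using am d by (intro mult_mono) auto
  have "b\<^sup>2 = a\<^sup>2 + 2 * a * (b - a) + (b - a)\<^sup>2" by (simp add: power2_eq_square algebra_simps)
  also have "\<dots> = a\<^sup>2 + 4 * a * (w \<bullet> (w' - w)) + 2 * (a * d\<^sup>2) + (b - a)\<^sup>2"
    unfolding ba [THEN arg_cong [of _ _ "\<lambda>t. 2 * a * t"]] by (simp add: algebra_simps)
  also have "\<dots> \<le> a\<^sup>2 + 4 * a * (w \<bullet> (w' - w)) + 6 * m\<^sup>2 * \<Delta>\<^sup>2" using 1 2 by linarith
  finally have "b\<^sup>2 \<le> a\<^sup>2 + 4 * a * (w \<bullet> (w' - w)) + 6 * m\<^sup>2 * \<Delta>\<^sup>2" .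
  moreover have "b\<^sup>2 = (norm w') ^ 4" "a\<^sup>2 = (norm w) ^ 4" by (simp_all add: a_def b_def)
  ultimately show ?thesis by (simp add: a_def)
qed

text \<open>
The quantitative form of the vanishing derivative in \<open>m\<close>: over a step of length \<open>\<Delta>\<close> the first-order
change is the gradient in \<open>w\<close> alone.  The constant is \<open>22 = 6 + 8 + 8\<close>, from the remainder of
\<open>|w|\<^sup>4\<close>, from the growth of \<open>m\<close> to \<open>m'\<close>, and from evaluating the gradient at \<open>m\<close> instead of \<open>m'\<close>.
\<close>

lemma sup_lyapunov_step:
  fixes w w' :: "'a::real_inner"
  assumes w: "norm w \<le> m" "norm w' \<le> m'" and m: "m \<le> m'" "m' \<le> max m (norm w + \<Delta>)"
    and d: "norm (w' - w) \<le> \<Delta>"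
  shows "sup_lyapunov m' w' \<le> sup_lyapunov m w + sup_lyapunov_grad m w \<bullet> (w' - w) + 22 * \<Delta>\<^sup>2"
proof (cases "m = 0")
  case True
  then have w0: "w = 0" using w by simp
  have \<Delta>: "\<Delta> \<ge> 0" using d norm_ge_zero order_trans by blast
  then have m': "0 \<le> m'" "m' \<le> \<Delta>" using True w0 m by auto
  have "(norm w') ^ 4 / m'\<^sup>2 \<le> m'\<^sup>2"
  proof (cases "m' = 0")
    case False
    have "(norm w') ^ 4 \<le> m' ^ 4" using w by (intro power_mono) auto
    then show ?thesis using False m' by (simp add: divide_le_eq power_add [symmetric])
  qed simp
  moreover have "m'\<^sup>2 \<le> \<Delta>\<^sup>2" using m' by (intro power_mono) auto
  moreover have "0 \<le> \<Delta>\<^sup>2" by simp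
  ultimately have "sup_lyapunov m' w' \<le> 22 * \<Delta>\<^sup>2" unfolding sup_lyapunov_def by linarith
  then show ?thesis using True w0 by (simp add: sup_lyapunov_def sup_lyapunov_grad_def)
next
  case False
  define n p where "n = norm w" and "p = w \<bullet> (w' - w)"
  have n0: "0 \<le> n" by (simp add: n_def)
  have "0 \<le> m" by (rule order_trans [OF norm_ge_zero w(1)])
  then have m0: "m > 0" using False by simp
  have m'0: "m' > 0" using m0 m by simp
  have nm: "n \<le> m" using w by (simp add: n_def)
  have \<Delta>: "\<Delta> \<ge> 0" using d norm_ge_zero order_trans by blast
  have "\<bar>p\<bar> \<le> n * norm (w' - w)" unfolding p_def n_def by (rule Cauchy_Schwarz_ineq2)
  also have "\<dots> \<le> n * \<Delta>" using d n0 by (intro mult_left_mono) auto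
  finally have p: "\<bar>p\<bar> \<le> n * \<Delta>" .
  have "(norm w') ^ 4 \<le> n ^ 4 + 4 * n\<^sup>2 * p + 6 * m'\<^sup>2 * \<Delta>\<^sup>2"
    using norm_power4_expansion [of w m' w' \<Delta>] w m d by (simp add: n_def p_def)
  then have "(norm w') ^ 4 / m'\<^sup>2 \<le> (n ^ 4 + 4 * n\<^sup>2 * p + 6 * m'\<^sup>2 * \<Delta>\<^sup>2) / m'\<^sup>2"
    by (rule divide_right_mono) simp
  also have "\<dots> = n ^ 4 / m'\<^sup>2 + 4 * n\<^sup>2 * p / m'\<^sup>2 + 6 * \<Delta>\<^sup>2"
    using m'0 by (simp add: add_divide_distrib)
  finally have A: "sup_lyapunov m' w' \<le> m'\<^sup>2 + n ^ 4 / m'\<^sup>2 + 4 * n\<^sup>2 * p / m'\<^sup>2 + 6 * \<Delta>\<^sup>2"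
    by (simp add: sup_lyapunov_def)
  have g: "sup_lyapunov_grad m w \<bullet> (w' - w) = 4 * n\<^sup>2 * p / m\<^sup>2"
    by (simp add: sup_lyapunov_grad_def n_def p_def)
  have f: "sup_lyapunov m w = m\<^sup>2 + n ^ 4 / m\<^sup>2" by (simp add: sup_lyapunov_def n_def)
  show ?thesis
  proof (cases "m' = m")
    case True
    have "0 \<le> \<Delta>\<^sup>2" by simp
    then show ?thesis using A unfolding True f g by linarith
  next
    case False
    then have mm: "m < m'" "m' \<le> n + \<Delta>" using m by (auto simp: n_def)
    have X: "0 \<le> m'\<^sup>2 - m\<^sup>2" "m'\<^sup>2 - m\<^sup>2 \<le> 2 * m' * \<Delta>"
    proof -
      have eq: "m'\<^sup>2 - m\<^sup>2 = (m' - m) * (m' + m)" by (simp add: power2_eq_square algebra_simps)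
      show "0 \<le> m'\<^sup>2 - m\<^sup>2" unfolding eq using mm m0 by simp
      have "(m' - m) * (m' + m) \<le> \<Delta> * (2 * m')" using mm m0 nm by (intro mult_mono) auto
      then show "m'\<^sup>2 - m\<^sup>2 \<le> 2 * m' * \<Delta>" unfolding eq by (simp add: algebra_simps)
    qed
    have Y: "1 - n ^ 4 / (m\<^sup>2 * m'\<^sup>2) \<le> 4 * \<Delta> / m'"
    proof -
      have "n ^ 4 / m' ^ 4 \<le> n ^ 4 / (m\<^sup>2 * m'\<^sup>2)"
      proof (rule divide_left_mono)
        have "m\<^sup>2 * m'\<^sup>2 \<le> m'\<^sup>2 * m'\<^sup>2" using X by (intro mult_right_mono) auto
        then show "m\<^sup>2 * m'\<^sup>2 \<le> m' ^ 4" by (simp add: power_add [symmetric])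
      qed (use m0 m'0 n0 in auto)
      moreover have "1 - n ^ 4 / m' ^ 4 \<le> 4 * \<Delta> / m'"
      proof -
        have "m' ^ 4 - n ^ 4 = (m' - n) * ((m' + n) * (m'\<^sup>2 + n\<^sup>2))"
          by (simp add: power2_eq_square power4_eq_xxxx algebra_simps)
        also have "\<dots> \<le> \<Delta> * ((2 * m') * (2 * m'\<^sup>2))"
        proof (intro mult_mono)
          show "m'\<^sup>2 + n\<^sup>2 \<le> 2 * m'\<^sup>2" using power_mono [of n m' 2] nm mm n0 by simp
        qed (use nm mm n0 m'0 \<Delta> in auto)
        finally have "m' ^ 4 - n ^ 4 \<le> 4 * \<Delta> * m' ^ 3" by (simp add: power2_eq_square power3_eq_cube algebra_simps)
        then have "(m' ^ 4 - n ^ 4) / m' ^ 4 \<le> 4 * \<Delta> * m' ^ 3 / m' ^ 4" by (rule divide_right_mono) simp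
        moreover have "(m' ^ 4 - n ^ 4) / m' ^ 4 = 1 - n ^ 4 / m' ^ 4" using m'0 by (simp add: diff_divide_distrib)
        moreover have "4 * \<Delta> * m' ^ 3 / m' ^ 4 = 4 * \<Delta> / m'" using m'0 by (simp add: power3_eq_cube power4_eq_xxxx)
        ultimately show ?thesis by simp
      qed
      ultimately show ?thesis by linarith
    qed
    have D1: "(m'\<^sup>2 - m\<^sup>2) * (1 - n ^ 4 / (m\<^sup>2 * m'\<^sup>2)) \<le> 8 * \<Delta>\<^sup>2"
    proof -
      have "(m'\<^sup>2 - m\<^sup>2) * (1 - n ^ 4 / (m\<^sup>2 * m'\<^sup>2)) \<le> (m'\<^sup>2 - m\<^sup>2) * (4 * \<Delta> / m')"
        using X Y by (intro mult_left_mono)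
      also have "\<dots> \<le> (2 * m' * \<Delta>) * (4 * \<Delta> / m')" using X \<Delta> m'0 by (intro mult_right_mono) auto
      also have "\<dots> = 8 * \<Delta>\<^sup>2" using m'0 by (simp add: power2_eq_square)
      finally show ?thesis .
    qed
    have D2: "4 * n\<^sup>2 * p / m'\<^sup>2 - 4 * n\<^sup>2 * p / m\<^sup>2 \<le> 8 * \<Delta>\<^sup>2"
    proof -
      have "4 * n\<^sup>2 * p / m'\<^sup>2 - 4 * n\<^sup>2 * p / m\<^sup>2 = (- (4 * n\<^sup>2 * p)) * (m'\<^sup>2 - m\<^sup>2) / (m\<^sup>2 * m'\<^sup>2)"
      proof -
        have frac: "A / a - A / b = (- A) * (a - b) / (b * a)" if "a > 0" "b > 0" for A a b :: real
          using that by (simp add: field_simps)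
        show ?thesis by (rule frac) (use m0 m'0 in auto)
      qed
      also have "\<dots> \<le> (4 * n\<^sup>2 * (n * \<Delta>)) * (2 * m' * \<Delta>) / (m\<^sup>2 * m'\<^sup>2)"
      proof (rule divide_right_mono [OF mult_mono])
        have "- p \<le> n * \<Delta>" using p by linarith
        then have "4 * n\<^sup>2 * (- p) \<le> 4 * n\<^sup>2 * (n * \<Delta>)" by (rule mult_left_mono) simp
        then show "- (4 * n\<^sup>2 * p) \<le> 4 * n\<^sup>2 * (n * \<Delta>)" by (simp only: mult_minus_right)
        show "m'\<^sup>2 - m\<^sup>2 \<le> 2 * m' * \<Delta>" "0 \<le> m'\<^sup>2 - m\<^sup>2" by (rule X)+
        show "0 \<le> 4 * n\<^sup>2 * (n * \<Delta>)" using n0 \<Delta> by simp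
        show "0 \<le> m\<^sup>2 * m'\<^sup>2" by simp
      qed
      also have "\<dots> = 8 * \<Delta>\<^sup>2 * ((n\<^sup>2 * n) / (m\<^sup>2 * m'))" proof -
        have "(4 * n\<^sup>2 * (n * \<Delta>)) * (2 * m' * \<Delta>) = 8 * \<Delta>\<^sup>2 * (n\<^sup>2 * n) * m'" by (simp add: power2_eq_square)
        then have "(4 * n\<^sup>2 * (n * \<Delta>)) * (2 * m' * \<Delta>) / (m\<^sup>2 * m'\<^sup>2)
            = 8 * \<Delta>\<^sup>2 * (n\<^sup>2 * n) * m' / (m\<^sup>2 * m'\<^sup>2)" by (rule arg_cong)
        also have "\<dots> = 8 * \<Delta>\<^sup>2 * (n\<^sup>2 * n) / (m\<^sup>2 * m')"
          unfolding power2_eq_square [of m'] using m'0 by simp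
        finally show ?thesis by (simp only: times_divide_eq_right)
      qed
      also have "\<dots> \<le> 8 * \<Delta>\<^sup>2 * 1"
      proof (rule mult_left_mono)
        have "n\<^sup>2 * n \<le> m\<^sup>2 * m'" using nm mm n0 by (intro mult_mono power_mono) auto
        then show "(n\<^sup>2 * n) / (m\<^sup>2 * m') \<le> 1" using m0 m'0 by (simp add: divide_le_eq)
      qed simp
      finally show ?thesis by simp
    qed
    have "m'\<^sup>2 + n ^ 4 / m'\<^sup>2 - (m\<^sup>2 + n ^ 4 / m\<^sup>2) = (m'\<^sup>2 - m\<^sup>2) * (1 - n ^ 4 / (m\<^sup>2 * m'\<^sup>2))"
    proof -
      have frac: "a + r / a - (b + r / b) = (a - b) * (1 - r / (b * a))" if "a > 0" "b > 0" for a b r :: real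
        using that by (simp add: field_simps)
      show ?thesis by (rule frac) (use m0 m'0 in auto)
    qed
    then show ?thesis using A D1 D2 unfolding f g by linarith
  qed
qed

section \<open>The comparison principle\<close>

text \<open>
The arithmetic of one step in the comparison argument.  Here \<open>E\<close> and \<open>E'\<close> are the weights of the
penalty before and after the step, \<open>F\<close> and \<open>F'\<close> its values, \<open>p\<close> and \<open>p'\<close> the gaps between
subsolution and supersolution, and \<open>\<zeta>\<close> is the length of the common slope.  The Hamiltonians
contribute at most \<open>M (1 + C + \<zeta>) m' \<delta>\<close>.  The weight decays at rate \<open>8 M + 1\<close>: the part \<open>8 M\<close>
absorbs the term with \<open>\<zeta>\<close>, as \<open>\<zeta> \<le> 4 m E / \<epsilon> \<le> 8 m' E' / \<epsilon>\<close>, and the part \<open>1\<close> absorbs the rest up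
to a multiple of \<open>\<epsilon>\<close>, by \<open>a b \<le> a\<^sup>2 + b\<^sup>2\<close>.
\<close>

lemma weighted_step_estimate:
  fixes M C \<epsilon> \<delta> K :: real
  assumes pos: "\<epsilon> > 0" "\<delta> > 0" "M \<ge> 0" "C \<ge> 0" and rate: "(8 * M + 1) * \<delta> \<le> 1"
    and E': "e > 0" "e \<le> E'" and E: "E = E' * (1 + (8 * M + 1) * \<delta>)" "E \<le> 1"
    and m: "0 \<le> m" "m \<le> m'" and F': "m'\<^sup>2 \<le> F'" and \<zeta>: "\<zeta> \<le> 4 * m * E / \<epsilon>"
    and g: "F' \<le> F + g + 22 * (K * \<delta>)\<^sup>2"
    and p': "p + E / \<epsilon> * g - M * (1 + C + \<zeta>) * m' * \<delta> \<le> p'"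
    and p: "c + E * F / \<epsilon> - k \<le> p"
  shows "c + E' * F' / \<epsilon> - k - \<delta> * (\<epsilon> * (M\<^sup>2 * (1 + C)\<^sup>2 / e) + 22 * K\<^sup>2 * \<delta> / \<epsilon>) \<le> p'"
proof -
  have E0: "E' > 0" using E' by simp
  have "0 \<le> (8 * M + 1) * \<delta>" using pos by simp
  then have EE: "E > 0" using E(1) E0 by (simp add: add_pos_nonneg)
  have "E' * (1 + (8 * M + 1) * \<delta>) \<le> E' * 2" using E0 rate by (intro mult_left_mono) auto
  then have E2: "E \<le> 2 * E'" using E by simp
  have m'0: "0 \<le> m'" using m by simp
  define s where "s = E' * m'\<^sup>2 / \<epsilon>"
  have 1: "M * \<zeta> * m' * \<delta> \<le> 8 * M * \<delta> * s"
  proof -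
    have "\<zeta> \<le> 8 * m' * E' / \<epsilon>"
    proof -
      have "4 * m * E \<le> 4 * m' * (2 * E')" using m m'0 E2 EE by (intro mult_mono) auto
      then have "4 * m * E / \<epsilon> \<le> 4 * m' * (2 * E') / \<epsilon>" using pos by (intro divide_right_mono) auto
      then show ?thesis using \<zeta> by simp
    qed
    then have "\<zeta> * (M * m' * \<delta>) \<le> 8 * m' * E' / \<epsilon> * (M * m' * \<delta>)"
      using pos m'0 by (intro mult_right_mono) auto
    then show ?thesis by (simp add: s_def power2_eq_square algebra_simps)
  qed
  have 2: "M * (1 + C) * m' * \<delta> \<le> \<delta> * s + \<delta> * (\<epsilon> * (M\<^sup>2 * (1 + C)\<^sup>2 / e))"
  proof -
    have "M * (1 + C) * m' \<le> s + \<epsilon> * (M\<^sup>2 * (1 + C)\<^sup>2 / E')"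
    proof -
      define a b where "a = E' * m'" and "b = \<epsilon> * (M * (1 + C))"
      have nn: "0 \<le> a" "0 \<le> b" using E0 m'0 pos by (auto simp: a_def b_def)
      have "a * b \<le> a\<^sup>2 + b\<^sup>2"
        using sum_squares_bound [of a b] nn mult_nonneg_nonneg [OF nn] by linarith
      then have "a * b / (E' * \<epsilon>) \<le> (a\<^sup>2 + b\<^sup>2) / (E' * \<epsilon>)" using E0 pos by (intro divide_right_mono) auto
      moreover have "a * b / (E' * \<epsilon>) = M * (1 + C) * m'" using E0 pos by (simp add: a_def b_def)
      moreover have "(a\<^sup>2 + b\<^sup>2) / (E' * \<epsilon>) = s + \<epsilon> * (M\<^sup>2 * (1 + C)\<^sup>2 / E')"
        using E0 pos by (simp add: a_def b_def s_def power2_eq_square field_simps)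
      ultimately show ?thesis by simp
    qed
    also have "M\<^sup>2 * (1 + C)\<^sup>2 / E' \<le> M\<^sup>2 * (1 + C)\<^sup>2 / e" using E' by (intro divide_left_mono) auto
    finally have "M * (1 + C) * m' \<le> s + \<epsilon> * (M\<^sup>2 * (1 + C)\<^sup>2 / e)"
      using pos by (simp add: mult_left_mono)
    then have "(M * (1 + C) * m') * \<delta> \<le> (s + \<epsilon> * (M\<^sup>2 * (1 + C)\<^sup>2 / e)) * \<delta>"
      using pos by (intro mult_right_mono) auto
    then show ?thesis by (simp add: algebra_simps)
  qed
  have 3: "E' * F' / \<epsilon> + (8 * M + 1) * \<delta> * s \<le> E * F' / \<epsilon>"
  proof -
    have "(8 * M + 1) * \<delta> * s \<le> (8 * M + 1) * \<delta> * (E' * F' / \<epsilon>)"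
      unfolding s_def using pos E0 F' by (intro mult_left_mono divide_right_mono) auto
    moreover have "E * F' / \<epsilon> = E' * F' / \<epsilon> + (8 * M + 1) * \<delta> * (E' * F' / \<epsilon>)"
      unfolding E(1) by (simp add: algebra_simps add_divide_distrib)
    ultimately show ?thesis by linarith
  qed
  have 4: "E * F' / \<epsilon> - 22 * K\<^sup>2 * \<delta>\<^sup>2 / \<epsilon> \<le> E * F / \<epsilon> + E / \<epsilon> * g"
  proof -
    have "E * F' \<le> E * (F + g + 22 * (K * \<delta>)\<^sup>2)" using g EE by (intro mult_left_mono) auto
    also have "\<dots> = E * F + E * g + E * (22 * (K * \<delta>)\<^sup>2)" by (simp add: algebra_simps)
    also have "E * (22 * (K * \<delta>)\<^sup>2) \<le> 1 * (22 * (K * \<delta>)\<^sup>2)" using E(2) by (intro mult_right_mono) auto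
    finally have "E * F' / \<epsilon> \<le> (E * F + E * g + 22 * (K * \<delta>)\<^sup>2) / \<epsilon>"
      using pos by (intro divide_right_mono) auto
    then show ?thesis by (simp add: add_divide_distrib power_mult_distrib mult.assoc)
  qed
  have "M * (1 + C + \<zeta>) * m' * \<delta> = M * (1 + C) * m' * \<delta> + M * \<zeta> * m' * \<delta>" by (simp add: algebra_simps)
  moreover have "(8 * M + 1) * \<delta> * s = 8 * M * \<delta> * s + \<delta> * s" by (simp add: algebra_simps)
  moreover have "\<delta> * (22 * K\<^sup>2 * \<delta> / \<epsilon>) = 22 * K\<^sup>2 * \<delta>\<^sup>2 / \<epsilon>" by (simp add: power2_eq_square)
  ultimately show ?thesis using 1 2 3 4 p p' by (simp only: distrib_left)
qed

text \<open>
At the first zero of \<open>p\<close> the function would have been non-negative so far, and \<open>step\<close> forbids that zero.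
\<close>

lemma positive_continuation:
  fixes p :: "real \<Rightarrow> real"
  assumes cont: "continuous_on {a..b} p" and pa: "p a > 0"
    and step: "\<And>t. \<lbrakk>a \<le> t; t \<le> b; \<forall>s\<in>{a..t}. 0 \<le> p s\<rbrakk> \<Longrightarrow> 0 < p t"
    and t: "t \<in> {a..b}"
  shows "0 < p t"
proof (rule ccontr)
  assume "\<not> 0 < p t"
  define S where "S = {s \<in> {a..t}. p s \<le> 0}"
  have tS: "t \<in> S" using \<open>\<not> 0 < p t\<close> t by (simp add: S_def)
  have "closed S" unfolding S_def
  proof (rule continuous_on_closed_Collect_le)
    show "continuous_on {a..t} p" using cont t by (auto elim: continuous_on_subset)
  qed auto
  moreover have "S = {a..t} \<inter> S" by (auto simp: S_def)
  ultimately have "compact S" by (metis compact_Icc compact_Int_closed)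
  then obtain s where s: "s \<in> S" "\<And>r. r \<in> S \<Longrightarrow> s \<le> r"
    using compact_attains_inf [of S] tS by blast
  have s': "a \<le> s" "s \<le> t" "p s \<le> 0" using s(1) by (auto simp: S_def)
  have below: "0 < p r" if "a \<le> r" "r < s" for r
    using s(2) [of r] that s' by (force simp: S_def)
  have as: "a < s" using s' pa by (cases "a = s") auto
  have "0 \<le> p s"
  proof -
    have "continuous_on {a..s} p" using cont s' t by (auto elim: continuous_on_subset)
    then have "(p \<longlongrightarrow> p s) (at s within {a..s})" using as by (auto simp: continuous_on_def)
    then have "(p \<longlongrightarrow> p s) (at_left s)" using as by (simp add: at_within_Icc_at_left)
    then show ?thesis
    proof (rule tendsto_lowerbound)
      show "\<forall>\<^sub>F r in at_left s. 0 \<le> p r"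
        unfolding eventually_at_left_field using as below by (intro exI [of _ a]) (auto simp: less_imp_le)
    qed simp
  qed
  then have "\<forall>r\<in>{a..s}. 0 \<le> p r" using below less_imp_le by (metis atLeastAtMost_iff order_le_less)
  then have "0 < p s" using step s' t by auto
  then show False using s' by simp
qed

lemma X_set_compact_self:
  fixes xs :: "nat \<Rightarrow> real \<Rightarrow> real^'n"
  assumes L: "L \<ge> 0" and s0: "s\<^sub>0 \<in> {0..T}" and x0: "x\<^sub>0 \<in> path_space T" and xs: "\<And>n. xs n \<in> X_set T L s\<^sub>0 x\<^sub>0"
  obtains r x where "strict_mono (r :: nat \<Rightarrow> nat)" "x \<in> X_set T L s\<^sub>0 x\<^sub>0" "uniform_limit {0..T} (xs \<circ> r) x sequentially"
proof (rule X_set_compact [of L "\<lambda>_. s\<^sub>0" T s\<^sub>0 "\<lambda>_. x\<^sub>0" x\<^sub>0 xs, OF L s0 s0 x0 x0 xs])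
  show "(\<lambda>n. d_infty T (s\<^sub>0, x\<^sub>0) (s\<^sub>0, x\<^sub>0)) \<longlonglongrightarrow> 0" using d_infty_self [OF x0 s0] by simp
qed (rule that)

text \<open>
Lower semicontinuity bounds \<open>u\<close> from below near each point, and the path set is compact.
\<close>

lemma lsc_bounded_below_on_X_set:
  fixes u :: "real \<Rightarrow> (real \<Rightarrow> real^'n) \<Rightarrow> real"
  assumes lsc: "lsc_on_paths T u" and L: "L \<ge> 0" and s0: "s\<^sub>0 \<in> {0..T}" and x0: "x\<^sub>0 \<in> path_space T"
  obtains C where "\<forall>t\<in>{s\<^sub>0..T}. \<forall>x\<in>X_set T L s\<^sub>0 x\<^sub>0. - C \<le> u t x"
proof (rule ccontr)
  assume "\<not> thesis"
  then have "\<not> (\<forall>t\<in>{s\<^sub>0..T}. \<forall>x\<in>X_set T L s\<^sub>0 x\<^sub>0. - C \<le> u t x)" for C using that by blast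
  then have "\<exists>t x. t \<in> {s\<^sub>0..T} \<and> x \<in> X_set T L s\<^sub>0 x\<^sub>0 \<and> u t x < - real n" for n by (meson not_le)
  then obtain ts xs where ts: "\<And>n. ts n \<in> {s\<^sub>0..T}" and xs: "\<And>n. xs n \<in> X_set T L s\<^sub>0 x\<^sub>0"
    and un: "\<And>n. u (ts n) (xs n) < - real n" by metis
  have "compact {s\<^sub>0..T}" by simp
  then obtain t r1 where t: "t \<in> {s\<^sub>0..T}" and r1: "strict_mono (r1 :: nat \<Rightarrow> nat)" and tl: "(ts \<circ> r1) \<longlonglongrightarrow> t"
    using ts unfolding compact_def by blast
  obtain r2 x where r2: "strict_mono (r2 :: nat \<Rightarrow> nat)" and x: "x \<in> X_set T L s\<^sub>0 x\<^sub>0"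
    and xl: "uniform_limit {0..T} ((\<lambda>n. xs (r1 n)) \<circ> r2) x sequentially"
    by (rule X_set_compact_self [OF L s0 x0, of "\<lambda>n. xs (r1 n)"]) (use xs in blast)+
  have tl2: "(\<lambda>n. ts (r1 (r2 n))) \<longlonglongrightarrow> t"
    using LIMSEQ_subseq_LIMSEQ [OF tl r2] by (simp add: o_def)
  have t': "t \<in> {0..T}" using t s0 by auto
  obtain \<delta> where \<delta>: "\<delta> > 0" "\<forall>s\<in>{0..T}. \<forall>x'\<in>path_space T. d_infty T (t, x) (s, x') < \<delta> \<longrightarrow> u s x' > u t x - 1"
    using lsc t' X_setD(1) [OF x] zero_less_one unfolding lsc_on_paths_def by blast
  have "\<forall>\<^sub>F n in sequentially. d_infty T (t, x) (ts (r1 (r2 n)), ((\<lambda>n. xs (r1 n)) \<circ> r2) n) < \<delta>"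
    by (rule d_infty_tendsto_0 [OF L s0 x xl always_eventually tl2 t \<delta>(1)]) (use ts in blast)
  then obtain N where N: "\<And>n. n \<ge> N \<Longrightarrow> d_infty T (t, x) (ts (r1 (r2 n)), xs (r1 (r2 n))) < \<delta>"
    by (auto simp: eventually_sequentially)
  obtain k :: nat where k: "1 - u t x < real k" using reals_Archimedean2 by blast
  define n where "n = max N k"
  have "n \<le> r2 n" "r2 n \<le> r1 (r2 n)" using seq_suble [OF r2] seq_suble [OF r1] by auto
  then have "real k \<le> real (r1 (r2 n))" by (simp add: n_def)
  moreover have "u t x - 1 < u (ts (r1 (r2 n))) (xs (r1 (r2 n)))"
    using \<delta>(2) N [of n] ts [of "r1 (r2 n)"] s0 X_setD(1) [OF xs] by (auto simp: n_def)
  ultimately show False using un [of "r1 (r2 n)"] k by linarith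
qed

context tvp_data
begin

text \<open>
The exceptional set of the Lipschitz condition in \<open>x\<close> depends on \<open>y\<close>.  Rational values of \<open>y\<close> and
continuity of \<open>H\<close> give one null set for all \<open>y\<close>, as is needed to insert a function \<open>y(t)\<close>.
\<close>

lemma H_Lipschitz_all_y:
  assumes M: "\<And>y. AE t in lebesgue. t\<^sub>0 < t \<and> t < T \<longrightarrow>
            \<bar>H t x y z - H t x' y z\<bar> \<le> M * (1 + \<bar>y\<bar> + norm z) * (SUP s\<in>{0..t}. norm (x s - x' s))"
    and x: "x \<in> path_space T" "x' \<in> path_space T" and t0: "0 \<le> t\<^sub>0"
  obtains N where "negligible N" "\<And>t y. \<lbrakk>t \<in> {t\<^sub>0..T}; t \<notin> N\<rbrakk> \<Longrightarrow> t \<in> good_times \<and>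
     \<bar>H t x y z - H t x' y z\<bar> \<le> M * (1 + \<bar>y\<bar> + norm z) * (SUP s\<in>{0..t}. norm (x s - x' s))"
proof -
  let ?D = "\<lambda>t. SUP s\<in>{0..t}. norm (x s - x' s)"
  have "AE t in lebesgue. \<forall>q::rat. t\<^sub>0 < t \<and> t < T \<longrightarrow>
            \<bar>H t x (of_rat q) z - H t x' (of_rat q) z\<bar> \<le> M * (1 + \<bar>of_rat q\<bar> + norm z) * ?D t"
    unfolding AE_all_countable using M by blast
  then obtain N1 where N1: "N1 \<in> null_sets lebesgue"
    "\<And>t q. \<lbrakk>t \<notin> N1; t\<^sub>0 < t; t < T\<rbrakk> \<Longrightarrow> \<bar>H t x (of_rat q) z - H t x' (of_rat q) z\<bar> \<le> M * (1 + \<bar>of_rat q\<bar> + norm z) * ?D t"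
    by (auto simp: eventually_ae_filter)
  define N where "N = N1 \<union> {t\<^sub>0} \<union> ({0..T} - good_times)"
  have "negligible N" using N1(1) negligible_bad_times by (simp add: N_def negligible_iff_null_sets [symmetric])
  moreover have "t \<in> good_times \<and> \<bar>H t x y z - H t x' y z\<bar> \<le> M * (1 + \<bar>y\<bar> + norm z) * ?D t"
    if t: "t \<in> {t\<^sub>0..T}" "t \<notin> N" for t y
  proof
    show g: "t \<in> good_times" using t t0 by (auto simp: N_def)
    have "\<exists>q::rat. y < of_rat q \<and> of_rat q < y + inverse (real (Suc n))" for n
      by (rule of_rat_dense) simp
    then obtain q :: "nat \<Rightarrow> rat" where q: "\<And>n. y < of_rat (q n)" "\<And>n. of_rat (q n) < y + inverse (real (Suc n))" by metis
    have ql: "(\<lambda>n. real_of_rat (q n)) \<longlonglongrightarrow> y"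
    proof (rule tendsto_sandwich [OF _ _ tendsto_const])
      show "(\<lambda>n. y + inverse (real (Suc n))) \<longlonglongrightarrow> y"
        using tendsto_add [OF tendsto_const LIMSEQ_inverse_real_of_nat, of y] by simp
    qed (use q in \<open>auto intro: always_eventually less_imp_le\<close>)
    have Hl: "(\<lambda>n. H t \<xi> (of_rat (q n)) z) \<longlonglongrightarrow> H t \<xi> y z" if "\<xi> \<in> path_space T" for \<xi>
      by (rule H_tendsto [OF g that that uniform_limit_const ql])
    have "(\<lambda>n. \<bar>H t x (of_rat (q n)) z - H t x' (of_rat (q n)) z\<bar>) \<longlonglongrightarrow> \<bar>H t x y z - H t x' y z\<bar>"
      by (intro tendsto_intros Hl x)
    moreover have "(\<lambda>n. M * (1 + \<bar>of_rat (q n)\<bar> + norm z) * ?D t) \<longlonglongrightarrow> M * (1 + \<bar>y\<bar> + norm z) * ?D t"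
      by (intro tendsto_intros ql)
    moreover have "t \<notin> N1" "t\<^sub>0 < t" "t < T" using t good_timesD [OF g] by (auto simp: N_def)
    ultimately show "\<bar>H t x y z - H t x' y z\<bar> \<le> M * (1 + \<bar>y\<bar> + norm z) * ?D t"
      using N1(2) by (intro LIMSEQ_le) auto
  qed
  ultimately show ?thesis by (rule that)
qed

text \<open>
As long as \<open>y1 \<le> y2\<close>, monotonicity in \<open>y\<close> allows \<open>y2\<close> to be replaced by \<open>y1\<close> in the first
Hamiltonian, and \<open>y1\<close> is bounded from both sides by \<open>C\<close>, so that the Lipschitz condition in \<open>x\<close>
applies.  The gap assumed at time \<open>a\<close> is so large that the resulting estimate itself keeps \<open>y1 < y2\<close>
up to time \<open>b\<close>.
\<close>

lemma comparison_one_step: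
  assumes t0: "t\<^sub>0 \<in> {0..<T}" and a: "t\<^sub>0 \<le> a" "a \<le> b" "b \<le> T"
    and \<xi>: "\<xi>1 \<in> X_set T L\<^sub>H t\<^sub>0 x\<^sub>0" "\<xi>2 \<in> X_set T L\<^sub>H t\<^sub>0 x\<^sub>0"
    and Y1: "(x1, y1) \<in> Y_set T H L\<^sub>H a \<xi>1 (y1 a) z" and Y2: "(x2, y2) \<in> Y_set T H L\<^sub>H a \<xi>2 (y2 a) z"
    and M: "M \<ge> 0" "\<And>x x' y z. \<lbrakk>x \<in> X_set T L\<^sub>H t\<^sub>0 x\<^sub>0; x' \<in> X_set T L\<^sub>H t\<^sub>0 x\<^sub>0\<rbrakk> \<Longrightarrow>
        AE t in lebesgue. t\<^sub>0 < t \<and> t < T \<longrightarrow>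
            \<bar>H t x y z - H t x' y z\<bar> \<le> M * (1 + \<bar>y\<bar> + norm z) * (SUP s\<in>{0..t}. norm (x s - x' s))"
    and C: "C \<ge> 0" "\<And>t. \<lbrakk>a \<le> t; t \<le> b\<rbrakk> \<Longrightarrow> - C \<le> y1 t" "\<And>t. \<lbrakk>a \<le> t; t \<le> b\<rbrakk> \<Longrightarrow> y2 t \<le> C"
    and \<mu>: "\<And>t. \<lbrakk>0 \<le> t; t \<le> b\<rbrakk> \<Longrightarrow> norm (x2 t - x1 t) \<le> \<mu>"
    and d: "\<And>t. \<lbrakk>a \<le> t; t \<le> b\<rbrakk> \<Longrightarrow> norm ((x2 t - x1 t) - (x2 a - x1 a)) \<le> \<Delta>"
    and gap: "norm z * \<Delta> + M * (1 + C + norm z) * \<mu> * (b - a) < y2 a - y1 a"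
  shows "y2 a - y1 a + ((x2 b - x1 b) - (x2 a - x1 a)) \<bullet> z - M * (1 + C + norm z) * \<mu> * (b - a) \<le> y2 b - y1 b"
proof -
  define w where "w = (\<lambda>t. x2 t - x1 t)"
  define p where "p = (\<lambda>t. y2 t - y1 t)"
  define B where "B = M * (1 + C + norm z) * \<mu>"
  have a': "a \<in> {0..T}" "0 \<le> a" using a t0 by auto
  have t0': "t\<^sub>0 \<in> {0..T}" using t0 by auto
  note D1 = Y_setD [OF Y1] and D2 = Y_setD [OF Y2]
  have X: "x1 \<in> X_set T L\<^sub>H t\<^sub>0 x\<^sub>0" "x2 \<in> X_set T L\<^sub>H t\<^sub>0 x\<^sub>0"
    using X_set_trans [OF L_H_nonneg t0' \<xi>(1) _ D1(1)] X_set_trans [OF L_H_nonneg t0' \<xi>(2) _ D2(1)] a by auto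
  have \<mu>0: "\<mu> \<ge> 0" using \<mu> [of a] a' a norm_ge_zero order_trans by blast
  have B0: "B \<ge> 0" using M(1) C(1) \<mu>0 by (simp add: B_def)
  obtain N where N: "negligible N" "\<And>t y. \<lbrakk>t \<in> {t\<^sub>0..T}; t \<notin> N\<rbrakk> \<Longrightarrow> t \<in> good_times \<and>
     \<bar>H t x2 y z - H t x1 y z\<bar> \<le> M * (1 + \<bar>y\<bar> + norm z) * (SUP s\<in>{0..t}. norm (x2 s - x1 s))"
    by (rule H_Lipschitz_all_y [OF M(2) [OF X(2) X(1)] D2(4) D1(4), of z]) (use t0 in auto)
  have est: "p a + (w t - w a) \<bullet> z - B * (t - a) \<le> p t"
    if t: "a \<le> t" "t \<le> b" and pos: "\<forall>s\<in>{a..t}. 0 \<le> p s" for t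
  proof -
    have tT: "t \<le> T" using t a by simp
    let ?f = "\<lambda>s. H s x2 (y2 s) z - H s x1 (y1 s) z"
    have i1: "(\<lambda>s. H s x1 (y1 s) z) integrable_on {a..t}" and i2: "(\<lambda>s. H s x2 (y2 s) z) integrable_on {a..t}"
      using Y_set_increment(2) [OF L_H_nonneg a'(1) Y1 order_refl t(1) tT]
        Y_set_increment(2) [OF L_H_nonneg a'(1) Y2 order_refl t(1) tT] by auto
    define g where "g = (\<lambda>s. if s \<in> N then 0 else ?f s)"
    have gf: "g integrable_on {a..t}" "integral {a..t} g = integral {a..t} ?f"
    proof -
      have "?f integrable_on {a..t}" by (rule Henstock_Kurzweil_Integration.integrable_diff [OF i2 i1])
      then show "g integrable_on {a..t}" by (rule integrable_spike [OF _ N(1)]) (simp add: g_def)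
      show "integral {a..t} g = integral {a..t} ?f" by (rule integral_spike [OF N(1)]) (simp add: g_def)
    qed
    have "integral {a..t} g \<le> integral {a..t} (\<lambda>_. B)"
    proof (rule integral_le [OF gf(1)])
      fix s assume s: "s \<in> {a..t}"
      show "g s \<le> B"
      proof (cases "s \<in> N")
        case False
        have s': "s \<in> {t\<^sub>0..T}" using s t a by auto
        have gs: "s \<in> good_times" using N(2) [OF s' False] by blast
        have "y1 s \<le> y2 s" using pos s by (auto simp: p_def)
        then have 1: "H s x2 (y2 s) z \<le> H s x2 (y1 s) z" by (rule H_antimono [OF gs D2(4)])
        have "\<bar>y1 s\<bar> \<le> C" using C(2,3) [of s] \<open>y1 s \<le> y2 s\<close> s t by (auto simp: abs_le_iff)
        moreover have "(SUP r\<in>{0..s}. norm (x2 r - x1 r)) \<le> \<mu>"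
          by (rule cSUP_least) (use \<mu> s t a' in auto)
        moreover have "0 \<le> (SUP r\<in>{0..s}. norm (x2 r - x1 r))"
        proof (rule cSUP_upper2 [where x = 0])
          show "bdd_above ((\<lambda>r. norm (x2 r - x1 r)) ` {0..s})"
            by (rule bdd_aboveI2 [of _ _ \<mu>]) (use \<mu> s t in auto)
        qed (use s a' in auto)
        ultimately have "M * (1 + \<bar>y1 s\<bar> + norm z) * (SUP r\<in>{0..s}. norm (x2 r - x1 r)) \<le> B"
          unfolding B_def using M(1) C(1) by (intro mult_mono mult_left_mono) auto
        then have "H s x2 (y1 s) z - H s x1 (y1 s) z \<le> B" using N(2) [OF s' False, of "y1 s"] by linarith
        then show ?thesis using 1 False by (simp add: g_def)
      qed (use B0 in \<open>simp add: g_def\<close>)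
    qed auto
    then have "integral {a..t} ?f \<le> B * (t - a)" using gf(2) t by (simp add: mult.commute)
    moreover have "p t - p a = (w t - w a) \<bullet> z - integral {a..t} ?f"
    proof -
      have "integral {a..t} ?f = integral {a..t} (\<lambda>s. H s x2 (y2 s) z) - integral {a..t} (\<lambda>s. H s x1 (y1 s) z)"
        by (rule Henstock_Kurzweil_Integration.integral_diff [OF i2 i1])
      then show ?thesis
        using Y_set_increment(1) [OF L_H_nonneg a'(1) Y1 order_refl t(1) tT]
          Y_set_increment(1) [OF L_H_nonneg a'(1) Y2 order_refl t(1) tT]
        by (simp add: p_def w_def inner_diff_left)
    qed
    ultimately show ?thesis by linarith
  qed
  have pos: "0 < p t" if t: "t \<in> {a..b}" for t
  proof (rule positive_continuation [OF _ _ _ t])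
    show "continuous_on {a..b} p" unfolding p_def
      using D1(2) D2(2) a by (intro continuous_intros) (auto elim: continuous_on_subset)
    have small: "0 \<le> norm z * \<Delta> + B * (b - a)"
      using B0 a d [of a] by (auto intro!: add_nonneg_nonneg mult_nonneg_nonneg)
    then show "0 < p a" using gap unfolding p_def B_def by linarith
    fix s assume s: "a \<le> s" "s \<le> b" "\<forall>r\<in>{a..s}. 0 \<le> p r"
    have "\<bar>(w s - w a) \<bullet> z\<bar> \<le> norm (w s - w a) * norm z" by (rule Cauchy_Schwarz_ineq2)
    also have "\<dots> \<le> \<Delta> * norm z" using d [OF s(1,2)] by (intro mult_right_mono) (auto simp: w_def)
    finally have "- (norm z * \<Delta>) \<le> (w s - w a) \<bullet> z" by (simp add: mult.commute abs_le_iff)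
    moreover have "B * (s - a) \<le> B * (b - a)" using B0 s by (intro mult_left_mono) auto
    moreover have "norm z * \<Delta> + B * (b - a) < p a" using gap by (simp add: p_def B_def)
    ultimately show "0 < p s" using est [OF s] by linarith
  qed
  have "p a + (w b - w a) \<bullet> z - B * (b - a) \<le> p b"
    by (rule est [OF a(2) order_refl]) (use pos in \<open>auto intro: less_imp_le\<close>)
  then show ?thesis by (simp add: p_def w_def B_def)
qed

text \<open>
Divide \<open>[t\<^sub>0,T]\<close> into short steps.  On each step follow a characteristic of \<open>u\<close> and one of \<open>v\<close> with the
same slope, the gradient of the weighted penalty at the beginning of the step.  The gap \<open>y2 - y1\<close> then
grows at least as much as the penalty, up to an error whose sum is at most \<open>c/2\<close>.  At time \<open>T\<close> the gap
is at most \<open>h x2 - h x1\<close>, which therefore is at least \<open>c/2\<close>; it is also at most \<open>2 C\<close>, which bounds the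
penalty and thereby the distance of the paths.
\<close>

lemma comparison_near_optimal_pair:
  assumes u: "minimax_supersolution T h H L\<^sub>H u" and v: "minimax_subsolution T h H L\<^sub>H v"
    and t0: "t\<^sub>0 \<in> {0..<T}" and x0: "x\<^sub>0 \<in> path_space T"
    and c: "0 < c" "c \<le> v t\<^sub>0 x\<^sub>0 - u t\<^sub>0 x\<^sub>0"
    and R: "\<And>x. x \<in> X_set T L\<^sub>H t\<^sub>0 x\<^sub>0 \<Longrightarrow> 1 + running_sup x T \<le> R"
    and C: "C \<ge> 0" "\<And>t x. \<lbrakk>t \<in> {t\<^sub>0..T}; x \<in> X_set T L\<^sub>H t\<^sub>0 x\<^sub>0\<rbrakk> \<Longrightarrow> - C \<le> u t x"
      "\<And>t x. \<lbrakk>t \<in> {t\<^sub>0..T}; x \<in> X_set T L\<^sub>H t\<^sub>0 x\<^sub>0\<rbrakk> \<Longrightarrow> v t x \<le> C"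
    and M: "M \<ge> 0" "\<And>x x' y z. \<lbrakk>x \<in> X_set T L\<^sub>H t\<^sub>0 x\<^sub>0; x' \<in> X_set T L\<^sub>H t\<^sub>0 x\<^sub>0\<rbrakk> \<Longrightarrow>
        AE t in lebesgue. t\<^sub>0 < t \<and> t < T \<longrightarrow>
            \<bar>H t x y z - H t x' y z\<bar> \<le> M * (1 + \<bar>y\<bar> + norm z) * (SUP s\<in>{0..t}. norm (x s - x' s))"
    and e: "e = exp (- ((8 * M + 1) * T))"
    and \<epsilon>: "\<epsilon> > 0" "T * (\<epsilon> * (M\<^sup>2 * (1 + C)\<^sup>2 / e)) \<le> c / 4"
  shows "\<exists>x1 x2 m. x1 \<in> X_set T L\<^sub>H t\<^sub>0 x\<^sub>0 \<and> x2 \<in> X_set T L\<^sub>H t\<^sub>0 x\<^sub>0 \<and> (\<forall>r\<in>{0..T}. norm (x2 r - x1 r) \<le> m) \<and>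
    c / 2 \<le> h x2 - h x1 \<and> e * m\<^sup>2 \<le> 2 * C * \<epsilon>"
proof -
  let ?X = "X_set T L\<^sub>H t\<^sub>0 x\<^sub>0"
  have t0': "t\<^sub>0 \<in> {0..T}" using t0 by auto
  have e0: "e > 0" by (simp add: e)
  \<comment> \<open>\<open>K\<close> is a Lipschitz constant for the difference of two paths, and \<open>B\<close> will bound the quantity \<open>m\<close> of all steps.\<close>
  define K where "K = 2 * (L\<^sub>H * R)"
  have R0: "R \<ge> 0"
    using R [OF stop_path_in_X_set [OF L_H_nonneg t0' x0]]
      running_sup_nonneg [OF stop_path_in_path_space [OF x0 t0'] T_nonneg order_refl] by linarith
  have K0: "K \<ge> 0" using R0 L_H_nonneg by (simp add: K_def)
  have Xn: "norm (x r) \<le> R" if "x \<in> ?X" "r \<in> {0..T}" for x r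
    using norm_le_running_sup [OF X_setD(1) [OF that(1)], of r T] R [OF that(1)] that(2) by auto
  have Xlip: "norm (x s - x r) \<le> L\<^sub>H * R * \<bar>s - r\<bar>" if "x \<in> ?X" "s \<in> {t\<^sub>0..T}" "r \<in> {t\<^sub>0..T}" for x s r
    by (rule X_set_Lipschitz [OF L_H_nonneg t0' that]) (use R [OF that(1)] L_H_nonneg in \<open>auto intro: mult_left_mono\<close>)
  define B where "B = 2 * R + K * T"
  have B0: "B \<ge> 0" using R0 K0 T_nonneg by (simp add: B_def)
  define rate where "rate = 8 * M + 1"
  have rate_pos: "rate > 0" using M(1) by (simp add: rate_def)
  have small: "\<forall>\<^sub>F n in sequentially. A * ((T - t\<^sub>0) / real (Suc n)) < b" if "b > 0" for A b :: real
  proof (rule order_tendstoD(2))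
    have "(\<lambda>n. A * (T - t\<^sub>0) * inverse (real (Suc n))) \<longlonglongrightarrow> 0"
      by (rule tendsto_mult_right_zero [OF LIMSEQ_inverse_real_of_nat])
    then show "(\<lambda>n. A * ((T - t\<^sub>0) / real (Suc n))) \<longlonglongrightarrow> 0" by (simp add: divide_inverse mult.assoc)
  qed (use that in simp)
  have "\<forall>\<^sub>F n in sequentially. rate * ((T - t\<^sub>0) / real (Suc n)) < 1 \<and>
      (T * (22 * K\<^sup>2 / \<epsilon>)) * ((T - t\<^sub>0) / real (Suc n)) < c / 4 \<and>
      (4 * B / \<epsilon> * K + M * (1 + C + 4 * B / \<epsilon>) * B) * ((T - t\<^sub>0) / real (Suc n)) < c / 2"
    by (intro eventually_conj small) (use c in auto)
  then obtain n where n: "rate * ((T - t\<^sub>0) / real (Suc n)) < 1"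
      "(T * (22 * K\<^sup>2 / \<epsilon>)) * ((T - t\<^sub>0) / real (Suc n)) < c / 4"
      "(4 * B / \<epsilon> * K + M * (1 + C + 4 * B / \<epsilon>) * B) * ((T - t\<^sub>0) / real (Suc n)) < c / 2"
    by (auto simp: eventually_sequentially)
  define \<delta> where "\<delta> = (T - t\<^sub>0) / real (Suc n)"
  have \<delta>: "\<delta> > 0" "real (Suc n) * \<delta> = T - t\<^sub>0" using t0 by (auto simp: \<delta>_def)
  have \<delta>T: "\<delta> \<le> T"
  proof -
    have "(T - t\<^sub>0) / real (Suc n) \<le> (T - t\<^sub>0) / 1" using t0 by (intro divide_left_mono) auto
    then show ?thesis using t0 by (simp add: \<delta>_def)
  qed
  note n' = n [folded \<delta>_def]
  define A where "A = \<epsilon> * (M\<^sup>2 * (1 + C)\<^sup>2 / e) + 22 * K\<^sup>2 * \<delta> / \<epsilon>"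
  have A0: "A \<ge> 0" using \<epsilon> e0 \<delta> by (simp add: A_def)
  have TA: "T * A \<le> c / 2"
  proof -
    have "T * A = T * (\<epsilon> * (M\<^sup>2 * (1 + C)\<^sup>2 / e)) + (T * (22 * K\<^sup>2 / \<epsilon>)) * \<delta>"
      by (simp add: A_def algebra_simps)
    then show ?thesis using \<epsilon>(2) n'(2) by linarith
  qed
  define \<tau> where "\<tau> = (\<lambda>i. t\<^sub>0 + real i * \<delta>)"
  have \<tau>0: "\<tau> 0 = t\<^sub>0" and \<tau>N: "\<tau> (Suc n) = T" and \<tau>S: "\<tau> (Suc i) = \<tau> i + \<delta>" for i
    using \<delta> by (auto simp: \<tau>_def algebra_simps)
  have \<tau>m: "\<tau> i \<le> T" "t\<^sub>0 \<le> \<tau> i" if "i \<le> Suc n" for i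
  proof -
    have "real i * \<delta> \<le> real (Suc n) * \<delta>" using that \<delta> by (intro mult_right_mono) auto
    then show "\<tau> i \<le> T" using \<delta>(2) unfolding \<tau>_def by linarith
    show "t\<^sub>0 \<le> \<tau> i" using \<delta> by (simp add: \<tau>_def)
  qed
  have iA: "real i * \<delta> * A \<le> c / 2" if "i \<le> Suc n" for i
  proof -
    have "real i * \<delta> \<le> T" using \<tau>m(1) [OF that] t0 by (simp add: \<tau>_def)
    then have "real i * \<delta> * A \<le> T * A" using A0 by (intro mult_right_mono) auto
    then show ?thesis using TA by linarith
  qed
  \<comment> \<open>A discrete exponential, bounded below by \<open>e\<close> whatever the number of steps.\<close>
  define E where "E = (\<lambda>i. 1 / (1 + rate * \<delta>) ^ i)"
  have q: "1 + rate * \<delta> > 1" using rate_pos \<delta> by simp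
  have E_pos: "E i > 0" for i using q by (simp add: E_def)
  have E_le: "E i \<le> 1" for i using q one_le_power [of "1 + rate * \<delta>" i] by (simp add: E_def)
  have E_S: "E i = E (Suc i) * (1 + rate * \<delta>)" for i using q by (simp add: E_def)
  have E_e: "e \<le> E i" if "i \<le> Suc n" for i
  proof -
    have "(1 + rate * \<delta>) ^ i \<le> exp (rate * \<delta>) ^ i" using q exp_ge_add_one_self [of "rate * \<delta>"] by (intro power_mono) auto
    also have "\<dots> = exp (rate * (real i * \<delta>))" by (simp add: exp_of_nat_mult [symmetric] ac_simps)
    also have "\<dots> \<le> exp (rate * T)"
      using \<tau>m(1) [OF that] t0 rate_pos by (simp add: \<tau>_def)
    finally have "1 / exp (rate * T) \<le> 1 / (1 + rate * \<delta>) ^ i" using q by (intro divide_left_mono) auto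
    then show ?thesis by (simp add: E_def e rate_def exp_minus inverse_eq_divide)
  qed
  have usol: "\<exists>x y. (x, y) \<in> Y_set T H L\<^sub>H s \<xi> y\<^sub>0 z \<and> (\<forall>t\<in>{s..T}. u t x \<le> y t)"
    if "s \<in> {0..<T}" "\<xi> \<in> path_space T" "u s \<xi> \<le> y\<^sub>0" for s \<xi> y\<^sub>0 z
    using u that unfolding minimax_supersolution_def by blast
  have vsol: "\<exists>x y. (x, y) \<in> Y_set T H L\<^sub>H s \<xi> y\<^sub>0 z \<and> (\<forall>t\<in>{s..T}. y t \<le> v t x)"
    if "s \<in> {0..<T}" "\<xi> \<in> path_space T" "y\<^sub>0 \<le> v s \<xi>" for s \<xi> y\<^sub>0 z
    using v that unfolding minimax_subsolution_def by blast
  \<comment> \<open>The invariant at the \<open>i\<close>-th partition point; its last part says that the gap exceeds \<open>c\<close> plus the penalty minus the accumulated error.\<close>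
  define St where "St = (\<lambda>i x1 x2 y1 y2 m. x1 \<in> ?X \<and> x2 \<in> ?X \<and> u (\<tau> i) x1 \<le> y1 \<and> y2 \<le> v (\<tau> i) x2 \<and>
     0 \<le> m \<and> m \<le> B \<and> (\<forall>r. 0 \<le> r \<longrightarrow> r \<le> \<tau> i \<longrightarrow> norm (x2 r - x1 r) \<le> m) \<and>
     c + E i * sup_lyapunov m (x2 (\<tau> i) - x1 (\<tau> i)) / \<epsilon> - real i * \<delta> * A \<le> y2 - y1)"
  have "\<exists>x1 x2 y1 y2 m. St i x1 x2 y1 y2 m" if "i \<le> Suc n" for i
    using that
  proof (induction i)
    case 0
    obtain x1 y1 where 1: "(x1, y1) \<in> Y_set T H L\<^sub>H t\<^sub>0 x\<^sub>0 (u t\<^sub>0 x\<^sub>0) 0" "\<forall>t\<in>{t\<^sub>0..T}. u t x1 \<le> y1 t"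
      using usol [OF t0 x0 order_refl] by blast
    obtain x2 y2 where 2: "(x2, y2) \<in> Y_set T H L\<^sub>H t\<^sub>0 x\<^sub>0 (v t\<^sub>0 x\<^sub>0) 0" "\<forall>t\<in>{t\<^sub>0..T}. y2 t \<le> v t x2"
      using vsol [OF t0 x0 order_refl] by blast
    note X1 = Y_setD(1) [OF 1(1)] and X2 = Y_setD(1) [OF 2(1)]
    have "u t\<^sub>0 x1 \<le> u t\<^sub>0 x\<^sub>0" using bspec [OF 1(2), of t\<^sub>0] Y_set_initial [OF L_H_nonneg t0' 1(1)] t0 by auto
    moreover have "v t\<^sub>0 x\<^sub>0 \<le> v t\<^sub>0 x2" using bspec [OF 2(2), of t\<^sub>0] Y_set_initial [OF L_H_nonneg t0' 2(1)] t0 by auto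
    moreover have "x2 r - x1 r = 0" if "0 \<le> r" "r \<le> t\<^sub>0" for r
      using X_setD(2) [OF X1 that] X_setD(2) [OF X2 that] by simp
    ultimately have "St 0 x1 x2 (u t\<^sub>0 x\<^sub>0) (v t\<^sub>0 x\<^sub>0) 0"
      unfolding St_def using X1 X2 c(2) B0 t0 by (simp add: \<tau>0 sup_lyapunov_def)
    then show ?case by blast
  next
    case (Suc i)
    then have i: "i \<le> Suc n" "i \<le> n" by auto
    let ?a = "\<tau> i" and ?b = "\<tau> (Suc i)"
    obtain x1 x2 y1 y2 m where S: "St i x1 x2 y1 y2 m" using Suc.IH [OF i(1)] by blast
    have X: "x1 \<in> ?X" "x2 \<in> ?X" and u1: "u ?a x1 \<le> y1" and v2: "y2 \<le> v ?a x2"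
      and m: "0 \<le> m" "m \<le> B" "\<And>r. \<lbrakk>0 \<le> r; r \<le> ?a\<rbrakk> \<Longrightarrow> norm (x2 r - x1 r) \<le> m"
      and p: "c + E i * sup_lyapunov m (x2 ?a - x1 ?a) / \<epsilon> - real i * \<delta> * A \<le> y2 - y1"
      using S unfolding St_def by auto
    have ab: "t\<^sub>0 \<le> ?a" "?a \<le> ?b" "?b \<le> T" "?a < T"
      using \<tau>m [OF i(1)] \<tau>m(1) [OF Suc.prems] \<delta> by (auto simp: \<tau>S)
    have a': "?a \<in> {0..<T}" "?a \<in> {0..T}" "0 \<le> ?a" using ab t0 by auto
    define w where "w = x2 ?a - x1 ?a"
    define z where "z = (E i / \<epsilon>) *\<^sub>R sup_lyapunov_grad m w"
    have wm: "norm w \<le> m" using m(3) [of ?a] a' by (simp add: w_def)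
    have nz: "norm z \<le> 4 * m * E i / \<epsilon>"
    proof -
      have "norm z = E i / \<epsilon> * norm (sup_lyapunov_grad m w)" using E_pos [of i] \<epsilon> by (simp add: z_def)
      also have "\<dots> \<le> E i / \<epsilon> * (4 * m)"
        using norm_sup_lyapunov_grad_le [OF wm] E_pos [of i] \<epsilon> by (intro mult_left_mono) auto
      finally show ?thesis by (simp add: algebra_simps)
    qed
    obtain x1' y1' where 1: "(x1', y1') \<in> Y_set T H L\<^sub>H ?a x1 y1 z" "\<forall>t\<in>{?a..T}. u t x1' \<le> y1' t"
      using usol [OF a'(1) X_setD(1) [OF X(1)] u1] by blast
    obtain x2' y2' where 2: "(x2', y2') \<in> Y_set T H L\<^sub>H ?a x2 y2 z" "\<forall>t\<in>{?a..T}. y2' t \<le> v t x2'"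
      using vsol [OF a'(1) X_setD(1) [OF X(2)] v2] by blast
    have X': "x1' \<in> ?X" "x2' \<in> ?X"
      using X_set_trans [OF L_H_nonneg t0' X(1) _ Y_setD(1) [OF 1(1)]]
        X_set_trans [OF L_H_nonneg t0' X(2) _ Y_setD(1) [OF 2(1)]] ab by auto
    have y': "y1' ?a = y1" "y2' ?a = y2"
      using Y_set_initial [OF L_H_nonneg a'(2) 1(1)] Y_set_initial [OF L_H_nonneg a'(2) 2(1)] by auto
    have same: "x1' r = x1 r" "x2' r = x2 r" if "0 \<le> r" "r \<le> ?a" for r
      using X_setD(2) [OF Y_setD(1) [OF 1(1)] that] X_setD(2) [OF Y_setD(1) [OF 2(1)] that] by auto
    have wa: "x2' ?a - x1' ?a = w" using same [of ?a] a' by (simp add: w_def)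
    have d: "norm ((x2' t - x1' t) - (x2' ?a - x1' ?a)) \<le> K * \<delta>" if t: "?a \<le> t" "t \<le> ?b" for t
    proof -
      have tt: "t \<in> {t\<^sub>0..T}" "?a \<in> {t\<^sub>0..T}" using t ab by auto
      have "norm ((x2' t - x1' t) - (x2' ?a - x1' ?a)) = norm ((x2' t - x2' ?a) - (x1' t - x1' ?a))"
        by (simp add: algebra_simps)
      also have "\<dots> \<le> norm (x2' t - x2' ?a) + norm (x1' t - x1' ?a)" by (rule norm_triangle_ineq4)
      also have "\<dots> \<le> L\<^sub>H * R * \<bar>t - ?a\<bar> + L\<^sub>H * R * \<bar>t - ?a\<bar>"
        using Xlip [OF X'(2) tt] Xlip [OF X'(1) tt] by (rule add_mono)
      also have "\<dots> = K * \<bar>t - ?a\<bar>" by (simp add: K_def)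
      also have "\<dots> \<le> K * \<delta>" using K0 t by (intro mult_left_mono) (auto simp: \<tau>S)
      finally show ?thesis .
    qed
    \<comment> \<open>This bounds the supremum of the difference over the next step, and is the form that the step estimate for the penalty requires.\<close>
    define m' where "m' = max m (norm w + K * \<delta>)"
    define w' where "w' = x2' ?b - x1' ?b"
    have m': "m \<le> m'" "0 \<le> m'" "m' \<le> B"
    proof -
      have "norm w \<le> R + R" unfolding w_def
        by (rule order_trans [OF norm_triangle_ineq4 add_mono]) (use Xn X ab a' in auto)
      moreover have "K * \<delta> \<le> K * T" using K0 \<delta>T by (rule mult_left_mono [rotated])
      ultimately show "m' \<le> B" using m by (simp add: m'_def B_def)
    qed (use m in \<open>auto simp: m'_def\<close>)
    have \<mu>: "norm (x2' t - x1' t) \<le> m'" if t: "0 \<le> t" "t \<le> ?b" for t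
    proof (cases "t \<le> ?a")
      case True
      then show ?thesis using same [of t] m(3) [of t] t m'(1) by simp
    next
      case False
      have "norm (x2' t - x1' t) \<le> norm w + norm ((x2' t - x1' t) - w)"
        by (metis add_diff_cancel_left' diff_add_cancel norm_triangle_ineq add.commute)
      also have "\<dots> \<le> norm w + K * \<delta>" using d [of t] False t by (simp add: wa)
      finally show ?thesis by (simp add: m'_def)
    qed
    have E1: "E i / \<epsilon> * sup_lyapunov m w \<ge> 0"
      using E_pos [of i] \<epsilon> sup_lyapunov_ge [of m w] by (simp add: order_trans [OF zero_le_power2])
    have p2: "c / 2 \<le> y2 - y1" using p iA [OF i(1)] E1 by (simp add: w_def)
    have nzB: "norm z \<le> 4 * B / \<epsilon>"
    proof -
      have "4 * m * E i \<le> 4 * B * 1" using m B0 E_le [of i] E_pos [of i] by (intro mult_mono) auto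
      then have "4 * m * E i / \<epsilon> \<le> 4 * B / \<epsilon>" using \<epsilon> by (simp add: divide_right_mono)
      then show ?thesis using nz by linarith
    qed
    have ba: "?b - ?a = \<delta>" by (simp add: \<tau>S)
    have gap: "norm z * (K * \<delta>) + M * (1 + C + norm z) * m' * (?b - ?a) < y2' ?a - y1' ?a"
    proof -
      have "norm z * (K * \<delta>) \<le> 4 * B / \<epsilon> * (K * \<delta>)" using nzB K0 \<delta> by (intro mult_right_mono) auto
      moreover have "M * (1 + C + norm z) * m' * \<delta> \<le> M * (1 + C + 4 * B / \<epsilon>) * B * \<delta>"
        using nzB m' M(1) C(1) \<delta> B0 \<epsilon> by (intro mult_right_mono mult_mono mult_left_mono) auto
      moreover have "4 * B / \<epsilon> * (K * \<delta>) + M * (1 + C + 4 * B / \<epsilon>) * B * \<delta>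
          = (4 * B / \<epsilon> * K + M * (1 + C + 4 * B / \<epsilon>) * B) * \<delta>" by (simp add: algebra_simps)
      ultimately show ?thesis using n'(3) p2 unfolding y' ba by linarith
    qed
    have Cy: "- C \<le> y1' t" "y2' t \<le> C" if "?a \<le> t" "t \<le> ?b" for t
    proof -
      have t: "t \<in> {?a..T}" "t \<in> {t\<^sub>0..T}" using that ab by auto
      show "- C \<le> y1' t" using 1(2) t(1) C(2) [OF t(2) X'(1)] by force
      show "y2' t \<le> C" using 2(2) t(1) C(3) [OF t(2) X'(2)] by force
    qed
    have "y2' ?a - y1' ?a + ((x2' ?b - x1' ?b) - (x2' ?a - x1' ?a)) \<bullet> z - M * (1 + C + norm z) * m' * (?b - ?a) \<le> y2' ?b - y1' ?b"
      by (rule comparison_one_step [OF t0 ab(1-3) X 1(1) [folded y'(1)] 2(1) [folded y'(2)] M C(1) Cy \<mu> d gap])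
    then have est: "(y2 - y1) + E i / \<epsilon> * (sup_lyapunov_grad m w \<bullet> (w' - w)) - M * (1 + C + norm z) * m' * \<delta> \<le> y2' ?b - y1' ?b"
      unfolding y' ba wa by (simp add: w'_def z_def inner_commute)
    have lyap: "sup_lyapunov m' w' \<le> sup_lyapunov m w + sup_lyapunov_grad m w \<bullet> (w' - w) + 22 * (K * \<delta>)\<^sup>2"
    proof (rule sup_lyapunov_step [OF wm _ m'(1)])
      show "norm w' \<le> m'" unfolding w'_def using \<mu> [of ?b] a' ab by auto
      show "m' \<le> max m (norm w + K * \<delta>)" by (simp add: m'_def)
      show "norm (w' - w) \<le> K * \<delta>" using d [of ?b] ab by (simp add: w'_def wa)
    qed
    have "c + E (Suc i) * sup_lyapunov m' w' / \<epsilon> - real i * \<delta> * A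
        - \<delta> * (\<epsilon> * (M\<^sup>2 * (1 + C)\<^sup>2 / e) + 22 * K\<^sup>2 * \<delta> / \<epsilon>) \<le> y2' ?b - y1' ?b"
    proof (rule weighted_step_estimate [OF \<epsilon>(1) \<delta>(1) M(1) C(1) _ e0 E_e [OF Suc.prems] E_S [unfolded rate_def] E_le
          m(1) m'(1) sup_lyapunov_ge nz lyap est])
      show "(8 * M + 1) * \<delta> \<le> 1" using n'(1) by (simp add: rate_def)
      show "c + E i * sup_lyapunov m w / \<epsilon> - real i * \<delta> * A \<le> y2 - y1" using p by (simp add: w_def)
    qed
    then have "c + E (Suc i) * sup_lyapunov m' (x2' ?b - x1' ?b) / \<epsilon> - real (Suc i) * \<delta> * A \<le> y2' ?b - y1' ?b"
      unfolding A_def [symmetric] w'_def by (simp add: algebra_simps)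
    moreover have "u ?b x1' \<le> y1' ?b" "y2' ?b \<le> v ?b x2'" using 1(2) 2(2) ab by auto
    ultimately have "St (Suc i) x1' x2' (y1' ?b) (y2' ?b) m'"
      unfolding St_def using X' m' \<mu> by auto
    then show ?case by blast
  qed
  from this [OF order_refl] obtain x1 x2 y1 y2 m where S: "St (Suc n) x1 x2 y1 y2 m" by blast
  have X: "x1 \<in> ?X" "x2 \<in> ?X" and uv: "u T x1 \<le> y1" "y2 \<le> v T x2"
    and m: "\<And>r. \<lbrakk>0 \<le> r; r \<le> T\<rbrakk> \<Longrightarrow> norm (x2 r - x1 r) \<le> m"
    and p: "c + E (Suc n) * sup_lyapunov m (x2 T - x1 T) / \<epsilon> - real (Suc n) * \<delta> * A \<le> y2 - y1"
    using S unfolding St_def \<tau>N by auto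
  define V where "V = E (Suc n) * sup_lyapunov m (x2 T - x1 T) / \<epsilon>"
  have pV: "c / 2 + V \<le> y2 - y1" using p iA [of "Suc n"] by (simp add: V_def)
  have Vm: "e * m\<^sup>2 / \<epsilon> \<le> V"
  proof -
    have "e * m\<^sup>2 \<le> E (Suc n) * sup_lyapunov m (x2 T - x1 T)"
      using E_e [of "Suc n"] E_pos [of "Suc n"] sup_lyapunov_ge [of m] by (intro mult_mono) auto
    then show ?thesis unfolding V_def using \<epsilon> by (intro divide_right_mono) auto
  qed
  have V0: "0 \<le> V" by (rule order_trans [OF _ Vm]) (use e0 \<epsilon> in simp)
  have "h x1 \<le> u T x1" "v T x2 \<le> h x2"
    using u v X_setD(1) [OF X(1)] X_setD(1) [OF X(2)]
    unfolding minimax_supersolution_def minimax_subsolution_def by auto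
  then have "c / 2 \<le> h x2 - h x1" using pV V0 uv by linarith
  moreover have "e * m\<^sup>2 \<le> 2 * C * \<epsilon>"
  proof -
    have TT: "T \<in> {t\<^sub>0..T}" using t0 by simp
    have "V \<le> 2 * C" using pV uv C(2) [OF TT X(1)] C(3) [OF TT X(2)] c(1) by linarith
    then have "e * m\<^sup>2 / \<epsilon> \<le> 2 * C" using Vm by linarith
    then show ?thesis using \<epsilon>(1) by (simp add: divide_le_eq)
  qed
  ultimately show ?thesis using X m by (intro exI [of _ x1] exI [of _ x2] exI [of _ m]) auto
qed

text \<open>
Assume that the subsolution exceeds the supersolution by \<open>c > 0\<close>.  Letting \<open>\<epsilon>\<close> tend to zero in the
previous lemma, the two paths have a common limit, where continuity of \<open>h\<close> contradicts the gap
\<open>c/2\<close>.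
\<close>

theorem comparison_principle:
  assumes u: "minimax_supersolution T h H L\<^sub>H u" and v: "minimax_subsolution T h H L\<^sub>H v"
    and t0: "t\<^sub>0 \<in> {0..T}" and x0: "x\<^sub>0 \<in> path_space T"
  shows "v t\<^sub>0 x\<^sub>0 \<le> u t\<^sub>0 x\<^sub>0"
proof (cases "t\<^sub>0 = T")
  case True
  have "h x\<^sub>0 \<le> u T x\<^sub>0" "v T x\<^sub>0 \<le> h x\<^sub>0"
    using u v x0 unfolding minimax_supersolution_def minimax_subsolution_def by auto
  then show ?thesis using True by simp
next
  case False
  then have t0': "t\<^sub>0 \<in> {0..<T}" using t0 by auto
  let ?X = "X_set T L\<^sub>H t\<^sub>0 x\<^sub>0"
  show ?thesis
  proof (rule ccontr)
    assume neg: "\<not> v t\<^sub>0 x\<^sub>0 \<le> u t\<^sub>0 x\<^sub>0"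
    define c where "c = v t\<^sub>0 x\<^sub>0 - u t\<^sub>0 x\<^sub>0"
    have c: "c > 0" using neg by (simp add: c_def)
    have "lsc_on_paths T u" using u by (simp add: minimax_supersolution_def)
    then obtain C1 where C1: "\<forall>t\<in>{t\<^sub>0..T}. \<forall>x\<in>?X. - C1 \<le> u t x"
      using lsc_bounded_below_on_X_set [OF _ L_H_nonneg t0 x0] by blast
    have "lsc_on_paths T (\<lambda>t x. - v t x)"
      using v unfolding minimax_subsolution_dual minimax_supersolution_def by blast
    then obtain C2 where C2: "\<forall>t\<in>{t\<^sub>0..T}. \<forall>x\<in>?X. - C2 \<le> - v t x"
      using lsc_bounded_below_on_X_set [OF _ L_H_nonneg t0 x0] by blast
    define C where "C = \<bar>C1\<bar> + \<bar>C2\<bar>"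
    have C: "C \<ge> 0" "\<And>t x. \<lbrakk>t \<in> {t\<^sub>0..T}; x \<in> ?X\<rbrakk> \<Longrightarrow> - C \<le> u t x"
        "\<And>t x. \<lbrakk>t \<in> {t\<^sub>0..T}; x \<in> ?X\<rbrakk> \<Longrightarrow> v t x \<le> C"
      using C1 C2 by (force simp: C_def)+
    define N where "N = Suc (nat \<lceil>2 * L\<^sub>H * T\<rceil>)"
    have N: "2 * L\<^sub>H * T \<le> real N" "N > 0" unfolding N_def by linarith+
    define R where "R = 2 ^ N * (1 + running_sup x\<^sub>0 t\<^sub>0)"
    have R: "1 + running_sup x T \<le> R" if "x \<in> ?X" for x
      unfolding R_def by (rule X_set_running_sup_bound [OF L_H_nonneg t0 that N])
    obtain M where M: "M \<ge> 0" "\<And>x x' y z. \<lbrakk>x \<in> ?X; x' \<in> ?X\<rbrakk> \<Longrightarrow>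
        AE t in lebesgue. t\<^sub>0 < t \<and> t < T \<longrightarrow>
            \<bar>H t x y z - H t x' y z\<bar> \<le> M * (1 + \<bar>y\<bar> + norm z) * (SUP s\<in>{0..t}. norm (x s - x' s))"
    proof -
      obtain M where "M \<ge> 0" "\<forall>t\<^sub>0\<in>{0..<T}. \<forall>x\<^sub>0\<in>path_space T.
        \<forall>x\<in>X_set T L\<^sub>H t\<^sub>0 x\<^sub>0. \<forall>x'\<in>X_set T L\<^sub>H t\<^sub>0 x\<^sub>0. \<forall>y z.
          AE t in lebesgue. t\<^sub>0 < t \<and> t < T \<longrightarrow>
            \<bar>H t x y z - H t x' y z\<bar> \<le> M * (1 + \<bar>y\<bar> + norm z) * (SUP s\<in>{0..t}. norm (x s - x' s))"
        using H_Lipschitz_x [OF L_H_nonneg] by blast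
      then show ?thesis using that t0' x0 by blast
    qed
    define e where "e = exp (- ((8 * M + 1) * T))"
    have e0: "e > 0" by (simp add: e_def)
    define G where "G = M\<^sup>2 * (1 + C)\<^sup>2 / e"
    have G0: "G \<ge> 0" using e0 by (simp add: G_def)
    \<comment> \<open>The factor keeps \<open>T * (\<epsilon> n * G)\<close> below \<open>c / 4\<close>, as the previous lemma demands.\<close>
    define \<epsilon> where "\<epsilon> = (\<lambda>n. c / (4 * (T * G + 1)) * inverse (real (Suc n)))"
    have TG: "T * G + 1 > 0" using T_nonneg G0 by (simp add: add_nonneg_pos)
    have \<epsilon>0: "\<epsilon> n > 0" for n using c TG by (simp add: \<epsilon>_def)
    have \<epsilon>le: "T * (\<epsilon> n * G) \<le> c / 4" for n
    proof -
      have "\<epsilon> n \<le> c / (4 * (T * G + 1)) * 1"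
        unfolding \<epsilon>_def using c TG by (intro mult_left_mono) (auto simp: inverse_le_1_iff)
      then have "T * G * \<epsilon> n \<le> (T * G + 1) * (c / (4 * (T * G + 1)))"
        using T_nonneg G0 \<epsilon>0 [of n] by (intro mult_mono) auto
      also have "\<dots> = c / 4"
      proof -
        have "D * (c / (4 * D)) = c / 4" if "D > 0" for D :: real using that by simp
        from this [OF TG] show ?thesis .
      qed
      finally show ?thesis by (simp add: algebra_simps)
    qed
    have \<epsilon>lim: "\<epsilon> \<longlonglongrightarrow> 0" unfolding \<epsilon>_def by (rule tendsto_mult_right_zero [OF LIMSEQ_inverse_real_of_nat])
    define P where "P = (\<lambda>n x1 x2 m. x1 \<in> ?X \<and> x2 \<in> ?X \<and> (\<forall>r\<in>{0..T}. norm (x2 r - x1 r) \<le> m) \<and>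
      c / 2 \<le> h x2 - h x1 \<and> e * m\<^sup>2 \<le> 2 * C * \<epsilon> n)"
    have "\<exists>x1 x2 m. P n x1 x2 m" for n
      unfolding P_def
      by (rule comparison_near_optimal_pair [OF u v t0' x0 c _ R C M e_def \<epsilon>0 \<epsilon>le [unfolded G_def]])
         (simp add: c_def)
    then obtain x1 x2 m where P: "\<And>n. P n (x1 n) (x2 n) (m n)" by metis
    have X: "x1 n \<in> ?X" "x2 n \<in> ?X" for n using P [of n] by (auto simp: P_def)
    obtain r x where r: "strict_mono (r :: nat \<Rightarrow> nat)" and x: "x \<in> ?X"
      and lim1: "uniform_limit {0..T} (x1 \<circ> r) x sequentially"
      by (rule X_set_compact_self [OF L_H_nonneg t0 x0, of x1]) (use X in blast)+
    have lim2: "uniform_limit {0..T} (x2 \<circ> r) x sequentially"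
      unfolding uniform_limit_iff
    proof (intro allI impI)
      fix \<eta> :: real assume \<eta>: "\<eta> > 0"
      have "\<forall>\<^sub>F n in sequentially. \<forall>t\<in>{0..T}. dist ((x1 \<circ> r) n t) (x t) < \<eta> / 2"
        using lim1 half_gt_zero [OF \<eta>] unfolding uniform_limit_iff by blast
      moreover have "\<forall>\<^sub>F n in sequentially. 2 * C * \<epsilon> (r n) < e * (\<eta> / 2)\<^sup>2"
      proof (rule order_tendstoD(2))
        show "(\<lambda>n. 2 * C * \<epsilon> (r n)) \<longlonglongrightarrow> 0"
          using tendsto_mult_right_zero [OF LIMSEQ_subseq_LIMSEQ [OF \<epsilon>lim r]] by (simp add: o_def)
      qed (use e0 \<eta> in simp)
      ultimately show "\<forall>\<^sub>F n in sequentially. \<forall>t\<in>{0..T}. dist ((x2 \<circ> r) n t) (x t) < \<eta>"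
      proof eventually_elim
        case (elim n)
        have "e * (m (r n))\<^sup>2 < e * (\<eta> / 2)\<^sup>2" using P [of "r n"] elim(2) unfolding P_def by linarith
        then have "(m (r n))\<^sup>2 < (\<eta> / 2)\<^sup>2" using e0 by (simp only: mult_less_cancel_left_pos)
        then have m2: "m (r n) < \<eta> / 2" by (rule power2_less_imp_less) (use \<eta> in simp)
        show ?case
        proof
          fix t assume t: "t \<in> {0..T}"
          have "dist (x2 (r n) t) (x1 (r n) t) < \<eta> / 2"
            using P [of "r n"] t m2 unfolding P_def dist_norm by force
          moreover have "dist (x1 (r n) t) (x t) < \<eta> / 2" using elim(1) t unfolding o_def by blast
          ultimately have "dist (x2 (r n) t) (x t) < \<eta>"
            using dist_triangle [of "x2 (r n) t" "x t" "x1 (r n) t"] by linarith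
          then show "dist ((x2 \<circ> r) n t) (x t) < \<eta>" by simp
        qed
      qed
    qed
    have "(\<lambda>n. h ((x2 \<circ> r) n) - h ((x1 \<circ> r) n)) \<longlonglongrightarrow> h x - h x"
      by (intro tendsto_diff h_tendsto lim1 lim2 X_setD(1) [OF x]) (use X_setD(1) [OF X(1)] X_setD(1) [OF X(2)] in auto)
    then have "c / 2 \<le> h x - h x"
      by (rule tendsto_lowerbound) (use P in \<open>auto simp: P_def\<close>)
    then show False using c by simp
  qed
qed

section \<open>Existence and uniqueness\<close>

text \<open>
The envelopes satisfy \<open>lo \<le> u \<le> - up\<close> by construction, and comparison gives \<open>- up \<le> lo\<close>.
\<close>

theorem perron_infimum_minimax_solution:
  shows "\<And>t x. \<lbrakk>t \<in> {0..T}; x \<in> path_space T\<rbrakk> \<Longrightarrow> \<bar>perron_infimum T h H L\<^sub>H t x\<bar> \<noteq> \<infinity>"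
    and "minimax_solution T h H L\<^sub>H (\<lambda>t x. real_of_ereal (perron_infimum T h H L\<^sub>H t x))"
proof -
  let ?u = "perron_infimum T h H L\<^sub>H" and ?H' = "\<lambda>t x y z. - H t x (- y) (- z)"
  interpret dual: tvp_data T "\<lambda>x. - h x" ?H' L\<^sub>H by (rule tvp_data_dual)
  note super = perron_infimum_one_step_super
  have sub: "dual.one_step_super (\<lambda>t x. - ?u t x)"
    by (rule one_step_sub_dual [OF perron_infimum_one_step_sub])
  have uT: "?u T x = ereal (h x)" and uT': "- ?u T x = ereal (- h x)" if "x \<in> path_space T" for x
    using perron_infimum_terminal [OF that] by auto
  define lo up where "lo = lsc_envelope T ?u" and "up = lsc_envelope T (\<lambda>t x. - ?u t x)"
  have le: "lo t x \<le> ?u t x" "up t x \<le> - ?u t x" if "t \<in> {0..T}" "x \<in> path_space T" for t x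
    unfolding lo_def up_def by (rule lsc_envelope_le [OF that(2,1)])+
  have notM: "lo t x \<noteq> - \<infinity>" "up t x \<noteq> - \<infinity>" if "t \<in> {0..T}" "x \<in> path_space T" for t x
    unfolding lo_def up_def
    using lsc_envelope_not_MInf [OF super uT that] dual.lsc_envelope_not_MInf [OF sub uT' that] by auto
  have fin: "\<bar>?u t x\<bar> \<noteq> \<infinity>" if "t \<in> {0..T}" "x \<in> path_space T" for t x
    using le [OF that] notM [OF that] by (cases "?u t x") auto
  then show "\<And>t x. \<lbrakk>t \<in> {0..T}; x \<in> path_space T\<rbrakk> \<Longrightarrow> \<bar>?u t x\<bar> \<noteq> \<infinity>" .
  have ninf: "?u t x \<noteq> \<infinity>" "- ?u t x \<noteq> \<infinity>"
    if "t \<in> {0..T}" "x \<in> path_space T" for t x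
    using fin [OF that] by (cases "?u t x"; simp)+
  have S1: "minimax_supersolution T h H L\<^sub>H (\<lambda>t x. real_of_ereal (lo t x))"
    unfolding lo_def
    by (rule lsc_envelope_minimax_supersolution [OF super uT ninf(1)])
  have "minimax_supersolution T (\<lambda>x. - h x) ?H' L\<^sub>H (\<lambda>t x. real_of_ereal (up t x))"
    unfolding up_def
    by (rule dual.lsc_envelope_minimax_supersolution [OF sub uT' ninf(2)])
  then have S2: "minimax_subsolution T h H L\<^sub>H (\<lambda>t x. - real_of_ereal (up t x))"
    unfolding minimax_subsolution_dual by simp
  have cmp: "- real_of_ereal (up t x) \<le> real_of_ereal (lo t x)" if "t \<in> {0..T}" "x \<in> path_space T" for t x
    by (rule comparison_principle [OF S1 S2 that])
  have eq: "real_of_ereal (lo t x) = real_of_ereal (?u t x) \<and> - real_of_ereal (up t x) = real_of_ereal (?u t x)"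
    if "t \<in> {0..T}" "x \<in> path_space T" for t x
    using le [OF that] notM [OF that] fin [OF that] cmp [OF that]
    by (cases "?u t x"; cases "lo t x"; cases "up t x") auto
  have "minimax_supersolution T h H L\<^sub>H (\<lambda>t x. real_of_ereal (?u t x))"
    by (rule minimax_supersolution_cong [OF _ T_nonneg S1]) (use eq in blast)
  moreover have "minimax_subsolution T h H L\<^sub>H (\<lambda>t x. real_of_ereal (?u t x))"
    unfolding minimax_subsolution_dual
    by (rule minimax_supersolution_cong [OF _ T_nonneg S2 [unfolded minimax_subsolution_dual]]) (use eq in force)
  ultimately show "minimax_solution T h H L\<^sub>H (\<lambda>t x. real_of_ereal (?u t x))"
    by (simp add: minimax_solution_def)
qed

end

theorem theorem6p4:
  fixes T L\<^sub>H :: real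
    and h :: "(real \<Rightarrow> real^'n) \<Rightarrow> real"
    and H :: "real \<Rightarrow> (real \<Rightarrow> real^'n) \<Rightarrow> real \<Rightarrow> real^'n \<Rightarrow> real"
    and u\<^sub>0 :: "real \<Rightarrow> (real \<Rightarrow> real^'n) \<Rightarrow> ereal"
  assumes "tvp_data T h H L\<^sub>H"
    and "\<And>t x. u\<^sub>0 t x = perron_infimum T h H L\<^sub>H t x"
  shows "(\<forall>t\<in>{0..T}. \<forall>x\<in>path_space T. \<bar>u\<^sub>0 t x\<bar> \<noteq> \<infinity>) \<and>
    minimax_solution T h H L\<^sub>H (\<lambda>t x. real_of_ereal (u\<^sub>0 t x)) \<and>
    (\<forall>v. minimax_solution T h H L\<^sub>H v \<longrightarrow>
      (\<forall>t\<in>{0..T}. \<forall>x\<in>path_space T. ereal (v t x) = u\<^sub>0 t x))"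
proof -
  interpret tvp_data T h H L\<^sub>H by (rule assms(1))
  have u0: "u\<^sub>0 = perron_infimum T h H L\<^sub>H" by (intro ext assms(2))
  have fin: "\<bar>u\<^sub>0 t x\<bar> \<noteq> \<infinity>" if "t \<in> {0..T}" "x \<in> path_space T" for t x
    unfolding u0 by (rule perron_infimum_minimax_solution(1) [OF that])
  have sol: "minimax_solution T h H L\<^sub>H (\<lambda>t x. real_of_ereal (u\<^sub>0 t x))"
    unfolding u0 by (rule perron_infimum_minimax_solution(2))
  have uniq: "ereal (v t x) = u\<^sub>0 t x"
    if v: "minimax_solution T h H L\<^sub>H v" and tx: "t \<in> {0..T}" "x \<in> path_space T" for v t x
  proof -
    have "v t x \<le> real_of_ereal (u\<^sub>0 t x)" "real_of_ereal (u\<^sub>0 t x) \<le> v t x"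
      using comparison_principle [OF _ _ tx] v sol unfolding minimax_solution_def by blast+
    then have "v t x = real_of_ereal (u\<^sub>0 t x)" by simp
    then show ?thesis using fin [OF tx] by (simp add: ereal_real)
  qed
  show ?thesis by (intro conjI ballI allI impI fin sol uniq)
qed

end
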